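(* Let $0<d\le n-1$, let $\Gamma\subset\mathbb{R}^n$ be a $d$-Ahlfors regular set with Ahlfors regular measure $\sigma$ of constant $C_\sigma$, and let $\Omega=\mathbb{R}^n\setminus\Gamma$. Let $\gamma\in(-1,1)$, $\beta>0$, and consider $L:=-\operatorname{div} D_\beta^{d+1+\gamma-n}\mathcal{A}\nabla$, where $\mathcal{A}$ is a measurable real matrix-valued function on $\Omega$ such that, for some constant $C_2$, for all $X\in\Omega$ and $\xi,\zeta\in\mathbb{R}^n$, $|\mathcal{A}(X)\xi\cdot\zeta|\le C_2|\xi||\zeta|$ and $\mathcal{A}(X)\xi\cdot\xi\ge C_2^{-1}|\xi|^2$. Assume that there exist a scalar function $b$ and a vector function $\mathcal{V}$, both defined on $\Omega$, such that $$\operatorname{div}\big[(b\mathcal{A}^T\nabla D_\beta+\mathcal{V})D_\beta^{d+1-n}\big]=0\quad\text{in }\Omega$$ in the weak sense, and such that, for some constant $C_1>0$: (i) $C_1^{-1}\le b\le C_1$; (ii) $D_\beta\nabla b\in CM(C_1)$; (iii) $|\mathcal{V}|\le C_1$; (iv) $\mathcal{V}\in CM(C_1)$. Then for any ball $B\subset\mathbb{R}^n$ centered on $\Gamma$ and any weak solution $u$ to $Lu=0$ in $2B$, one has $$\int_B|\nabla u|^2D_\beta^{d+2-n}\,dX\le C\Big(\sup_{2B}|u|^2\Big)\sigma(B),$$ where $C$ depends only on $C_\sigma$, $C_1$, $C_2$, $\beta$, $\gamma$, $n$ and $d$. In particular, when $d<n-1$ (so that the harmonic measure $\omega_L^X$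 of $L$ is defined), there is a constant $K$ such that for any ball $B\subset\mathbb{R}^n$ centered on $\Gamma$ and any Borel set $H\subset\Gamma$, the solution $u_H(X):=\omega_L^X(H)$ satisfies $\int_B|\nabla u_H|^2D_\beta^{d+2-n}\,dX\le K\sigma(B)$.
   Context: Ahlfors regularity: $\Gamma$ is closed and $\sigma$ is a measure supported on $\Gamma$ with $C_\sigma^{-1}r^d\le\sigma(B(x,r))\le C_\sigma r^d$ for all $x\in\Gamma$, $r>0$. Here $d$ may be any real number in $(0,n-1]$. For $X\in\Omega$, $D_\beta(X)=\big(\int_\Gamma|X-y|^{-d-\beta}\,d\sigma(y)\big)^{-1/\beta}$; it is comparable to $\operatorname{dist}(X,\Gamma)$ with constants depending only on $n,d,\beta,C_\sigma$. For a ball $B$ of center $x$ and radius $r$, $2B=B(x,2r)$; integrals and suprema over $B$, $2B$ are over $B\cap\Omega$, $2B\cap\Omega$. Carleson measure condition: a (scalar or vector) function $f$ on $\Omega$ satisfies $f\in CM(C)$ if $f\in L^\infty(\Omega)$ and $\int_{B(x,r)}|f(X)|^2\operatorname{dist}(X,\Gamma)^{d-n}\,dX\le C\,\sigma(B(x,r))$ for all $x\in\Gamma$, $r>0$. The divergence-free condition is understood weakly: for every (scalar) $\varphi\in W^{1,1}(\Omega)$ with compact support in $\Omega$, $\int_\Omega\nabla\varphi\cdot(b\mathcal{A}^T\nabla D_\beta+\mathcal{V})D_\beta^{d+1-n}\,dX=0$. Weak solution: $u$ is a weak solution to $Lu=0$ in an open set $U$ (here in $2B\cap\Omega$ or $\Omega$)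 if $u\in W^{1,2}_{loc}(U)$ and $\int_U(\mathcal{A}\nabla u\cdot\nabla\varphi)D_\beta^{d+1+\gamma-n}\,dX=0$ for all $\varphi\in C_0^\infty(U)$. Harmonic measure of $L$ (for $d<n-1$): for each $X\in\Omega$, $\omega_L^X$ is the unique probability measure on $\Gamma$ such that for every compactly supported continuous $g$ on $\Gamma$, $u_g(X)=\int_\Gamma g\,d\omega_L^X$ is a weak solution of $Lu=0$ in $\Omega$ which, extended by $g$ on $\Gamma$, is continuous on $\mathbb{R}^n$. For Borel $H\subset\Gamma$, $X\mapsto\omega_L^X(H)$ is a weak solution of $Lu=0$ in $\Omega$ with values in $[0,1]$. *)

theory Defs
  imports "HOL-Analysis.Analysis" "HOL-Probability.Probability_Measure" "HOL-Probability.Essential_Supremum"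
begin

text \<open>Throughout, the ambient space is \<open>real ^ 'n\<close>, so that \<open>n = CARD('n)\<close>, and the domain is
  \<open>\<Omega> = - \<Gamma>\<close>. Functions on an open set \<open>U\<close> are total functions of which only the values on
  \<open>U\<close> matter; measurability and integrability are with respect to Lebesgue measure.\<close>

definition gradient :: "(real ^ 'n \<Rightarrow> real) \<Rightarrow> real ^ 'n \<Rightarrow> real ^ 'n" where
  "gradient f x = (THE v. GDERIV f x :> v)"

primrec Ck_function :: "nat \<Rightarrow> (real ^ 'n \<Rightarrow> real) \<Rightarrow> bool" where
  "Ck_function 0 f \<longleftrightarrow> continuous_on UNIV f"
| "Ck_function (Suc k) f \<longleftrightarrow>
     f differentiable_on UNIV \<and> (\<forall>i. Ck_function k (\<lambda>x. gradient f x $ i))"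

text \<open>The class \<open>C\<^sub>0\<^sup>\<infinity>(U)\<close>, its elements being extended by zero outside \<open>U\<close>.\<close>

definition test_function :: "(real ^ 'n) set \<Rightarrow> (real ^ 'n \<Rightarrow> real) \<Rightarrow> bool" where
  "test_function U \<phi> \<longleftrightarrow>
     (\<forall>k. Ck_function k \<phi>) \<and> (\<exists>K. compact K \<and> K \<subseteq> U \<and> (\<forall>x. x \<notin> K \<longrightarrow> \<phi> x = 0))"

text \<open>\<open>g\<close> is a weak gradient of \<open>u\<close> in the open set \<open>U\<close>; it is determined almost everywhere.\<close>

definition weak_gradient ::
    "(real ^ 'n) set \<Rightarrow> (real ^ 'n \<Rightarrow> real) \<Rightarrow> (real ^ 'n \<Rightarrow> real ^ 'n) \<Rightarrow> bool" where
  "weak_gradient U u g \<longleftrightarrow>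
     (\<forall>K. compact K \<and> K \<subseteq> U \<longrightarrow> u absolutely_integrable_on K \<and> g absolutely_integrable_on K) \<and>
     (\<forall>\<phi>. test_function U \<phi> \<longrightarrow>
        (LINT x:U|lebesgue. u x *\<^sub>R gradient \<phi> x) = - (LINT x:U|lebesgue. \<phi> x *\<^sub>R g x))"

text \<open>\<open>u \<in> W\<^sup>1\<^sup>,\<^sup>1(U)\<close>, respectively \<open>u \<in> W\<^sup>1\<^sup>,\<^sup>2\<^sub>l\<^sub>o\<^sub>c(U)\<close>, with weak gradient \<open>g\<close>.\<close>

definition W11 ::
    "(real ^ 'n) set \<Rightarrow> (real ^ 'n \<Rightarrow> real) \<Rightarrow> (real ^ 'n \<Rightarrow> real ^ 'n) \<Rightarrow> bool" where
  "W11 U u g \<longleftrightarrow>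
     weak_gradient U u g \<and> u absolutely_integrable_on U \<and> g absolutely_integrable_on U"

definition W12_loc ::
    "(real ^ 'n) set \<Rightarrow> (real ^ 'n \<Rightarrow> real) \<Rightarrow> (real ^ 'n \<Rightarrow> real ^ 'n) \<Rightarrow> bool" where
  "W12_loc U u g \<longleftrightarrow>
     weak_gradient U u g \<and>
     (\<forall>K. compact K \<and> K \<subseteq> U \<longrightarrow>
        (\<lambda>x. \<bar>u x\<bar>\<^sup>2) absolutely_integrable_on K \<and> (\<lambda>x. (norm (g x))\<^sup>2) absolutely_integrable_on K)"

text \<open>The equation \<open>div F = 0\<close> in \<open>U\<close>, tested against compactly supported \<open>W\<^sup>1\<^sup>,\<^sup>1\<close> functions. As
  these are classes modulo null sets, the support is understood up to a null set.\<close>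

definition weakly_div_free :: "(real ^ 'n) set \<Rightarrow> (real ^ 'n \<Rightarrow> real ^ 'n) \<Rightarrow> bool" where
  "weakly_div_free U F \<longleftrightarrow>
     (\<forall>\<phi> \<psi>. W11 U \<phi> \<psi> \<and>
        (\<exists>K. compact K \<and> K \<subseteq> U \<and> (AE x in lebesgue. x \<in> U - K \<longrightarrow> \<phi> x = 0)) \<longrightarrow>
        (LINT x:U|lebesgue. \<psi> x \<bullet> F x) = 0)"

text \<open>\<open>\<Gamma>\<close> is \<open>d\<close>-Ahlfors regular with Ahlfors regular measure \<open>\<sigma>\<close>, a Borel measure on the whole space
  carried by \<open>\<Gamma>\<close>.\<close>

definition ahlfors_regular ::
    "(real ^ 'n) set \<Rightarrow> (real ^ 'n) measure \<Rightarrow> real \<Rightarrow> real \<Rightarrow> bool" where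
  "ahlfors_regular \<Gamma> \<sigma> d C \<longleftrightarrow>
     C > 0 \<and> closed \<Gamma> \<and> sets \<sigma> = sets borel \<and> emeasure \<sigma> (- \<Gamma>) = 0 \<and>
     (\<forall>x\<in>\<Gamma>. \<forall>r>0. ennreal (inverse C * r powr d) \<le> emeasure \<sigma> (ball x r) \<and>
                   emeasure \<sigma> (ball x r) \<le> ennreal (C * r powr d))"

text \<open>The regularized distance \<open>D\<^sub>\<beta>\<close>; it is meant for \<open>X \<notin> \<Gamma>\<close>, where the integral is finite.\<close>

definition Dbeta ::
    "(real ^ 'n) set \<Rightarrow> (real ^ 'n) measure \<Rightarrow> real \<Rightarrow> real \<Rightarrow> real ^ 'n \<Rightarrow> real" where
  "Dbeta \<Gamma> \<sigma> d \<beta> X = (LINT y:\<Gamma>|\<sigma>. norm (X - y) powr (- d - \<beta>)) powr (- 1 / \<beta>)"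

definition in_CM ::
    "(real ^ 'n) set \<Rightarrow> (real ^ 'n) measure \<Rightarrow> real \<Rightarrow>
     (real ^ 'n \<Rightarrow> 'b::{real_normed_vector, second_countable_topology}) \<Rightarrow> real \<Rightarrow> bool" where
  "in_CM \<Gamma> \<sigma> d f C \<longleftrightarrow>
     f \<in> borel_measurable (lebesgue_on (- \<Gamma>)) \<and>
     (\<exists>M. AE X in lebesgue_on (- \<Gamma>). norm (f X) \<le> M) \<and>
     (\<forall>x\<in>\<Gamma>. \<forall>r>0.
        (\<integral>\<^sup>+ X \<in> ball x r - \<Gamma>.
            ennreal ((norm (f X))\<^sup>2 * infdist X \<Gamma> powr (d - real CARD('n))) \<partial>lebesgue)
        \<le> ennreal C * emeasure \<sigma> (ball x r))"

definition elliptic_matrix :: "(real ^ 'n) set \<Rightarrow> (real ^ 'n \<Rightarrow> real ^ 'n ^ 'n) \<Rightarrow> real \<Rightarrow> bool" where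
  "elliptic_matrix U A C \<longleftrightarrow>
     C > 0 \<and> A \<in> borel_measurable (lebesgue_on U) \<and>
     (\<forall>X\<in>U. \<forall>\<xi> \<zeta>. \<bar>(A X *v \<xi>) \<bullet> \<zeta>\<bar> \<le> C * norm \<xi> * norm \<zeta>) \<and>
     (\<forall>X\<in>U. \<forall>\<xi>. (A X *v \<xi>) \<bullet> \<xi> \<ge> inverse C * (norm \<xi>)\<^sup>2)"

text \<open>\<open>u\<close>, with weak gradient \<open>g\<close>, is a weak solution to
  \<open>L u = - div (D\<^sub>\<beta>\<^bsup>d+1+\<gamma>-n\<^esup> A \<nabla>u) = 0\<close> in the open set \<open>U \<subseteq> - \<Gamma>\<close>.\<close>

definition weak_solution ::
    "(real ^ 'n) set \<Rightarrow> (real ^ 'n) measure \<Rightarrow> real \<Rightarrow> real \<Rightarrow> real \<Rightarrow>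
     (real ^ 'n \<Rightarrow> real ^ 'n ^ 'n) \<Rightarrow>
     (real ^ 'n) set \<Rightarrow> (real ^ 'n \<Rightarrow> real) \<Rightarrow> (real ^ 'n \<Rightarrow> real ^ 'n) \<Rightarrow> bool" where
  "weak_solution \<Gamma> \<sigma> d \<beta> \<gamma> A U u g \<longleftrightarrow>
     W12_loc U u g \<and>
     (\<forall>\<phi>. test_function U \<phi> \<longrightarrow>
        (LINT X:U|lebesgue. ((A X *v g X) \<bullet> gradient \<phi> X) *
           Dbeta \<Gamma> \<sigma> d \<beta> X powr (d + 1 + \<gamma> - real CARD('n))) = 0)"

text \<open>The family \<open>\<omega>\<close> of measures is the harmonic measure of \<open>L\<close>. Each \<open>\<omega> X\<close> is a Borel probability
  measure on the whole space giving full mass to \<open>\<Gamma>\<close>.\<close>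

definition harmonic_measure ::
    "(real ^ 'n) set \<Rightarrow> (real ^ 'n) measure \<Rightarrow> real \<Rightarrow> real \<Rightarrow> real \<Rightarrow>
     (real ^ 'n \<Rightarrow> real ^ 'n ^ 'n) \<Rightarrow> (real ^ 'n \<Rightarrow> (real ^ 'n) measure) \<Rightarrow> bool" where
  "harmonic_measure \<Gamma> \<sigma> d \<beta> \<gamma> A \<omega> \<longleftrightarrow>
     (\<forall>X\<in>- \<Gamma>. sets (\<omega> X) = sets borel \<and> prob_space (\<omega> X) \<and> emeasure (\<omega> X) \<Gamma> = 1) \<and>
     (\<forall>g :: real ^ 'n \<Rightarrow> real.
        continuous_on \<Gamma> g \<and> (\<exists>K. compact K \<and> K \<subseteq> \<Gamma> \<and> (\<forall>y\<in>\<Gamma> - K. g y = 0)) \<longrightarrow>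
        (\<exists>Du. weak_solution \<Gamma> \<sigma> d \<beta> \<gamma> A (- \<Gamma>) (\<lambda>X. LINT y:\<Gamma>|\<omega> X. g y) Du) \<and>
        continuous_on UNIV (\<lambda>X. if X \<in> \<Gamma> then g X else (LINT y:\<Gamma>|\<omega> X. g y)))"

end

theory Submission
  imports Defs "HOL-Computational_Algebra.Polynomial"
begin

text \<open>
  Write \<open>D = D\<^sub>\<beta>\<close> and let \<open>\<psi>\<close> be a cutoff supported in \<open>2B\<close> and away from \<open>\<Gamma>\<close>. Testing \<open>Lu = 0\<close> with
  \<open>u b \<psi>\<^sup>2 D\<^bsup>1-\<gamma>\<^esup>\<close> gives the weighted energy of \<open>u\<close>, error terms containing \<open>\<nabla>b\<close> or \<open>\<nabla>\<psi>\<close>, and the term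
  \<open>(1-\<gamma>) u \<psi>\<^sup>2 \<nabla>u \<sqdot> b A\<^sup>T\<nabla>D D\<^bsup>d+1-n\<^esup>\<close>, which is not absorbable. Testing the divergence-free condition with
  \<open>u\<^sup>2 \<psi>\<^sup>2\<close> trades the latter for terms containing only \<open>V\<close> or \<open>\<nabla>\<psi>\<close>. After Cauchy-Schwarz and absorption,
  the errors are \<open>\<parallel>u\<parallel>\<^sub>\<infinity>\<^sup>2\<close> times the Carleson integrals of \<open>D\<nabla>b\<close> and \<open>V\<close> and integrals of \<open>D\<bar>\<nabla>\<psi>\<bar>\<close>,
  which Ahlfors regularity bounds by \<open>\<sigma>(B)\<close> uniformly as the cutoff approaches the boundary.

  By Caccioppoli's inequality, bounded pointwise limits of solutions are solutions. Hence the Borel sets \<open>H\<close>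
  for which \<open>\<omega>\<^bsup>X\<^esup>(H)\<close> is a solution form a Dynkin system containing the closed sets, so they are all the
  Borel sets.
\<close>

section \<open>Gradients and a smooth bump function\<close>

text \<open>The power \<open>1 - \<gamma>\<close> is forced. Differentiating
  \<open>D^(1-\<gamma>)\<close> against the weight \<open>D^(d+1+\<gamma>-n)\<close> leaves
  \<open>D^(d+1-n)\<close>, the weight of the divergence condition, and \<open>u \<nabla>u\<close>
  is half the gradient of \<open>u^2\<close>; so the bad term cancels identically instead of being
  estimated. The obstacle is regularity: the equation is tested with smooth functions only, while
  \<open>u\<close> and \<open>b\<close> have weak gradients. Product rule and larger test classes
  are therefore proved by mollification, always as convergence of pairings of two L2 functions. A
  finite essential supremum makes \<open>u\<close> locally bounded, which keeps the test functions
  in these classes; if it is infinite, the estimate is trivial. Uniformity of the constants is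
  carried by quantifier order: in the estimate they are produced before the set, the measure and the
  coefficients are introduced. For limits of solutions no weak compactness is used. Differences of
  solutions are solutions, so Caccioppoli makes the gradients Cauchy in L2 on compact sets.\<close>

lemma GDERIV_unique:
  fixes f :: "real ^ 'n::finite \<Rightarrow> real"
  assumes "GDERIV f x :> v" "GDERIV f x :> w"
  shows "v = w"
proof -
  have "(\<lambda>h. h \<bullet> v) = (\<lambda>h. h \<bullet> w)"
    using assms unfolding gderiv_def by (rule has_derivative_unique)
  then have "(v - w) \<bullet> v = (v - w) \<bullet> w" by metis
  then have "(v - w) \<bullet> (v - w) = 0" by (simp add: inner_diff_right)
  then show ?thesis by simp
qed

lemma gradient_eqI:
  fixes f :: "real ^ 'n::finite \<Rightarrow> real"
  assumes "GDERIV f x :> v"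
  shows "gradient f x = v"
  unfolding gradient_def using assms by (blast intro: GDERIV_unique)

lemma differentiable_imp_GDERIV:
  fixes f :: "real ^ 'n::finite \<Rightarrow> real"
  assumes "f differentiable (at x)"
  shows "GDERIV f x :> gradient f x"
proof -
  obtain f' where f': "(f has_derivative f') (at x)" using assms by (auto simp: differentiable_def)
  then interpret bounded_linear f' by (rule has_derivative_bounded_linear)
  define v where "v = (\<chi> i. f' (axis i 1))"
  have "f' h = h \<bullet> v" for h
  proof -
    have "f' h = f' (\<Sum>i\<in>UNIV. h $ i *\<^sub>R axis i 1)"
      using basis_expansion[of h] by (simp add: scalar_mult_eq_scaleR)
    also have "\<dots> = h \<bullet> v" by (simp add: sum scaleR v_def inner_vec_def)
    finally show ?thesis .
  qed
  then have "f' = (\<lambda>h. h \<bullet> v)" by blast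
  with f' have "GDERIV f x :> v" by (simp add: gderiv_def)
  then show ?thesis using gradient_eqI by metis
qed

lemma GDERIV_imp_differentiable: "GDERIV f x :> v \<Longrightarrow> f differentiable (at x)"
  unfolding gderiv_def differentiable_def by blast

lemma GDERIV_imp_continuous: "GDERIV f x :> v \<Longrightarrow> isCont f x"
  unfolding gderiv_def by (rule has_derivative_continuous)

lemma GDERIV_transform_open:
  assumes "GDERIV f x :> v" "open S" "x \<in> S" "\<And>y. y \<in> S \<Longrightarrow> f y = g y"
  shows "GDERIV g x :> v"
  using assms unfolding gderiv_def by (rule has_derivative_transform_within_open)

lemma gradient_cong_open:
  fixes f :: "real ^ 'n::finite \<Rightarrow> real"
  assumes "open S" "x \<in> S" "\<And>y. y \<in> S \<Longrightarrow> f y = g y"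
  shows "gradient f x = gradient g x"
proof -
  have "GDERIV f x :> v \<longleftrightarrow> GDERIV g x :> v" for v
    using assms GDERIV_transform_open[of f x v S g] GDERIV_transform_open[of g x v S f] by auto
  then have "gderiv f x = gderiv g x" by blast
  then show ?thesis unfolding gradient_def by simp
qed

lemma gradient_eq_0_outside:
  fixes f :: "real ^ 'n::finite \<Rightarrow> real"
  assumes "closed K" "\<And>x. x \<notin> K \<Longrightarrow> f x = 0" "x \<notin> K"
  shows "gradient f x = 0"
proof -
  have "gradient f x = gradient (\<lambda>_. 0) x"
    by (rule gradient_cong_open[of "- K"]) (use assms in auto)
  then show ?thesis using gradient_eqI[OF GDERIV_const] by metis
qed

lemma Ck_const [simp]: "Ck_function k (\<lambda>x::real ^ 'n::finite. c)"
proof (induction k arbitrary: c)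
  case (Suc k)
  have "gradient (\<lambda>x::real ^ 'n. c) x = 0" for x using gradient_eqI[OF GDERIV_const] by metis
  then show ?case using Suc by (simp)
qed simp

lemma Ck_SucD: "Ck_function (Suc k) f \<Longrightarrow> Ck_function k f"
proof (induction k arbitrary: f)
  case 0
  then show ?case using differentiable_imp_continuous_on by auto
next
  case (Suc k)
  from Suc.prems have "f differentiable_on UNIV" and *: "\<And>i. Ck_function (Suc k) (\<lambda>x. gradient f x $ i)"
    unfolding Ck_function.simps(2)[of "Suc k"] by auto
  with Suc.IH[OF *] show ?case by simp
qed

lemma Ck_Suc_GDERIV:
  fixes f :: "real ^ 'n::finite \<Rightarrow> real"
  assumes "Ck_function (Suc k) f"
  shows "GDERIV f x :> gradient f x"
  using assms by (intro differentiable_imp_GDERIV) (auto simp: differentiable_on_def)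

lemma Ck_SucI:
  fixes f :: "real ^ 'n::finite \<Rightarrow> real"
  assumes "\<And>x. GDERIV f x :> g x" "\<And>i. Ck_function k (\<lambda>x. g x $ i)"
  shows "Ck_function (Suc k) f"
proof -
  have "gradient f = g" using gradient_eqI[OF assms(1)] by auto
  moreover have "f differentiable at x" for x by (rule GDERIV_imp_differentiable[OF assms(1)])
  ultimately show ?thesis using assms(2) by (simp add: differentiable_on_def)
qed

lemma Ck_add:
  fixes f g :: "real ^ 'n::finite \<Rightarrow> real"
  shows "Ck_function k f \<Longrightarrow> Ck_function k g \<Longrightarrow> Ck_function k (\<lambda>x. f x + g x)"
proof (induction k arbitrary: f g)
  case 0
  then show ?case by (auto intro: continuous_intros)
next
  case (Suc k)
  show ?case
  proof (rule Ck_SucI)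
    show "GDERIV (\<lambda>x. f x + g x) x :> gradient f x + gradient g x" for x
      by (intro GDERIV_add Ck_Suc_GDERIV[OF Suc.prems(1)] Ck_Suc_GDERIV[OF Suc.prems(2)])
    show "Ck_function k (\<lambda>x. (gradient f x + gradient g x) $ i)" for i
      using Suc by simp
  qed
qed

lemma Ck_mult:
  fixes f g :: "real ^ 'n::finite \<Rightarrow> real"
  shows "Ck_function k f \<Longrightarrow> Ck_function k g \<Longrightarrow> Ck_function k (\<lambda>x. f x * g x)"
proof (induction k arbitrary: f g)
  case 0
  then show ?case by (auto intro: continuous_intros)
next
  case (Suc k)
  show ?case
  proof (rule Ck_SucI)
    show "GDERIV (\<lambda>x. f x * g x) x :> f x *\<^sub>R gradient g x + g x *\<^sub>R gradient f x" for x
      by (intro GDERIV_mult Ck_Suc_GDERIV[OF Suc.prems(1)] Ck_Suc_GDERIV[OF Suc.prems(2)])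
    show "Ck_function k (\<lambda>x. (f x *\<^sub>R gradient g x + g x *\<^sub>R gradient f x) $ i)" for i
      using Suc.prems Suc.prems[THEN Ck_SucD] by (auto intro!: Ck_add Suc.IH)
  qed
qed

lemma Ck_sum:
  fixes f :: "'i \<Rightarrow> real ^ 'n::finite \<Rightarrow> real"
  assumes "\<And>i. i \<in> I \<Longrightarrow> Ck_function k (f i)"
  shows "Ck_function k (\<lambda>x. \<Sum>i\<in>I. f i x)"
  using assms by (induction I rule: infinite_finite_induct) (auto intro: Ck_add)

lemma GDERIV_nth: "GDERIV (\<lambda>x::real ^ 'n::finite. x $ i) x :> axis i 1"
  unfolding gderiv_def inner_axis by (auto intro!: derivative_eq_intros bounded_linear_imp_has_derivative bounded_linear_vec_nth)

lemma Ck_nth: "Ck_function k (\<lambda>x::real ^ 'n::finite. x $ i)"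
proof (cases k)
  case 0
  then show ?thesis by (auto intro: continuous_intros)
next
  case (Suc k')
  show ?thesis unfolding Suc by (rule Ck_SucI[OF GDERIV_nth]) simp
qed

lemma Ck_inner_self: "Ck_function k (\<lambda>x::real ^ 'n::finite. x \<bullet> x)"
  unfolding inner_vec_def inner_real_def by (intro Ck_sum Ck_mult Ck_nth)

text \<open>\<open>F\<close> lists the successive derivatives of one real function. The chain rule
  sends \<open>F j\<close> to \<open>F (Suc j)\<close> times a partial derivative of
  \<open>g\<close>, so the induction on \<open>k\<close> must leave \<open>j\<close> free.\<close>

lemma Ck_compose:
  fixes g :: "real ^ 'n::finite \<Rightarrow> real" and F :: "nat \<Rightarrow> real \<Rightarrow> real"
  assumes F: "\<And>j t. (F j has_real_derivative F (Suc j) t) (at t)"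
  shows "(\<And>k. Ck_function k g) \<Longrightarrow> Ck_function k (\<lambda>x. F j (g x))"
proof (induction k arbitrary: j)
  case 0
  have "continuous_on UNIV (F j)"
    by (meson F DERIV_isCont continuous_at_imp_continuous_on)
  moreover have "continuous_on UNIV g" using 0[of 0] by simp
  ultimately show ?case
    by (auto intro: continuous_on_compose2)
next
  case (Suc k)
  show ?case
  proof (rule Ck_SucI)
    show "GDERIV (\<lambda>x. F j (g x)) x :> F (Suc j) (g x) *\<^sub>R gradient g x" for x
      by (rule GDERIV_DERIV_compose[OF Ck_Suc_GDERIV[OF Suc.prems[of "Suc 0"]] F])
    show "Ck_function k (\<lambda>x. (F (Suc j) (g x) *\<^sub>R gradient g x) $ i)" for i
      using Suc.prems[of "Suc k"] by (auto intro!: Ck_mult Suc.IH Suc.prems)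
  qed
qed

lemma GDERIV_affine:
  fixes f :: "real ^ 'n::finite \<Rightarrow> real"
  assumes "GDERIV f (c *\<^sub>R x + a) :> v"
  shows "GDERIV (\<lambda>x. f (c *\<^sub>R x + a)) x :> c *\<^sub>R v"
proof -
  have "((\<lambda>x. f (c *\<^sub>R x + a)) has_derivative (\<lambda>h. (c *\<^sub>R h) \<bullet> v)) (at x)"
    by (rule has_derivative_compose[of "\<lambda>x. c *\<^sub>R x + a" "\<lambda>h. c *\<^sub>R h" x UNIV f])
      (use assms in \<open>auto simp: gderiv_def intro!: derivative_eq_intros\<close>)
  then show ?thesis unfolding gderiv_def by simp
qed

lemma Ck_affine:
  fixes f :: "real ^ 'n::finite \<Rightarrow> real"
  shows "Ck_function k f \<Longrightarrow> Ck_function k (\<lambda>x. f (c *\<^sub>R x + a))"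
proof (induction k arbitrary: f)
  case 0
  then show ?case by (auto intro!: continuous_intros continuous_on_compose2[of UNIV f])
next
  case (Suc k)
  show ?case
  proof (rule Ck_SucI)
    show "GDERIV (\<lambda>x. f (c *\<^sub>R x + a)) x :> c *\<^sub>R gradient f (c *\<^sub>R x + a)" for x
      by (rule GDERIV_affine[OF Ck_Suc_GDERIV[OF Suc.prems]])
    show "Ck_function k (\<lambda>x. (c *\<^sub>R gradient f (c *\<^sub>R x + a)) $ i)" for i
      using Suc.prems Suc.IH[of "\<lambda>x. gradient f x $ i"] by (auto intro!: Ck_mult)
  qed
qed

section \<open>The flat exponential and a compactly supported smooth bump\<close>

lemma poly_times_exp_minus_tendsto_0:
  fixes p :: "real poly"
  shows "((\<lambda>s. poly p s * exp (- s)) \<longlongrightarrow> 0) at_top"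
proof -
  have "((\<lambda>s. \<Sum>i\<le>degree p. coeff p i * (s ^ i / exp s)) \<longlongrightarrow> (\<Sum>i\<le>degree p. coeff p i * 0)) at_top"
    by (intro tendsto_sum tendsto_mult tendsto_const tendsto_power_div_exp_0)
  moreover have "(\<lambda>s. \<Sum>i\<le>degree p. coeff p i * (s ^ i / exp s)) = (\<lambda>s. poly p s * exp (- s))"
    by (auto simp: poly_altdef sum_distrib_right exp_minus divide_inverse mult.assoc)
  ultimately show ?thesis by simp
qed

text \<open>This family contains \<open>exp (- 1 / t)\<close> and is closed under differentiation.\<close>

definition flat :: "real poly \<Rightarrow> real \<Rightarrow> real" where
  "flat p t = (if t > 0 then poly p (1 / t) * exp (- (1 / t)) else 0)"

text \<open>With s = 1/t, differentiating p(s) e^(-s) in t gives s^2 (p(s) - p'(s)) e^(-s), and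
  \<open>[:0, 0, 1:]\<close> is the polynomial s^2. Only the origin needs an argument: there
  exponential decay beats every polynomial.\<close>

lemma flat_has_derivative:
  "(flat p has_real_derivative flat ([:0, 0, 1:] * (p - pderiv p)) t) (at t)"
proof -
  consider "t > 0" | "t < 0" | "t = 0" by linarith
  then show ?thesis
  proof cases
    case 1
    have "((\<lambda>t. poly p (1 / t) * exp (- (1 / t))) has_real_derivative
        poly (pderiv p) (1 / t) * (- (1 / t\<^sup>2)) * exp (- (1 / t)) + poly p (1 / t) * (exp (- (1 / t)) * (1 / t\<^sup>2))) (at t)"
      using 1 by (auto intro!: derivative_eq_intros DERIV_chain2[OF poly_DERIV] simp: power2_eq_square field_simps)
    moreover have "poly (pderiv p) (1 / t) * (- (1 / t\<^sup>2)) * exp (- (1 / t)) + poly p (1 / t) * (exp (- (1 / t)) * (1 / t\<^sup>2))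
        = flat ([:0, 0, 1:] * (p - pderiv p)) t"
      using 1 by (simp add: flat_def algebra_simps power2_eq_square)
    ultimately have "((\<lambda>t. poly p (1 / t) * exp (- (1 / t))) has_real_derivative flat ([:0, 0, 1:] * (p - pderiv p)) t) (at t)"
      by simp
    then show ?thesis
      by (rule has_field_derivative_transform_within_open[where S="{0<..}"]) (use 1 in \<open>auto simp: flat_def\<close>)
  next
    case 2
    have "((\<lambda>t. 0) has_real_derivative 0) (at t)" by simp
    then have "(flat p has_real_derivative 0) (at t)"
      by (rule has_field_derivative_transform_within_open[where S="{..<0}"]) (use 2 in \<open>auto simp: flat_def\<close>)
    then show ?thesis using 2 by (simp add: flat_def)
  next
    case 3
    \<comment> \<open>The right difference quotient at 0 is s p(s) e^(-s) with s = 1/h; the extra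
      factor s is the shift to \<open>pCons 0 p\<close>.\<close>
    have "((\<lambda>h. poly (pCons 0 p) (inverse h) * exp (- inverse h)) \<longlongrightarrow> 0) (at_right 0)"
      by (rule filterlim_compose[OF poly_times_exp_minus_tendsto_0 filterlim_inverse_at_top_right])
    then have "((\<lambda>h. (flat p (0 + h) - flat p 0) / h) \<longlongrightarrow> 0) (at_right 0)"
      by (rule Lim_transform_eventually)
        (auto simp: eventually_at_right_less flat_def field_simps intro!: eventually_mono[OF eventually_at_right_less])
    moreover have "((\<lambda>h. (flat p (0 + h) - flat p 0) / h) \<longlongrightarrow> 0) (at_left 0)"
      by (rule tendsto_eventually) (auto simp: flat_def eventually_at_left_field intro: exI[of _ "-1"])
    ultimately have "((\<lambda>h. (flat p (0 + h) - flat p 0) / h) \<longlongrightarrow> 0) (at 0)"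
      by (simp add: filterlim_split_at)
    then show ?thesis using 3 by (simp add: DERIV_def flat_def)
  qed
qed

text \<open>The classical exp (-1 / (1 - |x|^2)) on the unit ball, extended by zero; the constant
  polynomial \<open>1\<close> is the start of the family \<open>flat\<close>.\<close>

definition bump :: "real ^ 'n::finite \<Rightarrow> real" where
  "bump x = flat 1 (1 - x \<bullet> x)"

lemma bump_Ck: "Ck_function k (bump :: real ^ 'n::finite \<Rightarrow> real)"
proof -
  \<comment> \<open>\<open>flat (P j)\<close> is the j-th derivative of \<open>flat 1\<close>, so
    the sequence has the form that \<open>Ck_compose\<close> asks for, with a quadratic polynomial
    as inner function.\<close>
  define P where "P = rec_nat (1::real poly) (\<lambda>_ p. [:0, 0, 1:] * (p - pderiv p))"
  have P: "P 0 = 1" "\<And>j. P (Suc j) = [:0, 0, 1:] * (P j - pderiv (P j))" by (simp_all add: P_def)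
  have "(flat (P j) has_real_derivative flat (P (Suc j)) t) (at t)" for j t
    unfolding P by (rule flat_has_derivative)
  then have "Ck_function k (\<lambda>x::real ^ 'n. flat (P 0) (1 + (-1) * (x \<bullet> x)))"
    by (rule Ck_compose[where F = "\<lambda>j. flat (P j)"]) (intro Ck_add Ck_mult Ck_inner_self Ck_const)
  then show ?thesis by (simp add: P bump_def[abs_def])
qed

lemma bump_nonneg: "bump x \<ge> 0"
  by (simp add: bump_def flat_def)

lemma bump_pos: "norm x < 1 \<Longrightarrow> bump x > 0"
  by (simp add: bump_def flat_def dot_square_norm abs_square_less_1)

lemma bump_outside: "norm x \<ge> 1 \<Longrightarrow> bump x = 0"
  by (simp add: bump_def flat_def dot_square_norm abs_square_less_1 not_less)

section \<open>Mollification\<close>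

text \<open>Differentiation under the integral sign by dominated convergence. The majorant compares
  values with the one at \<open>x\<close> only, so differentiability is asked at the single point
  \<open>x\<close>; the bound on \<open>G\<close> then follows from the majorant by moving in the
  direction of \<open>G y\<close> itself.\<close>

lemma GDERIV_integral:
  fixes f :: "real ^ 'n::finite \<Rightarrow> 'b \<Rightarrow> real"
  assumes \<delta>: "\<delta> > 0" and f: "\<And>z. z \<in> ball x \<delta> \<Longrightarrow> integrable M (f z)"
    and G: "AE y in M. GDERIV (\<lambda>z. f z y) x :> G y" "G \<in> borel_measurable M"
    and L: "integrable M L"
      "AE y in M. \<forall>z\<in>ball x \<delta>. \<bar>f z y - f x y\<bar> \<le> L y * norm (z - x)"
  shows "integrable M G" and "AE y in M. norm (G y) \<le> L y"
    and "GDERIV (\<lambda>z. LINT y|M. f z y) x :> (LINT y|M. G y)"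
proof -
  show bd: "AE y in M. norm (G y) \<le> L y"
    using G(1) L(2)
  proof eventually_elim
    case (elim y)
    define h where "h = (\<delta> / (2 * (1 + norm (G y)))) *\<^sub>R G y"
    have der: "((\<lambda>z. f z y) has_derivative (\<lambda>h. h \<bullet> G y)) (at x)" using elim by (simp add: gderiv_def)
    \<comment> \<open>Along the direction \<open>G y\<close> the derivative is the squared norm of
      \<open>G y\<close>, whereas the majorant caps the quotient by \<open>L y * norm (G y)\<close>.
      Cancelling one norm gives the claim.\<close>
    have "((\<lambda>t. (f (x + t *\<^sub>R G y) y - f x y) / t) \<longlongrightarrow> G y \<bullet> G y) (at 0)"
    proof -
      have "((\<lambda>t. f (x + t *\<^sub>R G y) y) has_derivative (\<lambda>t. (t *\<^sub>R G y) \<bullet> G y)) (at 0)"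
        by (rule has_derivative_compose[of "\<lambda>t. x + t *\<^sub>R G y" "\<lambda>t. t *\<^sub>R G y" 0 UNIV "\<lambda>z. f z y"])
          (use der in \<open>auto intro!: derivative_eq_intros\<close>)
      then have "((\<lambda>t. f (x + t *\<^sub>R G y) y) has_real_derivative (G y \<bullet> G y)) (at 0)"
        by (simp add: has_field_derivative_def mult_commute_abs)
      then show ?thesis by (simp add: DERIV_def)
    qed
    then have "((\<lambda>t. (f (x + t *\<^sub>R G y) y - f x y) / t) \<longlongrightarrow> G y \<bullet> G y) (at_right 0)"
      by (rule filterlim_mono) (auto simp: at_within_le_at)
    moreover have "\<forall>\<^sub>F t in at_right 0. (f (x + t *\<^sub>R G y) y - f x y) / t \<le> L y * norm (G y)"
    proof -
      have "\<forall>\<^sub>F t in at_right 0. 0 < t \<and> t < \<delta> / (1 + norm (G y))"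
        using \<delta> by (auto simp: eventually_at_right_field add_pos_nonneg intro!: exI[of _ "\<delta> / (1 + norm (G y))"])
      then show ?thesis
      proof eventually_elim
        case t: (elim t)
        have "t * norm (G y) \<le> t * (1 + norm (G y))" using t by simp
        also have "\<dots> < \<delta>" using t by (simp add: pos_less_divide_eq add_pos_nonneg)
        finally have "x + t *\<^sub>R G y \<in> ball x \<delta>" using t by (simp add: dist_norm)
        with elim have "\<bar>f (x + t *\<^sub>R G y) y - f x y\<bar> \<le> L y * (t * norm (G y))" using t by force
        then have "f (x + t *\<^sub>R G y) y - f x y \<le> L y * norm (G y) * t" by (simp add: algebra_simps)
        then show ?case using t by (simp add: pos_divide_le_eq)
      qed
    qed
    ultimately have "G y \<bullet> G y \<le> L y * norm (G y)"
      by (rule tendsto_upperbound) simp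
    then have *: "norm (G y) * norm (G y) \<le> L y * norm (G y)" by (simp add: dot_square_norm power2_eq_square)
    \<comment> \<open>The sign of the Lipschitz factor needs a point of the ball other than
      \<open>x\<close>; half a radius along a coordinate axis supplies one.\<close>
    have "L y \<ge> 0"
    proof -
      define z where "z = x + (\<delta> / 2) *\<^sub>R axis undefined 1"
      have "z \<in> ball x \<delta>" "norm (z - x) = \<delta> / 2" using \<delta> by (auto simp: z_def dist_norm)
      with elim(2) have "0 \<le> L y * (\<delta> / 2)" by (metis abs_ge_zero order_trans)
      then show ?thesis using \<delta> by (simp add: zero_le_mult_iff)
    qed
    then show ?case using * by (cases "norm (G y) = 0") (auto simp: mult_le_cancel_right)
  qed
  show int: "integrable M G"
    by (rule Bochner_Integration.integrable_bound[OF L(1) G(2)]) (use bd in eventually_elim, simp)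
  show "GDERIV (\<lambda>z. LINT y|M. f z y) x :> (LINT y|M. G y)"
    unfolding gderiv_def has_derivative_at2
  proof (intro conjI)
    show "bounded_linear (\<lambda>h. h \<bullet> (LINT y|M. G y))" by (rule bounded_linear_inner_left)
    show "((\<lambda>z. (1 / norm (z - x)) *\<^sub>R ((LINT y|M. f z y) - ((LINT y|M. f x y) + (z - x) \<bullet> (LINT y|M. G y)))) \<longlongrightarrow> 0) (at x)"
      unfolding tendsto_at_iff_sequentially comp_def
    proof (intro allI impI)
      fix X :: "nat \<Rightarrow> real ^ 'n"
      assume X: "\<forall>i. X i \<in> UNIV - {x}" and lim: "X \<longlonglongrightarrow> x"
      \<comment> \<open>The integrands are controlled inside the ball only, so the finitely many
        terms of the sequence outside it are dropped by the shift to \<open>Y\<close>.\<close>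
      then obtain N where N: "\<And>i. i \<ge> N \<Longrightarrow> X i \<in> ball x \<delta>"
        using \<delta> by (metis (no_types) dist_commute lim_sequentially mem_ball)
      define Y where "Y i = X (i + N)" for i
      have Y: "Y i \<in> ball x \<delta>" "Y i \<noteq> x" for i using N X by (auto simp: Y_def)
      have Ylim: "Y \<longlonglongrightarrow> x" unfolding Y_def using lim by (rule LIMSEQ_ignore_initial_segment)
      define q where "q i y = (1 / norm (Y i - x)) * (f (Y i) y - f x y - (Y i - x) \<bullet> G y)" for i y
      have fx: "integrable M (f x)" using f \<delta> by simp
      have Gi: "integrable M (\<lambda>y. v \<bullet> G y)" for v using int by simp
      have "(\<lambda>i. LINT y|M. q i y) \<longlonglongrightarrow> (LINT y|M. 0)"
      proof (rule integral_dominated_convergence)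
        \<comment> \<open>One \<open>L\<close> bounds the increment of \<open>f\<close>, the other
          the linear part, through the gradient bound just proved.\<close>
        show "integrable M (\<lambda>y. 2 * L y)" using L by simp
        show "q i \<in> borel_measurable M" for i
          unfolding q_def using f[OF Y(1)] fx Gi by (intro borel_measurable_integrable) auto
        show "AE y in M. (\<lambda>i. q i y) \<longlonglongrightarrow> 0"
          using G(1)
        proof eventually_elim
          case (elim y)
          then have "((\<lambda>z. (1 / norm (z - x)) *\<^sub>R (f z y - (f x y + (z - x) \<bullet> G y))) \<longlongrightarrow> 0) (at x)"
            by (simp add: gderiv_def has_derivative_at2)
          then have "(\<lambda>i. (1 / norm (Y i - x)) *\<^sub>R (f (Y i) y - (f x y + (Y i - x) \<bullet> G y))) \<longlonglongrightarrow> 0"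
            using Y Ylim unfolding tendsto_at_iff_sequentially comp_def by auto
          then show ?case by (simp add: q_def algebra_simps)
        qed
        show "AE y in M. norm (q i y) \<le> 2 * L y" for i
          using bd L(2)
        proof eventually_elim
          case (elim y)
          have n: "norm (Y i - x) > 0" using Y by simp
          have "\<bar>f (Y i) y - f x y - (Y i - x) \<bullet> G y\<bar> \<le> \<bar>f (Y i) y - f x y\<bar> + \<bar>(Y i - x) \<bullet> G y\<bar>" by linarith
          also have "\<dots> \<le> L y * norm (Y i - x) + norm (Y i - x) * norm (G y)"
            using elim(2) Y by (intro add_mono Cauchy_Schwarz_ineq2) auto
          also have "\<dots> \<le> 2 * L y * norm (Y i - x)" using elim(1) n by (simp add: algebra_simps mult_left_mono)
          finally show ?case using n by (simp add: q_def abs_mult field_simps)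
        qed
      qed simp
      moreover have "(LINT y|M. q i y) = (1 / norm (Y i - x)) *\<^sub>R ((LINT y|M. f (Y i) y) - ((LINT y|M. f x y) + (Y i - x) \<bullet> (LINT y|M. G y)))" for i
        unfolding q_def using f[OF Y(1)] fx Gi int by simp
      ultimately have "(\<lambda>i. (1 / norm (Y i - x)) *\<^sub>R ((LINT y|M. f (Y i) y) - ((LINT y|M. f x y) + (Y i - x) \<bullet> (LINT y|M. G y)))) \<longlonglongrightarrow> 0"
        by simp
      then show "(\<lambda>i. (1 / norm (X i - x)) *\<^sub>R ((LINT y|M. f (X i) y) - ((LINT y|M. f x y) + (X i - x) \<bullet> (LINT y|M. G y)))) \<longlonglongrightarrow> 0"
        unfolding Y_def by (rule LIMSEQ_offset)
    qed
  qed
qed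

section \<open>Test functions and convolution with them\<close>

lemma test_function_Ck: "test_function U \<phi> \<Longrightarrow> Ck_function k \<phi>"
  by (auto simp: test_function_def)

lemma test_function_GDERIV:
  fixes \<phi> :: "real ^ 'n::finite \<Rightarrow> real"
  shows "test_function U \<phi> \<Longrightarrow> GDERIV \<phi> x :> gradient \<phi> x"
  using Ck_Suc_GDERIV test_function_Ck by blast

lemma test_function_continuous: "test_function U \<phi> \<Longrightarrow> continuous_on S \<phi>"
  using test_function_Ck[of U \<phi> 0] continuous_on_subset by auto

lemma test_function_partial:
  fixes \<phi> :: "real ^ 'n::finite \<Rightarrow> real"
  assumes "test_function U \<phi>"
  shows "test_function U (\<lambda>x. gradient \<phi> x $ i)"
proof -
  obtain K where K: "compact K" "K \<subseteq> U" "\<And>x. x \<notin> K \<Longrightarrow> \<phi> x = 0"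
    using assms by (auto simp: test_function_def)
  have "gradient \<phi> x $ i = 0" if "x \<notin> K" for x
    using gradient_eq_0_outside[OF compact_imp_closed[OF K(1)] K(3) that] by simp
  moreover have "Ck_function k (\<lambda>x. gradient \<phi> x $ i)" for k
    using test_function_Ck[OF assms, of "Suc k"] by simp
  ultimately show ?thesis using K(1,2) unfolding test_function_def by auto
qed

lemma test_function_continuous_gradient:
  fixes \<phi> :: "real ^ 'n::finite \<Rightarrow> real"
  assumes "test_function U \<phi>"
  shows "continuous_on S (gradient \<phi>)"
proof -
  have "continuous_on S (\<lambda>x. \<chi> i. gradient \<phi> x $ i)"
    by (intro continuous_on_vec_lambda test_function_continuous[OF test_function_partial[OF assms]])
  then show ?thesis by simp
qed

lemma test_function_mono: "test_function U \<phi> \<Longrightarrow> U \<subseteq> V \<Longrightarrow> test_function V \<phi>"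
  unfolding test_function_def by blast

lemma test_function_mult_Ck:
  fixes \<phi> :: "real ^ 'n::finite \<Rightarrow> real"
  assumes "test_function U \<phi>" "\<And>k. Ck_function k \<psi>"
  shows "test_function U (\<lambda>x. \<phi> x * \<psi> x)"
  using assms unfolding test_function_def by (auto intro: Ck_mult)

lemma continuous_compact_support_bounded:
  fixes f :: "real ^ 'n::finite \<Rightarrow> 'b::real_normed_vector"
  assumes "continuous_on UNIV f" "compact K" "\<And>x. x \<notin> K \<Longrightarrow> f x = 0"
  obtains B where "B > 0" "\<And>x. norm (f x) \<le> B"
proof -
  have "bounded (f ` K)"
    using assms by (intro compact_imp_bounded compact_continuous_image) (auto intro: continuous_on_subset)
  then obtain B where "B > 0" "\<And>x. x \<in> K \<Longrightarrow> norm (f x) \<le> B"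
    unfolding bounded_pos by auto
  with that[of B] show ?thesis by (metis assms(3) less_imp_le norm_zero)
qed

lemma test_function_bounded:
  fixes \<phi> :: "real ^ 'n::finite \<Rightarrow> real"
  assumes "test_function U \<phi>"
  obtains B where "B > 0" "\<And>x. \<bar>\<phi> x\<bar> \<le> B" "\<And>x. norm (gradient \<phi> x) \<le> B"
proof -
  obtain K where K: "compact K" "K \<subseteq> U" "\<And>x. x \<notin> K \<Longrightarrow> \<phi> x = 0"
    using assms by (auto simp: test_function_def)
  have K': "gradient \<phi> x = 0" if "x \<notin> K" for x
    using gradient_eq_0_outside[OF compact_imp_closed[OF K(1)] K(3) that] by simp
  obtain B1 B2 where "B1 > 0" "\<And>x. norm (\<phi> x) \<le> B1" "B2 > 0" "\<And>x. norm (gradient \<phi> x) \<le> B2"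
    using continuous_compact_support_bounded[OF test_function_continuous[OF assms] K(1,3)]
      continuous_compact_support_bounded[OF test_function_continuous_gradient[OF assms] K(1) K'] by metis
  then show ?thesis using that[of "max B1 B2"]
    by (auto simp: le_max_iff_disj less_max_iff_disj)
qed

lemma GDERIV_bounded_Lipschitz:
  fixes f :: "real ^ 'n::finite \<Rightarrow> real"
  assumes "convex S" "\<And>z. z \<in> S \<Longrightarrow> GDERIV f z :> g z" "\<And>z. z \<in> S \<Longrightarrow> norm (g z) \<le> B" "x \<in> S" "y \<in> S"
  shows "\<bar>f x - f y\<bar> \<le> B * norm (x - y)"
proof -
  have "norm (f x - f y) \<le> B * norm (x - y)"
  proof (rule differentiable_bound[OF assms(1) _ _ assms(4,5), where f' = "\<lambda>z h. h \<bullet> g z"])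
    show "(f has_derivative (\<lambda>h. h \<bullet> g z)) (at z within S)" if "z \<in> S" for z
      using assms(2)[OF that] unfolding gderiv_def by (rule has_derivative_at_withinI)
    show "onorm (\<lambda>h. h \<bullet> g z) \<le> B" if "z \<in> S" for z
    proof (rule onorm_le)
      fix h
      have "norm (h \<bullet> g z) \<le> norm h * norm (g z)" using Cauchy_Schwarz_ineq2 by auto
      also have "\<dots> \<le> norm h * B" using assms(3)[OF that] by (intro mult_left_mono) auto
      finally show "norm (h \<bullet> g z) \<le> B * norm h" by (simp add: mult.commute)
    qed
  qed
  then show ?thesis by simp
qed

text \<open>Convolution, taken over \<open>lebesgue\<close> because the functions to be smoothed are
  only Lebesgue measurable. Arguments that need Tonelli move to \<open>lborel\<close> first.\<close>

definition mconv :: "(real ^ 'n \<Rightarrow> real) \<Rightarrow> (real ^ 'n \<Rightarrow> real) \<Rightarrow> real ^ 'n \<Rightarrow> real" where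
  "mconv \<rho> f x = (LINT y|lebesgue. \<rho> (x - y) * f y)"

lemma continuous_imp_lebesgue_measurable:
  fixes f :: "real ^ 'n::finite \<Rightarrow> 'b::{second_countable_topology, topological_space}"
  assumes "continuous_on UNIV f"
  shows "f \<in> borel_measurable lebesgue"
  using borel_measurable_continuous_onI[OF assms] by (intro measurable_completion) simp

lemma integrable_bounded_mult_lebesgue:
  fixes f :: "real ^ 'n::finite \<Rightarrow> 'b::euclidean_space" and \<rho> :: "real ^ 'n \<Rightarrow> real"
  assumes "integrable lebesgue f" "\<rho> \<in> borel_measurable lebesgue" "\<And>x. \<bar>\<rho> x\<bar> \<le> B"
  shows "integrable lebesgue (\<lambda>x. \<rho> x *\<^sub>R f x)"
proof (rule Bochner_Integration.integrable_bound)
  show "integrable lebesgue (\<lambda>x. B *\<^sub>R f x)" using assms by simp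
  show "(\<lambda>x. \<rho> x *\<^sub>R f x) \<in> borel_measurable lebesgue" using assms by measurable
  show "AE x in lebesgue. norm (\<rho> x *\<^sub>R f x) \<le> norm (B *\<^sub>R f x)"
    using order_trans[OF assms(3) abs_ge_self] by (auto intro!: mult_right_mono)
qed

lemma translated_continuous:
  assumes "continuous_on UNIV \<rho>"
  shows "continuous_on UNIV (\<lambda>y::real ^ 'n::finite. \<rho> (x - y))"
  by (rule continuous_on_compose2[OF assms]) (auto intro: continuous_intros)

lemma mconv_integrable:
  fixes \<rho> :: "real ^ 'n::finite \<Rightarrow> real"
  assumes "test_function UNIV \<rho>" "integrable lebesgue f"
  shows "integrable lebesgue (\<lambda>y. \<rho> (x - y) * f y)"
proof -
  obtain B where "\<And>x. \<bar>\<rho> x\<bar> \<le> B" using test_function_bounded[OF assms(1)] by metis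
  then have "integrable lebesgue (\<lambda>y. \<rho> (x - y) *\<^sub>R f y)"
    by (intro integrable_bounded_mult_lebesgue[OF assms(2)] continuous_imp_lebesgue_measurable
        translated_continuous test_function_continuous[OF assms(1)])
  then show ?thesis by simp
qed

text \<open>The derivative falls on the kernel. A test function is globally Lipschitz, and its
  Lipschitz constant times \<open>\<bar>f y\<bar>\<close> is the majorant for
  \<open>GDERIV_integral\<close>.\<close>

lemma mconv_gradient_integrable:
  fixes \<rho> :: "real ^ 'n::finite \<Rightarrow> real"
  assumes "test_function UNIV \<rho>" "integrable lebesgue f"
  shows "integrable lebesgue (\<lambda>y. f y *\<^sub>R gradient \<rho> (x - y))"
    and "GDERIV (mconv \<rho> f) x :> (LINT y|lebesgue. f y *\<^sub>R gradient \<rho> (x - y))"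
proof -
  obtain B where B: "\<And>x. norm (gradient \<rho> x) \<le> B" using test_function_bounded[OF assms(1)] by metis
  have 1: "AE y in lebesgue. GDERIV (\<lambda>z. \<rho> (z - y) * f y) x :> f y *\<^sub>R gradient \<rho> (x - y)"
  proof (rule AE_I2)
    fix y
    have "GDERIV (\<lambda>z. \<rho> (1 *\<^sub>R z + (- y))) x :> 1 *\<^sub>R gradient \<rho> (x - y)"
      by (rule GDERIV_affine) (use test_function_GDERIV[OF assms(1)] in simp)
    then have "GDERIV (\<lambda>z. \<rho> (z - y)) x :> gradient \<rho> (x - y)" by simp
    from GDERIV_mult[OF this GDERIV_const[of "f y" x]]
    show "GDERIV (\<lambda>z. \<rho> (z - y) * f y) x :> f y *\<^sub>R gradient \<rho> (x - y)" by simp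
  qed
  have 2: "(\<lambda>y. f y *\<^sub>R gradient \<rho> (x - y)) \<in> borel_measurable lebesgue"
    using assms(2) continuous_imp_lebesgue_measurable[OF translated_continuous[OF test_function_continuous_gradient[OF assms(1)], of x]]
    by measurable
  have 3: "integrable lebesgue (\<lambda>y. B * \<bar>f y\<bar>)" using assms(2) by simp
  have 4: "AE y in lebesgue. \<forall>z\<in>ball x 1. \<bar>\<rho> (z - y) * f y - \<rho> (x - y) * f y\<bar> \<le> (B * \<bar>f y\<bar>) * norm (z - x)"
  proof (intro AE_I2 ballI)
    fix y z
    have "\<bar>\<rho> (z - y) - \<rho> (x - y)\<bar> \<le> B * norm ((z - y) - (x - y))"
      by (rule GDERIV_bounded_Lipschitz[of UNIV]) (use test_function_GDERIV[OF assms(1)] B in auto)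
    then have "\<bar>\<rho> (z - y) - \<rho> (x - y)\<bar> * \<bar>f y\<bar> \<le> B * norm (z - x) * \<bar>f y\<bar>" by (intro mult_right_mono) auto
    then show "\<bar>\<rho> (z - y) * f y - \<rho> (x - y) * f y\<bar> \<le> (B * \<bar>f y\<bar>) * norm (z - x)"
      by (simp add: abs_mult[symmetric] algebra_simps)
  qed
  have pos: "(1::real) > 0" by simp
  note * = GDERIV_integral[OF pos mconv_integrable[OF assms] 1 2 3 4]
  show "integrable lebesgue (\<lambda>y. f y *\<^sub>R gradient \<rho> (x - y))" by (rule *(1))
  show "GDERIV (mconv \<rho> f) x :> (LINT y|lebesgue. f y *\<^sub>R gradient \<rho> (x - y))"
    unfolding mconv_def[abs_def] by (rule *(3))
qed

lemma mconv_gradient_nth: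
  fixes \<rho> :: "real ^ 'n::finite \<Rightarrow> real"
  assumes "test_function UNIV \<rho>" "integrable lebesgue f"
  shows "gradient (mconv \<rho> f) x $ i = mconv (\<lambda>z. gradient \<rho> z $ i) f x"
  using gradient_eqI[OF mconv_gradient_integrable(2)[OF assms]]
    integral_bounded_linear[OF bounded_linear_vec_nth mconv_gradient_integrable(1)[OF assms]]
  by (simp add: mconv_def mult.commute)

text \<open>A partial derivative of a convolution is the convolution with a partial derivative of
  the kernel, again a test function; hence the induction varies the kernel and keeps
  \<open>f\<close>.\<close>

lemma mconv_Ck:
  fixes \<rho> :: "real ^ 'n::finite \<Rightarrow> real"
  assumes "test_function UNIV \<rho>" "integrable lebesgue f"
  shows "Ck_function k (mconv \<rho> f)"
  using assms(1)
proof (induction k arbitrary: \<rho>)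
  case 0
  then show ?case
    using GDERIV_imp_continuous[OF mconv_gradient_integrable(2)[OF _ assms(2)]]
    by (simp add: continuous_on_eq_continuous_at)
next
  case (Suc k)
  show ?case
  proof (rule Ck_SucI)
    show "GDERIV (mconv \<rho> f) x :> gradient (mconv \<rho> f) x" for x
      using mconv_gradient_integrable(2)[OF Suc.prems assms(2)] gradient_eqI by metis
    show "Ck_function k (\<lambda>x. gradient (mconv \<rho> f) x $ i)" for i
      unfolding mconv_gradient_nth[OF Suc.prems assms(2)]
      by (rule Suc.IH[OF test_function_partial[OF Suc.prems]])
  qed
qed

lemma mconv_eq_0:
  assumes "\<And>z. norm z \<ge> e \<Longrightarrow> \<rho> z = 0" "\<And>y. dist x y < e \<Longrightarrow> f y = 0"
  shows "mconv \<rho> f x = 0"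
proof -
  have "\<rho> (x - y) * f y = 0" for y
    using assms(1)[of "x - y"] assms(2)[of y] by (cases "dist x y < e") (auto simp: dist_norm)
  then show ?thesis unfolding mconv_def by (subst Bochner_Integration.integral_cong[OF refl, of _ _ "\<lambda>_. 0"]) auto
qed

section \<open>The standard mollifier\<close>

lemma bump_test_function: "test_function UNIV (bump :: real ^ 'n::finite \<Rightarrow> real)"
  unfolding test_function_def
  by (auto simp: bump_Ck intro!: exI[of _ "cball 0 1"] bump_outside)

text \<open>Dividing by the integral of the rescaled bump makes the mass one by construction;
  \<open>moll_alt\<close> supplies the explicit power of \<open>e\<close> when size matters.\<close>

definition moll :: "real \<Rightarrow> real ^ 'n::finite \<Rightarrow> real" where
  "moll e x = bump ((1 / e) *\<^sub>R x) / (LINT z|lborel. bump ((1 / e) *\<^sub>R (z :: real ^ 'n)))"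

lemma bump_integral_scale:
  assumes "e > 0"
  shows "(LINT z|lborel. bump ((1 / e) *\<^sub>R (z :: real ^ 'n::finite))) = e ^ CARD('n) * (LINT z|lborel. bump (z :: real ^ 'n))"
proof -
  have [measurable]: "(bump :: real ^ 'n \<Rightarrow> real) \<in> borel_measurable borel"
    using test_function_continuous[OF bump_test_function] by (rule borel_measurable_continuous_onI)
  have "(LINT z|lborel. bump ((1 / e) *\<^sub>R (z :: real ^ 'n)))
      = (LINT z|density (distr lborel borel (\<lambda>x. 0 + e *\<^sub>R x)) (\<lambda>_. \<bar>e\<bar> ^ DIM(real ^ 'n)). bump ((1 / e) *\<^sub>R (z :: real ^ 'n)))"
    using assms by (simp only: lborel_affine[of e 0, symmetric])
  also have "\<dots> = (LINT z|distr lborel borel (\<lambda>x. 0 + e *\<^sub>R x). \<bar>e\<bar> ^ DIM(real ^ 'n) * bump ((1 / e) *\<^sub>R (z :: real ^ 'n)))"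
    by (subst integral_density) auto
  also have "\<dots> = (LINT z|lborel. \<bar>e\<bar> ^ DIM(real ^ 'n) * bump ((1 / e) *\<^sub>R (0 + e *\<^sub>R z :: real ^ 'n)))"
    by (subst integral_distr) auto
  finally show ?thesis using assms by simp
qed

lemma bump_integrable: "integrable lborel (bump :: real ^ 'n::finite \<Rightarrow> real)"
proof -
  have "integrable lborel (\<lambda>x :: real ^ 'n. indicator (cball 0 1) x *\<^sub>R (bump x :: real))"
    by (rule borel_integrable_compact) (auto intro: test_function_continuous[OF bump_test_function])
  moreover from bump_outside[where 'a='n] have "indicator (cball 0 1) x *\<^sub>R bump x = (bump x :: real)" for x :: "real ^ 'n"
    by (cases "norm x \<le> 1") (simp_all add: indicator_def)
  then have "(\<lambda>x. indicator (cball 0 1) x *\<^sub>R (bump x :: real)) = (bump :: real ^ 'n \<Rightarrow> real)" by blast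
  ultimately show ?thesis by simp
qed

lemma bump_integral_pos: "(LINT z|lborel. bump (z :: real ^ 'n::finite)) > 0"
proof -
  have "\<not> (AE z in lborel. bump (z :: real ^ 'n) = 0)"
  proof
    assume "AE z in lborel. bump (z :: real ^ 'n) = 0"
    then have "AE z in lborel. z \<notin> ball (0 :: real ^ 'n) 1"
      by eventually_elim (use bump_pos in \<open>fastforce simp: dist_norm\<close>)
    then have "emeasure lborel (ball (0 :: real ^ 'n) 1) = 0" by (simp add: AE_iff_measurable[OF _ refl] ball_def)
    then have "measure lborel (ball (0 :: real ^ 'n) 1) = 0" by (simp add: measure_def)
    moreover have "measure lborel (ball (0 :: real ^ 'n) 1) > 0" by (subst content_ball_gt_0_iff) simp
    ultimately show False by linarith
  qed
  then have "(LINT z|lborel. bump (z :: real ^ 'n)) \<noteq> 0"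
    using integral_nonneg_eq_0_iff_AE[OF bump_integrable] bump_nonneg by auto
  then show ?thesis using Bochner_Integration.integral_nonneg[of lborel "bump :: real ^ 'n \<Rightarrow> real"] bump_nonneg
    by (metis less_eq_real_def)
qed

lemma moll_alt: "e > 0 \<Longrightarrow> moll e x = bump ((1 / e) *\<^sub>R x) / (e ^ CARD('n) * (LINT z|lborel. bump (z :: real ^ 'n)))"
  for x :: "real ^ 'n::finite"
  by (simp add: moll_def bump_integral_scale)

lemma moll_nonneg: "e > 0 \<Longrightarrow> moll e x \<ge> 0"
  using bump_integral_pos by (simp add: moll_alt bump_nonneg less_imp_le)

lemma moll_outside: "e > 0 \<Longrightarrow> norm x \<ge> e \<Longrightarrow> moll e x = 0"
  by (simp add: moll_alt bump_outside)

lemma moll_test_function: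
  assumes "e > 0"
  shows "test_function UNIV (moll e :: real ^ 'n::finite \<Rightarrow> real)"
  unfolding test_function_def
proof (intro conjI allI impI exI[of _ "cball 0 e"])
  have "Ck_function k (\<lambda>x. bump ((1 / e) *\<^sub>R x + 0) * (1 / (LINT z|lborel. bump ((1 / e) *\<^sub>R (z :: real ^ 'n)))))" for k
    by (rule Ck_mult[OF Ck_affine[OF bump_Ck] Ck_const])
  moreover have "(\<lambda>x :: real ^ 'n. bump ((1 / e) *\<^sub>R x + 0) * (1 / (LINT z|lborel. bump ((1 / e) *\<^sub>R (z :: real ^ 'n))))) = moll e"
    by (rule ext) (simp only: moll_def add_0_right times_divide_eq_right mult_1_right)
  ultimately show "Ck_function k (moll e :: real ^ 'n \<Rightarrow> real)" for k by metis
  show "moll e x = 0" if "x \<notin> cball 0 e" for x :: "real ^ 'n"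
    by (rule moll_outside) (use assms that in auto)
qed auto

lemma moll_integral:
  assumes "e > 0"
  shows "(LINT z|lborel. moll e (z :: real ^ 'n::finite)) = 1" "integrable lborel (moll e :: real ^ 'n::finite \<Rightarrow> real)"
proof -
  show 1: "(LINT z|lborel. moll e (z :: real ^ 'n::finite)) = 1"
    using assms bump_integral_pos[where 'n='n] by (simp add: moll_def bump_integral_scale)
  \<comment> \<open>A function that is not integrable has integral 0 by convention, so integral 1
    already implies integrability.\<close>
  then show "integrable lborel (moll e :: real ^ 'n::finite \<Rightarrow> real)"
    using not_integrable_integral_eq by fastforce
qed

text \<open>The gradient has size \<open>e\<close> to the power -n-1 and the ball has volume of
  order \<open>e\<close> to the power n. The product form is what is left after integrating the
  kernel gradient over its support.\<close>

lemma moll_gradient_bound: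
  "\<exists>C>0. \<forall>e>0. \<forall>x :: real ^ 'n::finite. norm (gradient (moll e) x) * measure lborel (ball (0 :: real ^ 'n) e) \<le> C / e"
proof -
  obtain B where B: "B > 0" "\<And>x :: real ^ 'n. norm (gradient bump x) \<le> B"
    using test_function_bounded[OF bump_test_function] by metis
  let ?I = "LINT z|lborel. bump (z :: real ^ 'n)"
  let ?v = "measure lborel (ball (0 :: real ^ 'n) 1)"
  have v: "?v > 0" by (subst content_ball_gt_0_iff) simp
  show ?thesis
  proof (intro exI[of _ "B * ?v / ?I"] conjI allI impI)
    show "B * ?v / ?I > 0" using B v bump_integral_pos[where 'n='n] by (intro divide_pos_pos mult_pos_pos)
    fix e :: real and x :: "real ^ 'n" assume e: "e > 0"
    have "GDERIV (\<lambda>x. bump ((1 / e) *\<^sub>R x + 0)) x :> (1 / e) *\<^sub>R gradient bump ((1 / e) *\<^sub>R x)"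
      by (rule GDERIV_affine) (use test_function_GDERIV[OF bump_test_function] in simp)
    from GDERIV_mult[OF this GDERIV_const[of "1 / (e ^ CARD('n) * ?I)" x]]
    have "GDERIV (\<lambda>x. bump ((1 / e) *\<^sub>R x + 0) * (1 / (e ^ CARD('n) * ?I))) x :> (1 / (e ^ CARD('n) * ?I)) *\<^sub>R (1 / e) *\<^sub>R gradient bump ((1 / e) *\<^sub>R x)"
      by simp
    moreover have "(\<lambda>x :: real ^ 'n. bump ((1 / e) *\<^sub>R x + 0) * (1 / (e ^ CARD('n) * ?I))) = moll e"
      by (rule ext) (simp only: moll_alt[OF e] add_0_right times_divide_eq_right mult_1_right)
    ultimately have "GDERIV (moll e) x :> (1 / (e ^ CARD('n) * ?I)) *\<^sub>R (1 / e) *\<^sub>R gradient bump ((1 / e) *\<^sub>R x)"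
      by metis
    then have "norm (gradient (moll e) x) = (1 / (e ^ CARD('n) * ?I)) * (1 / e) * norm (gradient bump ((1 / e) *\<^sub>R x))"
      using e bump_integral_pos[where 'n='n] by (simp add: gradient_eqI abs_mult)
    also have "\<dots> \<le> (1 / (e ^ CARD('n) * ?I)) * (1 / e) * B"
      using e bump_integral_pos[where 'n='n] by (intro mult_left_mono B) auto
    finally have "norm (gradient (moll e) x) * measure lborel (ball (0 :: real ^ 'n) e)
        \<le> (1 / (e ^ CARD('n) * ?I)) * (1 / e) * B * measure lborel (ball (0 :: real ^ 'n) e)"
      by (rule mult_right_mono) simp
    moreover have "measure lborel (ball (0 :: real ^ 'n) e) = e ^ CARD('n) * ?v"
      using e by (simp add: content_ball mult.commute del: content_ball_eq_0_iff)
    moreover have "(1 / (e ^ CARD('n) * ?I)) * (1 / e) * B * (e ^ CARD('n) * ?v) = B * ?v / ?I / e"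
      using e bump_integral_pos[where 'n='n] by (simp add: field_simps)
    ultimately show "norm (gradient (moll e) x) * measure lborel (ball (0 :: real ^ 'n) e) \<le> B * ?v / ?I / e"
      by simp
  qed
qed

section \<open>Convergence of mollified L2 pairings\<close>

lemma distr_lborel_reflect: "distr lborel borel (\<lambda>y. x - y) = (lborel :: 'a::euclidean_space measure)"
  using lborel_affine[of "-1" x] by (simp add: density_1)

lemma distr_lborel_translate: "distr lborel borel (\<lambda>y. y - x) = (lborel :: 'a::euclidean_space measure)"
  using lborel_affine[of 1 "- x"] by (simp add: density_1)

lemma nn_integral_lborel_reflect:
  fixes f :: "'a::euclidean_space \<Rightarrow> ennreal"
  assumes [measurable]: "f \<in> borel_measurable borel"
  shows "(\<integral>\<^sup>+ y. f (x - y) \<partial>lborel) = (\<integral>\<^sup>+ y. f y \<partial>lborel)"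
proof -
  have "(\<integral>\<^sup>+ y. f y \<partial>lborel) = (\<integral>\<^sup>+ y. f y \<partial>distr lborel borel (\<lambda>y. x - y))"
    by (simp only: distr_lborel_reflect)
  also have "\<dots> = (\<integral>\<^sup>+ y. f (x - y) \<partial>lborel)" by (rule nn_integral_distr) auto
  finally show ?thesis by simp
qed

lemma nn_integral_lborel_translate:
  fixes f :: "'a::euclidean_space \<Rightarrow> ennreal"
  assumes [measurable]: "f \<in> borel_measurable borel"
  shows "(\<integral>\<^sup>+ y. f (y - x) \<partial>lborel) = (\<integral>\<^sup>+ y. f y \<partial>lborel)"
proof -
  have "(\<integral>\<^sup>+ y. f y \<partial>lborel) = (\<integral>\<^sup>+ y. f y \<partial>distr lborel borel (\<lambda>y. y - x))"
    by (simp only: distr_lborel_translate)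
  also have "\<dots> = (\<integral>\<^sup>+ y. f (y - x) \<partial>lborel)" by (rule nn_integral_distr) auto
  finally show ?thesis by simp
qed

lemma moll_borel [measurable]: "e > 0 \<Longrightarrow> (moll e :: real ^ 'n::finite \<Rightarrow> real) \<in> borel_measurable borel"
  using test_function_continuous[OF moll_test_function] by (rule borel_measurable_continuous_onI)

lemma moll_nn_integral:
  fixes x :: "real ^ 'n::finite"
  assumes e: "e > 0"
  shows "(\<integral>\<^sup>+ y. ennreal (moll e (x - y)) \<partial>lborel) = 1" "(\<integral>\<^sup>+ y. ennreal (moll e (y - x)) \<partial>lborel) = 1"
proof -
  note [measurable] = moll_borel[OF e]
  have "(\<integral>\<^sup>+ y. ennreal (moll e (y :: real ^ 'n)) \<partial>lborel) = 1"
    using nn_integral_eq_integral[OF moll_integral(2)[OF e, where 'n='n]] moll_integral(1)[OF e, where 'n='n] moll_nonneg[OF e, where 'a='n]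
    by simp
  then show "(\<integral>\<^sup>+ y. ennreal (moll e (x - y)) \<partial>lborel) = 1" "(\<integral>\<^sup>+ y. ennreal (moll e (y - x)) \<partial>lborel) = 1"
    using nn_integral_lborel_reflect[of "\<lambda>y. ennreal (moll e y)" x] nn_integral_lborel_translate[of "\<lambda>y. ennreal (moll e y)" x]
    by simp_all
qed

lemma mconv_lborel:
  fixes f :: "real ^ 'n::finite \<Rightarrow> real"
  assumes [measurable]: "f \<in> borel_measurable borel" and e: "e > 0"
  shows "mconv (moll e) f x = (LINT y|lborel. moll e (x - y) * f y)"
proof -
  note [measurable] = moll_borel[OF e]
  show ?thesis unfolding mconv_def by (rule integral_completion) simp
qed

lemma Young_weighted:
  fixes a b \<delta> :: real
  assumes "\<delta> > 0"
  shows "\<bar>a * b\<bar> \<le> \<delta> / 2 * a\<^sup>2 + 1 / (2 * \<delta>) * b\<^sup>2"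
proof -
  have "0 \<le> (\<delta> * \<bar>a\<bar> - \<bar>b\<bar>)\<^sup>2" by simp
  then have "2 * \<delta> * \<bar>a * b\<bar> \<le> \<delta>\<^sup>2 * a\<^sup>2 + b\<^sup>2"
    by (simp add: power2_diff power_mult_distrib abs_mult algebra_simps)
  also have "\<dots> = 2 * \<delta> * (\<delta> / 2 * a\<^sup>2 + 1 / (2 * \<delta>) * b\<^sup>2)"
    using assms by (simp add: field_simps power2_eq_square)
  finally show ?thesis using assms by (simp add: mult_le_cancel_left_pos)
qed

text \<open>Young's inequality is applied to \<open>F x\<close> and \<open>h y\<close> under the
  double integral, before any integration. By Tonelli each resulting term integrates the mollifier
  to one in the other variable, so the bound does not depend on \<open>e\<close>.\<close>

lemma mconv_pairing_bound:
  fixes F h :: "real ^ 'n::finite \<Rightarrow> real"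
  assumes [measurable]: "F \<in> borel_measurable borel" "h \<in> borel_measurable borel"
    and h: "integrable lborel h" "integrable lborel (\<lambda>x. (h x)\<^sup>2)" and F: "integrable lborel (\<lambda>x. (F x)\<^sup>2)"
    and e: "e > 0" and \<delta>: "\<delta> > 0"
  shows "(\<integral>\<^sup>+ x. ennreal \<bar>F x * mconv (moll e) h x\<bar> \<partial>lborel)
    \<le> ennreal (\<delta> / 2 * (LINT x|lborel. (F x)\<^sup>2) + 1 / (2 * \<delta>) * (LINT x|lborel. (h x)\<^sup>2))"
proof -
  note [measurable] = moll_borel[OF e]
  have int: "integrable lborel (\<lambda>y. moll e (x - y) * \<bar>h y\<bar>)" for x
  proof -
    obtain B where B: "\<And>x :: real ^ 'n. \<bar>moll e x\<bar> \<le> B" using test_function_bounded[OF moll_test_function[OF e]] by metis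
    show ?thesis
      by (rule Bochner_Integration.integrable_bound[where f = "\<lambda>y. B * \<bar>h y\<bar>"])
        (use h order_trans[OF B abs_ge_self] in \<open>auto simp: abs_mult intro!: mult_right_mono\<close>)
  qed
  have "(\<integral>\<^sup>+ x. ennreal \<bar>F x * mconv (moll e) h x\<bar> \<partial>lborel)
     \<le> (\<integral>\<^sup>+ x. (\<integral>\<^sup>+ y. ennreal (\<bar>F x\<bar> * (moll e (x - y) * \<bar>h y\<bar>)) \<partial>lborel) \<partial>lborel)"
  proof (rule nn_integral_mono)
    fix x
    have "\<bar>mconv (moll e) h x\<bar> \<le> (LINT y|lborel. \<bar>moll e (x - y) * h y\<bar>)"
      unfolding mconv_lborel[OF assms(2) e] by (rule integral_abs_bound)
    then have "\<bar>mconv (moll e) h x\<bar> \<le> (LINT y|lborel. moll e (x - y) * \<bar>h y\<bar>)"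
      using moll_nonneg[OF e, where 'a='n] by (simp add: abs_mult)
    then have "\<bar>F x * mconv (moll e) h x\<bar> \<le> \<bar>F x\<bar> * (LINT y|lborel. moll e (x - y) * \<bar>h y\<bar>)"
      by (simp add: abs_mult mult_left_mono)
    then have "ennreal \<bar>F x * mconv (moll e) h x\<bar> \<le> ennreal (LINT y|lborel. \<bar>F x\<bar> * (moll e (x - y) * \<bar>h y\<bar>))"
      by (simp add: ennreal_leI)
    also have "\<dots> = (\<integral>\<^sup>+ y. ennreal (\<bar>F x\<bar> * (moll e (x - y) * \<bar>h y\<bar>)) \<partial>lborel)"
      by (rule nn_integral_eq_integral[symmetric]) (use int[of x] moll_nonneg[OF e, where 'a='n] in auto)
    finally show "ennreal \<bar>F x * mconv (moll e) h x\<bar> \<le> (\<integral>\<^sup>+ y. ennreal (\<bar>F x\<bar> * (moll e (x - y) * \<bar>h y\<bar>)) \<partial>lborel)" .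
  qed
  also have "\<dots> \<le> (\<integral>\<^sup>+ x. (\<integral>\<^sup>+ y. ennreal (\<delta> / 2 * (F x)\<^sup>2) * ennreal (moll e (x - y)) + ennreal (1 / (2 * \<delta>) * (h y)\<^sup>2) * ennreal (moll e (x - y)) \<partial>lborel) \<partial>lborel)"
  proof (intro nn_integral_mono)
    fix x y
    have "\<bar>F x\<bar> * \<bar>h y\<bar> \<le> \<delta> / 2 * (F x)\<^sup>2 + 1 / (2 * \<delta>) * (h y)\<^sup>2"
      using Young_weighted[OF \<delta>, of "F x" "h y"] by (simp add: abs_mult)
    then have "\<bar>F x\<bar> * \<bar>h y\<bar> * moll e (x - y) \<le> (\<delta> / 2 * (F x)\<^sup>2 + 1 / (2 * \<delta>) * (h y)\<^sup>2) * moll e (x - y)"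
      by (rule mult_right_mono) (rule moll_nonneg[OF e, where 'a='n])
    then have "ennreal (\<bar>F x\<bar> * (moll e (x - y) * \<bar>h y\<bar>)) \<le> ennreal (\<delta> / 2 * (F x)\<^sup>2 * moll e (x - y) + 1 / (2 * \<delta>) * (h y)\<^sup>2 * moll e (x - y))"
      by (intro ennreal_leI) (simp add: algebra_simps)
    then show "ennreal (\<bar>F x\<bar> * (moll e (x - y) * \<bar>h y\<bar>)) \<le> ennreal (\<delta> / 2 * (F x)\<^sup>2) * ennreal (moll e (x - y)) + ennreal (1 / (2 * \<delta>) * (h y)\<^sup>2) * ennreal (moll e (x - y))"
      using \<delta> moll_nonneg[OF e, where 'a='n] by (simp add: ennreal_plus[symmetric] ennreal_mult''[symmetric] del: ennreal_plus)
  qed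
  also have "\<dots> = (\<integral>\<^sup>+ x. ennreal (\<delta> / 2 * (F x)\<^sup>2) \<partial>lborel) + (\<integral>\<^sup>+ x. (\<integral>\<^sup>+ y. ennreal (1 / (2 * \<delta>) * (h y)\<^sup>2) * ennreal (moll e (x - y)) \<partial>lborel) \<partial>lborel)"
    by (simp add: nn_integral_add nn_integral_cmult moll_nn_integral[OF e])
  also have "(\<integral>\<^sup>+ x. (\<integral>\<^sup>+ y. ennreal (1 / (2 * \<delta>) * (h y)\<^sup>2) * ennreal (moll e (x - y)) \<partial>lborel) \<partial>lborel)
      = (\<integral>\<^sup>+ y. (\<integral>\<^sup>+ x. ennreal (1 / (2 * \<delta>) * (h y)\<^sup>2) * ennreal (moll e (x - y)) \<partial>lborel) \<partial>lborel)"
    by (rule lborel_pair.Fubini') simp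
  also have "\<dots> = (\<integral>\<^sup>+ y. ennreal (1 / (2 * \<delta>) * (h y)\<^sup>2) \<partial>lborel)"
    by (simp add: nn_integral_cmult moll_nn_integral[OF e])
  also have "\<dots> = ennreal (1 / (2 * \<delta>) * (LINT x|lborel. (h x)\<^sup>2))"
    using h \<delta> by (subst nn_integral_eq_integral) auto
  also have "(\<integral>\<^sup>+ x. ennreal (\<delta> / 2 * (F x)\<^sup>2) \<partial>lborel) = ennreal (\<delta> / 2 * (LINT x|lborel. (F x)\<^sup>2))"
    using F \<delta> by (subst nn_integral_eq_integral) auto
  finally show ?thesis using \<delta> by (simp add: ennreal_plus[symmetric] del: ennreal_plus)
qed

text \<open>First truncate \<open>h\<close> at a height \<open>N\<close>, then approximate the
  truncation almost everywhere by continuous functions, truncated at the same height and cut off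
  radially. Everything is then bounded and lives on one ball, so dominated convergence applies to
  the squares.\<close>

lemma L2_approx_continuous:
  fixes h :: "real ^ 'n::finite \<Rightarrow> real"
  assumes [measurable]: "h \<in> borel_measurable borel" and h: "integrable lborel (\<lambda>x. (h x)\<^sup>2)"
    and R: "\<And>x. norm x > R \<Longrightarrow> h x = 0" and \<epsilon>: "\<epsilon> > 0"
  obtains k where "continuous_on UNIV k" "\<And>x. norm x > R + 1 \<Longrightarrow> k x = 0"
    "(LINT x|lborel. (h x - k x)\<^sup>2) < \<epsilon>" "integrable lborel (\<lambda>x. (h x - k x)\<^sup>2)"
proof -
  define c where "c N t = max (- N) (min N t)" for N t :: real
  define hN where "hN N x = c (real N) (h x)" for N x
  have "(\<lambda>N. LINT x|lborel. (h x - hN N x)\<^sup>2) \<longlonglongrightarrow> (LINT x::real ^ 'n|lborel. 0)"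
  proof (rule integral_dominated_convergence[where w = "\<lambda>x. (h x)\<^sup>2"])
    show "AE x in lborel. (\<lambda>N. (h x - hN N x)\<^sup>2) \<longlonglongrightarrow> 0"
    proof (rule AE_I2)
      fix x
      have "\<forall>\<^sub>F N in sequentially. (h x - hN N x)\<^sup>2 = 0"
        using eventually_ge_at_top[of "nat \<lceil>\<bar>h x\<bar>\<rceil>"]
      proof eventually_elim
        case (elim N)
        then have "\<bar>h x\<bar> \<le> real N" by linarith
        then have "c (real N) (h x) = h x" unfolding c_def by linarith
          then show ?case by (simp add: hN_def)
      qed
      then show "(\<lambda>N. (h x - hN N x)\<^sup>2) \<longlonglongrightarrow> 0" by (rule tendsto_eventually)
    qed
    show "AE x in lborel. norm ((h x - hN N x)\<^sup>2) \<le> (h x)\<^sup>2" for N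
    proof (rule AE_I2)
      fix x
      have "\<bar>h x - hN N x\<bar> \<le> \<bar>h x\<bar>" unfolding hN_def c_def by linarith
      then show "norm ((h x - hN N x)\<^sup>2) \<le> (h x)\<^sup>2" by (simp add: abs_le_square_iff)
    qed
    show "(\<lambda>x. (h x - hN N x)\<^sup>2) \<in> borel_measurable lborel" for N unfolding hN_def c_def by measurable
  qed (use h in auto)
  then have "\<forall>\<^sub>F N in sequentially. (LINT x|lborel. (h x - hN N x)\<^sup>2) < \<epsilon> / 4"
    using \<epsilon> by (intro order_tendstoD(2)) auto
  then obtain N where N: "(LINT x|lborel. (h x - hN N x)\<^sup>2) < \<epsilon> / 4"
    by (meson eventually_sequentially order_refl)
  have iN: "integrable lborel (\<lambda>x. (h x - hN N x)\<^sup>2)"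
  proof (rule Bochner_Integration.integrable_bound[OF h])
    show "(\<lambda>x. (h x - hN N x)\<^sup>2) \<in> borel_measurable lborel" unfolding hN_def c_def by measurable
    show "AE x in lborel. norm ((h x - hN N x)\<^sup>2) \<le> norm ((h x)\<^sup>2)"
    proof (rule AE_I2)
      fix x
      have "\<bar>h x - hN N x\<bar> \<le> \<bar>h x\<bar>" unfolding hN_def c_def by linarith
      then show "norm ((h x - hN N x)\<^sup>2) \<le> norm ((h x)\<^sup>2)" by (simp add: abs_le_square_iff)
    qed
  qed
  \<comment> \<open>\<open>measurable_on\<close> comes with continuous functions converging off a
    negligible set, which is the source of the approximants.\<close>
  have "h measurable_on UNIV"
    by (rule lebesgue_measurable_imp_measurable_on_real) (auto intro: measurable_completion)
  then obtain Z g where Z: "negligible Z" and g: "\<And>n. continuous_on UNIV (g n)"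
    and lim: "\<And>x. x \<notin> Z \<Longrightarrow> (\<lambda>n. g n x) \<longlonglongrightarrow> h x"
    unfolding measurable_on_def by auto
  define cut where "cut x = max 0 (min 1 (R + 1 - norm x))" for x :: "real ^ 'n"
  have cut: "0 \<le> cut x" "cut x \<le> 1" "norm x \<le> R \<Longrightarrow> cut x = 1" "norm x > R + 1 \<Longrightarrow> cut x = 0" for x
    by (auto simp: cut_def)
  define k where "k n x = cut x * c (real N) (g n x)" for n x
  have kc: "continuous_on UNIV (k n)" for n
    unfolding k_def c_def cut_def by (intro continuous_intros g)
  then have [measurable]: "k n \<in> borel_measurable borel" for n by (rule borel_measurable_continuous_onI)
  have k0: "k n x = 0" if "norm x > R + 1" for n x using that by (simp add: k_def cut)
  have kb: "\<bar>k n x\<bar> \<le> real N" for n x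
  proof -
    have "\<bar>cut x\<bar> * \<bar>c (real N) (g n x)\<bar> \<le> 1 * real N"
      using cut[of x] by (intro mult_mono) (auto simp: c_def)
    then show ?thesis by (simp add: k_def abs_mult)
  qed
  have hb: "\<bar>hN N x\<bar> \<le> real N" for x by (auto simp: hN_def c_def)
  have hN0: "hN N x = 0" if "norm x > R" for x using R[OF that] by (simp add: hN_def c_def)
  have wi: "integrable lborel (\<lambda>x. indicator (cball 0 (R + 1)) x * (2 * real N)\<^sup>2)"
    by (intro integrable_mult_left integrable_real_indicator emeasure_lborel_cball_finite) auto
  have bd: "norm ((hN N x - k n x)\<^sup>2) \<le> indicator (cball 0 (R + 1)) x * (2 * real N)\<^sup>2" for n x
  proof (cases "norm x > R + 1")
    case True
    then show ?thesis using k0 hN0 by simp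
  next
    case False
    have "\<bar>hN N x - k n x\<bar> \<le> 2 * real N" using kb[of n x] hb[of x] by linarith
    then have "(hN N x - k n x)\<^sup>2 \<le> (2 * real N)\<^sup>2" by (subst abs_le_square_iff[symmetric]) simp
    then show ?thesis using False by (simp add: indicator_def)
  qed
  have ik: "integrable lborel (\<lambda>x. (hN N x - k n x)\<^sup>2)" for n
    by (rule Bochner_Integration.integrable_bound[OF wi]) (use bd in \<open>auto simp: hN_def c_def\<close>)
  have "(\<lambda>n. LINT x|lborel. (hN N x - k n x)\<^sup>2) \<longlonglongrightarrow> (LINT x::real ^ 'n|lborel. 0)"
  proof (rule integral_dominated_convergence[OF _ _ wi])
    have "AE x in lebesgue. x \<notin> Z"
      using Z unfolding negligible_iff_null_sets by (rule AE_not_in)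
    then have "AE x in lborel. x \<notin> Z" by (simp add: AE_completion_iff)
    then show "AE x in lborel. (\<lambda>n. (hN N x - k n x)\<^sup>2) \<longlonglongrightarrow> 0"
    proof eventually_elim
      case (elim x)
      have "(\<lambda>n. k n x) \<longlonglongrightarrow> cut x * c (real N) (h x)"
        unfolding k_def c_def by (intro tendsto_intros lim elim)
      moreover have "cut x * c (real N) (h x) = hN N x"
        using cut(3)[of x] hN0[of x] by (cases "norm x \<le> R") (auto simp: hN_def)
      ultimately have "(\<lambda>n. (hN N x - k n x)\<^sup>2) \<longlonglongrightarrow> (hN N x - hN N x)\<^sup>2"
        by (intro tendsto_intros) simp
      then show ?case by simp
    qed
  qed (use bd ik in auto)
  then have "\<forall>\<^sub>F n in sequentially. (LINT x|lborel. (hN N x - k n x)\<^sup>2) < \<epsilon> / 4"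
    using \<epsilon> by (intro order_tendstoD(2)) auto
  then obtain n where n: "(LINT x|lborel. (hN N x - k n x)\<^sup>2) < \<epsilon> / 4"
    by (meson eventually_sequentially order_refl)
  \<comment> \<open>This inequality doubles two errors below \<open>\<epsilon> / 4\<close> each, so
    their sum stays below \<open>\<epsilon>\<close>.\<close>
  have pw: "(h x - k n x)\<^sup>2 \<le> 2 * (h x - hN N x)\<^sup>2 + 2 * (hN N x - k n x)\<^sup>2" for x
  proof -
    have "0 \<le> ((h x - hN N x) - (hN N x - k n x))\<^sup>2" by simp
    then show ?thesis by (simp add: power2_eq_square algebra_simps)
  qed
  have fin: "integrable lborel (\<lambda>x. (h x - k n x)\<^sup>2)"
    by (rule Bochner_Integration.integrable_bound[where f = "\<lambda>x. 2 * (h x - hN N x)\<^sup>2 + 2 * (hN N x - k n x)\<^sup>2"])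
      (use iN ik pw in \<open>auto intro: order_trans[OF _ abs_ge_self]\<close>)
  have "(LINT x|lborel. (h x - k n x)\<^sup>2) \<le> (LINT x|lborel. 2 * (h x - hN N x)\<^sup>2 + 2 * (hN N x - k n x)\<^sup>2)"
    by (rule integral_mono) (use fin iN ik pw in auto)
  also have "\<dots> = 2 * (LINT x|lborel. (h x - hN N x)\<^sup>2) + 2 * (LINT x|lborel. (hN N x - k n x)\<^sup>2)"
    using iN ik by simp
  also have "\<dots> < \<epsilon>" using N n by simp
  finally show ?thesis using that[OF kc k0 _ fin] by blast
qed

lemma integrable_of_square_bounded_support:
  fixes h :: "real ^ 'n::finite \<Rightarrow> real"
  assumes "h \<in> borel_measurable M" "cball 0 R \<in> sets M" "integrable M (\<lambda>x. (h x)\<^sup>2)" "\<And>x. norm x > R \<Longrightarrow> h x = 0"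
    "emeasure M (cball 0 R) < \<infinity>"
  shows "integrable M h"
proof (rule Bochner_Integration.integrable_bound[where f = "\<lambda>x. indicator (cball 0 R) x + (h x)\<^sup>2"])
  show "integrable M (\<lambda>x. indicator (cball 0 R) x + (h x)\<^sup>2)"
    using assms(2,3,5) by (intro Bochner_Integration.integrable_add integrable_real_indicator)
  have "\<bar>t\<bar> \<le> 1 + t\<^sup>2" for t :: real
  proof -
    have "0 \<le> (\<bar>t\<bar> - 1)\<^sup>2" by simp
    then have "2 * \<bar>t\<bar> \<le> 1 + t\<^sup>2" by (simp add: power2_diff)
    then show ?thesis by linarith
  qed
  then show "AE x in M. norm (h x) \<le> norm (indicator (cball 0 R) x + (h x)\<^sup>2 :: real)"
    using assms(4) by (intro AE_I2) (auto simp: indicator_def)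
qed (rule assms)

lemma mconv_uniform_limit:
  fixes k :: "real ^ 'n::finite \<Rightarrow> real"
  assumes k: "continuous_on UNIV k" and "\<eta> > 0"
  shows "\<exists>e0>0. \<forall>e x. 0 < e \<and> e < e0 \<and> norm x \<le> R \<longrightarrow> \<bar>mconv (moll e) k x - k x\<bar> \<le> \<eta>"
proof -
  have [measurable]: "k \<in> borel_measurable borel" using k by (rule borel_measurable_continuous_onI)
  \<comment> \<open>The radius \<open>R + 1\<close> leaves room for the mollifier: the scale is kept
    below 1, so the averaged points stay in this ball.\<close>
  have "uniformly_continuous_on (cball 0 (R + 1)) k"
    by (intro compact_uniformly_continuous continuous_on_subset[OF k]) auto
  then obtain d where d: "d > 0" "\<And>x y. x \<in> cball 0 (R + 1) \<Longrightarrow> y \<in> cball 0 (R + 1) \<Longrightarrow> dist y x < d \<Longrightarrow> dist (k y) (k x) < \<eta>"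
    unfolding uniformly_continuous_on_def using \<open>\<eta> > 0\<close> by metis
  have "\<bar>mconv (moll e) k x - k x\<bar> \<le> \<eta>" if e: "0 < e" "e < min d 1" "norm x \<le> R" for e x
  proof -
    note [measurable] = moll_borel[OF e(1)]
    have i1: "integrable lborel (\<lambda>y. moll e (x - y))" "(LINT y|lborel. moll e (x - y)) = 1"
    proof -
      have "has_bochner_integral lborel (\<lambda>y. moll e (x - y)) 1"
        by (rule has_bochner_integral_nn_integral) (use e moll_nn_integral(1)[OF e(1), of x] moll_nonneg in auto)
      then show "integrable lborel (\<lambda>y. moll e (x - y))" "(LINT y|lborel. moll e (x - y)) = 1"
        by (auto simp: has_bochner_integral_iff)
    qed
    have bd: "moll e (x - y) * \<bar>k y - k x\<bar> \<le> moll e (x - y) * \<eta>" for y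
    proof (cases "norm (x - y) < e")
      case True
      have "norm y \<le> norm x + norm (x - y)" using norm_triangle_ineq4[of x "x - y"] by simp
      then have "dist (k y) (k x) < \<eta>"
        using True e by (intro d(2)) (auto simp: dist_norm norm_minus_commute)
      then show ?thesis using moll_nonneg[OF e(1), where 'a='n] by (intro mult_left_mono) (auto simp: dist_norm)
    next
      case False
      then show ?thesis using moll_outside[OF e(1), where 'a='n] by simp
    qed
    have i2: "integrable lborel (\<lambda>y. moll e (x - y) * (k y - k x))"
      by (rule Bochner_Integration.integrable_bound[where f = "\<lambda>y. moll e (x - y) * \<eta>"])
        (use i1 bd moll_nonneg[OF e(1), where 'a='n] \<open>\<eta> > 0\<close> in \<open>auto simp: abs_mult\<close>)
    then have i3: "integrable lborel (\<lambda>y. moll e (x - y) * (k y - k x) + moll e (x - y) * k x)"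
      using i1 by simp
    have "mconv (moll e) k x = (LINT y|lborel. moll e (x - y) * (k y - k x) + moll e (x - y) * k x)"
      unfolding mconv_lborel[OF \<open>k \<in> borel_measurable borel\<close> e(1)] by (simp add: algebra_simps)
    also have "\<dots> = (LINT y|lborel. moll e (x - y) * (k y - k x)) + k x"
      using i1 i2 by (subst Bochner_Integration.integral_add) auto
    finally have "\<bar>mconv (moll e) k x - k x\<bar> = \<bar>LINT y|lborel. moll e (x - y) * (k y - k x)\<bar>" by simp
    also have "\<dots> \<le> (LINT y|lborel. \<bar>moll e (x - y) * (k y - k x)\<bar>)" by (rule integral_abs_bound)
    also have "\<dots> \<le> (LINT y|lborel. moll e (x - y) * \<eta>)"
      by (rule integral_mono) (use i1 integrable_abs[OF i2] bd moll_nonneg[OF e(1), where 'a='n] in \<open>auto simp: abs_mult\<close>)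
    also have "\<dots> = \<eta>" using i1 by simp
    finally show ?thesis .
  qed
  then show ?thesis using d(1) by (intro exI[of _ "min d 1"]) auto
qed

text \<open>Insert a continuous \<open>k\<close> close to \<open>h\<close> in L2. The two terms with
  \<open>h - k\<close>, mollified or not, are small by Young uniformly in the scale; the remaining
  term is small because \<open>k\<close> is uniformly approximated on the bounded set where
  \<open>F\<close> lives.\<close>

lemma mollify_pairing_borel:
  fixes F h :: "real ^ 'n::finite \<Rightarrow> real"
  assumes [measurable]: "F \<in> borel_measurable borel" "h \<in> borel_measurable borel"
    and F: "integrable lborel (\<lambda>x. (F x)\<^sup>2)" "\<And>x. norm x > R \<Longrightarrow> F x = 0"
    and h: "integrable lborel (\<lambda>x. (h x)\<^sup>2)" "\<And>x. norm x > R \<Longrightarrow> h x = 0"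
  shows "((\<lambda>e. LINT x|lborel. F x * mconv (moll e) h x) \<longlongrightarrow> (LINT x|lborel. F x * h x)) (at_right 0)"
    and "e > 0 \<Longrightarrow> integrable lborel (\<lambda>x. F x * mconv (moll e) h x)"
proof -
  have fin: "emeasure lborel (cball (0 :: real ^ 'n) r) < \<infinity>" for r by (rule emeasure_lborel_cball_finite)
  have iF: "integrable lborel F"
    by (rule integrable_of_square_bounded_support[OF _ _ F fin]) auto
  have ih: "integrable lborel h"
    by (rule integrable_of_square_bounded_support[OF _ _ h fin]) auto
  have sq_prod: "integrable lborel (\<lambda>x. f x * g x)"
    if [measurable]: "f \<in> borel_measurable borel" "g \<in> borel_measurable borel"
      and "integrable lborel (\<lambda>x. (f x)\<^sup>2)" "integrable lborel (\<lambda>x. (g x)\<^sup>2)" for f g :: "real ^ 'n \<Rightarrow> real"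
  proof (rule Bochner_Integration.integrable_bound[where f = "\<lambda>x. (f x)\<^sup>2 + (g x)\<^sup>2"])
    show "AE x in lborel. norm (f x * g x) \<le> norm ((f x)\<^sup>2 + (g x)\<^sup>2)"
    proof (rule AE_I2)
      fix x
      have "2 * \<bar>f x\<bar> * \<bar>g x\<bar> \<le> \<bar>f x\<bar>\<^sup>2 + \<bar>g x\<bar>\<^sup>2" by (rule sum_squares_bound)
      then show "norm (f x * g x) \<le> norm ((f x)\<^sup>2 + (g x)\<^sup>2)"
        using mult_nonneg_nonneg[OF abs_ge_zero[of "f x"] abs_ge_zero[of "g x"]]
        unfolding power2_abs real_norm_def abs_mult by linarith
    qed
  qed (use that in auto)
  have conv_borel: "mconv (moll e) f \<in> borel_measurable borel" if "integrable lborel f" "e > 0" for f :: "real ^ 'n \<Rightarrow> real" and e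
  proof -
    have "integrable lebesgue f" using that(1) integrable_completion by blast
    from mconv_Ck[OF moll_test_function[OF that(2)] this, of 0]
    show ?thesis by (simp add: borel_measurable_continuous_onI)
  qed
  have pair: "integrable lborel (\<lambda>x. F x * mconv (moll e) f x)"
    "\<bar>LINT x|lborel. F x * mconv (moll e) f x\<bar> \<le> \<delta> / 2 * (LINT x|lborel. (F x)\<^sup>2) + 1 / (2 * \<delta>) * (LINT x|lborel. (f x)\<^sup>2)"
    if [measurable]: "f \<in> borel_measurable borel" and f: "integrable lborel f" "integrable lborel (\<lambda>x. (f x)\<^sup>2)" and e: "e > 0" and \<delta>: "\<delta> > 0" for f e \<delta>
  proof -
    note [measurable] = conv_borel[OF f(1) e]
    note b = mconv_pairing_bound[OF assms(1) that(1) f F(1) e \<delta>]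
    show i: "integrable lborel (\<lambda>x. F x * mconv (moll e) f x)"
      by (rule integrableI_bounded) (use b in \<open>auto simp: top_unique less_top[symmetric]\<close>)
    have "ennreal \<bar>LINT x|lborel. F x * mconv (moll e) f x\<bar> \<le> (\<integral>\<^sup>+ x. ennreal \<bar>F x * mconv (moll e) f x\<bar> \<partial>lborel)"
      using integral_norm_bound_ennreal[OF i] by simp
    also note b
    finally show "\<bar>LINT x|lborel. F x * mconv (moll e) f x\<bar> \<le> \<delta> / 2 * (LINT x|lborel. (F x)\<^sup>2) + 1 / (2 * \<delta>) * (LINT x|lborel. (f x)\<^sup>2)"
      using \<delta> by (subst (asm) ennreal_le_iff) auto
  qed
  show "e > 0 \<Longrightarrow> integrable lborel (\<lambda>x. F x * mconv (moll e) h x)"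
    by (rule pair(1)[OF assms(2) ih h(1) _ zero_less_one])
  show "((\<lambda>e. LINT x|lborel. F x * mconv (moll e) h x) \<longlongrightarrow> (LINT x|lborel. F x * h x)) (at_right 0)"
  proof (rule tendstoI)
    fix \<eta> :: real assume \<eta>: "\<eta> > 0"
    define A where "A = (LINT x|lborel. (F x)\<^sup>2) + (LINT x|lborel. \<bar>F x\<bar>) + 1"
    have A: "A \<ge> 1" "(LINT x|lborel. (F x)\<^sup>2) \<le> A" "(LINT x|lborel. \<bar>F x\<bar>) \<le> A"
      unfolding A_def by auto
    \<comment> \<open>\<open>\<delta>\<close> and then \<open>\<epsilon>\<close> make both Young
      terms at most \<open>\<eta> / 8\<close>; \<open>\<delta>\<close> is also the uniform accuracy
      demanded of the mollified \<open>k\<close>, which costs \<open>\<eta> / 4\<close>.\<close>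
    define \<delta> where "\<delta> = \<eta> / (4 * A)"
    have \<delta>: "\<delta> > 0" using \<eta> A by (simp add: \<delta>_def)
    define \<epsilon> where "\<epsilon> = \<eta> * \<delta> / 4"
    have \<epsilon>: "\<epsilon> > 0" using \<eta> \<delta> by (simp add: \<epsilon>_def)
    obtain k where k: "continuous_on UNIV k" "\<And>x. norm x > R + 1 \<Longrightarrow> k x = 0"
      "(LINT x|lborel. (h x - k x)\<^sup>2) < \<epsilon>" "integrable lborel (\<lambda>x. (h x - k x)\<^sup>2)"
      using L2_approx_continuous[OF assms(2) h \<epsilon>] by blast
    have [measurable]: "k \<in> borel_measurable borel" using k(1) by (rule borel_measurable_continuous_onI)
    have ihk: "integrable lborel (\<lambda>x. h x - k x)"
      by (rule integrable_of_square_bounded_support[OF _ _ k(4) _ fin[of "R + 1"]]) (use k(2) h(2) in auto)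
    have ik: "integrable lborel k" using Bochner_Integration.integrable_diff[OF ih ihk] by simp
    have bound: "\<bar>LINT x|lborel. F x * g x\<bar> \<le> \<eta> / 4"
      if "\<bar>LINT x|lborel. F x * g x\<bar> \<le> \<delta> / 2 * (LINT x|lborel. (F x)\<^sup>2) + 1 / (2 * \<delta>) * (LINT x|lborel. (h x - k x)\<^sup>2)" for g
    proof -
      have "\<delta> / 2 * (LINT x|lborel. (F x)\<^sup>2) \<le> \<delta> / 2 * A" using \<delta> A by (intro mult_left_mono) auto
      moreover have "1 / (2 * \<delta>) * (LINT x|lborel. (h x - k x)\<^sup>2) \<le> 1 / (2 * \<delta>) * \<epsilon>" using \<delta> k(3) by (intro mult_left_mono) auto
      moreover have "\<delta> / 2 * A = \<eta> / 8" "1 / (2 * \<delta>) * \<epsilon> = \<eta> / 8" using A \<delta> by (auto simp: \<delta>_def \<epsilon>_def)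
      ultimately show ?thesis using that by linarith
    qed
    obtain e0 where e0: "e0 > 0" "\<And>e x. 0 < e \<Longrightarrow> e < e0 \<Longrightarrow> norm x \<le> R \<Longrightarrow> \<bar>mconv (moll e) k x - k x\<bar> \<le> \<delta>"
      using mconv_uniform_limit[OF k(1) \<delta>, of R] by blast
    have "dist (LINT x|lborel. F x * mconv (moll e) h x) (LINT x|lborel. F x * h x) < \<eta>" if e: "0 < e" "e < e0" for e
    proof -
      have hk2: "integrable lborel (\<lambda>x. F x * (h x - k x))" by (rule sq_prod[OF assms(1) _ F(1) k(4)]) measurable
      have "\<bar>LINT x|lborel. F x * (h x - k x)\<bar> \<le> \<delta> / 2 * (LINT x|lborel. (F x)\<^sup>2) + 1 / (2 * \<delta>) * (LINT x|lborel. (h x - k x)\<^sup>2)"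
      proof -
        have "\<bar>LINT x|lborel. F x * (h x - k x)\<bar> \<le> (LINT x|lborel. \<bar>F x * (h x - k x)\<bar>)" by (rule integral_abs_bound)
        also have "\<dots> \<le> (LINT x|lborel. \<delta> / 2 * (F x)\<^sup>2 + 1 / (2 * \<delta>) * (h x - k x)\<^sup>2)"
        proof (rule integral_mono)
          fix x
          show "\<bar>F x * (h x - k x)\<bar> \<le> \<delta> / 2 * (F x)\<^sup>2 + 1 / (2 * \<delta>) * (h x - k x)\<^sup>2"
            by (rule Young_weighted[OF \<delta>])
        qed (intro integrable_abs hk2 Bochner_Integration.integrable_add integrable_mult_right F(1) k(4))+
        also have "\<dots> = \<delta> / 2 * (LINT x|lborel. (F x)\<^sup>2) + 1 / (2 * \<delta>) * (LINT x|lborel. (h x - k x)\<^sup>2)"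
          using F k by simp
        finally show ?thesis .
      qed
      then have 1: "\<bar>LINT x|lborel. F x * (h x - k x)\<bar> \<le> \<eta> / 4" by (rule bound)
      have 2: "\<bar>LINT x|lborel. F x * mconv (moll e) (\<lambda>x. h x - k x) x\<bar> \<le> \<eta> / 4"
        by (rule bound, rule pair(2)[OF _ ihk k(4) e(1) \<delta>]) measurable
      have ihe: "integrable lborel (\<lambda>x. F x * mconv (moll e) h x)" by (rule pair(1)[OF assms(2) ih h(1) e(1) \<delta>])
      have ihke: "integrable lborel (\<lambda>x. F x * mconv (moll e) (\<lambda>x. h x - k x) x)"
        by (rule pair(1)[OF _ ihk k(4) e(1) \<delta>]) measurable
      have lin: "mconv (moll e) (\<lambda>x. h x - k x) x = mconv (moll e) h x - mconv (moll e) k x" for x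
      proof -
        have "integrable lebesgue h" "integrable lebesgue k" using ih ik by (auto simp: integrable_completion)
        then show ?thesis
          unfolding mconv_def right_diff_distrib
          by (intro Bochner_Integration.integral_diff mconv_integrable[OF moll_test_function[OF e(1)]])
      qed
      have ike: "integrable lborel (\<lambda>x. F x * (mconv (moll e) k x - k x))"
      proof -
        have "integrable lborel (\<lambda>x. F x * mconv (moll e) h x - F x * mconv (moll e) (\<lambda>x. h x - k x) x - (F x * h x - F x * (h x - k x)))"
          by (intro Bochner_Integration.integrable_diff ihe ihke hk2 sq_prod[OF assms(1,2) F(1) h(1)])
        then show ?thesis unfolding lin by (simp add: algebra_simps)
      qed
      have 3: "\<bar>LINT x|lborel. F x * (mconv (moll e) k x - k x)\<bar> \<le> \<eta> / 4"
      proof -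
        have "\<bar>LINT x|lborel. F x * (mconv (moll e) k x - k x)\<bar> \<le> (LINT x|lborel. \<bar>F x * (mconv (moll e) k x - k x)\<bar>)"
          by (rule integral_abs_bound)
        also have "\<dots> \<le> (LINT x|lborel. \<bar>F x\<bar> * \<delta>)"
        proof (rule integral_mono)
          fix x
          show "\<bar>F x * (mconv (moll e) k x - k x)\<bar> \<le> \<bar>F x\<bar> * \<delta>"
            using e0(2)[OF e, of x] F(2)[of x] by (cases "norm x \<le> R") (auto simp: abs_mult intro!: mult_left_mono)
        qed (use ike iF in auto)
        also have "\<dots> = (LINT x|lborel. \<bar>F x\<bar>) * \<delta>" by simp
        also have "\<dots> \<le> A * \<delta>" using A \<delta> by (intro mult_right_mono) auto
        also have "\<dots> = \<eta> / 4" using A by (simp add: \<delta>_def)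
        finally show ?thesis .
      qed
      have "(LINT x|lborel. F x * mconv (moll e) h x) - (LINT x|lborel. F x * h x)
        = (LINT x|lborel. F x * mconv (moll e) (\<lambda>x. h x - k x) x) + (LINT x|lborel. F x * (mconv (moll e) k x - k x))
          - (LINT x|lborel. F x * (h x - k x))"
      proof -
        have "(LINT x|lborel. F x * mconv (moll e) (\<lambda>x. h x - k x) x) + (LINT x|lborel. F x * (mconv (moll e) k x - k x))
          - (LINT x|lborel. F x * (h x - k x)) = (LINT x|lborel. F x * mconv (moll e) (\<lambda>x. h x - k x) x + F x * (mconv (moll e) k x - k x) - F x * (h x - k x))"
          using ihke ike hk2 by simp
        also have "\<dots> = (LINT x|lborel. F x * mconv (moll e) h x - F x * h x)"
          unfolding lin by (simp add: algebra_simps)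
        also have "\<dots> = (LINT x|lborel. F x * mconv (moll e) h x) - (LINT x|lborel. F x * h x)"
          by (rule Bochner_Integration.integral_diff[OF ihe sq_prod[OF assms(1,2) F(1) h(1)]])
        finally show ?thesis by simp
      qed
      then show ?thesis using 1 2 3 \<eta> unfolding dist_real_def by linarith
    qed
    then show "\<forall>\<^sub>F e in at_right 0. dist (LINT x|lborel. F x * mconv (moll e) h x) (LINT x|lborel. F x * h x) < \<eta>"
      using e0(1) by (auto simp: eventually_at_right_field)
  qed
qed

text \<open>Tonelli and the change of variables are used on \<open>lborel\<close> and need Borel
  functions; the representative keeps the bounded support exactly, not just up to a null
  set.\<close>

lemma lebesgue_borel_representative:
  fixes h :: "real ^ 'n::finite \<Rightarrow> real"
  assumes "h \<in> borel_measurable lebesgue" "\<And>x. norm x > R \<Longrightarrow> h x = 0"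
  obtains h' where "h' \<in> borel_measurable borel" "AE x in lebesgue. h x = h' x" "\<And>x. norm x > R \<Longrightarrow> h' x = 0"
proof -
  obtain g where g: "g \<in> borel_measurable lborel" "AE x in lborel. h x = g x"
    using completion_ex_borel_measurable_real[OF assms(1)] by auto
  show ?thesis
  proof (rule that[of "\<lambda>x. indicator (cball 0 R) x * g x"])
    have "AE x in lebesgue. h x = g x" using g(2) by (rule AE_completion)
    then show "AE x in lebesgue. h x = indicator (cball 0 R) x * g x"
      by eventually_elim (use assms(2) in \<open>auto simp: indicator_def\<close>)
    show "(\<lambda>x. indicator (cball 0 R) x * g x) \<in> borel_measurable borel"
      using g(1) by (intro borel_measurable_times borel_measurable_indicator) auto
  qed auto
qed

text \<open>Passing to Borel representatives changes the pairings by nothing, and a convolution is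
  insensitive to null sets at every point, so the mollifications of \<open>h\<close> and of its
  representative are the same function.\<close>

lemma mollify_pairing:
  fixes F h :: "real ^ 'n::finite \<Rightarrow> real"
  assumes F: "F \<in> borel_measurable lebesgue" "integrable lebesgue (\<lambda>x. (F x)\<^sup>2)" "\<And>x. norm x > R \<Longrightarrow> F x = 0"
    and h: "h \<in> borel_measurable lebesgue" "integrable lebesgue (\<lambda>x. (h x)\<^sup>2)" "\<And>x. norm x > R \<Longrightarrow> h x = 0"
  shows "((\<lambda>e. LINT x|lebesgue. F x * mconv (moll e) h x) \<longlongrightarrow> (LINT x|lebesgue. F x * h x)) (at_right 0)"
    and "e > 0 \<Longrightarrow> integrable lebesgue (\<lambda>x. F x * mconv (moll e) h x)"
proof -
  obtain F' where F'[measurable]: "F' \<in> borel_measurable borel" and FF': "AE x in lebesgue. F x = F' x" and F'0: "\<And>x. norm x > R \<Longrightarrow> F' x = 0"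
    using lebesgue_borel_representative[OF F(1,3)] by metis
  obtain h' where h'[measurable]: "h' \<in> borel_measurable borel" and hh': "AE x in lebesgue. h x = h' x" and h'0: "\<And>x. norm x > R \<Longrightarrow> h' x = 0"
    using lebesgue_borel_representative[OF h(1,3)] by metis
  have [measurable]: "F' \<in> borel_measurable lebesgue" "h' \<in> borel_measurable lebesgue"
    by (auto intro: measurable_completion)
  have "integrable lebesgue (\<lambda>x. (F' x)\<^sup>2)"
    by (rule integrable_cong_AE_imp[OF F(2)]) (use FF' in \<open>auto elim: eventually_mono\<close>)
  then have F'2: "integrable lborel (\<lambda>x. (F' x)\<^sup>2)" by (simp add: integrable_completion)
  have "integrable lebesgue (\<lambda>x. (h' x)\<^sup>2)"
    by (rule integrable_cong_AE_imp[OF h(2)]) (use hh' in \<open>auto elim: eventually_mono\<close>)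
  then have h'2: "integrable lborel (\<lambda>x. (h' x)\<^sup>2)" by (simp add: integrable_completion)
  have h'1: "integrable lborel h'"
    by (rule integrable_of_square_bounded_support[OF _ _ h'2 h'0 emeasure_lborel_cball_finite]) auto
  then have h'1L: "integrable lebesgue h'" by (simp add: integrable_completion)
  have mc: "mconv (moll e) h = mconv (moll e) h'" if e: "e > 0" for e
  proof (rule ext)
    fix x
    note mb = continuous_imp_lebesgue_measurable[OF translated_continuous[OF test_function_continuous[OF moll_test_function[OF e]]], of x]
    show "mconv (moll e) h x = mconv (moll e) h' x"
      unfolding mconv_def
    proof (rule integral_cong_AE)
      show "(\<lambda>y. moll e (x - y) * h y) \<in> borel_measurable lebesgue"
        by (rule borel_measurable_times[OF mb h(1)])
      show "(\<lambda>y. moll e (x - y) * h' y) \<in> borel_measurable lebesgue"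
        by (rule borel_measurable_times[OF mb]) measurable
    qed (use hh' in \<open>auto elim: eventually_mono\<close>)
  qed
  have mcm: "mconv (moll e) h' \<in> borel_measurable borel" if e: "e > 0" for e
    using mconv_Ck[OF moll_test_function[OF e] h'1L, of 0] by (simp add: borel_measurable_continuous_onI)
  have eqi: "(LINT x|lebesgue. F x * mconv (moll e) h x) = (LINT x|lborel. F' x * mconv (moll e) h' x)" if e: "e > 0" for e
  proof -
    note [measurable] = F(1) mcm[OF e] measurable_completion[OF mcm[OF e, folded measurable_lborel1]]
    have "(LINT x|lebesgue. F x * mconv (moll e) h x) = (LINT x|lebesgue. F' x * mconv (moll e) h' x)"
      unfolding mc[OF e]
    proof (rule integral_cong_AE)
      have m: "mconv (moll e) h' \<in> borel_measurable lebesgue"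
        using mcm[OF e] by (intro measurable_completion) simp
      show "(\<lambda>x. F x * mconv (moll e) h' x) \<in> borel_measurable lebesgue" by (rule borel_measurable_times[OF F(1) m])
      show "(\<lambda>x. F' x * mconv (moll e) h' x) \<in> borel_measurable lebesgue" by (rule borel_measurable_times[OF _ m]) measurable
    qed (use FF' in \<open>auto elim: eventually_mono\<close>)
    also have "\<dots> = (LINT x|lborel. F' x * mconv (moll e) h' x)" by (rule integral_completion) simp
    finally show ?thesis .
  qed
  have eq0: "(LINT x|lebesgue. F x * h x) = (LINT x|lborel. F' x * h' x)"
  proof -
    have "(LINT x|lebesgue. F x * h x) = (LINT x|lebesgue. F' x * h' x)"
      by (rule integral_cong_AE) (use F(1) h(1) FF' hh' in \<open>auto elim: eventually_elim2\<close>)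
    also have "\<dots> = (LINT x|lborel. F' x * h' x)" by (rule integral_completion) simp
    finally show ?thesis .
  qed
  show "((\<lambda>e. LINT x|lebesgue. F x * mconv (moll e) h x) \<longlongrightarrow> (LINT x|lebesgue. F x * h x)) (at_right 0)"
    unfolding eq0
  proof (rule Lim_transform_eventually[OF mollify_pairing_borel(1)[OF F' h' F'2 F'0 h'2 h'0]])
    show "\<forall>\<^sub>F e in at_right 0. (LINT x|lborel. F' x * mconv (moll e) h' x) = (LINT x|lebesgue. F x * mconv (moll e) h x)"
      using eventually_at_right_less[of "0::real"] by eventually_elim (simp add: eqi)
  qed
  show "integrable lebesgue (\<lambda>x. F x * mconv (moll e) h x)" if e: "e > 0"
  proof -
    note [measurable] = F(1) mcm[OF e] measurable_completion[OF mcm[OF e, folded measurable_lborel1]]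
    have "integrable lebesgue (\<lambda>x. F' x * mconv (moll e) h' x)"
      using mollify_pairing_borel(2)[OF F' h' F'2 F'0 h'2 h'0 e] by (subst integrable_completion) auto
    then show ?thesis
      unfolding mc[OF e]
    proof (rule integrable_cong_AE_imp)
      have m: "mconv (moll e) h' \<in> borel_measurable lebesgue"
        using mcm[OF e] by (intro measurable_completion) simp
      show "(\<lambda>x. F x * mconv (moll e) h' x) \<in> borel_measurable lebesgue" by (rule borel_measurable_times[OF F(1) m])
    qed (use FF' in \<open>auto elim: eventually_mono\<close>)
  qed
qed

section \<open>Local function spaces and weak gradients\<close>

text \<open>Provides the room in which mollification at scales below \<open>\<delta>\<close> stays
  inside \<open>U\<close>.\<close>

lemma compact_neighbourhood:
  fixes K :: "(real ^ 'n::finite) set"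
  assumes "compact K" "open U" "K \<subseteq> U"
  obtains \<delta> K' where "\<delta> > 0" "compact K'" "K \<subseteq> K'" "K' \<subseteq> U" "\<And>x. x \<in> K \<Longrightarrow> cball x \<delta> \<subseteq> K'"
    "\<And>y. y \<in> K' \<Longrightarrow> \<exists>x\<in>K. dist x y \<le> \<delta>"
proof -
  obtain \<delta> where \<delta>: "\<delta> > 0" "(\<Union>x\<in>K. cball x \<delta>) \<subseteq> U"
    using compact_subset_open_imp_cball_epsilon_subset[OF assms(1,2)] assms(3) by metis
  \<comment> \<open>Writing the neighbourhood as the sum of \<open>K\<close> with a closed ball
    shows that it is compact.\<close>
  have eq: "{x + y |x y. x \<in> K \<and> y \<in> cball 0 \<delta>} = (\<Union>x\<in>K. cball x \<delta>)"
  proof safe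
    fix x y :: "real ^ 'n" assume "x \<in> K" "y \<in> cball 0 \<delta>"
    then show "x + y \<in> (\<Union>x\<in>K. cball x \<delta>)" by (auto simp: dist_norm intro!: bexI[of _ x])
  next
    fix x y :: "real ^ 'n" assume "x \<in> K" "y \<in> cball x \<delta>"
    then show "\<exists>x' y'. y = x' + y' \<and> x' \<in> K \<and> y' \<in> cball 0 \<delta>"
      by (intro exI[of _ x] exI[of _ "y - x"]) (auto simp: dist_norm norm_minus_commute)
  qed
  have "compact (\<Union>x\<in>K. cball x \<delta>)"
    using compact_sums[OF assms(1) compact_cball[of 0 \<delta>]] unfolding eq .
  moreover have "K \<subseteq> (\<Union>x\<in>K. cball x \<delta>)" using \<delta>(1) by (auto intro: less_imp_le)
  ultimately show ?thesis by (rule that[OF \<delta>(1) _ _ \<delta>(2)]) auto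
qed

section \<open>Functions measurable, square integrable or bounded on compact subsets\<close>

definition meas_loc :: "(real ^ 'n::finite) set \<Rightarrow> (real ^ 'n \<Rightarrow> 'b::real_normed_vector) \<Rightarrow> bool" where
  "meas_loc U f \<longleftrightarrow> (\<forall>K. compact K \<and> K \<subseteq> U \<longrightarrow> (\<lambda>x. indicator K x *\<^sub>R f x) \<in> borel_measurable lebesgue)"

definition L2_loc :: "(real ^ 'n::finite) set \<Rightarrow> (real ^ 'n \<Rightarrow> real) \<Rightarrow> bool" where
  "L2_loc U f \<longleftrightarrow> meas_loc U f \<and> (\<forall>K. compact K \<and> K \<subseteq> U \<longrightarrow> integrable lebesgue (\<lambda>x. indicator K x * (f x)\<^sup>2))"

text \<open>The bound is almost everywhere because the Carleson condition and the essential supremum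
  control functions only up to null sets. As in \<open>meas_loc\<close>, values off \<open>U\<close>
  are arbitrary and are masked by compact subsets.\<close>

definition bdd_loc :: "(real ^ 'n::finite) set \<Rightarrow> (real ^ 'n \<Rightarrow> real) \<Rightarrow> bool" where
  "bdd_loc U f \<longleftrightarrow> meas_loc U f \<and>
    (\<forall>K. compact K \<and> K \<subseteq> U \<longrightarrow> (\<exists>B. AE x in lebesgue. x \<in> K \<longrightarrow> \<bar>f x\<bar> \<le> B))"

lemma compact_sets_lebesgue: "compact K \<Longrightarrow> K \<in> sets lebesgue"
  for K :: "(real ^ 'n::finite) set"
  using borel_compact by (metis sets_completionI_sets sets_lborel)

lemma indicator_compact_measurable:
  "compact K \<Longrightarrow> (indicator K :: real ^ 'n::finite \<Rightarrow> real) \<in> borel_measurable lebesgue"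
  by (intro borel_measurable_indicator compact_sets_lebesgue)

lemma compact_integrable_indicator:
  fixes K :: "(real ^ 'n::finite) set"
  assumes "compact K"
  shows "integrable lebesgue (indicator K :: _ \<Rightarrow> real)"
proof -
  have "emeasure lborel K < \<infinity>" using assms emeasure_compact_finite by blast
  then show ?thesis
    using assms compact_sets_lebesgue borel_compact[OF assms] by (intro integrable_real_indicator) auto
qed

lemma indicator_square: "(indicator K x * c)\<^sup>2 = indicator K x * (c::real)\<^sup>2"
  by (simp add: indicator_def)

lemma meas_loc_mult:
  fixes f g :: "real ^ 'n::finite \<Rightarrow> real"
  assumes "meas_loc U f" "meas_loc U g"
  shows "meas_loc U (\<lambda>x. f x * g x)"
  unfolding meas_loc_def
proof safe
  fix K assume K: "compact K" "K \<subseteq> U"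
  have "(\<lambda>x. (indicator K x *\<^sub>R f x) * (indicator K x *\<^sub>R g x)) \<in> borel_measurable lebesgue"
    using assms K unfolding meas_loc_def by (intro borel_measurable_times) auto
  then show "(\<lambda>x. indicator K x *\<^sub>R (f x * g x)) \<in> borel_measurable lebesgue"
    by (rule measurable_cong[THEN iffD1, rotated]) (simp add: indicator_def)
qed

lemma meas_loc_add:
  fixes f g :: "real ^ 'n::finite \<Rightarrow> real"
  assumes "meas_loc U f" "meas_loc U g"
  shows "meas_loc U (\<lambda>x. f x + g x)"
  using assms unfolding meas_loc_def by (auto simp: scaleR_add_right simp del: real_scaleR_def intro!: borel_measurable_add)

lemma meas_loc_I:
  fixes f :: "real ^ 'n::finite \<Rightarrow> 'b::euclidean_space"
  assumes "(\<lambda>x. indicator U x *\<^sub>R f x) \<in> borel_measurable lebesgue"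
  shows "meas_loc U f"
  unfolding meas_loc_def
proof safe
  fix K assume K: "compact K" "K \<subseteq> U"
  have "(\<lambda>x. indicator K x *\<^sub>R (indicator U x *\<^sub>R f x)) \<in> borel_measurable lebesgue"
    by (intro borel_measurable_scaleR assms indicator_compact_measurable K)
  then show "(\<lambda>x. indicator K x *\<^sub>R f x) \<in> borel_measurable lebesgue"
    by (rule measurable_cong[THEN iffD1, rotated]) (use K in \<open>auto simp: indicator_def\<close>)
qed

text \<open>An exhaustion of \<open>U\<close> by compact sets exhibits the masked function as a
  pointwise limit of measurable ones.\<close>

lemma meas_loc_D:
  fixes f :: "real ^ 'n::finite \<Rightarrow> 'b::euclidean_space"
  assumes "meas_loc U f" "open U"
  shows "(\<lambda>x. indicator U x *\<^sub>R f x) \<in> borel_measurable lebesgue"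
proof -
  obtain C :: "nat \<Rightarrow> (real ^ 'n) set" where C: "\<And>n. compact (C n)" "\<And>n. C n \<subseteq> U" "\<And>n. C n \<subseteq> interior (C (Suc n))" "\<Union>(range C) = U"
    using open_Union_compact_subsets[OF assms(2)] by metis
  have inc: "C n \<subseteq> C m" if "n \<le> m" for n m
    using that C(3) interior_subset by (induction rule: dec_induct) blast+
  show ?thesis
  proof (rule borel_measurable_LIMSEQ_metric)
    show "(\<lambda>x. indicator (C n) x *\<^sub>R f x) \<in> borel_measurable lebesgue" for n
      using assms(1) C(1,2) by (auto simp: meas_loc_def)
    show "(\<lambda>n. indicator (C n) x *\<^sub>R f x) \<longlonglongrightarrow> indicator U x *\<^sub>R f x" for x
    proof (cases "x \<in> U")
      case True
      then obtain n where "x \<in> C n" using C(4) by blast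
      then have "\<forall>m\<ge>n. indicator (C m) x *\<^sub>R f x = indicator U x *\<^sub>R f x"
        using inc True by (auto simp: indicator_def)
      then show ?thesis by (intro tendsto_eventually) (auto simp: eventually_sequentially)
    next
      case False
      then have "(\<lambda>n. indicator (C n) x *\<^sub>R f x) = (\<lambda>n. 0)" using C(2) by (auto simp: indicator_def fun_eq_iff)
      then show ?thesis using False by simp
    qed
  qed
qed

lemma bdd_loc_mult: "bdd_loc U f \<Longrightarrow> bdd_loc U g \<Longrightarrow> bdd_loc U (\<lambda>x. f x * g x)"
  unfolding bdd_loc_def
proof (intro conjI meas_loc_mult allI impI; (elim conjE)?)
  fix K assume *: "\<forall>K. compact K \<and> K \<subseteq> U \<longrightarrow> (\<exists>B. AE x in lebesgue. x \<in> K \<longrightarrow> \<bar>f x\<bar> \<le> B)"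
    "\<forall>K. compact K \<and> K \<subseteq> U \<longrightarrow> (\<exists>B. AE x in lebesgue. x \<in> K \<longrightarrow> \<bar>g x\<bar> \<le> B)" "compact K" "K \<subseteq> U"
  obtain B1 B2 where "AE x in lebesgue. x \<in> K \<longrightarrow> \<bar>f x\<bar> \<le> B1" "AE x in lebesgue. x \<in> K \<longrightarrow> \<bar>g x\<bar> \<le> B2"
    using * by blast
  then have "AE x in lebesgue. x \<in> K \<longrightarrow> \<bar>f x * g x\<bar> \<le> B1 * B2"
    by eventually_elim (auto simp: abs_mult intro: mult_mono order_trans[OF abs_ge_zero])
  then show "\<exists>B. AE x in lebesgue. x \<in> K \<longrightarrow> \<bar>f x * g x\<bar> \<le> B" by blast
qed auto

lemma bdd_loc_add: "bdd_loc U f \<Longrightarrow> bdd_loc U g \<Longrightarrow> bdd_loc U (\<lambda>x. f x + g x)"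
  unfolding bdd_loc_def
proof (intro conjI meas_loc_add allI impI; (elim conjE)?)
  fix K assume *: "\<forall>K. compact K \<and> K \<subseteq> U \<longrightarrow> (\<exists>B. AE x in lebesgue. x \<in> K \<longrightarrow> \<bar>f x\<bar> \<le> B)"
    "\<forall>K. compact K \<and> K \<subseteq> U \<longrightarrow> (\<exists>B. AE x in lebesgue. x \<in> K \<longrightarrow> \<bar>g x\<bar> \<le> B)" "compact K" "K \<subseteq> U"
  obtain B1 B2 where "AE x in lebesgue. x \<in> K \<longrightarrow> \<bar>f x\<bar> \<le> B1" "AE x in lebesgue. x \<in> K \<longrightarrow> \<bar>g x\<bar> \<le> B2"
    using * by blast
  then have "AE x in lebesgue. x \<in> K \<longrightarrow> \<bar>f x + g x\<bar> \<le> B1 + B2"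
    by eventually_elim auto
  then show "\<exists>B. AE x in lebesgue. x \<in> K \<longrightarrow> \<bar>f x + g x\<bar> \<le> B" by blast
qed auto

lemma bdd_loc_L2_loc:
  assumes "bdd_loc U f"
  shows "L2_loc U f"
  unfolding L2_loc_def
proof (intro conjI allI impI)
  show m: "meas_loc U f" using assms by (simp add: bdd_loc_def)
  fix K assume K: "compact K \<and> K \<subseteq> U"
  then obtain B where B: "AE x in lebesgue. x \<in> K \<longrightarrow> \<bar>f x\<bar> \<le> B" using assms unfolding bdd_loc_def by blast
  have mK: "(\<lambda>x. (indicator K x *\<^sub>R f x)\<^sup>2) \<in> borel_measurable lebesgue"
    using m K by (intro borel_measurable_power) (auto simp: meas_loc_def)
  show "integrable lebesgue (\<lambda>x. indicator K x * (f x)\<^sup>2)"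
  proof (rule Bochner_Integration.integrable_bound[where f = "\<lambda>x. indicator K x * B\<^sup>2"])
    show "integrable lebesgue (\<lambda>x. indicator K x * B\<^sup>2)" using compact_integrable_indicator K by (intro integrable_mult_left) auto
    show "(\<lambda>x. indicator K x * (f x)\<^sup>2) \<in> borel_measurable lebesgue" using mK by (simp add: indicator_square)
    show "AE x in lebesgue. norm (indicator K x * (f x)\<^sup>2) \<le> norm (indicator K x * B\<^sup>2)"
      using B
    proof eventually_elim
      case (elim x)
      then have "x \<in> K \<Longrightarrow> (f x)\<^sup>2 \<le> B\<^sup>2" by (subst abs_le_square_iff[symmetric]) auto
      then show ?case by (auto simp: indicator_def)
    qed
  qed
qed

lemma L2_loc_add:
  assumes f: "L2_loc U f" and g: "L2_loc U g"
  shows "L2_loc U (\<lambda>x. f x + g x)"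
  unfolding L2_loc_def
proof (intro conjI allI impI)
  show m: "meas_loc U (\<lambda>x. f x + g x)" using f g by (auto simp: L2_loc_def intro: meas_loc_add)
  fix K assume K: "compact K \<and> K \<subseteq> U"
  have mK: "(\<lambda>x. (indicator K x *\<^sub>R (f x + g x))\<^sup>2) \<in> borel_measurable lebesgue"
    using m K by (intro borel_measurable_power) (auto simp: meas_loc_def)
  have i: "integrable lebesgue (\<lambda>x. 2 * (indicator K x * (f x)\<^sup>2) + 2 * (indicator K x * (g x)\<^sup>2))"
    using f g K by (intro Bochner_Integration.integrable_add integrable_mult_right) (auto simp: L2_loc_def)
  show "integrable lebesgue (\<lambda>x. indicator K x * (f x + g x)\<^sup>2)"
  proof (rule Bochner_Integration.integrable_bound[OF i])
    show "(\<lambda>x. indicator K x * (f x + g x)\<^sup>2) \<in> borel_measurable lebesgue" using mK by (simp add: indicator_square)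
    show "AE x in lebesgue. norm (indicator K x * (f x + g x)\<^sup>2) \<le> norm (2 * (indicator K x * (f x)\<^sup>2) + 2 * (indicator K x * (g x)\<^sup>2))"
    proof (rule AE_I2)
      fix x
      have "(f x + g x)\<^sup>2 \<le> 2 * (f x)\<^sup>2 + 2 * (g x)\<^sup>2"
        using sum_squares_bound[of "f x" "g x"] by (simp add: power2_sum)
      then show "norm (indicator K x * (f x + g x)\<^sup>2) \<le> norm (2 * (indicator K x * (f x)\<^sup>2) + 2 * (indicator K x * (g x)\<^sup>2))"
        by (auto simp: indicator_def)
    qed
  qed
qed

lemma L2_loc_bdd_mult:
  assumes f: "bdd_loc U f" and g: "L2_loc U g"
  shows "L2_loc U (\<lambda>x. f x * g x)"
  unfolding L2_loc_def
proof (intro conjI allI impI)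
  show m: "meas_loc U (\<lambda>x. f x * g x)" using f g by (auto simp: L2_loc_def bdd_loc_def intro: meas_loc_mult)
  fix K assume K: "compact K \<and> K \<subseteq> U"
  then obtain B where B: "AE x in lebesgue. x \<in> K \<longrightarrow> \<bar>f x\<bar> \<le> B" using f unfolding bdd_loc_def by blast
  have mK: "(\<lambda>x. (indicator K x *\<^sub>R (f x * g x))\<^sup>2) \<in> borel_measurable lebesgue"
    using m K by (intro borel_measurable_power) (auto simp: meas_loc_def)
  have i: "integrable lebesgue (\<lambda>x. B\<^sup>2 * (indicator K x * (g x)\<^sup>2))"
    using g K by (intro integrable_mult_right) (auto simp: L2_loc_def)
  show "integrable lebesgue (\<lambda>x. indicator K x * (f x * g x)\<^sup>2)"
  proof (rule Bochner_Integration.integrable_bound[OF i])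
    show "(\<lambda>x. indicator K x * (f x * g x)\<^sup>2) \<in> borel_measurable lebesgue" using mK by (simp add: indicator_square)
    show "AE x in lebesgue. norm (indicator K x * (f x * g x)\<^sup>2) \<le> norm (B\<^sup>2 * (indicator K x * (g x)\<^sup>2))"
      using B
    proof eventually_elim
      case (elim x)
      then have "x \<in> K \<Longrightarrow> (f x)\<^sup>2 \<le> B\<^sup>2" by (subst abs_le_square_iff[symmetric]) auto
      then show ?case by (auto simp: indicator_def power_mult_distrib intro: mult_right_mono)
    qed
  qed
qed

lemma L2_loc_prod_integrable:
  assumes f: "L2_loc U f" and g: "L2_loc U g" and K: "compact K" "K \<subseteq> U"
  shows "integrable lebesgue (\<lambda>x. indicator K x * (f x * g x))"
proof -
  have m: "meas_loc U (\<lambda>x. f x * g x)" using f g by (auto simp: L2_loc_def intro: meas_loc_mult)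
  have i: "integrable lebesgue (\<lambda>x. (indicator K x * (f x)\<^sup>2) + (indicator K x * (g x)\<^sup>2))"
    using f g K by (intro Bochner_Integration.integrable_add) (auto simp: L2_loc_def)
  show ?thesis
  proof (rule Bochner_Integration.integrable_bound[OF i])
    show "(\<lambda>x. indicator K x * (f x * g x)) \<in> borel_measurable lebesgue"
      using m K by (auto simp: meas_loc_def)
    show "AE x in lebesgue. norm (indicator K x * (f x * g x)) \<le> norm ((indicator K x * (f x)\<^sup>2) + (indicator K x * (g x)\<^sup>2))"
    proof (rule AE_I2)
      fix x
      have "\<bar>f x * g x\<bar> \<le> 1 / 2 * (f x)\<^sup>2 + 1 / (2 * 1) * (g x)\<^sup>2" using Young_weighted[of 1 "f x" "g x"] by simp
      also have "\<dots> \<le> (f x)\<^sup>2 + (g x)\<^sup>2" using zero_le_power2[of "f x"] zero_le_power2[of "g x"] by linarith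
      finally show "norm (indicator K x * (f x * g x)) \<le> norm ((indicator K x * (f x)\<^sup>2) + (indicator K x * (g x)\<^sup>2))"
        by (auto simp: indicator_def)
    qed
  qed
qed

lemma meas_loc_subset: "meas_loc U f \<Longrightarrow> V \<subseteq> U \<Longrightarrow> meas_loc V f"
  unfolding meas_loc_def by blast

lemma L2_loc_subset: "L2_loc U f \<Longrightarrow> V \<subseteq> U \<Longrightarrow> L2_loc V f"
  unfolding L2_loc_def using meas_loc_subset by blast

lemma bdd_loc_subset: "bdd_loc U f \<Longrightarrow> V \<subseteq> U \<Longrightarrow> bdd_loc V f"
  unfolding bdd_loc_def using meas_loc_subset by blast

lemma continuous_meas_loc:
  fixes f :: "real ^ 'n::finite \<Rightarrow> 'b::euclidean_space"
  assumes "open U" "continuous_on U f"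
  shows "meas_loc U f"
proof (rule meas_loc_I, rule measurable_completion)
  show "(\<lambda>x. indicator U x *\<^sub>R f x) \<in> borel_measurable lborel"
    using borel_measurable_continuous_on_indicator[OF _ assms(2)] assms(1) by simp
qed

lemma continuous_bdd_loc:
  fixes f :: "real ^ 'n::finite \<Rightarrow> real"
  assumes "open U" "continuous_on U f"
  shows "bdd_loc U f"
  unfolding bdd_loc_def
proof (intro conjI allI impI)
  show "meas_loc U f" by (rule continuous_meas_loc[OF assms])
  fix K assume "compact K \<and> K \<subseteq> U"
  then have "compact (f ` K)" using assms(2) by (auto intro: compact_continuous_image continuous_on_subset)
  then obtain B where "\<forall>y\<in>f ` K. norm y \<le> B" using compact_imp_bounded bounded_iff by metis
  then show "\<exists>B. AE x in lebesgue. x \<in> K \<longrightarrow> \<bar>f x\<bar> \<le> B" by (intro exI[of _ B] AE_I2) auto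
qed

section \<open>Weak gradients, mollification and the product rule\<close>

lemma test_function_support:
  fixes \<phi> :: "real ^ 'n::finite \<Rightarrow> real"
  assumes "test_function U \<phi>"
  obtains K where "compact K" "K \<subseteq> U" "\<And>x. x \<notin> K \<Longrightarrow> \<phi> x = 0" "\<And>x. x \<notin> K \<Longrightarrow> gradient \<phi> x = 0"
proof -
  obtain K where K: "compact K" "K \<subseteq> U" "\<And>x. x \<notin> K \<Longrightarrow> \<phi> x = 0"
    using assms by (auto simp: test_function_def)
  have "gradient \<phi> x = 0" if "x \<notin> K" for x
    using gradient_eq_0_outside[OF compact_imp_closed[OF K(1)] K(3) that] by simp
  with K that show ?thesis by blast
qed

lemma test_mult_integrable:
  fixes u :: "real ^ 'n::finite \<Rightarrow> 'b::euclidean_space"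
  assumes "test_function U \<phi>" "\<And>K. compact K \<Longrightarrow> K \<subseteq> U \<Longrightarrow> u absolutely_integrable_on K"
  shows "integrable lebesgue (\<lambda>x. \<phi> x *\<^sub>R u x)"
proof -
  obtain K where K: "compact K" "K \<subseteq> U" "\<And>x. x \<notin> K \<Longrightarrow> \<phi> x = 0"
    using assms(1) by (auto simp: test_function_def)
  obtain B where B: "\<And>x. \<bar>\<phi> x\<bar> \<le> B" using test_function_bounded[OF assms(1)] by metis
  have "integrable lebesgue (\<lambda>x. \<phi> x *\<^sub>R (indicator K x *\<^sub>R u x))"
    using assms(2)[OF K(1,2)] unfolding set_integrable_def
    by (rule integrable_bounded_mult_lebesgue[OF _ continuous_imp_lebesgue_measurable[OF test_function_continuous[OF assms(1)]] B])
  moreover have "(\<lambda>x. \<phi> x *\<^sub>R (indicator K x *\<^sub>R u x)) = (\<lambda>x. \<phi> x *\<^sub>R u x)" using K(3) by (auto simp: indicator_def fun_eq_iff)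
  ultimately show ?thesis by (simp only:)
qed

lemma abs_integrable_nth:
  fixes g :: "real ^ 'n::finite \<Rightarrow> real ^ 'n"
  assumes "g absolutely_integrable_on K"
  shows "(\<lambda>x. g x $ i) absolutely_integrable_on K"
  using integrable_bounded_linear[OF bounded_linear_vec_nth[of i], of lebesgue "\<lambda>x. indicator K x *\<^sub>R g x"] assms
  by (simp add: set_integrable_def)

text \<open>Test functions vanish with their gradients off a compact subset of \<open>U\<close>, so
  the identity may be read over the whole space and in components; later computations use this form,
  and \<open>weak_gradientI\<close> is the way back.\<close>

lemma weak_gradient_test:
  fixes u :: "real ^ 'n::finite \<Rightarrow> real"
  assumes w: "weak_gradient U u g" and t: "test_function U \<phi>"
  shows "integrable lebesgue (\<lambda>x. u x * gradient \<phi> x $ i)" "integrable lebesgue (\<lambda>x. \<phi> x * g x $ i)"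
    "(LINT x|lebesgue. u x * gradient \<phi> x $ i) = - (LINT x|lebesgue. \<phi> x * g x $ i)"
proof -
  obtain K where K: "compact K" "K \<subseteq> U" "\<And>x. x \<notin> K \<Longrightarrow> \<phi> x = 0" "\<And>x. x \<notin> K \<Longrightarrow> gradient \<phi> x = 0"
    using test_function_support[OF t] by metis
  have au: "u absolutely_integrable_on K" and ag: "g absolutely_integrable_on K" if "compact K" "K \<subseteq> U" for K
    using w that by (auto simp: weak_gradient_def)
  have i1: "integrable lebesgue (\<lambda>x. gradient \<phi> x $ j *\<^sub>R u x)" for j
    by (rule test_mult_integrable[OF test_function_partial[OF t] au])
  then show i1': "integrable lebesgue (\<lambda>x. u x * gradient \<phi> x $ i)" by (simp add: mult.commute)
  have i2: "integrable lebesgue (\<lambda>x. \<phi> x *\<^sub>R g x)"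
    by (rule test_mult_integrable[OF t ag])
  show "integrable lebesgue (\<lambda>x. \<phi> x * g x $ i)"
    using integrable_bounded_linear[OF bounded_linear_vec_nth[of i] i2] by simp
  have i3: "integrable lebesgue (\<lambda>x. u x *\<^sub>R gradient \<phi> x)"
  proof -
    obtain B where B: "B > 0" "\<And>x. norm (gradient \<phi> x) \<le> B" using test_function_bounded[OF t] by metis
    have "integrable lebesgue (\<lambda>x. B * \<bar>indicator K x * u x\<bar>)" using au[OF K(1,2)] by (simp add: set_integrable_def)
    then show ?thesis
    proof (rule Bochner_Integration.integrable_bound)
      have "(\<lambda>x. (indicator K x * u x) *\<^sub>R gradient \<phi> x) \<in> borel_measurable lebesgue"
        using au[OF K(1,2)] continuous_imp_lebesgue_measurable[OF test_function_continuous_gradient[OF t]]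
        by (intro borel_measurable_scaleR) (auto simp: set_integrable_def dest: borel_measurable_integrable)
      then show "(\<lambda>x. u x *\<^sub>R gradient \<phi> x) \<in> borel_measurable lebesgue"
        by (rule measurable_cong[THEN iffD1, rotated]) (use K(4) in \<open>auto simp: indicator_def\<close>)
      show "AE x in lebesgue. norm (u x *\<^sub>R gradient \<phi> x) \<le> norm (B * \<bar>indicator K x * u x\<bar>)"
      proof (rule AE_I2)
        fix x
        show "norm (u x *\<^sub>R gradient \<phi> x) \<le> norm (B * \<bar>indicator K x * u x\<bar>)"
          using K(4)[of x] B(1) mult_left_mono[OF B(2)[of x], of "\<bar>u x\<bar>"]
          by (cases "x \<in> K") (auto simp: abs_mult mult.commute)
      qed
    qed
  qed
  have "(LINT x:U|lebesgue. u x *\<^sub>R gradient \<phi> x) = - (LINT x:U|lebesgue. \<phi> x *\<^sub>R g x)"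
    using w t by (simp add: weak_gradient_def)
  moreover have "indicator U x *\<^sub>R (u x *\<^sub>R gradient \<phi> x) = u x *\<^sub>R gradient \<phi> x" "indicator U x *\<^sub>R (\<phi> x *\<^sub>R g x) = \<phi> x *\<^sub>R g x" for x
    using K(2,3,4) by (auto simp: indicator_def)
  ultimately have "(LINT x|lebesgue. u x *\<^sub>R gradient \<phi> x) = - (LINT x|lebesgue. \<phi> x *\<^sub>R g x)"
    by (simp only: set_lebesgue_integral_def)
  then have "(LINT x|lebesgue. u x *\<^sub>R gradient \<phi> x) $ i = - ((LINT x|lebesgue. \<phi> x *\<^sub>R g x) $ i)" by simp
  then show "(LINT x|lebesgue. u x * gradient \<phi> x $ i) = - (LINT x|lebesgue. \<phi> x * g x $ i)"
    using integral_bounded_linear[OF bounded_linear_vec_nth[of i] i3] integral_bounded_linear[OF bounded_linear_vec_nth[of i] i2]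
    by simp
qed

lemma vec_integrable_componentwise:
  fixes g :: "'a \<Rightarrow> real ^ 'n::finite"
  assumes "\<And>i. integrable M (\<lambda>x. g x $ i)"
  shows "integrable M g"
proof -
  have "integrable M (\<lambda>x. \<Sum>i\<in>UNIV. g x $ i *\<^sub>R (axis i 1 :: real ^ 'n))"
    using assms by (intro Bochner_Integration.integrable_sum integrable_scaleR_left)
  moreover have "(\<lambda>x. \<Sum>i\<in>UNIV. g x $ i *\<^sub>R (axis i 1 :: real ^ 'n)) = g"
    using basis_expansion[of "g _"] by (simp add: scalar_mult_eq_scaleR fun_eq_iff)
  ultimately show ?thesis by (simp only:)
qed

lemma weak_gradientI:
  fixes u :: "real ^ 'n::finite \<Rightarrow> real"
  assumes u: "\<And>K. compact K \<Longrightarrow> K \<subseteq> U \<Longrightarrow> u absolutely_integrable_on K"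
    and g: "\<And>K i. compact K \<Longrightarrow> K \<subseteq> U \<Longrightarrow> (\<lambda>x. g x $ i) absolutely_integrable_on K"
    and eq: "\<And>\<phi> i. test_function U \<phi> \<Longrightarrow> (LINT x|lebesgue. u x * gradient \<phi> x $ i) = - (LINT x|lebesgue. \<phi> x * g x $ i)"
  shows "weak_gradient U u g"
  unfolding weak_gradient_def
proof (intro conjI allI impI)
  have gK: "g absolutely_integrable_on K" if "compact K" "K \<subseteq> U" for K
    using g[OF that] unfolding set_integrable_def by (intro vec_integrable_componentwise) simp
  fix K assume K: "compact K \<and> K \<subseteq> U"
  show "u absolutely_integrable_on K" using u K by blast
  show "g absolutely_integrable_on K" using gK K by blast
next
  fix \<phi> assume t: "test_function U \<phi>"
  obtain K where K: "compact K" "K \<subseteq> U" "\<And>x. x \<notin> K \<Longrightarrow> \<phi> x = 0" "\<And>x. x \<notin> K \<Longrightarrow> gradient \<phi> x = 0"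
    using test_function_support[OF t] by metis
  have e: "indicator U x *\<^sub>R (u x *\<^sub>R gradient \<phi> x) = u x *\<^sub>R gradient \<phi> x" "indicator U x *\<^sub>R (\<phi> x *\<^sub>R g x) = \<phi> x *\<^sub>R g x" for x
    using K(2,3,4) by (auto simp: indicator_def)
  have i1: "integrable lebesgue (\<lambda>x. u x *\<^sub>R gradient \<phi> x)"
    using test_mult_integrable[OF test_function_partial[OF t] u]
    by (intro vec_integrable_componentwise) (simp add: mult.commute)
  have i2: "integrable lebesgue (\<lambda>x. \<phi> x *\<^sub>R g x)"
    using test_mult_integrable[OF t g] by (intro vec_integrable_componentwise) simp
  show "(LINT x:U|lebesgue. u x *\<^sub>R gradient \<phi> x) = - (LINT x:U|lebesgue. \<phi> x *\<^sub>R g x)"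
    unfolding set_lebesgue_integral_def e
  proof (rule vec_eq_iff[THEN iffD2], rule allI)
    fix i
    show "(LINT x|lebesgue. u x *\<^sub>R gradient \<phi> x) $ i = (- (LINT x|lebesgue. \<phi> x *\<^sub>R g x)) $ i"
      using integral_bounded_linear[OF bounded_linear_vec_nth[of i] i1] integral_bounded_linear[OF bounded_linear_vec_nth[of i] i2]
        eq[OF t, of i] by simp
  qed
qed

text \<open>If the ball of radius \<open>e\<close> around \<open>x\<close> stays inside
  \<open>U\<close>, the reflected and translated mollifier is itself a test function. The sign from
  reflecting the kernel cancels the sign of the integration by parts.\<close>

lemma mconv_weak_gradient:
  fixes u :: "real ^ 'n::finite \<Rightarrow> real"
  assumes w: "weak_gradient U u g" and K': "compact K'" "K' \<subseteq> U" and e: "e > 0" and x: "cball x e \<subseteq> K'"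
  shows "gradient (mconv (moll e) (\<lambda>y. indicator K' y * u y)) x $ i = mconv (moll e) (\<lambda>y. indicator K' y * g y $ i) x"
proof -
  define \<phi> where "\<phi> y = moll e (x - y)" for y
  have supp: "\<phi> y = 0" if "y \<notin> cball x e" for y
    unfolding \<phi>_def by (rule moll_outside[OF e]) (use that in \<open>auto simp: dist_norm\<close>)
  have "Ck_function k (\<lambda>y. moll e ((-1) *\<^sub>R y + x))" for k
    by (rule Ck_affine[OF test_function_Ck[OF moll_test_function[OF e]]])
  then have "Ck_function k \<phi>" for k by (simp add: \<phi>_def[abs_def])
  then have t: "test_function U \<phi>"
    unfolding test_function_def using supp x K' by (intro conjI allI exI[of _ "cball x e"]) auto
  have "GDERIV (\<lambda>y. moll e ((-1) *\<^sub>R y + x)) y :> (-1) *\<^sub>R gradient (moll e) ((-1) *\<^sub>R y + x)" for y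
    by (rule GDERIV_affine[OF test_function_GDERIV[OF moll_test_function[OF e]]])
  then have gr: "gradient \<phi> y = - gradient (moll e) (x - y)" for y
    unfolding \<phi>_def[abs_def] by (intro gradient_eqI) simp
  have g0: "gradient \<phi> y = 0" if "y \<notin> K'" for y
    by (rule gradient_eq_0_outside[of "cball x e", OF _ supp]) (use that x in auto)
  have "u absolutely_integrable_on K'" using w K' by (auto simp: weak_gradient_def)
  then have iu: "integrable lebesgue (\<lambda>y. indicator K' y * u y)" by (simp add: set_integrable_def)
  have "gradient (mconv (moll e) (\<lambda>y. indicator K' y * u y)) x $ i
      = (LINT y|lebesgue. gradient (moll e) (x - y) $ i * (indicator K' y * u y))"
    using mconv_gradient_nth[OF moll_test_function[OF e] iu] by (simp add: mconv_def)
  also have "\<dots> = - (LINT y|lebesgue. u y * gradient \<phi> y $ i)"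
    unfolding Bochner_Integration.integral_minus[symmetric]
  proof (rule Bochner_Integration.integral_cong[OF refl])
    fix y show "gradient (moll e) (x - y) $ i * (indicator K' y * u y) = - (u y * gradient \<phi> y $ i)"
      using g0[of y] gr[of y] by (cases "y \<in> K'") auto
  qed
  also have "\<dots> = (LINT y|lebesgue. \<phi> y * g y $ i)" using weak_gradient_test(3)[OF w t] by simp
  also have "\<dots> = mconv (moll e) (\<lambda>y. indicator K' y * g y $ i) x"
    unfolding mconv_def
  proof (rule Bochner_Integration.integral_cong[OF refl])
    fix y show "\<phi> y * g y $ i = moll e (x - y) * (indicator K' y * g y $ i)"
      using supp[of y] x by (cases "y \<in> K'") (auto simp: \<phi>_def simp del: mem_cball)
  qed
  finally show ?thesis .
qed

text \<open>The squares in \<open>W12_loc\<close> say nothing about the measurability of the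
  function itself; that comes from the local integrability contained in
  \<open>weak_gradient\<close>.\<close>

lemma W12_loc_L2:
  fixes u :: "real ^ 'n::finite \<Rightarrow> real"
  assumes "W12_loc U u g"
  shows "L2_loc U u" "L2_loc U (\<lambda>x. g x $ i)"
proof -
  have w: "weak_gradient U u g" and u2: "\<And>K. compact K \<Longrightarrow> K \<subseteq> U \<Longrightarrow> (\<lambda>x. \<bar>u x\<bar>\<^sup>2) absolutely_integrable_on K"
    and g2: "\<And>K. compact K \<Longrightarrow> K \<subseteq> U \<Longrightarrow> (\<lambda>x. (norm (g x))\<^sup>2) absolutely_integrable_on K"
    using assms by (auto simp: W12_loc_def)
  have uK: "u absolutely_integrable_on K" and gK: "(\<lambda>x. g x $ i) absolutely_integrable_on K" if "compact K" "K \<subseteq> U" for K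
    using w that by (auto simp: weak_gradient_def intro: abs_integrable_nth)
  have mu: "meas_loc U u" unfolding meas_loc_def
    using uK[unfolded set_integrable_def, THEN borel_measurable_integrable] by blast
  have mg: "meas_loc U (\<lambda>x. g x $ i)" unfolding meas_loc_def
    using gK[unfolded set_integrable_def, THEN borel_measurable_integrable] by blast
  show "L2_loc U u" using mu u2 by (auto simp: L2_loc_def set_integrable_def)
  show "L2_loc U (\<lambda>x. g x $ i)"
    unfolding L2_loc_def
  proof (intro conjI allI impI mg)
    fix K assume K: "compact K \<and> K \<subseteq> U"
    have mK: "(\<lambda>x. (indicator K x *\<^sub>R (g x $ i))\<^sup>2) \<in> borel_measurable lebesgue"
      using mg K by (intro borel_measurable_power) (auto simp: meas_loc_def)
    have "integrable lebesgue (\<lambda>x. indicator K x * (norm (g x))\<^sup>2)" using g2 K by (auto simp: set_integrable_def)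
    then show "integrable lebesgue (\<lambda>x. indicator K x * (g x $ i)\<^sup>2)"
    proof (rule Bochner_Integration.integrable_bound)
      show "(\<lambda>x. indicator K x * (g x $ i)\<^sup>2) \<in> borel_measurable lebesgue" using mK by (simp add: indicator_square)
      have "(g x $ i)\<^sup>2 \<le> (norm (g x))\<^sup>2" for x
        using component_le_norm_cart[of "g x" i] by (subst abs_le_square_iff[symmetric]) simp
      then show "AE x in lebesgue. norm (indicator K x * (g x $ i)\<^sup>2) \<le> norm (indicator K x * (norm (g x))\<^sup>2)"
        by (auto simp: indicator_def)
    qed
  qed
qed

lemma L2_loc_abs_integrable:
  assumes "L2_loc U f" "compact K" "K \<subseteq> U"
  shows "f absolutely_integrable_on K"
proof -
  have "bdd_loc K (\<lambda>x :: real ^ 'a. 1)"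
    unfolding bdd_loc_def meas_loc_def by (auto intro!: exI[of _ 1] indicator_compact_measurable)
  from L2_loc_prod_integrable[OF L2_loc_subset[OF assms(1,3)] bdd_loc_L2_loc[OF this] assms(2)]
  show ?thesis by (simp add: set_integrable_def)
qed

lemma L2_loc_prod_abs_integrable:
  assumes "L2_loc U f" "L2_loc U g" "compact K" "K \<subseteq> U"
  shows "(\<lambda>x. f x * g x) absolutely_integrable_on K"
  using L2_loc_prod_integrable[OF assms] by (simp add: set_integrable_def)

text \<open>Only the values of \<open>h\<close> on \<open>U\<close> have a meaning, so
  \<open>h\<close> is cut to a compact \<open>K'\<close> before smoothing. The limit does not see
  the cut because \<open>F\<close> lives on a subset of \<open>K'\<close>.\<close>

lemma L2_loc_mollify_pairing:
  fixes F h :: "real ^ 'n::finite \<Rightarrow> real"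
  assumes F: "L2_loc U F" and h: "L2_loc U h" and  K: "compact K" "K \<subseteq> U" "\<forall>x. x \<notin> K \<longrightarrow> F x = 0"
    and K': "compact K'" "K' \<subseteq> U" "K \<subseteq> K'"
  shows "((\<lambda>e. LINT x|lebesgue. F x * mconv (moll e) (\<lambda>y. indicator K' y * h y) x) \<longlongrightarrow> (LINT x|lebesgue. F x * h x)) (at_right 0)"
    and "e > 0 \<Longrightarrow> integrable lebesgue (\<lambda>x. F x * mconv (moll e) (\<lambda>y. indicator K' y * h y) x)"
    and "integrable lebesgue (\<lambda>x. F x * h x)"
proof -
  obtain R where R: "K' \<subseteq> cball 0 R" using compact_imp_bounded[OF K'(1)] using bounded_subset_ballD[of K' 0] ball_subset_cball by blast
  have F1: "F = (\<lambda>x. indicator K x * F x)" using K(3) by (auto simp: indicator_def fun_eq_iff)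
  have mF: "F \<in> borel_measurable lebesgue"
    using F K(1,2) by (subst F1) (auto simp: L2_loc_def meas_loc_def)
  have iF: "integrable lebesgue (\<lambda>x. (F x)\<^sup>2)"
    using F K(1,2) by (subst F1) (auto simp: L2_loc_def indicator_square)
  have F0: "F x = 0" if "norm x > R" for x using K(3) R K'(3) that by force
  have mh: "(\<lambda>x. indicator K' x * h x) \<in> borel_measurable lebesgue"
    using h K'(1,2) by (auto simp: L2_loc_def meas_loc_def)
  have ih: "integrable lebesgue (\<lambda>x. (indicator K' x * h x)\<^sup>2)"
    using h K'(1,2) by (auto simp: L2_loc_def indicator_square)
  have h0: "indicator K' x * h x = 0" if "norm x > R" for x using R that by (force simp: indicator_def)
  have eq: "F x * (indicator K' x * h x) = F x * h x" for x
    using K(3) K'(3) by (cases "x \<in> K") (auto simp: indicator_def)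
  show "((\<lambda>e. LINT x|lebesgue. F x * mconv (moll e) (\<lambda>y. indicator K' y * h y) x) \<longlongrightarrow> (LINT x|lebesgue. F x * h x)) (at_right 0)"
    using mollify_pairing(1)[OF mF iF F0 mh ih h0] by (simp only: eq)
  show "e > 0 \<Longrightarrow> integrable lebesgue (\<lambda>x. F x * mconv (moll e) (\<lambda>y. indicator K' y * h y) x)"
    by (rule mollify_pairing(2)[OF mF iF F0 mh ih h0])
  have "integrable lebesgue (\<lambda>x. indicator K x * (F x * h x))" by (rule L2_loc_prod_integrable[OF F h K(1,2)])
  moreover have "(\<lambda>x. indicator K x * (F x * h x)) = (\<lambda>x. F x * h x)" using K(3) by (auto simp: indicator_def fun_eq_iff)
  ultimately show "integrable lebesgue (\<lambda>x. F x * h x)" by (simp only:)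
qed

text \<open>Smooth \<open>f\<close> only. Then the test function times the smoothed \<open>f\<close>
  is again a test function and can be used in the identity for \<open>g\<close>. Each of the three
  resulting integrals pairs a compactly supported L2 function with a mollified one, so each
  converges separately.\<close>

lemma weak_gradient_mult:
  fixes f g :: "real ^ 'n::finite \<Rightarrow> real"
  assumes U: "open U" and f: "W12_loc U f Df" and g: "W12_loc U g Dg"
  shows "weak_gradient U (\<lambda>x. f x * g x) (\<lambda>x. f x *\<^sub>R Dg x + g x *\<^sub>R Df x)"
proof (rule weak_gradientI)
  note f2 = W12_loc_L2[OF f] and g2 = W12_loc_L2[OF g]
  have wf: "weak_gradient U f Df" and wg: "weak_gradient U g Dg" using f g by (auto simp: W12_loc_def)
  show "(\<lambda>x. f x * g x) absolutely_integrable_on K" if "compact K" "K \<subseteq> U" for K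
    by (rule L2_loc_prod_abs_integrable[OF f2(1) g2(1) that])
  show "(\<lambda>x. (f x *\<^sub>R Dg x + g x *\<^sub>R Df x) $ i) absolutely_integrable_on K" if "compact K" "K \<subseteq> U" for K i
    using L2_loc_prod_abs_integrable[OF f2(1) g2(2)[of i] that] L2_loc_prod_abs_integrable[OF g2(1) f2(2)[of i] that]
    by (simp add: set_integral_add)
  fix \<phi> :: "real ^ 'n \<Rightarrow> real" and i assume t: "test_function U \<phi>"
  obtain K where K: "compact K" "K \<subseteq> U" "\<And>x. x \<notin> K \<Longrightarrow> \<phi> x = 0" "\<And>x. x \<notin> K \<Longrightarrow> gradient \<phi> x = 0"
    using test_function_support[OF t] by metis
  obtain \<delta> K' where K': "\<delta> > 0" "compact K'" "K \<subseteq> K'" "K' \<subseteq> U" "\<And>x. x \<in> K \<Longrightarrow> cball x \<delta> \<subseteq> K'"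
    using compact_neighbourhood[OF K(1) U K(2)] by metis
  define fe where "fe e = mconv (moll e) (\<lambda>y. indicator K' y * f y)" for e
  define De where "De e = mconv (moll e) (\<lambda>y. indicator K' y * Df y $ i)" for e
  have bt: "bdd_loc U \<phi>" by (rule continuous_bdd_loc[OF U test_function_continuous[OF t]])
  have bt': "bdd_loc U (\<lambda>x. gradient \<phi> x $ i)"
    by (rule continuous_bdd_loc[OF U test_function_continuous[OF test_function_partial[OF t]]])
  have a1: "L2_loc U (\<lambda>x. gradient \<phi> x $ i * g x)" by (rule L2_loc_bdd_mult[OF bt' g2(1)])
  have a2: "L2_loc U (\<lambda>x. \<phi> x * g x)" by (rule L2_loc_bdd_mult[OF bt g2(1)])
  have a3: "L2_loc U (\<lambda>x. \<phi> x * Dg x $ i)" by (rule L2_loc_bdd_mult[OF bt g2(2)])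
  have z1: "\<forall>x. x \<notin> K \<longrightarrow> gradient \<phi> x $ i * g x = 0" "\<forall>x. x \<notin> K \<longrightarrow> \<phi> x * g x = 0" "\<forall>x. x \<notin> K \<longrightarrow> \<phi> x * Dg x $ i = 0"
    using K(3,4) by auto
  note L1 = L2_loc_mollify_pairing[OF a1 f2(1) K(1,2) z1(1) K'(2,4,3)]
  note L2 = L2_loc_mollify_pairing[OF a2 f2(2)[of i] K(1,2) z1(2) K'(2,4,3)]
  note L3 = L2_loc_mollify_pairing[OF a3 f2(1) K(1,2) z1(3) K'(2,4,3)]
  have fi: "integrable lebesgue (\<lambda>y. indicator K' y * f y)"
    using L2_loc_abs_integrable[OF f2(1) K'(2,4)] by (simp add: set_integrable_def)
  have eq: "(LINT x|lebesgue. gradient \<phi> x $ i * g x * fe e x) + (LINT x|lebesgue. \<phi> x * g x * De e x)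
     = - (LINT x|lebesgue. \<phi> x * Dg x $ i * fe e x)" if e: "0 < e" "e < \<delta>" for e
  proof -
    have Cf: "Ck_function k (fe e)" for k unfolding fe_def by (rule mconv_Ck[OF moll_test_function[OF e(1)] fi])
    have te: "test_function U (\<lambda>x. \<phi> x * fe e x)" by (rule test_function_mult_Ck[OF t Cf])
    have gr: "gradient (\<lambda>x. \<phi> x * fe e x) x = \<phi> x *\<^sub>R gradient (fe e) x + fe e x *\<^sub>R gradient \<phi> x" for x
      by (intro gradient_eqI GDERIV_mult test_function_GDERIV[OF t] Ck_Suc_GDERIV[OF Cf[of "Suc 0"]])
    \<comment> \<open>On the support of the test function the scale \<open>e\<close> is small enough
      for the gradient of the smoothed \<open>f\<close> to be the smoothed weak gradient; elsewhere
      both sides vanish.\<close>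
    have grD: "\<phi> x * gradient (fe e) x $ i = \<phi> x * De e x" for x
    proof (cases "x \<in> K")
      case True
      have "cball x e \<subseteq> K'" using K'(5)[OF True] e by force
      then show ?thesis unfolding fe_def De_def using mconv_weak_gradient[OF wf K'(2,4) e(1)] by simp
    qed (use K(3) in simp)
    have "(LINT x|lebesgue. gradient \<phi> x $ i * g x * fe e x) + (LINT x|lebesgue. \<phi> x * g x * De e x)
      = (LINT x|lebesgue. gradient \<phi> x $ i * g x * fe e x + \<phi> x * g x * De e x)"
      unfolding fe_def De_def by (rule Bochner_Integration.integral_add[OF L1(2)[OF e(1)] L2(2)[OF e(1)], symmetric])
    also have "\<dots> = (LINT x|lebesgue. g x * gradient (\<lambda>x. \<phi> x * fe e x) x $ i)"
      by (rule Bochner_Integration.integral_cong[OF refl]) (simp add: gr grD algebra_simps)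
    also have "\<dots> = - (LINT x|lebesgue. (\<phi> x * fe e x) * Dg x $ i)" by (rule weak_gradient_test(3)[OF wg te])
    finally show ?thesis by (simp add: algebra_simps)
  qed
  have lim: "((\<lambda>e. (LINT x|lebesgue. gradient \<phi> x $ i * g x * fe e x) + (LINT x|lebesgue. \<phi> x * g x * De e x))
      \<longlongrightarrow> (LINT x|lebesgue. gradient \<phi> x $ i * g x * f x) + (LINT x|lebesgue. \<phi> x * g x * Df x $ i)) (at_right 0)"
    unfolding fe_def De_def by (intro tendsto_add L1(1) L2(1))
  have "((\<lambda>e. (LINT x|lebesgue. gradient \<phi> x $ i * g x * fe e x) + (LINT x|lebesgue. \<phi> x * g x * De e x))
      \<longlongrightarrow> - (LINT x|lebesgue. \<phi> x * Dg x $ i * f x)) (at_right 0)"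
  proof (rule Lim_transform_eventually)
    show "((\<lambda>e. - (LINT x|lebesgue. \<phi> x * Dg x $ i * fe e x)) \<longlongrightarrow> - (LINT x|lebesgue. \<phi> x * Dg x $ i * f x)) (at_right 0)"
      unfolding fe_def by (intro tendsto_minus L3(1))
    show "\<forall>\<^sub>F e in at_right 0. - (LINT x|lebesgue. \<phi> x * Dg x $ i * fe e x)
      = (LINT x|lebesgue. gradient \<phi> x $ i * g x * fe e x) + (LINT x|lebesgue. \<phi> x * g x * De e x)"
      using eq K'(1) unfolding eventually_at_right_field by (intro exI[of _ \<delta>]) auto
  qed
  from tendsto_unique[OF trivial_limit_at_right_real this lim]
  have "- (LINT x|lebesgue. \<phi> x * Dg x $ i * f x) = (LINT x|lebesgue. gradient \<phi> x $ i * g x * f x) + (LINT x|lebesgue. \<phi> x * g x * Df x $ i)" .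
  moreover have "(LINT x|lebesgue. \<phi> x * (f x *\<^sub>R Dg x + g x *\<^sub>R Df x) $ i) = (LINT x|lebesgue. \<phi> x * Dg x $ i * f x) + (LINT x|lebesgue. \<phi> x * g x * Df x $ i)"
    using L3(3) L2(3) by (subst Bochner_Integration.integral_add[symmetric]) (auto simp: algebra_simps)
  ultimately show "(LINT x|lebesgue. f x * g x * gradient \<phi> x $ i) = - (LINT x|lebesgue. \<phi> x * (f x *\<^sub>R Dg x + g x *\<^sub>R Df x) $ i)"
    by (simp add: algebra_simps)
qed

section \<open>Pointwise gradients are weak gradients\<close>

lemma integral_lborel_translate:
  fixes f :: "real ^ 'n::finite \<Rightarrow> real"
  assumes [measurable]: "f \<in> borel_measurable borel"
  shows "(LINT y|lborel. f (y - x)) = (LINT y|lborel. f y)"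
proof -
  have "(LINT y|lborel. f y) = (LINT y|distr lborel borel (\<lambda>y. y - x). f y)"
    by (simp only: distr_lborel_translate)
  also have "\<dots> = (LINT y|lborel. f (y - x))" by (rule integral_distr) auto
  finally show ?thesis by simp
qed

lemma tendsto_at_seq:
  fixes f :: "real \<Rightarrow> real"
  assumes "(f \<longlongrightarrow> l) (at a)" "t \<longlonglongrightarrow> a" "\<And>n. t n \<noteq> a"
  shows "(\<lambda>n. f (t n)) \<longlonglongrightarrow> l"
proof -
  have "(f \<circ> t) \<longlonglongrightarrow> l"
    using assms unfolding tendsto_at_iff_sequentially by blast
  then show ?thesis by (simp add: comp_def)
qed

lemma cball_subset_support_shift:
  fixes x h :: "'a::euclidean_space"
  shows "x + h \<in> cball 0 R \<Longrightarrow> norm h \<le> 1 \<Longrightarrow> x \<in> cball 0 (R + 1)"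
  using norm_triangle_ineq4[of "x + h" h] by simp

text \<open>The partial derivative is a limit of difference quotients of the zero extension
  \<open>ff\<close>, which agrees with \<open>f\<close> near each point of the open set
  \<open>U\<close>; the indicator discards points where no limit is claimed.\<close>

lemma gradient_borel_measurable:
  fixes f :: "real ^ 'n::finite \<Rightarrow> real"
  assumes U: "open U" and d: "\<And>x. x \<in> U \<Longrightarrow> GDERIV f x :> G x"
  shows "(\<lambda>x. indicator U x * G x $ i) \<in> borel_measurable borel"
proof -
  define ff where "ff x = indicator U x *\<^sub>R f x" for x
  have "continuous_on U f"
    using GDERIV_imp_continuous[OF d] by (simp add: continuous_at_imp_continuous_on)
  then have [measurable]: "ff \<in> borel_measurable borel"
    unfolding ff_def[abs_def] using U by (intro borel_measurable_continuous_on_indicator) auto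
  have [measurable]: "U \<in> sets borel" using U by simp
  define t where "t n = 1 / real (Suc n)" for n
  have t: "t \<longlonglongrightarrow> 0" "\<And>n. t n > 0" unfolding t_def using LIMSEQ_inverse_real_of_nat by (auto simp: inverse_eq_divide)
  define q where "q n x = indicator U x * ((ff (x + t n *\<^sub>R axis i 1) - ff x) / t n)" for n x
  show ?thesis
  proof (rule borel_measurable_LIMSEQ_real)
    show "q n \<in> borel_measurable borel" for n
      unfolding q_def by measurable
    show "(\<lambda>n. q n x) \<longlonglongrightarrow> indicator U x * G x $ i" for x
    proof (cases "x \<in> U")
      case True
      have "GDERIV ff x :> G x"
        by (rule GDERIV_transform_open[OF d[OF True] U True]) (auto simp: ff_def)
      then have der: "(ff has_derivative (\<lambda>h. h \<bullet> G x)) (at x)" by (simp add: gderiv_def)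
      have "((\<lambda>s. ff (x + s *\<^sub>R axis i 1)) has_derivative (\<lambda>s. (s *\<^sub>R axis i 1) \<bullet> G x)) (at 0)"
        by (rule has_derivative_compose[of "\<lambda>s. x + s *\<^sub>R axis i 1" "\<lambda>s. s *\<^sub>R axis i 1" 0 UNIV ff])
          (use der in \<open>auto intro!: derivative_eq_intros\<close>)
      then have "((\<lambda>s. ff (x + s *\<^sub>R axis i 1)) has_real_derivative (G x $ i)) (at 0)"
        by (simp add: has_field_derivative_def mult_commute_abs inner_axis' )
      then have "((\<lambda>s. (ff (x + s *\<^sub>R axis i 1) - ff x) / s) \<longlongrightarrow> G x $ i) (at 0)" by (simp add: DERIV_def)
      then have "(\<lambda>n. (ff (x + t n *\<^sub>R axis i 1) - ff x) / t n) \<longlonglongrightarrow> G x $ i"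
        by (rule tendsto_at_seq[OF _ t(1)]) (use t(2) in \<open>auto simp: less_imp_neq[symmetric] dual_order.strict_implies_not_eq\<close>)
      then show ?thesis using True by (simp add: q_def)
    qed (simp add: q_def)
  qed
qed

text \<open>Difference quotients have integral zero by translation invariance, and the Lipschitz
  bound dominates them on a fixed ball, so the integral of their limit is zero too.\<close>

lemma integral_partial_derivative_eq_0:
  fixes p :: "real ^ 'n::finite \<Rightarrow> real"
  assumes d: "\<And>x. GDERIV p x :> G x" and B: "\<And>x. norm (G x) \<le> B" and R: "\<And>x. norm x > R \<Longrightarrow> p x = 0"
  shows "(LINT x|lborel. G x $ i) = 0"
proof -
  have cp: "continuous_on UNIV p" using GDERIV_imp_continuous[OF d] by (simp add: continuous_at_imp_continuous_on)
  then have [measurable]: "p \<in> borel_measurable borel" by (rule borel_measurable_continuous_onI)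
  have "(\<lambda>x. indicator UNIV x * G x $ i) \<in> borel_measurable borel" by (rule gradient_borel_measurable[of UNIV p]) (auto intro: d)
  then have [measurable]: "(\<lambda>x. G x $ i) \<in> borel_measurable borel" by simp
  have Lip: "\<bar>p x - p y\<bar> \<le> B * norm (x - y)" for x y
    by (rule GDERIV_bounded_Lipschitz[of UNIV p G]) (auto intro: d B)
  have ip: "integrable lborel p"
  proof -
    have "integrable lborel (\<lambda>x. indicator (cball 0 R) x *\<^sub>R p x)"
      by (rule borel_integrable_compact) (auto intro: continuous_on_subset[OF cp])
    moreover have "(\<lambda>x. indicator (cball 0 R) x *\<^sub>R p x) = p" using R by (auto simp: fun_eq_iff indicator_def)
    ultimately show ?thesis by (simp only:)
  qed
  define t where "t n = 1 / real (Suc n)" for n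
  have t: "t \<longlonglongrightarrow> 0" "\<And>n. t n > 0" "\<And>n. t n \<le> 1" unfolding t_def using LIMSEQ_inverse_real_of_nat by (auto simp: inverse_eq_divide)
  define v :: "real ^ 'n" where "v = axis i 1"
  have v: "norm v = 1" by (simp add: v_def)
  define q where "q n x = (p (x + t n *\<^sub>R v) - p x) / t n" for n x
  have [measurable]: "q n \<in> borel_measurable borel" for n unfolding q_def by measurable
  have "(\<lambda>n. LINT x|lborel. q n x) \<longlonglongrightarrow> (LINT x|lborel. G x $ i)"
  \<comment> \<open>The steps are at most 1, hence radius \<open>R + 1\<close> contains the supports
    of all the difference quotients.\<close>
  proof (rule integral_dominated_convergence[where w = "\<lambda>x. indicator (cball 0 (R + 1)) x * B"])
    show "integrable lborel (\<lambda>x :: real ^ 'n. indicator (cball 0 (R + 1)) x * B)"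
      by (intro integrable_mult_left integrable_real_indicator emeasure_lborel_cball_finite) auto
    show "AE x in lborel. (\<lambda>n. q n x) \<longlonglongrightarrow> G x $ i"
    proof (rule AE_I2)
      fix x
      have der: "(p has_derivative (\<lambda>h. h \<bullet> G x)) (at x)" using d by (simp add: gderiv_def)
      have "((\<lambda>s. p (x + s *\<^sub>R v)) has_derivative (\<lambda>s. (s *\<^sub>R v) \<bullet> G x)) (at 0)"
        by (rule has_derivative_compose[of "\<lambda>s. x + s *\<^sub>R v" "\<lambda>s. s *\<^sub>R v" 0 UNIV p])
          (use der in \<open>auto intro!: derivative_eq_intros\<close>)
      then have "((\<lambda>s. p (x + s *\<^sub>R v)) has_real_derivative (G x $ i)) (at 0)"
        by (simp add: has_field_derivative_def mult_commute_abs inner_axis' v_def)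
      then have "((\<lambda>s. (p (x + s *\<^sub>R v) - p x) / s) \<longlongrightarrow> G x $ i) (at 0)" by (simp add: DERIV_def)
      then show "(\<lambda>n. q n x) \<longlonglongrightarrow> G x $ i"
        unfolding q_def by (rule tendsto_at_seq[OF _ t(1)]) (use t(2) in \<open>auto simp: less_imp_neq[symmetric] dual_order.strict_implies_not_eq\<close>)
    qed
    show "AE x in lborel. norm (q n x) \<le> indicator (cball 0 (R + 1)) x * B" for n
    proof (rule AE_I2)
      fix x
      show "norm (q n x) \<le> indicator (cball 0 (R + 1)) x * B"
      proof (cases "x \<in> cball 0 (R + 1)")
        case True
        have "\<bar>p (x + t n *\<^sub>R v) - p x\<bar> \<le> B * t n" using Lip[of "x + t n *\<^sub>R v" x] v t(2)[of n] by simp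
        then show ?thesis using True t(2)[of n] by (simp add: q_def abs_mult pos_divide_le_eq)
      next
        case False
        have n1: "norm (t n *\<^sub>R v) \<le> 1" using v t(2,3)[of n] by simp
        have "x + t n *\<^sub>R v \<notin> cball 0 R" using cball_subset_support_shift[OF _ n1] False by blast
        then have "p (x + t n *\<^sub>R v) = 0" using R by simp
        moreover have "p x = 0" using False R[of x] by simp
        ultimately show ?thesis using False by (simp add: q_def)
      qed
    qed
  qed auto
  moreover have "(LINT x|lborel. q n x) = 0" for n
  proof -
    have "integrable (distr lborel borel (\<lambda>y. y - (- (t n *\<^sub>R v)))) p"
      unfolding distr_lborel_translate by (rule ip)
    then have "integrable lborel (\<lambda>x. p (x - (- (t n *\<^sub>R v))))"
      by (rule integrable_distr[rotated]) measurable
    then have i2: "integrable lborel (\<lambda>x. p (x + t n *\<^sub>R v))" by simp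
    have "(LINT x|lborel. p (x + t n *\<^sub>R v)) = (LINT x|lborel. p x)"
      using integral_lborel_translate[of p "- (t n *\<^sub>R v)"] by simp
    then show ?thesis unfolding q_def using i2 ip by simp
  qed
  ultimately show ?thesis by (simp add: LIMSEQ_const_iff)
qed

lemma GDERIV_bdd_meas_loc:
  fixes f :: "real ^ 'n::finite \<Rightarrow> real"
  assumes U: "open U" and d: "\<And>x. x \<in> U \<Longrightarrow> GDERIV f x :> G x"
    and B: "\<And>K. compact K \<Longrightarrow> K \<subseteq> U \<Longrightarrow> \<exists>B. \<forall>x\<in>K. norm (G x) \<le> B"
  shows "bdd_loc U f" "bdd_loc U (\<lambda>x. G x $ i)"
proof -
  have "continuous_on U f"
    using GDERIV_imp_continuous[OF d] by (simp add: continuous_at_imp_continuous_on)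
  then show "bdd_loc U f" by (rule continuous_bdd_loc[OF U])
  show "bdd_loc U (\<lambda>x. G x $ i)"
    unfolding bdd_loc_def
  proof (intro conjI allI impI)
    show "meas_loc U (\<lambda>x. G x $ i)"
      by (rule meas_loc_I) (use gradient_borel_measurable[OF U d, of i] in \<open>auto intro!: measurable_completion\<close>)
    fix K assume "compact K \<and> K \<subseteq> U"
    then obtain B where "\<forall>x\<in>K. norm (G x) \<le> B" using B by blast
    then show "\<exists>B. AE x in lebesgue. x \<in> K \<longrightarrow> \<bar>G x $ i\<bar> \<le> B"
      using component_le_norm_cart order_trans by (intro exI[of _ B] AE_I2) blast
  qed
qed

text \<open>Integration by parts for the product of \<open>f\<close> with a test function, whose
  partial derivatives integrate to zero. It is meant for powers of \<open>Dbeta\<close>, for which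
  existence and local boundedness of the gradient are what is established.\<close>

lemma GDERIV_weak_gradient:
  fixes f :: "real ^ 'n::finite \<Rightarrow> real"
  assumes U: "open U" and d: "\<And>x. x \<in> U \<Longrightarrow> GDERIV f x :> G x"
    and B: "\<And>K. compact K \<Longrightarrow> K \<subseteq> U \<Longrightarrow> \<exists>B. \<forall>x\<in>K. norm (G x) \<le> B"
  shows "weak_gradient U f G"
proof (rule weak_gradientI)
  note bd = GDERIV_bdd_meas_loc[OF U d B]
  show "f absolutely_integrable_on K" if "compact K" "K \<subseteq> U" for K
    by (rule L2_loc_abs_integrable[OF bdd_loc_L2_loc[OF bd(1)] that])
  show aG: "(\<lambda>x. G x $ i) absolutely_integrable_on K" if "compact K" "K \<subseteq> U" for K i
    by (rule L2_loc_abs_integrable[OF bdd_loc_L2_loc[OF bd(2)] that])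
  fix \<phi> :: "real ^ 'n \<Rightarrow> real" and i assume t: "test_function U \<phi>"
  obtain K where K: "compact K" "K \<subseteq> U" "\<And>x. x \<notin> K \<Longrightarrow> \<phi> x = 0" "\<And>x. x \<notin> K \<Longrightarrow> gradient \<phi> x = 0"
    using test_function_support[OF t] by metis
  have cf: "continuous_on K f"
    using GDERIV_imp_continuous[OF d] K(2) by (intro continuous_at_imp_continuous_on) auto
  obtain B1 where B1: "\<And>x. x \<in> K \<Longrightarrow> norm (G x) \<le> B1" using B[OF K(1,2)] by blast
  obtain B2 where B2: "\<And>x. x \<in> K \<Longrightarrow> \<bar>f x\<bar> \<le> B2"
    using compact_imp_bounded[OF compact_continuous_image[OF cf K(1)]] by (auto simp: bounded_iff)
  obtain B3 where B3: "B3 > 0" "\<And>x. \<bar>\<phi> x\<bar> \<le> B3" "\<And>x. norm (gradient \<phi> x) \<le> B3" using test_function_bounded[OF t] by metis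
  define H where "H x = f x *\<^sub>R gradient \<phi> x + \<phi> x *\<^sub>R G x" for x
  have dp: "GDERIV (\<lambda>x. f x * \<phi> x) x :> H x" for x
  proof (cases "x \<in> U")
    case True
    then show ?thesis unfolding H_def by (intro GDERIV_mult d test_function_GDERIV[OF t])
  next
    case False
    \<comment> \<open>Off \<open>U\<close> nothing is known about \<open>f\<close>, but the product
      with the test function is zero on the whole open complement of \<open>K\<close>.\<close>
    then have xK: "x \<in> - K" using K(2) by auto
    have "GDERIV (\<lambda>x. 0) x :> 0" by (rule GDERIV_const)
    then have "GDERIV (\<lambda>x. f x * \<phi> x) x :> 0"
      by (rule GDERIV_transform_open[OF _ _ xK]) (use K in \<open>auto simp: compact_imp_closed open_Compl\<close>)
    moreover have "H x = 0" using K(3,4) xK by (simp add: H_def)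
    ultimately show ?thesis by simp
  qed
  have HB: "norm (H x) \<le> \<bar>B2\<bar> * B3 + B3 * \<bar>B1\<bar>" for x
  proof (cases "x \<in> K")
    case True
    have "norm (H x) \<le> \<bar>f x\<bar> * norm (gradient \<phi> x) + \<bar>\<phi> x\<bar> * norm (G x)"
      unfolding H_def by (rule norm_triangle_le) simp
    also have "\<dots> \<le> \<bar>B2\<bar> * B3 + B3 * \<bar>B1\<bar>"
      using B1[OF True] B2[OF True] B3 by (intro add_mono mult_mono) auto
    finally show ?thesis .
  next
    case False
    then show ?thesis using K(3,4) B3(1) by (simp add: H_def)
  qed
  obtain R where R: "K \<subseteq> ball 0 R" using bounded_subset_ballD[OF compact_imp_bounded[OF K(1)]] by blast
  have "(LINT x|lborel. H x $ i) = 0"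
    by (rule integral_partial_derivative_eq_0[OF dp HB, of R]) (use R K(3) in force)
  moreover have "(LINT x|lebesgue. H x $ i) = (LINT x|lborel. H x $ i)"
  proof (rule integral_completion)
    have "(\<lambda>x. indicator UNIV x * H x $ i) \<in> borel_measurable borel"
      by (rule gradient_borel_measurable[OF open_UNIV dp])
    then show "(\<lambda>x. H x $ i) \<in> borel_measurable lborel" by simp
  qed
  ultimately have z: "(LINT x|lebesgue. H x $ i) = 0" by simp
  have i1: "integrable lebesgue (\<lambda>x. gradient \<phi> x $ i *\<^sub>R f x)"
    by (rule test_mult_integrable[OF test_function_partial[OF t]]) (rule L2_loc_abs_integrable[OF bdd_loc_L2_loc[OF bd(1)]])
  have i2: "integrable lebesgue (\<lambda>x. \<phi> x *\<^sub>R G x $ i)"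
    by (rule test_mult_integrable[OF t aG])
  have "(LINT x|lebesgue. H x $ i) = (LINT x|lebesgue. f x * gradient \<phi> x $ i) + (LINT x|lebesgue. \<phi> x * G x $ i)"
    using Bochner_Integration.integral_add[OF i1 i2] by (simp add: H_def mult.commute)
  then show "(LINT x|lebesgue. f x * gradient \<phi> x $ i) = - (LINT x|lebesgue. \<phi> x * G x $ i)" using z by simp
qed

lemma W12_loc_I:
  fixes u :: "real ^ 'n::finite \<Rightarrow> real"
  assumes "weak_gradient U u g" "L2_loc U u" "\<And>i. L2_loc U (\<lambda>x. g x $ i)"
  shows "W12_loc U u g"
  unfolding W12_loc_def
proof (intro conjI allI impI assms(1))
  fix K assume K: "compact K \<and> K \<subseteq> U"
  show "(\<lambda>x. \<bar>u x\<bar>\<^sup>2) absolutely_integrable_on K" using assms(2) K by (auto simp: L2_loc_def set_integrable_def)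
  have "integrable lebesgue (\<lambda>x. \<Sum>i\<in>UNIV. indicator K x * (g x $ i)\<^sup>2)"
    using assms(3) K by (intro Bochner_Integration.integrable_sum) (auto simp: L2_loc_def)
  moreover have "(\<Sum>i\<in>UNIV. indicator K x * (g x $ i)\<^sup>2) = indicator K x *\<^sub>R (norm (g x))\<^sup>2" for x
    by (simp add: norm_vec_def L2_set_def sum_nonneg sum_distrib_left)
  ultimately show "(\<lambda>x. (norm (g x))\<^sup>2) absolutely_integrable_on K" by (simp add: set_integrable_def)
qed

lemma GDERIV_W12_loc:
  fixes f :: "real ^ 'n::finite \<Rightarrow> real"
  assumes U: "open U" and d: "\<And>x. x \<in> U \<Longrightarrow> GDERIV f x :> G x"
    and B: "\<And>K. compact K \<Longrightarrow> K \<subseteq> U \<Longrightarrow> \<exists>B. \<forall>x\<in>K. norm (G x) \<le> B"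
  shows "W12_loc U f G"
proof (rule W12_loc_I)
  show "weak_gradient U f G" by (rule GDERIV_weak_gradient[OF U d B])
  show "L2_loc U f" by (rule bdd_loc_L2_loc, rule GDERIV_bdd_meas_loc(1)[OF U d B])
  show "L2_loc U (\<lambda>x. G x $ i)" for i by (rule bdd_loc_L2_loc, rule GDERIV_bdd_meas_loc(2)[OF U d B])
qed

text \<open>Mollified indicators are the source of all cutoffs. Mass one and support in radius
  \<open>e\<close> give the exact values 1 and 0 at points whose \<open>e\<close>-ball lies inside
  or misses \<open>E\<close>.\<close>

lemma mconv_indicator:
  fixes E :: "(real ^ 'n::finite) set"
  assumes E: "E \<in> sets lebesgue" "bounded E" and e: "e > 0"
  defines "f \<equiv> mconv (moll e) (indicator E)"
  shows "Ck_function k f" "0 \<le> f x" "f x \<le> 1"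
    "cball x e \<subseteq> E \<Longrightarrow> f x = 1" "cball x e \<inter> E = {} \<Longrightarrow> f x = 0"
proof -
  have "emeasure lebesgue E < \<infinity>" using fmeasurableD2[OF bounded_set_imp_lmeasurable[OF E(2,1)]] by (simp add: less_top)
  then have i: "integrable lebesgue (indicator E :: real ^ 'n \<Rightarrow> real)" using E by (intro integrable_real_indicator) auto
  show "Ck_function k f" unfolding f_def by (rule mconv_Ck[OF moll_test_function[OF e] i])
  have m: "integrable lebesgue (\<lambda>y. moll e (x - y))" "(LINT y|lebesgue. moll e (x - y)) = 1"
  proof -
    have mb: "(\<lambda>y. moll e (x - y)) \<in> borel_measurable lborel"
      using translated_continuous[OF test_function_continuous[OF moll_test_function[OF e]], of x] by (simp add: borel_measurable_continuous_onI)
    have "has_bochner_integral lborel (\<lambda>y. moll e (x - y)) 1"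
      by (rule has_bochner_integral_nn_integral) (use mb e moll_nn_integral(1)[OF e, of x] in \<open>auto simp: moll_nonneg[OF e]\<close>)
    then show "integrable lebesgue (\<lambda>y. moll e (x - y))" "(LINT y|lebesgue. moll e (x - y)) = 1"
      using integrable_completion[OF mb] integral_completion[OF mb] by (auto simp: has_bochner_integral_iff)
  qed
  have i2: "integrable lebesgue (\<lambda>y. moll e (x - y) * indicator E y)" by (rule mconv_integrable[OF moll_test_function[OF e] i])
  show "0 \<le> f x" unfolding f_def mconv_def by (rule Bochner_Integration.integral_nonneg) (simp add: moll_nonneg[OF e])
  have "f x \<le> (LINT y|lebesgue. moll e (x - y))" unfolding f_def mconv_def
    by (rule integral_mono[OF i2 m(1)]) (simp add: moll_nonneg[OF e] indicator_def)
  then show "f x \<le> 1" using m by simp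
  show "f x = 1" if "cball x e \<subseteq> E"
  proof -
    have "f x = (LINT y|lebesgue. moll e (x - y))" unfolding f_def mconv_def
    proof (rule Bochner_Integration.integral_cong[OF refl])
      fix y show "moll e (x - y) * indicator E y = moll e (x - y)"
        using that moll_outside[OF e, of "x - y"] by (cases "y \<in> cball x e") (auto simp: dist_norm)
    qed
    then show ?thesis using m by simp
  qed
  show "f x = 0" if "cball x e \<inter> E = {}"
    unfolding f_def
  proof (rule mconv_eq_0[of e])
    show "indicator E y = (0::real)" if "dist x y < e" for y
      using \<open>cball x e \<inter> E = {}\<close> that less_imp_le[OF that] by (auto simp: indicator_def disjoint_iff)
  qed (rule moll_outside[OF e])
qed

text \<open>One constant serves all sets and scales: the kernel gradient is at most
  \<open>C / e\<close> divided by the volume of the ball that carries it, and only that ball is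
  integrated over.\<close>

lemma mconv_indicator_gradient:
  "\<exists>C>0. \<forall>e>0. \<forall>E\<in>sets lebesgue. bounded E \<longrightarrow> (\<forall>x :: real ^ 'n::finite. norm (gradient (mconv (moll e) (indicator E)) x) \<le> C / e)"
proof -
  obtain C where C: "C > 0" "\<And>e x. e > 0 \<Longrightarrow> norm (gradient (moll e) (x :: real ^ 'n)) * measure lborel (ball (0 :: real ^ 'n) e) \<le> C / e"
    using moll_gradient_bound by blast
  show ?thesis
  proof (intro exI[of _ C] conjI allI ballI impI C(1))
    fix e :: real and E :: "(real ^ 'n) set" and x :: "real ^ 'n"
    assume e: "e > 0" and E: "E \<in> sets lebesgue" "bounded E"
    have "emeasure lebesgue E < \<infinity>" using fmeasurableD2[OF bounded_set_imp_lmeasurable[OF E(2,1)]] by (simp add: less_top)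
    then have i: "integrable lebesgue (indicator E :: real ^ 'n \<Rightarrow> real)" using E by (intro integrable_real_indicator) auto
    define S where "S = C / e / measure lborel (ball (0 :: real ^ 'n) e)"
    have mpos: "measure lborel (ball (0 :: real ^ 'n) e) > 0" using e by (subst content_ball_gt_0_iff)
    have S: "norm (gradient (moll e) z) \<le> S" for z :: "real ^ 'n"
      unfolding S_def using C(2)[OF e, of z] mpos by (subst pos_le_divide_eq)
    have z: "gradient (moll e) z = 0" if "z \<notin> cball 0 e" for z :: "real ^ 'n"
      by (rule gradient_eq_0_outside[of "cball 0 e"]) (use that moll_outside[OF e, where 'a='n] in auto)
    have "norm (gradient (mconv (moll e) (indicator E)) x) = norm (LINT y|lebesgue. indicator E y *\<^sub>R gradient (moll e) (x - y))"
      by (subst gradient_eqI[OF mconv_gradient_integrable(2)[OF moll_test_function[OF e] i]]) (rule refl)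
    also have "\<dots> \<le> (LINT y|lebesgue. norm (indicator E y *\<^sub>R gradient (moll e) (x - y)))" by (rule integral_norm_bound)
    also have "\<dots> \<le> (LINT y|lebesgue. indicator (cball x e) y * S)"
    proof (rule integral_mono)
      show "integrable lebesgue (\<lambda>y. norm (indicator E y *\<^sub>R gradient (moll e) (x - y)))"
        using mconv_gradient_integrable(1)[OF moll_test_function[OF e] i] by (rule integrable_norm)
      show "integrable lebesgue (\<lambda>y. indicator (cball x e) y * S)"
        by (intro integrable_mult_left compact_integrable_indicator compact_cball)
      have "S \<ge> 0" using S[of 0] norm_ge_zero order_trans by blast
      then show "norm (indicator E y *\<^sub>R gradient (moll e) (x - y)) \<le> indicator (cball x e) y * S" for y
        using S[of "x - y"] z[of "x - y"] by (cases "y \<in> cball x e") (auto simp: dist_norm norm_minus_commute indicator_def)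
    qed
    also have "\<dots> = S * measure lborel (cball x e)" by simp
    also have "measure lborel (cball x e) = measure lborel (ball (0 :: real ^ 'n) e)"
      using e by (subst content_ball, simp, subst content_cball) auto
    also have "S * measure lborel (ball (0 :: real ^ 'n) e) = C / e" using mpos by (simp add: S_def)
    finally show "norm (gradient (mconv (moll e) (indicator E)) x) \<le> C / e" .
  qed
qed

lemma smooth_cutoff:
  fixes K :: "(real ^ 'n::finite) set"
  assumes "compact K" "open U" "K \<subseteq> U"
  obtains \<psi> V where "test_function U \<psi>" "\<And>x. 0 \<le> \<psi> x" "\<And>x. \<psi> x \<le> 1" "open V" "K \<subseteq> V" "\<And>x. x \<in> V \<Longrightarrow> \<psi> x = 1"
proof -
  obtain \<delta> K' where K': "\<delta> > 0" "compact K'" "K \<subseteq> K'" "K' \<subseteq> U" "\<And>x. x \<in> K \<Longrightarrow> cball x \<delta> \<subseteq> K'"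
    using compact_neighbourhood[OF assms] by metis
  obtain \<delta>2 K2 where K2: "\<delta>2 > 0" "compact K2" "K' \<subseteq> K2" "K2 \<subseteq> U" "\<And>x. x \<in> K' \<Longrightarrow> cball x \<delta>2 \<subseteq> K2"
    using compact_neighbourhood[OF K'(2) assms(2) K'(4)] by metis
  \<comment> \<open>Half of \<open>\<delta>\<close> makes the function 1 on a whole neighbourhood of
    \<open>K\<close>, not merely on \<open>K\<close>; the bound by \<open>\<delta>2\<close> keeps
    its support inside \<open>U\<close>.\<close>
  define e where "e = min (\<delta> / 2) \<delta>2"
  have e: "e > 0" "e \<le> \<delta> / 2" "e \<le> \<delta>2" using K' K2 by (auto simp: e_def)
  note mi = mconv_indicator[OF compact_sets_lebesgue[OF K'(2)] compact_imp_bounded[OF K'(2)] e(1)]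
  show ?thesis
  proof (rule that[of "mconv (moll e) (indicator K')" "\<Union>x\<in>K. ball x (\<delta> / 2)"])
    have "mconv (moll e) (indicator K') x = 0" if "x \<notin> K2" for x
    proof (rule mi(5), rule ccontr)
      assume "cball x e \<inter> K' \<noteq> {}"
      then obtain y where "dist x y \<le> e" "y \<in> K'" by auto
      then have "x \<in> cball y \<delta>2" using e by (simp add: dist_commute)
      then show False using K2(5)[OF \<open>y \<in> K'\<close>] that by blast
    qed
    then show "test_function U (mconv (moll e) (indicator K'))"
      unfolding test_function_def using mi(1) K2(2,4) by blast
    show "mconv (moll e) (indicator K') x = 1" if x: "x \<in> (\<Union>x\<in>K. ball x (\<delta> / 2))" for x
    proof (rule mi(4))
      obtain z where z: "z \<in> K" "dist z x < \<delta> / 2" using x by auto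
      have "cball x e \<subseteq> cball z \<delta>"
      proof
        fix y assume "y \<in> cball x e"
        then have "dist x y \<le> \<delta> / 2" using e by simp
        then show "y \<in> cball z \<delta>" using z dist_triangle[of z y x] by simp
      qed
      then show "cball x e \<subseteq> K'" using K'(5)[OF z(1)] by blast
    qed
    show "K \<subseteq> (\<Union>x\<in>K. ball x (\<delta> / 2))" using K'(1) by auto
  qed (auto intro: mi(2,3))
qed

text \<open>A test function on the larger set is multiplied by a cutoff that is 1 near
  \<open>K\<close>. On \<open>K\<close> neither its value nor its gradient changes, and off
  \<open>K\<close> the integrands vanish.\<close>

lemma weak_gradient_extend:
  fixes v :: "real ^ 'n::finite \<Rightarrow> real"
  assumes w: "weak_gradient U v h" and U: "open U" "U \<subseteq> V" and K: "compact K" "K \<subseteq> U"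
    and v0: "\<And>x. x \<notin> K \<Longrightarrow> v x = 0" and h0: "\<And>x. x \<notin> K \<Longrightarrow> h x = 0"
  shows "weak_gradient V v h" "integrable lebesgue v" "integrable lebesgue h"
proof -
  have e1: "(\<lambda>x. indicator K x *\<^sub>R v x) = v" "(\<lambda>x. indicator K x *\<^sub>R h x) = h"
    using v0 h0 by (auto simp: indicator_def fun_eq_iff)
  have "integrable lebesgue (\<lambda>x. indicator K x *\<^sub>R v x)" "integrable lebesgue (\<lambda>x. indicator K x *\<^sub>R h x)"
    using w K by (auto simp: weak_gradient_def set_integrable_def)
  then show iv: "integrable lebesgue v" and ih: "integrable lebesgue h"
    unfolding e1 .
  have ihi: "integrable lebesgue (\<lambda>x. h x $ i)" for i
    by (rule integrable_bounded_linear[OF bounded_linear_vec_nth ih])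
  show "weak_gradient V v h"
  proof (rule weak_gradientI)
    fix K' :: "(real ^ 'n) set" assume K': "compact K'"
    show "v absolutely_integrable_on K'"
      unfolding set_integrable_def
      by (rule integrable_bounded_mult_lebesgue[OF iv indicator_compact_measurable[OF K'], of 1]) (simp add: indicator_def)
    show "(\<lambda>x. h x $ i) absolutely_integrable_on K'" for i
      unfolding set_integrable_def
      by (rule integrable_bounded_mult_lebesgue[OF ihi indicator_compact_measurable[OF K'], of 1]) (simp add: indicator_def)
  next
    fix \<phi> :: "real ^ 'n \<Rightarrow> real" and i assume t: "test_function V \<phi>"
    obtain \<psi> W where \<psi>: "test_function U \<psi>" "open W" "K \<subseteq> W" "\<And>x. x \<in> W \<Longrightarrow> \<psi> x = 1"
      using smooth_cutoff[OF K(1) U(1) K(2)] by metis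
    have t2: "test_function U (\<lambda>x. \<psi> x * \<phi> x)" by (rule test_function_mult_Ck[OF \<psi>(1) test_function_Ck[OF t]])
    have eq: "gradient (\<lambda>x. \<psi> x * \<phi> x) x = gradient \<phi> x" if "x \<in> K" for x
      by (rule gradient_cong_open[OF \<psi>(2)]) (use that \<psi> in auto)
    have "(LINT x|lebesgue. v x * gradient \<phi> x $ i) = (LINT x|lebesgue. v x * gradient (\<lambda>x. \<psi> x * \<phi> x) x $ i)"
    proof (rule Bochner_Integration.integral_cong[OF refl])
      fix x show "v x * gradient \<phi> x $ i = v x * gradient (\<lambda>x. \<psi> x * \<phi> x) x $ i"
        by (cases "x \<in> K") (simp_all add: eq v0)
    qed
    also have "\<dots> = - (LINT x|lebesgue. (\<psi> x * \<phi> x) * h x $ i)" by (rule weak_gradient_test(3)[OF w t2])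
    also have "(LINT x|lebesgue. (\<psi> x * \<phi> x) * h x $ i) = (LINT x|lebesgue. \<phi> x * h x $ i)"
    proof (rule Bochner_Integration.integral_cong[OF refl])
      fix x show "(\<psi> x * \<phi> x) * h x $ i = \<phi> x * h x $ i"
        using h0[of x] \<psi>(3,4) by (cases "x \<in> K") (auto simp: subset_iff)
    qed
    finally show "(LINT x|lebesgue. v x * gradient \<phi> x $ i) = - (LINT x|lebesgue. \<phi> x * h x $ i)" .
  qed
qed

text \<open>Passes from smooth test functions to compactly supported functions with an L2 weak
  gradient. Mollifications of \<open>v\<close> are smooth and admissible, their gradients are
  mollifications of \<open>h\<close>, and the pairing with the flux converges.\<close>

lemma test_gradient_annihilator_extend:
  fixes F :: "real ^ 'n::finite \<Rightarrow> real ^ 'n"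
  assumes U: "open U" and F: "\<And>i. L2_loc U (\<lambda>x. F x $ i)"
    and ann: "\<And>\<phi>. test_function U \<phi> \<Longrightarrow> (LINT x:U|lebesgue. F x \<bullet> gradient \<phi> x) = 0"
    and w: "weak_gradient U v h" and h: "\<And>i. L2_loc U (\<lambda>x. h x $ i)"
    and K: "compact K" "K \<subseteq> U" and v0: "\<And>x. x \<notin> K \<Longrightarrow> v x = 0" and h0: "\<And>x. x \<notin> K \<Longrightarrow> h x = 0"
  shows "(LINT x|lebesgue. F x \<bullet> h x) = 0"
proof -
  obtain \<delta> K' where K': "\<delta> > 0" "compact K'" "K \<subseteq> K'" "K' \<subseteq> U" "\<And>x. x \<in> K \<Longrightarrow> cball x \<delta> \<subseteq> K'"
    using compact_neighbourhood[OF K(1) U K(2)] by metis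
  obtain \<delta>2 K2 where K2: "\<delta>2 > 0" "compact K2" "K' \<subseteq> K2" "K2 \<subseteq> U" "\<And>x. x \<in> K' \<Longrightarrow> cball x \<delta>2 \<subseteq> K2"
    using compact_neighbourhood[OF K'(2) U K'(4)] by metis
  \<comment> \<open>Mollifications of \<open>v\<close> at scales below \<open>\<delta>\<close> live
    in \<open>K'\<close>, so the flux may be cut there; this gives the pairing a compactly supported
    factor.\<close>
  define F' where "F' i x = indicator K' x * F x $ i" for i x
  have bK': "bdd_loc U (indicator K')"
    unfolding bdd_loc_def
  proof (intro conjI allI impI)
    show "meas_loc U (indicator K' :: _ \<Rightarrow> real)"
      unfolding meas_loc_def using K'(2) by (auto intro!: borel_measurable_times indicator_compact_measurable)
  qed (auto intro!: exI[of _ 1] simp: indicator_def)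
  have F'L: "L2_loc U (F' i)" for i unfolding F'_def by (rule L2_loc_bdd_mult[OF bK' F])
  have F'0: "\<forall>x. x \<notin> K' \<longrightarrow> F' i x = 0" for i by (simp add: F'_def)
  note L = L2_loc_mollify_pairing[OF F'L h K'(2,4) F'0 K2(2,4,3)]
  have ext: "indicator K2 y * h y $ i = h y $ i" "indicator K2 y * v y = v y" for y i
  proof -
    have "y \<notin> K2 \<Longrightarrow> y \<notin> K" using K'(3) K2(3) by blast
    then have "y \<notin> K2 \<Longrightarrow> h y = 0" "y \<notin> K2 \<Longrightarrow> v y = 0" using h0[of y] v0[of y] by simp_all
    then show "indicator K2 y * h y $ i = h y $ i" "indicator K2 y * v y = v y" by (cases "y \<in> K2"; simp)+
  qed
  have iv: "integrable lebesgue v" by (rule weak_gradient_extend(2)[OF w U _ K v0 h0]) auto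
  have eq: "(\<Sum>i\<in>UNIV. LINT x|lebesgue. F' i x * mconv (moll e) (\<lambda>y. indicator K2 y * h y $ i) x) = 0"
    if e: "0 < e" "e < min \<delta> \<delta>2" for e
  proof -
    define ve where "ve = mconv (moll e) v"
    have far: "ve x = 0 \<and> mconv (moll e) (\<lambda>y. h y $ i) x = 0" if "x \<notin> K'" for x i
    proof -
      have "y \<notin> K" if "dist x y < e" for y
      proof
        assume "y \<in> K"
        moreover have "x \<in> cball y \<delta>" using that e by (simp add: dist_commute)
        ultimately show False using K'(5) \<open>x \<notin> K'\<close> by blast
      qed
      then show ?thesis unfolding ve_def using moll_outside[OF e(1)] v0 h0
        by (auto intro!: mconv_eq_0[of e])
    qed
    have Cv: "Ck_function k ve" for k unfolding ve_def by (rule mconv_Ck[OF moll_test_function[OF e(1)] iv])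
    have te: "test_function U ve" unfolding test_function_def using Cv far K'(2,4) by blast
    have gr: "indicator K' x * gradient ve x $ i = indicator K' x * mconv (moll e) (\<lambda>y. indicator K2 y * h y $ i) x" for x i
    proof (cases "x \<in> K'")
      case True
      have "cball x e \<subseteq> K2" using K2(5)[OF True] e by force
      from mconv_weak_gradient[OF w K2(2,4) e(1) this, of i] show ?thesis unfolding ve_def ext by simp
    qed simp
    have g0: "gradient ve x = 0" if "x \<notin> K'" for x
      by (rule gradient_eq_0_outside[OF compact_imp_closed[OF K'(2)] _ that]) (use far in blast)
    have "(\<Sum>i\<in>UNIV. LINT x|lebesgue. F' i x * mconv (moll e) (\<lambda>y. indicator K2 y * h y $ i) x)
      = (LINT x|lebesgue. (\<Sum>i\<in>UNIV. F' i x * mconv (moll e) (\<lambda>y. indicator K2 y * h y $ i) x))"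
      by (rule Bochner_Integration.integral_sum[symmetric]) (rule L(2)[OF e(1)])
    also have "\<dots> = (LINT x:U|lebesgue. F x \<bullet> gradient ve x)"
      unfolding set_lebesgue_integral_def
    proof (rule Bochner_Integration.integral_cong[OF refl])
      fix x
      have "(\<Sum>i\<in>UNIV. F' i x * mconv (moll e) (\<lambda>y. indicator K2 y * h y $ i) x) = (\<Sum>i\<in>UNIV. F x $ i * (indicator K' x * gradient ve x $ i))"
        unfolding gr F'_def by (simp add: algebra_simps)
      also have "\<dots> = indicator K' x * (F x \<bullet> gradient ve x)"
        by (simp add: inner_vec_def sum_distrib_left algebra_simps)
      also have "\<dots> = indicator U x *\<^sub>R (F x \<bullet> gradient ve x)"
        using g0[of x] K'(4) by (cases "x \<in> K'") (auto simp: indicator_def)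
      finally show "(\<Sum>i\<in>UNIV. F' i x * mconv (moll e) (\<lambda>y. indicator K2 y * h y $ i) x) = indicator U x *\<^sub>R (F x \<bullet> gradient ve x)" .
    qed
    also have "\<dots> = 0" by (rule ann[OF te])
    finally show ?thesis .
  qed
  have lim: "((\<lambda>e. \<Sum>i\<in>UNIV. LINT x|lebesgue. F' i x * mconv (moll e) (\<lambda>y. indicator K2 y * h y $ i) x)
    \<longlongrightarrow> (\<Sum>i\<in>UNIV. LINT x|lebesgue. F' i x * h x $ i)) (at_right 0)"
    by (intro tendsto_sum L(1))
  have "((\<lambda>e. \<Sum>i\<in>UNIV. LINT x|lebesgue. F' i x * mconv (moll e) (\<lambda>y. indicator K2 y * h y $ i) x) \<longlongrightarrow> 0) (at_right 0)"
    by (rule tendsto_eventually) (use eq K'(1) K2(1) in \<open>auto simp: eventually_at_right_field intro!: exI[of _ "min \<delta> \<delta>2"]\<close>)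
  from tendsto_unique[OF trivial_limit_at_right_real this lim]
  have "0 = (\<Sum>i\<in>UNIV. LINT x|lebesgue. F' i x * h x $ i)" .
  also have "\<dots> = (LINT x|lebesgue. (\<Sum>i\<in>UNIV. F' i x * h x $ i))"
    by (rule Bochner_Integration.integral_sum[symmetric]) (rule L(3))
  also have "\<dots> = (LINT x|lebesgue. F x \<bullet> h x)"
  proof (rule Bochner_Integration.integral_cong[OF refl])
    fix x show "(\<Sum>i\<in>UNIV. F' i x * h x $ i) = F x \<bullet> h x"
    proof (cases "x \<in> K'")
      case False
      then have "x \<notin> K" using K'(3) by blast
      then show ?thesis using False by (simp add: F'_def h0)
    qed (simp add: F'_def inner_vec_def)
  qed
  finally show ?thesis by simp
qed

section \<open>Ahlfors regular sets and the regularized distance\<close>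

lemma dyadic_scale:
  fixes t :: real
  assumes "t \<ge> 1"
  shows "\<exists>k::nat. 2 ^ k \<le> t \<and> t < 2 ^ Suc k"
proof -
  define m where "m = (LEAST m::nat. t < 2 ^ m)"
  have ex: "\<exists>m::nat. t < 2 ^ m" using real_arch_pow[of 2 t] by simp
  have m: "t < 2 ^ m" unfolding m_def by (rule LeastI_ex[OF ex])
  with assms have "m \<noteq> 0" by (intro notI) simp
  then obtain k where k: "m = Suc k" using not0_implies_Suc by blast
  have "\<not> t < 2 ^ k" using not_less_Least[of k "\<lambda>m. t < 2 ^ m"] k unfolding m_def by simp
  then show ?thesis using m k by (intro exI[of _ k]) simp
qed

lemma term_le_suminf: "h k \<le> (\<Sum>i. h i)" for h :: "nat \<Rightarrow> ennreal"
  using sum_le_suminf[of h "{k}"] by simp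

lemma ahlfors_regularD:
  assumes "ahlfors_regular \<Gamma> \<sigma> d C"
  shows "C > 0" "closed \<Gamma>" "sets \<sigma> = sets borel" "emeasure \<sigma> (- \<Gamma>) = 0" "space \<sigma> = UNIV"
    "\<And>x r. x \<in> \<Gamma> \<Longrightarrow> r > 0 \<Longrightarrow> ennreal (inverse C * r powr d) \<le> emeasure \<sigma> (ball x r)"
    "\<And>x r. x \<in> \<Gamma> \<Longrightarrow> r > 0 \<Longrightarrow> emeasure \<sigma> (ball x r) \<le> ennreal (C * r powr d)"
    "\<Gamma> \<in> sets borel" "\<Gamma> \<in> sets \<sigma>"
  using assms sets_eq_imp_space_eq[of \<sigma> borel] by (auto simp: ahlfors_regular_def)

lemma ahlfors_AE:
  assumes "ahlfors_regular \<Gamma> \<sigma> d C"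
  shows "AE y in \<sigma>. y \<in> \<Gamma>"
proof (rule AE_I[where N = "- \<Gamma>"])
  show "{x \<in> space \<sigma>. x \<notin> \<Gamma>} \<subseteq> - \<Gamma>" by auto
  show "emeasure \<sigma> (- \<Gamma>) = 0" "- \<Gamma> \<in> sets \<sigma>" using ahlfors_regularD[OF assms] by auto
qed

text \<open>The centre is arbitrary: a ball either misses \<open>\<Gamma>\<close> and has measure
  zero, or lies in the ball of twice the radius around one of its points of \<open>\<Gamma>\<close>.
  This is where the factor 2 comes from.\<close>

lemma ahlfors_ball_upper:
  assumes A: "ahlfors_regular \<Gamma> \<sigma> d C" and s: "s > 0"
  shows "emeasure \<sigma> (ball X s) \<le> ennreal (C * (2 * s) powr d)"
proof (cases "ball X s \<inter> \<Gamma> = {}")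
  case True
  then have "emeasure \<sigma> (ball X s) \<le> emeasure \<sigma> (- \<Gamma>)"
    using ahlfors_regularD[OF A] by (intro emeasure_mono) auto
  then show ?thesis using ahlfors_regularD(4)[OF A] by simp
next
  case False
  then obtain y where y: "y \<in> \<Gamma>" "dist X y < s" by auto
  have "ball X s \<subseteq> ball y (2 * s)"
  proof
    fix z assume "z \<in> ball X s"
    then show "z \<in> ball y (2 * s)" using y(2) dist_triangle[of y z X] by (simp add: dist_commute)
  qed
  then have "emeasure \<sigma> (ball X s) \<le> emeasure \<sigma> (ball y (2 * s))"
    using ahlfors_regularD(3)[OF A] by (intro emeasure_mono) auto
  also have "\<dots> \<le> ennreal (C * (2 * s) powr d)" using ahlfors_regularD(7)[OF A y(1)] s by simp
  finally show ?thesis .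
qed

lemma ahlfors_sigma_finite:
  assumes A: "ahlfors_regular \<Gamma> \<sigma> d C"
  shows "sigma_finite_measure \<sigma>"
proof
  have fin: "emeasure \<sigma> (ball 0 (real (Suc n))) \<noteq> \<infinity>" for n
    using ahlfors_ball_upper[OF A, of "real (Suc n)" 0] by (auto simp: top_unique)
  have cov: "\<exists>n. norm x < real (Suc n)" for x :: "real ^ 'a"
    using reals_Archimedean2[of "norm x"] by (metis less_trans lessI of_nat_less_iff)
  show "\<exists>B. countable B \<and> B \<subseteq> sets \<sigma> \<and> \<Union> B = space \<sigma> \<and> (\<forall>a\<in>B. emeasure \<sigma> a \<noteq> \<infinity>)"
    by (intro exI[of _ "range (\<lambda>n. ball 0 (real (Suc n)))"])
      (use fin cov ahlfors_regularD(3,5)[OF A] in \<open>auto simp del: of_nat_Suc\<close>)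
qed

lemma infdist_pos:
  fixes \<Gamma> :: "(real ^ 'n::finite) set"
  assumes "closed \<Gamma>" "\<Gamma> \<noteq> {}" "X \<notin> \<Gamma>"
  shows "infdist X \<Gamma> > 0"
  using assms infdist_nonneg[of X \<Gamma>] in_closed_iff_infdist_zero[of \<Gamma> X] by linarith

lemma powr_antimono:
  fixes x y p :: real
  assumes "0 < x" "x \<le> y" "p \<ge> 0"
  shows "y powr (- p) \<le> x powr (- p)"
  using assms by (simp add: powr_minus le_imp_inverse_le powr_mono2)

text \<open>The kernel integral under the outer power in \<open>Dbeta\<close>. Bounds and derivative
  are obtained for it first and transported through the power \<open>- 1 / \<beta>\<close>.\<close>

definition kint :: "(real ^ 'n) set \<Rightarrow> (real ^ 'n) measure \<Rightarrow> real \<Rightarrow> real ^ 'n \<Rightarrow> real" where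
  "kint \<Gamma> \<sigma> p X = (LINT y:\<Gamma>|\<sigma>. norm (X - y) powr (- p))"

lemma Dbeta_kint: "Dbeta \<Gamma> \<sigma> d \<beta> X = kint \<Gamma> \<sigma> (d + \<beta>) X powr (- 1 / \<beta>)"
proof -
  have "- d - \<beta> = - (d + \<beta>)" by simp
  then show ?thesis unfolding Dbeta_def kint_def by (simp only:)
qed

lemma kernel_measurable:
  fixes \<Gamma> :: "(real ^ 'n::finite) set"
  assumes A: "ahlfors_regular \<Gamma> \<sigma> d C"
  shows "(\<lambda>y. indicator \<Gamma> y * norm (X - y) powr p) \<in> borel_measurable \<sigma>"
proof -
  have [measurable]: "\<Gamma> \<in> sets borel" using ahlfors_regularD[OF A] by simp
  have "(\<lambda>y. indicator \<Gamma> y * norm (X - y) powr p) \<in> borel_measurable borel" by measurable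
  then show ?thesis using ahlfors_regularD(3)[OF A] measurable_cong_sets[of \<sigma> borel borel borel] by simp
qed

text \<open>Upper bound: in the annulus where the distance to \<open>X\<close> is about 2^k times
  \<open>\<delta>\<close>, kernel size times measure is a multiple of 2^(-k \<beta>)
  \<delta>^(-\<beta>), and the series is geometric. Lower bound: on the ball of radius
  \<open>\<delta>\<close> around a nearest point of \<open>\<Gamma>\<close> the distance to
  \<open>X\<close> is at most twice \<open>\<delta>\<close>.\<close>

lemma kernel_bounds:
  fixes \<Gamma> :: "(real ^ 'n::finite) set"
  assumes A: "ahlfors_regular \<Gamma> \<sigma> d C" and ne: "\<Gamma> \<noteq> {}" and X: "X \<notin> \<Gamma>" and d: "d > 0" and \<beta>: "\<beta> > 0"
  shows "integrable \<sigma> (\<lambda>y. indicator \<Gamma> y * norm (X - y) powr (- (d + \<beta>)))"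
    and "kint \<Gamma> \<sigma> (d + \<beta>) X \<le> C * 4 powr d / (1 - 2 powr (- \<beta>)) * infdist X \<Gamma> powr (- \<beta>)"
    and "2 powr (- (d + \<beta>)) * inverse C * infdist X \<Gamma> powr (- \<beta>) \<le> kint \<Gamma> \<sigma> (d + \<beta>) X"
proof -
  note AD = ahlfors_regularD[OF A]
  define \<delta> where "\<delta> = infdist X \<Gamma>"
  have \<delta>: "\<delta> > 0" unfolding \<delta>_def by (rule infdist_pos[OF AD(2) ne X])
  define p where "p = d + \<beta>"
  have p: "p > 0" using d \<beta> by (simp add: p_def)
  let ?k = "\<lambda>y. indicator \<Gamma> y * norm (X - y) powr (- p)"
  note km = kernel_measurable[OF A, of X "- p"]
  define q where "q = 2 powr (- \<beta>)"
  have q: "0 < q" "q < 1" using \<beta> powr_less_mono[of "- \<beta>" 0 2] by (auto simp: q_def)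
  \<comment> \<open>The constant \<open>4 powr d\<close> combines the outer radius of the annulus
    with the doubling for balls not centred on \<open>\<Gamma>\<close>.\<close>
  have tm: "ennreal ((2 ^ k * \<delta>) powr (- p)) * emeasure \<sigma> (ball X (2 ^ Suc k * \<delta>)) \<le> ennreal (C * 4 powr d * \<delta> powr (- \<beta>) * q ^ k)" for k
  proof -
    have "ennreal ((2 ^ k * \<delta>) powr (- p)) * emeasure \<sigma> (ball X (2 ^ Suc k * \<delta>))
      \<le> ennreal ((2 ^ k * \<delta>) powr (- p)) * ennreal (C * (2 * (2 ^ Suc k * \<delta>)) powr d)"
      by (intro mult_left_mono ahlfors_ball_upper[OF A]) (use \<delta> in auto)
    also have "\<dots> = ennreal ((2 ^ k * \<delta>) powr (- p) * (C * (2 * (2 ^ Suc k * \<delta>)) powr d))"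
      using AD(1) by (intro ennreal_mult[symmetric]) auto
    also have "(2 ^ k * \<delta>) powr (- p) * (C * (2 * (2 ^ Suc k * \<delta>)) powr d) = C * 4 powr d * \<delta> powr (- \<beta>) * q ^ k"
    proof -
      have "(2 * (2 ^ Suc k * \<delta>)) powr d = 4 powr d * (2 ^ k * \<delta>) powr d"
        using \<delta> by (simp add: powr_mult[symmetric] algebra_simps)
      then have "(2 ^ k * \<delta>) powr (- p) * (C * (2 * (2 ^ Suc k * \<delta>)) powr d) = C * 4 powr d * ((2 ^ k * \<delta>) powr (- p) * (2 ^ k * \<delta>) powr d)"
        by simp
      also have "(2 ^ k * \<delta>) powr (- p) * (2 ^ k * \<delta>) powr d = (2 ^ k * \<delta>) powr (- \<beta>)"
        by (simp add: powr_add[symmetric] p_def)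
      also have "\<dots> = (2 ^ k) powr (- \<beta>) * \<delta> powr (- \<beta>)" using \<delta> by (simp add: powr_mult)
      also have "(2 ^ k) powr (- \<beta>) = q ^ k"
        by (simp add: q_def powr_realpow[symmetric] powr_powr powr_power algebra_simps)
      finally show ?thesis by (simp add: ac_simps)
    qed
    finally show ?thesis .
  qed
  have "(\<integral>\<^sup>+ y. ennreal (?k y) \<partial>\<sigma>) \<le> (\<integral>\<^sup>+ y. (\<Sum>k. ennreal ((2 ^ k * \<delta>) powr (- p)) * indicator (ball X (2 ^ Suc k * \<delta>)) y) \<partial>\<sigma>)"
  proof (rule nn_integral_mono)
    fix y
    show "ennreal (?k y) \<le> (\<Sum>k. ennreal ((2 ^ k * \<delta>) powr (- p)) * indicator (ball X (2 ^ Suc k * \<delta>)) y)"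
    proof (cases "y \<in> \<Gamma>")
      case True
      have "\<delta> \<le> norm (X - y)" unfolding \<delta>_def using infdist_le[OF True, of X] by (simp add: dist_norm)
      then have "norm (X - y) / \<delta> \<ge> 1" using \<delta> by simp
      then obtain k where k: "2 ^ k \<le> norm (X - y) / \<delta>" "norm (X - y) / \<delta> < 2 ^ Suc k" using dyadic_scale by blast
      then have k': "2 ^ k * \<delta> \<le> norm (X - y)" "norm (X - y) < 2 ^ Suc k * \<delta>"
        using \<delta> by (simp_all add: pos_le_divide_eq pos_divide_less_eq)
      have "norm (X - y) powr (- p) \<le> (2 ^ k * \<delta>) powr (- p)"
        using \<delta> p k'(1) by (intro powr_antimono) auto
      then have "ennreal (?k y) \<le> ennreal ((2 ^ k * \<delta>) powr (- p)) * indicator (ball X (2 ^ Suc k * \<delta>)) y"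
        using True k'(2) by (simp add: dist_norm ennreal_leI)
      also have "\<dots> \<le> (\<Sum>i. ennreal ((2 ^ i * \<delta>) powr (- p)) * indicator (ball X (2 ^ Suc i * \<delta>)) y)"
        by (rule term_le_suminf)
      finally show ?thesis .
    qed simp
  qed
  also have "\<dots> = (\<Sum>k. \<integral>\<^sup>+ y. ennreal ((2 ^ k * \<delta>) powr (- p)) * indicator (ball X (2 ^ Suc k * \<delta>)) y \<partial>\<sigma>)"
    by (rule nn_integral_suminf, rule borel_measurable_times_ennreal) (simp_all add: AD(3) borel_measurable_indicator)
  also have "\<dots> = (\<Sum>k. ennreal ((2 ^ k * \<delta>) powr (- p)) * emeasure \<sigma> (ball X (2 ^ Suc k * \<delta>)))"
    by (intro suminf_cong nn_integral_cmult_indicator) (simp add: AD(3))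
  also have "\<dots> \<le> (\<Sum>k. ennreal (C * 4 powr d * \<delta> powr (- \<beta>) * q ^ k))"
    by (rule suminf_le[OF tm]) auto
  also have "\<dots> = ennreal (C * 4 powr d * \<delta> powr (- \<beta>) * (1 / (1 - q)))"
  proof -
    have "(\<lambda>k. C * 4 powr d * \<delta> powr (- \<beta>) * q ^ k) sums (C * 4 powr d * \<delta> powr (- \<beta>) * (1 / (1 - q)))"
      using q by (intro sums_mult geometric_sums) simp
    then show ?thesis
      by (subst suminf_ennreal2) (use q AD(1) in \<open>auto simp: sums_iff\<close>)
  qed
  finally have up: "(\<integral>\<^sup>+ y. ennreal (?k y) \<partial>\<sigma>) \<le> ennreal (C * 4 powr d * \<delta> powr (- \<beta>) * (1 / (1 - q)))" .
  have int: "integrable \<sigma> ?k"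
  proof (rule integrableI_nonneg[OF km])
    show "(\<integral>\<^sup>+ x. ennreal (?k x) \<partial>\<sigma>) < \<infinity>" using le_less_trans[OF up] by simp
  qed simp
  then show "integrable \<sigma> (\<lambda>y. indicator \<Gamma> y * norm (X - y) powr (- (d + \<beta>)))" by (simp add: p_def)
  have eq: "(\<integral>\<^sup>+ y. ennreal (?k y) \<partial>\<sigma>) = ennreal (kint \<Gamma> \<sigma> p X)"
    unfolding kint_def set_lebesgue_integral_def using nn_integral_eq_integral[OF int] by simp
  have c0: "0 \<le> C * 4 powr d * \<delta> powr (- \<beta>) * (1 / (1 - q))" using AD(1) q by simp
  have "kint \<Gamma> \<sigma> p X \<le> C * 4 powr d * \<delta> powr (- \<beta>) * (1 / (1 - q))"
    using up unfolding eq using c0 by (simp add: ennreal_le_iff)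
  then show "kint \<Gamma> \<sigma> (d + \<beta>) X \<le> C * 4 powr d / (1 - 2 powr (- \<beta>)) * infdist X \<Gamma> powr (- \<beta>)"
    by (simp add: p_def q_def \<delta>_def algebra_simps)
  obtain y0 where y0: "y0 \<in> \<Gamma>" "infdist X \<Gamma> = dist X y0" using infdist_attains_inf[OF AD(2) ne] by blast
  have "ennreal (2 powr (- p) * inverse C * \<delta> powr (- \<beta>)) = ennreal ((2 * \<delta>) powr (- p)) * ennreal (inverse C * \<delta> powr d)"
    using AD(1) \<delta> by (subst ennreal_mult[symmetric]) (auto simp: powr_mult p_def powr_add[symmetric] algebra_simps)
  also have "\<dots> \<le> ennreal ((2 * \<delta>) powr (- p)) * emeasure \<sigma> (ball y0 \<delta>)"
    by (intro mult_left_mono AD(6) y0 \<delta>) simp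
  also have "\<dots> = (\<integral>\<^sup>+ y. ennreal ((2 * \<delta>) powr (- p)) * indicator (ball y0 \<delta>) y \<partial>\<sigma>)"
    by (rule nn_integral_cmult_indicator[symmetric]) (simp add: AD(3))
  also have "\<dots> \<le> (\<integral>\<^sup>+ y. ennreal (?k y) \<partial>\<sigma>)"
  proof (rule nn_integral_mono_AE)
    show "AE y in \<sigma>. ennreal ((2 * \<delta>) powr (- p)) * indicator (ball y0 \<delta>) y \<le> ennreal (?k y)"
      using ahlfors_AE[OF A]
    proof eventually_elim
      case (elim y)
      show ?case
      proof (cases "y \<in> ball y0 \<delta>")
        case True
        have "\<delta> \<le> norm (X - y)" unfolding \<delta>_def using infdist_le[OF elim, of X] by (simp add: dist_norm)
        moreover have "norm (X - y) \<le> 2 * \<delta>" using True y0(2) dist_triangle[of X y y0] by (simp add: \<delta>_def dist_norm)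
        ultimately have "(2 * \<delta>) powr (- p) \<le> norm (X - y) powr (- p)" using \<delta> p by (intro powr_antimono) auto
        then show ?thesis using True elim by (simp add: ennreal_leI)
      qed simp
    qed
  qed
  also note eq
  finally have le: "ennreal (2 powr (- p) * inverse C * \<delta> powr (- \<beta>)) \<le> ennreal (kint \<Gamma> \<sigma> p X)" .
  have "kint \<Gamma> \<sigma> p X \<ge> 0" unfolding kint_def set_lebesgue_integral_def by (rule Bochner_Integration.integral_nonneg) simp
  with le show "2 powr (- (d + \<beta>)) * inverse C * infdist X \<Gamma> powr (- \<beta>) \<le> kint \<Gamma> \<sigma> (d + \<beta>) X"
    by (simp add: ennreal_le_iff p_def \<delta>_def)
qed

text \<open>The outer power is negative and reverses inequalities: the upper bound for the kernel
  integral yields this lower constant, and the lower bound yields \<open>Dup\<close>.\<close>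

definition Dlow :: "real \<Rightarrow> real \<Rightarrow> real \<Rightarrow> real" where
  "Dlow C d \<beta> = (C * 4 powr d / (1 - 2 powr (- \<beta>))) powr (- 1 / \<beta>)"

definition Dup :: "real \<Rightarrow> real \<Rightarrow> real \<Rightarrow> real" where
  "Dup C d \<beta> = (2 powr (- (d + \<beta>)) * inverse C) powr (- 1 / \<beta>)"

lemma Dlow_Dup_pos:
  assumes "C > 0" "\<beta> > 0"
  shows "Dlow C d \<beta> > 0" "Dup C d \<beta> > 0"
proof -
  have "2 powr (- \<beta>) < (1::real)" using powr_less_mono[of "- \<beta>" 0 2] assms by simp
  then show "Dlow C d \<beta> > 0" using assms by (simp add: Dlow_def)
  show "Dup C d \<beta> > 0" using assms by (simp add: Dup_def)
qed

lemma Dbeta_bounds: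
  fixes \<Gamma> :: "(real ^ 'n::finite) set"
  assumes A: "ahlfors_regular \<Gamma> \<sigma> d C" and ne: "\<Gamma> \<noteq> {}" and X: "X \<notin> \<Gamma>" and d: "d > 0" and \<beta>: "\<beta> > 0"
  shows "Dlow C d \<beta> * infdist X \<Gamma> \<le> Dbeta \<Gamma> \<sigma> d \<beta> X" "Dbeta \<Gamma> \<sigma> d \<beta> X \<le> Dup C d \<beta> * infdist X \<Gamma>"
    "Dbeta \<Gamma> \<sigma> d \<beta> X > 0" "kint \<Gamma> \<sigma> (d + \<beta>) X > 0"
proof -
  note AD = ahlfors_regularD[OF A]
  have \<delta>: "infdist X \<Gamma> > 0" by (rule infdist_pos[OF AD(2) ne X])
  have q: "2 powr (- \<beta>) < (1::real)" using powr_less_mono[of "- \<beta>" 0 2] \<beta> by simp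
  note kb = kernel_bounds[OF A ne X d \<beta>]
  have lo: "0 < 2 powr (- (d + \<beta>)) * inverse C * infdist X \<Gamma> powr (- \<beta>)" using AD(1) \<delta> by simp
  show kp: "kint \<Gamma> \<sigma> (d + \<beta>) X > 0" using less_le_trans[OF lo kb(3)] .
  then show "Dbeta \<Gamma> \<sigma> d \<beta> X > 0" by (simp add: Dbeta_kint)
  have pw: "(c * infdist X \<Gamma> powr (- \<beta>)) powr (- 1 / \<beta>) = c powr (- 1 / \<beta>) * infdist X \<Gamma>" if "c > 0" for c
    using that \<delta> \<beta> by (simp add: powr_mult powr_powr)
  have "(C * 4 powr d / (1 - 2 powr (- \<beta>)) * infdist X \<Gamma> powr (- \<beta>)) powr (- (1 / \<beta>)) \<le> kint \<Gamma> \<sigma> (d + \<beta>) X powr (- (1 / \<beta>))"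
    by (rule powr_antimono[OF kp kb(2)]) (use \<beta> in simp)
  then show "Dlow C d \<beta> * infdist X \<Gamma> \<le> Dbeta \<Gamma> \<sigma> d \<beta> X"
    using pw[of "C * 4 powr d / (1 - 2 powr (- \<beta>))"] AD(1) q by (simp add: Dbeta_kint Dlow_def)
  have "kint \<Gamma> \<sigma> (d + \<beta>) X powr (- (1 / \<beta>)) \<le> (2 powr (- (d + \<beta>)) * inverse C * infdist X \<Gamma> powr (- \<beta>)) powr (- (1 / \<beta>))"
    by (rule powr_antimono[OF lo kb(3)]) (use \<beta> in simp)
  then show "Dbeta \<Gamma> \<sigma> d \<beta> X \<le> Dup C d \<beta> * infdist X \<Gamma>"
    using pw[of "2 powr (- (d + \<beta>)) * inverse C"] AD(1) by (simp add: Dbeta_kint Dup_def)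
qed

lemma GDERIV_norm_powr:
  fixes y :: "real ^ 'n::finite"
  assumes "w \<noteq> y"
  shows "GDERIV (\<lambda>z. norm (z - y) powr (- p)) w :> (- p * norm (w - y) powr (- p - 1)) *\<^sub>R sgn (w - y)"
proof -
  have "GDERIV (\<lambda>z. norm (1 *\<^sub>R z + (- y))) w :> 1 *\<^sub>R sgn (w - y)"
    by (rule GDERIV_affine) (use GDERIV_norm[of "w - y"] assms in simp)
  then have 1: "GDERIV (\<lambda>z. norm (z - y)) w :> sgn (w - y)" by simp
  have "((\<lambda>t. t powr (- p)) has_real_derivative (- p * norm (w - y) powr (- p - 1))) (at (norm (w - y)))"
    by (rule has_real_derivative_powr) (use assms in simp)
  from GDERIV_DERIV_compose[OF 1 this] show ?thesis .
qed

text \<open>One derivative of the kernel costs a factor p divided by the distance to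
  \<open>y\<close>, which is at least \<open>\<delta>\<close>. Hence the gradient is bounded by a
  multiple of the integral itself, the form that survives taking a power.\<close>

lemma kint_GDERIV:
  fixes \<Gamma> :: "(real ^ 'n::finite) set"
  assumes A: "ahlfors_regular \<Gamma> \<sigma> d C" and ne: "\<Gamma> \<noteq> {}" and X: "X \<notin> \<Gamma>" and d: "d > 0" and \<beta>: "\<beta> > 0"
  shows "\<exists>G. GDERIV (kint \<Gamma> \<sigma> (d + \<beta>)) X :> G \<and> norm G \<le> (d + \<beta>) / infdist X \<Gamma> * kint \<Gamma> \<sigma> (d + \<beta>) X"
proof -
  note AD = ahlfors_regularD[OF A]
  define \<delta> where "\<delta> = infdist X \<Gamma>"
  have \<delta>: "\<delta> > 0" unfolding \<delta>_def by (rule infdist_pos[OF AD(2) ne X])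
  define p where "p = d + \<beta>"
  have p: "p > 0" using d \<beta> by (simp add: p_def)
  define f where "f z y = indicator \<Gamma> y * norm (z - y) powr (- p)" for z y :: "real ^ 'n"
  define G where "G y = (indicator \<Gamma> y * (- p * norm (X - y) powr (- p - 1))) *\<^sub>R sgn (X - y)" for y
  \<comment> \<open>Within radius \<open>\<delta> / 2\<close> of \<open>X\<close> the distance to a
    point of \<open>\<Gamma>\<close> at least halves, which costs \<open>2 powr (p + 1)\<close> in
    the derivative of the kernel.\<close>
  define L where "L y = 2 powr (p + 1) * p / \<delta> * f X y" for y
  have \<delta>y: "\<delta> \<le> norm (X - y)" if "y \<in> \<Gamma>" for y unfolding \<delta>_def using infdist_le[OF that, of X] by (simp add: dist_norm)
  have out: "z \<notin> \<Gamma>" if "z \<in> ball X (\<delta> / 2)" for z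
    using \<delta>y[of z] \<delta> that by (auto simp: dist_norm)
  have int: "integrable \<sigma> (f z)" if "z \<in> ball X (\<delta> / 2)" for z
    unfolding f_def p_def by (rule kernel_bounds(1)[OF A ne out[OF that] d \<beta>])
  have dominating: "norm (w - y) powr (- p - 1) \<le> (norm (X - y) / 2) powr (- p - 1)" if "y \<in> \<Gamma>" "w \<in> ball X (\<delta> / 2)" for w y
  proof -
    have "norm (X - y) \<le> norm (X - w) + norm (w - y)" using norm_triangle_ineq[of "X - w" "w - y"] by simp
    then have "norm (X - y) / 2 \<le> norm (w - y)" using \<delta>y[OF that(1)] that(2) by (simp add: dist_norm)
    then have "norm (w - y) powr (- (p + 1)) \<le> (norm (X - y) / 2) powr (- (p + 1))"
      using \<delta>y[OF that(1)] \<delta> p by (intro powr_antimono) auto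
    moreover have "- (p + 1) = - p - 1" by simp
    ultimately show ?thesis by (simp only:)
  qed
  have shift: "norm (X - y) powr (- p - 1) \<le> norm (X - y) powr (- p) / \<delta>" if "y \<in> \<Gamma>" for y
  proof -
    have n: "norm (X - y) > 0" using \<delta>y[OF that] \<delta> by linarith
    have "norm (X - y) powr (- p - 1) = norm (X - y) powr (- p) / norm (X - y)"
      using n by (simp add: powr_diff)
    also have "\<dots> \<le> norm (X - y) powr (- p) / \<delta>" using \<delta>y[OF that] \<delta> n by (intro divide_left_mono) auto
    finally show ?thesis .
  qed
  have A1: "AE y in \<sigma>. GDERIV (\<lambda>z. f z y) X :> G y"
  proof (rule AE_I2)
    fix y
    show "GDERIV (\<lambda>z. f z y) X :> G y"
    proof (cases "y \<in> \<Gamma>")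
      case True
      then have "X \<noteq> y" using X by auto
      from GDERIV_norm_powr[OF this, of p] True show ?thesis by (simp add: f_def G_def)
    next
      case False
      then show ?thesis using GDERIV_const[of 0 X] by (simp add: f_def G_def)
    qed
  qed
  have A2: "G \<in> borel_measurable \<sigma>"
  proof -
    have [measurable]: "\<Gamma> \<in> sets borel" using AD by simp
    have "(\<lambda>y. sgn (X - y)) \<in> borel_measurable borel"
      unfolding sgn_div_norm by measurable
    then have "G \<in> borel_measurable borel" unfolding G_def by measurable
    then show ?thesis using AD(3) measurable_cong_sets[of \<sigma> borel borel borel] by simp
  qed
  have A3: "integrable \<sigma> L" unfolding L_def using int[of X] \<delta> by simp
  have A4: "AE y in \<sigma>. \<forall>z\<in>ball X (\<delta> / 2). \<bar>f z y - f X y\<bar> \<le> L y * norm (z - X)"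
  proof (intro AE_I2 ballI)
    fix y z assume z: "z \<in> ball X (\<delta> / 2)"
    show "\<bar>f z y - f X y\<bar> \<le> L y * norm (z - X)"
    proof (cases "y \<in> \<Gamma>")
      case True
      have "\<bar>norm (z - y) powr (- p) - norm (X - y) powr (- p)\<bar> \<le> p * (norm (X - y) / 2) powr (- p - 1) * norm (z - X)"
      proof (rule GDERIV_bounded_Lipschitz[OF convex_ball[of X "\<delta> / 2"]])
        fix w assume w: "w \<in> ball X (\<delta> / 2)"
        show "GDERIV (\<lambda>z. norm (z - y) powr (- p)) w :> (- p * norm (w - y) powr (- p - 1)) *\<^sub>R sgn (w - y)"
          by (rule GDERIV_norm_powr) (use out[OF w] True in auto)
        have "norm ((- p * norm (w - y) powr (- p - 1)) *\<^sub>R sgn (w - y)) \<le> p * norm (w - y) powr (- p - 1)"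
          using p by (simp add: abs_mult norm_sgn)
        also have "\<dots> \<le> p * (norm (X - y) / 2) powr (- p - 1)"
          using dominating[OF True w] p by (intro mult_left_mono) auto
        finally show "norm ((- p * norm (w - y) powr (- p - 1)) *\<^sub>R sgn (w - y)) \<le> p * (norm (X - y) / 2) powr (- p - 1)" .
      qed (use z \<delta> in auto)
      also have "(norm (X - y) / 2) powr (- p - 1) = 2 powr (p + 1) * norm (X - y) powr (- p - 1)"
      proof -
        have "2 powr (- p - 1) * 2 powr (p + 1) = (1 :: real)" by (simp add: powr_add[symmetric])
        then show ?thesis by (simp add: powr_divide field_simps)
      qed
      also have "p * (2 powr (p + 1) * norm (X - y) powr (- p - 1)) * norm (z - X) \<le> p * (2 powr (p + 1) * (norm (X - y) powr (- p) / \<delta>)) * norm (z - X)"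
        using shift[OF True] p by (intro mult_right_mono mult_left_mono) auto
      finally show ?thesis using True by (simp add: f_def L_def algebra_simps)
    qed (simp add: f_def L_def)
  qed
  have \<delta>2: "\<delta> / 2 > 0" using \<delta> by simp
  note * = GDERIV_integral[OF \<delta>2 int A1 A2 A3 A4]
  have fk: "(\<lambda>z. LINT y|\<sigma>. f z y) = kint \<Gamma> \<sigma> p" by (simp add: kint_def f_def set_lebesgue_integral_def fun_eq_iff)
  have "norm (LINT y|\<sigma>. G y) \<le> (LINT y|\<sigma>. norm (G y))" by (rule integral_norm_bound)
  also have "\<dots> \<le> (LINT y|\<sigma>. p / \<delta> * f X y)"
  proof (rule integral_mono)
    show "integrable \<sigma> (\<lambda>y. norm (G y))" using *(1) by (rule integrable_norm)
    show "integrable \<sigma> (\<lambda>y. p / \<delta> * f X y)" using int[of X] \<delta> by simp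
    fix y
    show "norm (G y) \<le> p / \<delta> * f X y"
    proof (cases "y \<in> \<Gamma>")
      case True
      have "norm (G y) \<le> p * norm (X - y) powr (- p - 1)" using True p by (simp add: G_def abs_mult norm_sgn)
      also have "\<dots> \<le> p * (norm (X - y) powr (- p) / \<delta>)" using shift[OF True] p by (intro mult_left_mono) auto
      finally show ?thesis using True by (simp add: f_def)
    qed (simp add: f_def G_def)
  qed
  also have "\<dots> = p / \<delta> * kint \<Gamma> \<sigma> p X" using fk by (simp add: fun_eq_iff)
  finally show ?thesis using *(3) unfolding fk p_def \<delta>_def by blast
qed

text \<open>The logarithmic derivative of the kernel integral is at most
  \<open>(d + \<beta>) / \<delta>\<close>; the outer power divides it by \<open>\<beta>\<close>, and
  \<open>Dbeta\<close> is at most \<open>Dup\<close> times \<open>\<delta>\<close>. So the distance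
  cancels and the bound is global.\<close>

lemma Dbeta_GDERIV:
  fixes \<Gamma> :: "(real ^ 'n::finite) set"
  assumes A: "ahlfors_regular \<Gamma> \<sigma> d C" and ne: "\<Gamma> \<noteq> {}" and X: "X \<notin> \<Gamma>" and d: "d > 0" and \<beta>: "\<beta> > 0"
  shows "GDERIV (Dbeta \<Gamma> \<sigma> d \<beta>) X :> gradient (Dbeta \<Gamma> \<sigma> d \<beta>) X"
    "norm (gradient (Dbeta \<Gamma> \<sigma> d \<beta>) X) \<le> (d + \<beta>) / \<beta> * Dup C d \<beta>"
proof -
  note AD = ahlfors_regularD[OF A]
  define \<delta> where "\<delta> = infdist X \<Gamma>"
  have \<delta>: "\<delta> > 0" unfolding \<delta>_def by (rule infdist_pos[OF AD(2) ne X])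
  let ?k = "kint \<Gamma> \<sigma> (d + \<beta>)"
  obtain G where G: "GDERIV ?k X :> G" "norm G \<le> (d + \<beta>) / \<delta> * ?k X"
    using kint_GDERIV[OF assms] unfolding \<delta>_def by blast
  note kp = Dbeta_bounds(4)[OF assms]
  have "((\<lambda>t. t powr (- 1 / \<beta>)) has_real_derivative ((- 1 / \<beta>) * ?k X powr (- 1 / \<beta> - 1))) (at (?k X))"
    by (rule has_real_derivative_powr[OF kp])
  from GDERIV_DERIV_compose[OF G(1) this]
  have *: "GDERIV (Dbeta \<Gamma> \<sigma> d \<beta>) X :> ((- 1 / \<beta>) * ?k X powr (- 1 / \<beta> - 1)) *\<^sub>R G"
    by (simp add: Dbeta_kint[abs_def])
  then show "GDERIV (Dbeta \<Gamma> \<sigma> d \<beta>) X :> gradient (Dbeta \<Gamma> \<sigma> d \<beta>) X" using gradient_eqI by metis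
  have "norm (gradient (Dbeta \<Gamma> \<sigma> d \<beta>) X) = (1 / \<beta>) * ?k X powr (- 1 / \<beta> - 1) * norm G"
    unfolding gradient_eqI[OF *] using \<beta> by (simp add: abs_mult)
  also have "\<dots> \<le> (1 / \<beta>) * ?k X powr (- 1 / \<beta> - 1) * ((d + \<beta>) / \<delta> * ?k X)"
    using \<beta> G(2) by (intro mult_left_mono) auto
  also have "?k X powr (- 1 / \<beta> - 1) = Dbeta \<Gamma> \<sigma> d \<beta> X / ?k X"
    using kp by (simp add: Dbeta_kint powr_diff)
  also have "(1 / \<beta>) * (Dbeta \<Gamma> \<sigma> d \<beta> X / ?k X) * ((d + \<beta>) / \<delta> * ?k X) = (d + \<beta>) / \<beta> * (Dbeta \<Gamma> \<sigma> d \<beta> X / \<delta>)"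
    using kp \<delta> \<beta> by (simp add: field_simps)
  also have "\<dots> \<le> (d + \<beta>) / \<beta> * Dup C d \<beta>"
    using Dbeta_bounds(2)[OF assms] \<delta> d \<beta> by (intro mult_left_mono) (auto simp: pos_divide_le_eq \<delta>_def)
  finally show "norm (gradient (Dbeta \<Gamma> \<sigma> d \<beta>) X) \<le> (d + \<beta>) / \<beta> * Dup C d \<beta>" .
qed

section \<open>Cutoffs near the boundary\<close>

lemma tube_borel: "{X \<in> ball x R. infdist X \<Gamma> < s} \<in> sets borel"
  for x :: "real ^ 'n::finite"
proof -
  have "{X \<in> ball x R. infdist X \<Gamma> < s} = ball x R \<inter> {X. infdist X \<Gamma> < s}" by auto
  moreover have "open (ball x R \<inter> {X. infdist X \<Gamma> < s})"
    by (intro open_Int open_ball open_Collect_less continuous_intros)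
  ultimately show ?thesis by simp
qed

text \<open>Double counting with Tonelli. A point of the tube sees at least
  \<open>inverse C * s powr d\<close> of the measure within distance 2s, while a point of the space
  sees only the volume of a ball of radius 2s. Dividing gives the power n - d of
  \<open>s\<close>.\<close>

lemma tube_volume:
  "\<exists>V>0. \<forall>(\<Gamma> :: (real ^ 'n::finite) set) \<sigma> x R s. ahlfors_regular \<Gamma> \<sigma> d C \<and> x \<in> \<Gamma> \<and> 0 < s \<and> s \<le> 2 * R \<longrightarrow>
     emeasure lborel {X \<in> ball x R. infdist X \<Gamma> < s} \<le> ennreal (V * s powr (real CARD('n) - d) * R powr d)"
proof -
  define \<omega> where "\<omega> = measure lborel (ball (0 :: real ^ 'n) 1)"
  define V where "V = C\<^sup>2 * \<omega> * 2 ^ CARD('n) * 5 powr d + 1"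
  have \<omega>: "\<omega> \<ge> 0" by (simp add: \<omega>_def)
  then have V: "V > 0" by (simp add: V_def add_nonneg_pos)
  show ?thesis
  proof (intro exI[of _ V] conjI V allI impI; elim conjE)
    fix \<Gamma> :: "(real ^ 'n) set" and \<sigma> x and R s :: real
    assume A: "ahlfors_regular \<Gamma> \<sigma> d C" and x: "x \<in> \<Gamma>" and s: "0 < s" "s \<le> 2 * R"
    note AD = ahlfors_regularD[OF A]
    interpret \<sigma>: sigma_finite_measure \<sigma> by (rule ahlfors_sigma_finite[OF A])
    interpret P: pair_sigma_finite lborel \<sigma> ..
    define E where "E = {X \<in> ball x R. infdist X \<Gamma> < s}"
    have E: "E \<in> sets lborel" unfolding E_def using tube_borel by simp
    \<comment> \<open>The radius \<open>2 * s\<close> makes the section at a point of the tube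
      contain the ball of radius \<open>s\<close> around a nearest point of \<open>\<Gamma>\<close>,
      where the lower Ahlfors bound applies.\<close>
    define S where "S = {p :: (real ^ 'n) \<times> (real ^ 'n). dist x (fst p) < R \<and> dist (fst p) (snd p) < 2 * s}"
    have "open S" unfolding S_def by (intro open_Collect_conj open_Collect_less continuous_intros)
    then have "S \<in> sets borel" by simp
    moreover have seq: "sets (lborel \<Otimes>\<^sub>M \<sigma>) = sets (borel :: ((real ^ 'n) \<times> (real ^ 'n)) measure)"
    proof -
      have "sets (lborel \<Otimes>\<^sub>M \<sigma>) = sets ((borel :: (real ^ 'n) measure) \<Otimes>\<^sub>M (borel :: (real ^ 'n) measure))"
        by (rule sets_pair_measure_cong) (simp_all add: AD(3))
      then show ?thesis by (simp only: borel_prod)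
    qed
    ultimately have S: "S \<in> sets (lborel \<Otimes>\<^sub>M \<sigma>)" by simp
    have "ennreal (inverse C * s powr d) * emeasure lborel E = (\<integral>\<^sup>+ X. ennreal (inverse C * s powr d) * indicator E X \<partial>lborel)"
      by (rule nn_integral_cmult_indicator[OF E, symmetric])
    also have "\<dots> \<le> (\<integral>\<^sup>+ X. (\<integral>\<^sup>+ y. indicator S (X, y) \<partial>\<sigma>) \<partial>lborel)"
    proof (rule nn_integral_mono)
      fix X
      show "ennreal (inverse C * s powr d) * indicator E X \<le> (\<integral>\<^sup>+ y. indicator S (X, y) \<partial>\<sigma>)"
      proof (cases "X \<in> E")
        case True
        have ne: "\<Gamma> \<noteq> {}" using x by auto
        obtain y0 where y0: "y0 \<in> \<Gamma>" "infdist X \<Gamma> = dist X y0" using infdist_attains_inf[OF AD(2) ne] by blast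
        have "ennreal (inverse C * s powr d) \<le> emeasure \<sigma> (ball y0 s)" by (rule AD(6)[OF y0(1) s(1)])
        also have "\<dots> = (\<integral>\<^sup>+ y. indicator (ball y0 s) y \<partial>\<sigma>)" using AD(3) by simp
        also have "\<dots> \<le> (\<integral>\<^sup>+ y. indicator S (X, y) \<partial>\<sigma>)"
        proof (rule nn_integral_mono)
          fix y
          have "y \<in> ball y0 s \<Longrightarrow> (X, y) \<in> S"
            using True y0(2) dist_triangle[of X y y0] by (simp add: S_def E_def)
          then show "(indicator (ball y0 s) y :: ennreal) \<le> indicator S (X, y)" by (auto simp: indicator_def)
        qed
        finally show ?thesis using True by simp
      qed simp
    qed
    also have "\<dots> = (\<integral>\<^sup>+ y. (\<integral>\<^sup>+ X. indicator S (X, y) \<partial>lborel) \<partial>\<sigma>)"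
      by (rule P.Fubini'[symmetric]) (use S in simp)
    \<comment> \<open>Since \<open>s \<le> 2 * R\<close>, a \<open>y\<close> paired with a point of
      the ball lies within \<open>R + 2 * s\<close>, hence within \<open>5 * R\<close>, of the
      centre.\<close>
    also have "\<dots> \<le> (\<integral>\<^sup>+ y. ennreal (\<omega> * (2 * s) ^ CARD('n)) * indicator (ball x (5 * R)) y \<partial>\<sigma>)"
    proof (rule nn_integral_mono)
      fix y
      show "(\<integral>\<^sup>+ X. indicator S (X, y) \<partial>lborel) \<le> ennreal (\<omega> * (2 * s) ^ CARD('n)) * indicator (ball x (5 * R)) y"
      proof (cases "y \<in> ball x (5 * R)")
        case True
        have "(\<integral>\<^sup>+ X. indicator S (X, y) \<partial>lborel) \<le> (\<integral>\<^sup>+ X. indicator (ball y (2 * s)) X \<partial>lborel)"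
          by (rule nn_integral_mono) (auto simp: S_def indicator_def dist_commute)
        also have "\<dots> = emeasure lborel (ball y (2 * s))" by simp
        also have "\<dots> = ennreal (measure lborel (ball y (2 * s)))"
          by (rule emeasure_eq_ennreal_measure) (use emeasure_lborel_ball_finite[of y "2 * s"] in auto)
        also have "measure lborel (ball y (2 * s)) = \<omega> * (2 * s) ^ CARD('n)"
          using s by (simp add: content_ball \<omega>_def del: content_ball_eq_0_iff)
        finally show ?thesis using True by simp
      next
        case False
        have "(X, y) \<notin> S" for X
        proof
          assume "(X, y) \<in> S"
          then have "dist x X < R" "dist X y < 2 * s" by (auto simp: S_def)
          then have "dist x y < R + 2 * s" using dist_triangle[of x y X] by simp
          then show False using False s by simp
        qed
        then show ?thesis by simp
      qed
    qed
    also have "\<dots> = ennreal (\<omega> * (2 * s) ^ CARD('n)) * emeasure \<sigma> (ball x (5 * R))"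
      by (rule nn_integral_cmult_indicator) (simp add: AD(3))
    also have "\<dots> \<le> ennreal (\<omega> * (2 * s) ^ CARD('n)) * ennreal (C * (5 * R) powr d)"
      by (intro mult_left_mono AD(7) x) (use s in auto)
    also have "\<dots> = ennreal (\<omega> * (2 * s) ^ CARD('n) * (C * (5 * R) powr d))"
      using AD(1) \<omega> s by (intro ennreal_mult[symmetric]) auto
    finally have main: "ennreal (inverse C * s powr d) * emeasure lborel E \<le> ennreal (\<omega> * (2 * s) ^ CARD('n) * (C * (5 * R) powr d))" .
    have fin: "emeasure lborel E < \<infinity>"
      by (rule le_less_trans[OF emeasure_mono[of E "ball x R"] emeasure_lborel_ball_finite]) (auto simp: E_def)
    then have Em: "emeasure lborel E = ennreal (measure lborel E)" by (intro emeasure_eq_ennreal_measure) auto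
    have "ennreal (inverse C * s powr d * measure lborel E) \<le> ennreal (\<omega> * (2 * s) ^ CARD('n) * (C * (5 * R) powr d))"
      using main AD(1) unfolding Em by (subst ennreal_mult) auto
    then have "inverse C * s powr d * measure lborel E \<le> \<omega> * (2 * s) ^ CARD('n) * (C * (5 * R) powr d)"
      using AD(1) \<omega> s by (subst (asm) ennreal_le_iff) auto
    then have "measure lborel E \<le> C * s powr (- d) * (\<omega> * (2 * s) ^ CARD('n) * (C * (5 * R) powr d))"
      using AD(1) s by (simp add: powr_minus field_simps)
    also have "\<dots> = C\<^sup>2 * \<omega> * 2 ^ CARD('n) * 5 powr d * (s powr (real CARD('n) - d) * R powr d)"
    proof -
      have "(5 * R) powr d = 5 powr d * R powr d" using s by (simp add: powr_mult)
      moreover have "s powr (real CARD('n) - d) = s ^ CARD('n) * s powr (- d)"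
        using s by (simp add: powr_diff powr_minus powr_realpow divide_inverse)
      ultimately show ?thesis by (simp add: power_mult_distrib power2_eq_square)
    qed
    also have "\<dots> \<le> V * (s powr (real CARD('n) - d) * R powr d)"
      unfolding V_def by (intro mult_right_mono) auto
    finally show "emeasure lborel {X \<in> ball x R. infdist X \<Gamma> < s} \<le> ennreal (V * s powr (real CARD('n) - d) * R powr d)"
      unfolding E_def[symmetric] Em by (intro ennreal_leI) (simp add: mult.assoc)
  qed
qed

lemma infdist_ball_center: "x \<in> \<Gamma> \<Longrightarrow> X \<in> ball x R \<Longrightarrow> infdist X \<Gamma> < R"
  using infdist_le[of x \<Gamma> X] by (simp add: dist_commute)

text \<open>The exponent is -a with a = n - 1 - d. A layer at distance about \<rho> contributes
  \<rho>^(-a) times the tube volume \<rho>^(a+1) R^d, that is \<rho> R^d, and the dyadic \<rho> sum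
  to a multiple of R.\<close>

lemma infdist_power_integral:
  assumes d: "0 < d" "d \<le> real CARD('n::finite) - 1"
  shows "\<exists>W>0. \<forall>(\<Gamma> :: (real ^ 'n) set) \<sigma> x R. ahlfors_regular \<Gamma> \<sigma> d C \<and> x \<in> \<Gamma> \<and> 0 < R \<longrightarrow>
     (\<integral>\<^sup>+ X. indicator (ball x R - \<Gamma>) X * ennreal (infdist X \<Gamma> powr (d + 1 - real CARD('n))) \<partial>lborel) \<le> ennreal (W * R powr (d + 1))"
proof -
  obtain V where V: "V > 0" and tube: "\<And>(\<Gamma> :: (real ^ 'n) set) \<sigma> x R s. ahlfors_regular \<Gamma> \<sigma> d C \<Longrightarrow> x \<in> \<Gamma> \<Longrightarrow> 0 < s \<Longrightarrow> s \<le> 2 * R \<Longrightarrow>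
     emeasure lborel {X \<in> ball x R. infdist X \<Gamma> < s} \<le> ennreal (V * s powr (real CARD('n) - d) * R powr d)"
    using tube_volume[where 'n='n, of d C] by blast
  define n where "n = real CARD('n)"
  define a where "a = n - 1 - d"
  have a: "a \<ge> 0" using d by (simp add: a_def n_def)
  define W where "W = V * 2 powr a * 2 powr (a + 1) * 2"
  have W: "W > 0" using V by (simp add: W_def)
  show ?thesis
  proof (intro exI[of _ W] conjI W allI impI; elim conjE)
    fix \<Gamma> :: "(real ^ 'n) set" and \<sigma> x and R :: real
    assume A: "ahlfors_regular \<Gamma> \<sigma> d C" and x: "x \<in> \<Gamma>" and R: "0 < R"
    note AD = ahlfors_regularD[OF A]
    \<comment> \<open>The factor 2 turns the non-strict bound on a dyadic layer into the strict
      inequality of a tube; the width remains at most \<open>2 * R\<close>, as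
      \<open>tube_volume\<close> requires.\<close>
    define E where "E k = {X \<in> ball x R. infdist X \<Gamma> < 2 * (R / 2 ^ k)}" for k :: nat
    have E: "E k \<in> sets lborel" for k unfolding E_def using tube_borel by simp
    define c where "c k = (R / 2 ^ k / 2) powr (- a)" for k :: nat
    have "(\<integral>\<^sup>+ X. indicator (ball x R - \<Gamma>) X * ennreal (infdist X \<Gamma> powr (- a)) \<partial>lborel)
      \<le> (\<integral>\<^sup>+ X. (\<Sum>k. ennreal (c k) * indicator (E k) X) \<partial>lborel)"
    proof (rule nn_integral_mono)
      fix X
      show "indicator (ball x R - \<Gamma>) X * ennreal (infdist X \<Gamma> powr (- a)) \<le> (\<Sum>k. ennreal (c k) * indicator (E k) X)"
      proof (cases "X \<in> ball x R - \<Gamma>")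
        case True
        define t where "t = infdist X \<Gamma>"
        have t: "t > 0" unfolding t_def by (rule infdist_pos[OF AD(2)]) (use True x in auto)
        have "t < R" unfolding t_def by (rule infdist_ball_center[OF x]) (use True in auto)
        then have "R / t \<ge> 1" using t by simp
        then obtain k where k: "2 ^ k \<le> R / t" "R / t < 2 ^ Suc k" using dyadic_scale by blast
        have k1: "t \<le> R / 2 ^ k" using k(1) t by (simp add: field_simps)
        have k2: "R / 2 ^ k / 2 \<le> t" using k(2) t by (simp add: field_simps)
        have "t powr (- a) \<le> c k" unfolding c_def using R a k2 by (intro powr_antimono) auto
        moreover have "X \<in> E k"
        proof -
          have "t < 2 * (R / 2 ^ k)" using k1 t by linarith
          then show ?thesis using True by (simp add: E_def t_def)
        qed
        ultimately have "indicator (ball x R - \<Gamma>) X * ennreal (infdist X \<Gamma> powr (- a)) \<le> ennreal (c k) * indicator (E k) X"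
          using True by (simp add: t_def ennreal_leI)
        also have "\<dots> \<le> (\<Sum>k. ennreal (c k) * indicator (E k) X)" by (rule term_le_suminf)
        finally show ?thesis .
      qed simp
    qed
    also have "\<dots> = (\<Sum>k. \<integral>\<^sup>+ X. ennreal (c k) * indicator (E k) X \<partial>lborel)"
      by (intro nn_integral_suminf borel_measurable_times_ennreal borel_measurable_const borel_measurable_indicator E)
    also have "\<dots> = (\<Sum>k. ennreal (c k) * emeasure lborel (E k))"
      by (intro suminf_cong nn_integral_cmult_indicator E)
    also have "\<dots> \<le> (\<Sum>k. ennreal (V * 2 powr a * 2 powr (a + 1) * R powr (d + 1) * (1 / 2) ^ k))"
    proof (rule suminf_le)
      fix k
      define \<rho> where "\<rho> = R / 2 ^ k"
      have \<rho>: "\<rho> > 0" "2 * \<rho> \<le> 2 * R" using R by (auto simp: \<rho>_def divide_le_eq)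
      have "ennreal (c k) * emeasure lborel (E k) \<le> ennreal (c k) * ennreal (V * (2 * \<rho>) powr (n - d) * R powr d)"
        unfolding E_def n_def \<rho>_def[symmetric] by (intro mult_left_mono tube[OF A x]) (use \<rho> in auto)
      also have "\<dots> = ennreal (c k * (V * (2 * \<rho>) powr (n - d) * R powr d))"
        using V by (intro ennreal_mult[symmetric]) (auto simp: c_def)
      also have "c k * (V * (2 * \<rho>) powr (n - d) * R powr d) = V * 2 powr a * 2 powr (a + 1) * R powr (d + 1) * (1 / 2) ^ k"
      proof -
        have "c k = \<rho> powr (- a) * 2 powr a"
        proof -
          have "c k = \<rho> powr (- a) / 2 powr (- a)"
            unfolding c_def \<rho>_def[symmetric] by (rule powr_divide)
          then show ?thesis by (simp only: powr_minus[of 2 a] divide_inverse inverse_inverse_eq)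
        qed
        moreover have "(2 * \<rho>) powr (n - d) = 2 powr (a + 1) * \<rho> powr (a + 1)"
          using \<rho> by (simp add: powr_mult a_def)
        moreover have "\<rho> powr (- a) * \<rho> powr (a + 1) = \<rho>" using \<rho> by (simp add: powr_add[symmetric])
        ultimately have "c k * (V * (2 * \<rho>) powr (n - d) * R powr d) = V * 2 powr a * 2 powr (a + 1) * (\<rho> * R powr d)"
          by (simp add: algebra_simps)
        also have "\<rho> * R powr d = R powr (d + 1) * (1 / 2) ^ k"
          using R by (simp add: \<rho>_def powr_add power_divide)
        finally show ?thesis by (simp add: mult.assoc)
      qed
      finally show "ennreal (c k) * emeasure lborel (E k) \<le> ennreal (V * 2 powr a * 2 powr (a + 1) * R powr (d + 1) * (1 / 2) ^ k)" .
    qed auto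
    also have "\<dots> = ennreal (W * R powr (d + 1))"
    proof -
      have "(\<lambda>k. V * 2 powr a * 2 powr (a + 1) * R powr (d + 1) * (1 / 2) ^ k) sums (V * 2 powr a * 2 powr (a + 1) * R powr (d + 1) * (1 / (1 - 1 / 2)))"
        by (intro sums_mult geometric_sums) simp
      then show ?thesis
        by (subst suminf_ennreal2) (use V in \<open>auto simp: sums_iff W_def algebra_simps\<close>)
    qed
    finally show "(\<integral>\<^sup>+ X. indicator (ball x R - \<Gamma>) X * ennreal (infdist X \<Gamma> powr (d + 1 - real CARD('n))) \<partial>lborel) \<le> ennreal (W * R powr (d + 1))"
      by (simp add: a_def n_def algebra_simps)
  qed
qed

lemma infdist_shift: "dist X Y \<le> e \<Longrightarrow> infdist X \<Gamma> \<le> infdist Y \<Gamma> + e"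
  using infdist_triangle[of X \<Gamma> Y] by linarith

text \<open>A product of two mollified indicators: of a ball, at scale r/4, and of the set at
  distance at least 2e from \<open>\<Gamma>\<close>, at scale e. The first has gradient of order
  1/r; the second has gradient of order 1/e, seen only in a strip near
  \<open>\<Gamma>\<close>.\<close>

lemma boundary_cutoff:
  "\<exists>M>0. \<forall>(\<Gamma> :: (real ^ 'n::finite) set) x r e. closed \<Gamma> \<and> x \<in> \<Gamma> \<and> 0 < e \<and> 8 * e \<le> r \<longrightarrow>
    (\<exists>\<psi>. test_function (ball x (2 * r) - \<Gamma>) \<psi> \<and> (\<forall>X. 0 \<le> \<psi> X \<and> \<psi> X \<le> 1) \<and>
      (\<forall>X\<in>ball x r. 3 * e \<le> infdist X \<Gamma> \<longrightarrow> \<psi> X = 1) \<and>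
      (\<forall>X. infdist X \<Gamma> < e \<longrightarrow> gradient \<psi> X = 0) \<and>
      (\<forall>X. norm (gradient \<psi> X) \<le> M / r + M / e * (if infdist X \<Gamma> \<le> 3 * e then 1 else 0)))"
proof -
  obtain C where C: "C > 0" and gb: "\<And>e E x. e > 0 \<Longrightarrow> E \<in> sets lebesgue \<Longrightarrow> bounded E \<Longrightarrow>
      norm (gradient (mconv (moll e) (indicator E)) (x :: real ^ 'n)) \<le> C / e"
    using mconv_indicator_gradient[where 'n='n] by blast
  show ?thesis
  proof (intro exI[of _ "4 * C"] conjI allI impI; (elim conjE)?)
    show "4 * C > 0" using C by simp
    fix \<Gamma> :: "(real ^ 'n) set" and x and r e :: real
    assume cl: "closed \<Gamma>" and x: "x \<in> \<Gamma>" and e: "0 < e" "8 * e \<le> r"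
    have r: "r > 0" using e by linarith
    define E1 where "E1 = cball x (3 / 2 * r)"
    \<comment> \<open>The ball only serves to make the set compact. Its edge also produces a
      gradient of \<open>f2\<close>, but there \<open>f1\<close> has already vanished.\<close>
    define E2 where "E2 = cball x (2 * r) \<inter> {X. infdist X \<Gamma> \<ge> 2 * e}"
    have cE1: "compact E1" by (simp add: E1_def)
    have cE2: "compact E2"
      unfolding E2_def by (intro compact_Int_closed compact_cball closed_Collect_le continuous_intros)
    define f1 where "f1 = mconv (moll (r / 4)) (indicator E1)"
    define f2 where "f2 = mconv (moll e) (indicator E2)"
    have r4: "r / 4 > 0" using r by simp
    note m1 = mconv_indicator[OF compact_sets_lebesgue[OF cE1] compact_imp_bounded[OF cE1] r4, folded f1_def]
    note m2 = mconv_indicator[OF compact_sets_lebesgue[OF cE2] compact_imp_bounded[OF cE2] e(1), folded f2_def]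
    have g1: "norm (gradient f1 X) \<le> 4 * C / r" for X
      using gb[OF r4 compact_sets_lebesgue[OF cE1] compact_imp_bounded[OF cE1], of X] by (simp add: f1_def field_simps)
    have g2: "norm (gradient f2 X) \<le> C / e" for X
      using gb[OF e(1) compact_sets_lebesgue[OF cE2] compact_imp_bounded[OF cE2], of X] by (simp add: f2_def)
    have f1_1: "f1 X = 1" if "dist x X \<le> 5 / 4 * r" for X
    proof (rule m1(4), rule subsetI)
      fix y assume "y \<in> cball X (r / 4)"
      then show "y \<in> E1" using that dist_triangle[of x y X] by (simp add: E1_def)
    qed
    have f1_0: "f1 X = 0" if "dist x X > 7 / 4 * r" for X
    proof (rule m1(5), rule ccontr)
      assume "cball X (r / 4) \<inter> E1 \<noteq> {}"
      then obtain y where "dist X y \<le> r / 4" "dist x y \<le> 3 / 2 * r" by (auto simp: E1_def)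
      then show False using that dist_triangle[of x X y] by (simp add: dist_commute)
    qed
    \<comment> \<open>Because \<open>e\<close> is at most r/8, the averaging ball around such a
      point stays within radius 2r and within distance at least 2e of
      \<open>\<Gamma>\<close>.\<close>
    have f2_1: "f2 X = 1" if "dist x X < 15 / 8 * r" "3 * e \<le> infdist X \<Gamma>" for X
    proof (rule m2(4), rule subsetI)
      fix y assume y: "y \<in> cball X e"
      then have "dist x y \<le> 2 * r" using that(1) e dist_triangle[of x y X] by simp
      moreover have "infdist y \<Gamma> \<ge> 2 * e" using infdist_shift[of X y e \<Gamma>] y that(2) by simp
      ultimately show "y \<in> E2" by (simp add: E2_def)
    qed
    have f2_0: "f2 X = 0" if "infdist X \<Gamma> < e" for X
    proof (rule m2(5), rule ccontr)
      assume "cball X e \<inter> E2 \<noteq> {}"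
      then obtain y where "dist X y \<le> e" "2 * e \<le> infdist y \<Gamma>" by (auto simp: E2_def)
      then show False using that infdist_shift[of y X e \<Gamma>] by (simp add: dist_commute)
    qed
    define \<psi> where "\<psi> X = f1 X * f2 X" for X
    have C\<psi>: "Ck_function k \<psi>" for k unfolding \<psi>_def[abs_def] by (intro Ck_mult m1(1) m2(1))
    have gr: "gradient \<psi> X = f1 X *\<^sub>R gradient f2 X + f2 X *\<^sub>R gradient f1 X" for X
      unfolding \<psi>_def[abs_def]
      by (intro gradient_eqI GDERIV_mult Ck_Suc_GDERIV[OF m1(1)[of "Suc 0"]] Ck_Suc_GDERIV[OF m2(1)[of "Suc 0"]])
    show "\<exists>\<psi>. test_function (ball x (2 * r) - \<Gamma>) \<psi> \<and> (\<forall>X. 0 \<le> \<psi> X \<and> \<psi> X \<le> 1) \<and>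
      (\<forall>X\<in>ball x r. 3 * e \<le> infdist X \<Gamma> \<longrightarrow> \<psi> X = 1) \<and>
      (\<forall>X. infdist X \<Gamma> < e \<longrightarrow> gradient \<psi> X = 0) \<and>
      (\<forall>X. norm (gradient \<psi> X) \<le> 4 * C / r + 4 * C / e * (if infdist X \<Gamma> \<le> 3 * e then 1 else 0))"
    proof (intro exI[of _ \<psi>] conjI allI ballI impI)
      show "test_function (ball x (2 * r) - \<Gamma>) \<psi>"
        unfolding test_function_def
      proof (intro conjI allI exI[of _ "cball x (7 / 4 * r) \<inter> {X. infdist X \<Gamma> \<ge> e}"] impI C\<psi>)
        show "compact (cball x (7 / 4 * r) \<inter> {X. infdist X \<Gamma> \<ge> e})"
          by (intro compact_Int_closed compact_cball closed_Collect_le continuous_intros)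
        show "cball x (7 / 4 * r) \<inter> {X. infdist X \<Gamma> \<ge> e} \<subseteq> ball x (2 * r) - \<Gamma>"
          using r e by auto
        show "\<psi> X = 0" if "X \<notin> cball x (7 / 4 * r) \<inter> {X. infdist X \<Gamma> \<ge> e}" for X
          using that f1_0[of X] f2_0[of X] by (auto simp: \<psi>_def)
      qed
      show "0 \<le> \<psi> X" for X unfolding \<psi>_def using m1(2) m2(2) by simp
      show "\<psi> X \<le> 1" for X unfolding \<psi>_def using m1(2,3)[of X] m2(2,3)[of X] by (intro mult_le_one)
      show "\<psi> X = 1" if "X \<in> ball x r" "3 * e \<le> infdist X \<Gamma>" for X
        unfolding \<psi>_def using that r by (subst f1_1, simp, subst f2_1) auto
      show "gradient \<psi> X = 0" if "infdist X \<Gamma> < e" for X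
      proof (rule gradient_eq_0_outside[of "{X. e \<le> infdist X \<Gamma>}"])
        show "closed {X. e \<le> infdist X \<Gamma>}" by (intro closed_Collect_le continuous_intros)
      qed (use that f2_0 in \<open>auto simp: \<psi>_def\<close>)
      fix X
      have "norm (gradient \<psi> X) \<le> norm (f1 X *\<^sub>R gradient f2 X) + norm (f2 X *\<^sub>R gradient f1 X)"
        unfolding gr by (rule norm_triangle_ineq)
      also have "norm (f2 X *\<^sub>R gradient f1 X) \<le> 1 * (4 * C / r)"
        unfolding norm_scaleR using m2(2,3)[of X] g1[of X] C r by (intro mult_mono) auto
      also have "norm (f1 X *\<^sub>R gradient f2 X) \<le> 4 * C / e * (if infdist X \<Gamma> \<le> 3 * e then 1 else 0)"
      proof (cases "infdist X \<Gamma> \<le> 3 * e \<or> dist x X > 7 / 4 * r")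
        case True
        have "norm (f1 X *\<^sub>R gradient f2 X) \<le> 1 * (C / e)"
          unfolding norm_scaleR using m1(2,3)[of X] g2[of X] C e by (intro mult_mono) auto
        also have "\<dots> \<le> 4 * C / e" using C e by (simp add: divide_right_mono)
        finally show ?thesis using True f1_0[of X] by auto
      next
        \<comment> \<open>Here \<open>f2\<close> is 1 on an open neighbourhood: 7/4 lies below 15/8
          and the distance exceeds \<open>3 * e\<close>. So its gradient vanishes.\<close>
        case False
        have "gradient f2 X = gradient (\<lambda>_. 1) X"
        proof (rule gradient_cong_open[of "ball x (15 / 8 * r) \<inter> {X. 3 * e < infdist X \<Gamma>}"])
          show "open (ball x (15 / 8 * r) \<inter> {X. 3 * e < infdist X \<Gamma>})"
            by (intro open_Int open_ball open_Collect_less continuous_intros)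
        qed (use False r f2_1 in auto)
        also have "\<dots> = 0" using gradient_eqI[OF GDERIV_const] by metis
        finally show ?thesis using False by simp
      qed
      finally show "norm (gradient \<psi> X) \<le> 4 * C / r + 4 * C / e * (if infdist X \<Gamma> \<le> 3 * e then 1 else 0)" by simp
    qed
  qed
qed

text \<open>The 1/r part makes \<open>D\<close> times the gradient of order dist/r, and its weighted
  integral is of order r^d by \<open>infdist_power_integral\<close>. The 1/e part is bounded on a
  strip of volume of order e^(n-d) r^d, which the weight e^(d-n) compensates exactly. So the bound
  is free of \<open>e\<close>.\<close>

lemma cutoff_energy:
  assumes d: "0 < d" "d \<le> real CARD('n::finite) - 1" and \<beta>: "\<beta> > 0"
  shows "\<exists>Z>0. \<forall>(\<Gamma> :: (real ^ 'n) set) \<sigma> x r e. ahlfors_regular \<Gamma> \<sigma> d C \<and> x \<in> \<Gamma> \<and> 0 < e \<and> 8 * e \<le> r \<longrightarrow>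
    (\<exists>\<psi>. test_function (ball x (2 * r) - \<Gamma>) \<psi> \<and> (\<forall>X. 0 \<le> \<psi> X \<and> \<psi> X \<le> 1) \<and>
      (\<forall>X\<in>ball x r. 3 * e \<le> infdist X \<Gamma> \<longrightarrow> \<psi> X = 1) \<and>
      (\<integral>\<^sup>+ X. indicator (ball x (2 * r) - \<Gamma>) X * ennreal (Dbeta \<Gamma> \<sigma> d \<beta> X powr (d - real CARD('n)) *
          ((Dbeta \<Gamma> \<sigma> d \<beta> X * norm (gradient \<psi> X))\<^sup>2 + Dbeta \<Gamma> \<sigma> d \<beta> X * norm (gradient \<psi> X))) \<partial>lebesgue)
        \<le> ennreal (Z * r powr d))"
proof -
  obtain M where M: "M > 0" and cut: "\<forall>(\<Gamma> :: (real ^ 'n) set) x r e. closed \<Gamma> \<and> x \<in> \<Gamma> \<and> 0 < e \<and> 8 * e \<le> r \<longrightarrow>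
    (\<exists>\<psi>. test_function (ball x (2 * r) - \<Gamma>) \<psi> \<and> (\<forall>X. 0 \<le> \<psi> X \<and> \<psi> X \<le> 1) \<and>
      (\<forall>X\<in>ball x r. 3 * e \<le> infdist X \<Gamma> \<longrightarrow> \<psi> X = 1) \<and>
      (\<forall>X. infdist X \<Gamma> < e \<longrightarrow> gradient \<psi> X = 0) \<and>
      (\<forall>X. norm (gradient \<psi> X) \<le> M / r + M / e * (if infdist X \<Gamma> \<le> 3 * e then 1 else 0)))"
    using boundary_cutoff[where 'n='n] by (elim exE conjE) (rule that)
  obtain V where V: "V > 0" and tube: "\<And>(\<Gamma> :: (real ^ 'n) set) \<sigma> x R s. ahlfors_regular \<Gamma> \<sigma> d C \<Longrightarrow> x \<in> \<Gamma> \<Longrightarrow> 0 < s \<Longrightarrow> s \<le> 2 * R \<Longrightarrow>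
     emeasure lborel {X \<in> ball x R. infdist X \<Gamma> < s} \<le> ennreal (V * s powr (real CARD('n) - d) * R powr d)"
    using tube_volume[where 'n='n, of d C] by blast
  obtain W where W: "W > 0" and ip: "\<And>(\<Gamma> :: (real ^ 'n) set) \<sigma> x R. ahlfors_regular \<Gamma> \<sigma> d C \<Longrightarrow> x \<in> \<Gamma> \<Longrightarrow> 0 < R \<Longrightarrow>
     (\<integral>\<^sup>+ X. indicator (ball x R - \<Gamma>) X * ennreal (infdist X \<Gamma> powr (d + 1 - real CARD('n))) \<partial>lborel) \<le> ennreal (W * R powr (d + 1))"
    using infdist_power_integral[OF d, of C] by blast
  define n where "n = real CARD('n)"
  define b where "b = \<bar>Dup C d \<beta>\<bar>"
  define a where "a = Dlow C d \<beta>"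
  define Q where "Q = a powr (d - n) * (4 * b\<^sup>2 * M\<^sup>2 + 18 * b\<^sup>2 * M\<^sup>2 + 3 * b * M)"
  have Q0: "Q \<ge> 0" unfolding Q_def using M by (auto simp: b_def)
  \<comment> \<open>\<open>Q\<close> collects the pointwise constants; adding 1 secures positivity
    before any hypothesis on \<open>C\<close> is available.\<close>
  define Z where "Z = (Q + 1) * (W * 2 powr (d + 1) + V * 4 powr (n - d) * 2 powr d)"
  have Z: "Z > 0" unfolding Z_def using Q0 W V by (intro mult_pos_pos add_pos_pos add_nonneg_pos) auto
  show ?thesis
  proof (intro exI[of _ Z] conjI Z allI impI; elim conjE)
    fix \<Gamma> :: "(real ^ 'n) set" and \<sigma> x and r e :: real
    assume A: "ahlfors_regular \<Gamma> \<sigma> d C" and x: "x \<in> \<Gamma>" and e: "0 < e" "8 * e \<le> r"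
    note AD = ahlfors_regularD[OF A]
    have r: "r > 0" using e by linarith
    have ne: "\<Gamma> \<noteq> {}" using x by auto
    have a: "a > 0" and b: "b > 0" "b = Dup C d \<beta>" using Dlow_Dup_pos[OF AD(1) \<beta>, of d] by (auto simp: a_def b_def)
    obtain \<psi> where \<psi>: "test_function (ball x (2 * r) - \<Gamma>) \<psi>" "\<And>X. 0 \<le> \<psi> X \<and> \<psi> X \<le> 1"
      "\<And>X. X \<in> ball x r \<Longrightarrow> 3 * e \<le> infdist X \<Gamma> \<Longrightarrow> \<psi> X = 1"
      "\<And>X. infdist X \<Gamma> < e \<Longrightarrow> gradient \<psi> X = 0"
      "\<And>X. norm (gradient \<psi> X) \<le> M / r + M / e * (if infdist X \<Gamma> \<le> 3 * e then 1 else 0)"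
      using cut[rule_format, OF conjI[OF AD(2) conjI[OF x conjI[OF e]]]] by (elim exE conjE) (rule that, blast+)
    let ?D = "Dbeta \<Gamma> \<sigma> d \<beta>"
    \<comment> \<open>Width \<open>4 * e\<close> rather than \<open>3 * e\<close>, because the tube
      is defined by a strict inequality and the strip is closed.\<close>
    define E where "E = {X \<in> ball x (2 * r). infdist X \<Gamma> < 4 * e}"
    have E: "E \<in> sets lborel" unfolding E_def using tube_borel by simp
    have Om: "ball x (2 * r) - \<Gamma> \<in> sets lborel" using AD(8) by auto
    have pw: "indicator (ball x (2 * r) - \<Gamma>) X * ennreal (?D X powr (d - n) * ((?D X * norm (gradient \<psi> X))\<^sup>2 + ?D X * norm (gradient \<psi> X)))
      \<le> ennreal (Q / r) * (indicator (ball x (2 * r) - \<Gamma>) X * ennreal (infdist X \<Gamma> powr (d + 1 - n))) + ennreal (Q * e powr (d - n)) * indicator E X" for X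
    proof (cases "X \<in> ball x (2 * r) - \<Gamma> \<and> e \<le> infdist X \<Gamma>")
      case True
      define t where "t = infdist X \<Gamma>"
      define j where "j = (if t \<le> 3 * e then 1 else 0 :: real)"
      have t: "t > 0" "e \<le> t" using True e by (auto simp: t_def)
      have t2: "t < 2 * r" unfolding t_def by (rule infdist_ball_center[OF x]) (use True in auto)
      have Xn: "X \<notin> \<Gamma>" using True by simp
      note DB = Dbeta_bounds[OF A ne Xn d(1) \<beta>, folded a_def b(2) t_def]
      have Dn: "?D X powr (d - n) \<le> a powr (d - n) * t powr (d - n)"
      proof -
        have "?D X powr (- (n - d)) \<le> (a * t) powr (- (n - d))"
          using DB a t d by (intro powr_antimono) (auto simp: n_def)
        then show ?thesis using a t by (simp add: powr_mult)
      qed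
      define y where "y = ?D X * norm (gradient \<psi> X)"
      have y0: "y \<ge> 0" using DB by (simp add: y_def)
      have "y \<le> (b * t) * (M / r + M / e * j)"
        unfolding y_def using DB \<psi>(5)[of X] b t by (intro mult_mono) (auto simp: t_def j_def)
      also have "\<dots> \<le> b * M * (t / r) + 3 * b * M * j"
      proof -
        have "t * j \<le> 3 * e * j" by (auto simp: j_def)
        then have "b * M / e * (t * j) \<le> b * M / e * (3 * e * j)" using b M e by (intro mult_left_mono) auto
        moreover have "b * M / e * (3 * e * j) = 3 * b * M * j" using e by simp
        moreover have "(b * t) * (M / r + M / e * j) = b * M * (t / r) + b * M / e * (t * j)"
          by (simp add: distrib_left mult_ac)
        ultimately show ?thesis by linarith
      qed
      finally have y1: "y \<le> b * M * (t / r) + 3 * b * M * j" .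
      have tr: "0 \<le> t / r" "t / r \<le> 2" using t t2 r by (auto simp: divide_le_eq)
      have "y\<^sup>2 \<le> (b * M * (t / r) + 3 * b * M * j)\<^sup>2" using y0 y1 by (intro power_mono)
      also have "\<dots> \<le> 2 * (b * M * (t / r))\<^sup>2 + 2 * (3 * b * M * j)\<^sup>2"
        using sum_squares_bound[of "b * M * (t / r)" "3 * b * M * j"] by (simp add: power2_sum)
      also have "\<dots> = 2 * b\<^sup>2 * M\<^sup>2 * (t / r)\<^sup>2 + 18 * b\<^sup>2 * M\<^sup>2 * j"
      proof -
        have "j\<^sup>2 = j" by (simp add: j_def)
        then show ?thesis by (simp only: power_mult_distrib) simp
      qed
      also have "\<dots> \<le> 2 * b\<^sup>2 * M\<^sup>2 * (2 * (t / r)) + 18 * b\<^sup>2 * M\<^sup>2 * j"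
      proof -
        \<comment> \<open>Since \<open>t / r\<close> is at most 2, its square is at most linear, so
          one integral controls both powers of the gradient.\<close>
        have "(t / r)\<^sup>2 \<le> 2 * (t / r)" unfolding power2_eq_square by (rule mult_right_mono) (use tr in auto)
        then show ?thesis by (intro add_mono mult_left_mono) auto
      qed
      finally have "y\<^sup>2 + y \<le> 4 * b\<^sup>2 * M\<^sup>2 * (t / r) + 18 * b\<^sup>2 * M\<^sup>2 * j + b * M * (t / r) + 3 * b * M * j"
        using y1 by (simp add: algebra_simps)
      also have "\<dots> \<le> (4 * b\<^sup>2 * M\<^sup>2 + 18 * b\<^sup>2 * M\<^sup>2 + 3 * b * M) * (t / r + j)"
      proof -
        have "0 \<le> b\<^sup>2 * M\<^sup>2 * (t / r)" "0 \<le> b * M * (t / r)" "0 \<le> b\<^sup>2 * M\<^sup>2 * j" "0 \<le> b * M * j"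
          by (intro mult_nonneg_nonneg zero_le_power2 tr(1) less_imp_le[OF b(1)] less_imp_le[OF M]; simp add: j_def)+
        moreover have "(4 * b\<^sup>2 * M\<^sup>2 + 18 * b\<^sup>2 * M\<^sup>2 + 3 * b * M) * (t / r + j)
          = 22 * (b\<^sup>2 * M\<^sup>2 * (t / r)) + 3 * (b * M * (t / r)) + 22 * (b\<^sup>2 * M\<^sup>2 * j) + 3 * (b * M * j)"
          by (simp add: algebra_simps)
        moreover have "4 * b\<^sup>2 * M\<^sup>2 * (t / r) = 4 * (b\<^sup>2 * M\<^sup>2 * (t / r))" "18 * b\<^sup>2 * M\<^sup>2 * j = 18 * (b\<^sup>2 * M\<^sup>2 * j)"
          "3 * b * M * j = 3 * (b * M * j)" by simp_all
        ultimately show ?thesis by linarith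
      qed
      finally have y2: "y\<^sup>2 + y \<le> (4 * b\<^sup>2 * M\<^sup>2 + 18 * b\<^sup>2 * M\<^sup>2 + 3 * b * M) * (t / r + j)" .
      have "?D X powr (d - n) * (y\<^sup>2 + y) \<le> a powr (d - n) * t powr (d - n) * ((4 * b\<^sup>2 * M\<^sup>2 + 18 * b\<^sup>2 * M\<^sup>2 + 3 * b * M) * (t / r + j))"
        using Dn y2 y0 by (intro mult_mono) auto
      also have "\<dots> = Q * (t powr (d - n) * (t / r)) + Q * (t powr (d - n) * j)"
        by (simp add: Q_def algebra_simps)
      also have "t powr (d - n) * (t / r) = t powr (d + 1 - n) / r"
      proof -
        have "t powr (d + 1 - n) = t powr ((d - n) + 1)" by (simp add: algebra_simps)
        also have "\<dots> = t powr (d - n) * t" using t by (simp only: powr_add) simp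
        finally show ?thesis by simp
      qed
      also have "Q * (t powr (d - n) * j) \<le> Q * (e powr (d - n) * j)"
      proof -
        have "t powr (- (n - d)) \<le> e powr (- (n - d))" using t e d by (intro powr_antimono) (auto simp: n_def)
        then show ?thesis using Q0 by (intro mult_left_mono mult_right_mono) (auto simp: j_def)
      qed
      finally have fin: "?D X powr (d - n) * (y\<^sup>2 + y) \<le> Q / r * t powr (d + 1 - n) + Q * e powr (d - n) * j" by simp
      have jE: "ennreal (Q * e powr (d - n) * j) \<le> ennreal (Q * e powr (d - n)) * indicator E X"
        using True e by (auto simp: j_def E_def t_def indicator_def)
      have "ennreal (?D X powr (d - n) * (y\<^sup>2 + y)) \<le> ennreal (Q / r * t powr (d + 1 - n)) + ennreal (Q * e powr (d - n) * j)"
      proof -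
        have "0 \<le> Q / r * t powr (d + 1 - n)" "0 \<le> Q * e powr (d - n) * j" using Q0 r by (auto simp: j_def)
        then show ?thesis using ennreal_leI[OF fin] by (simp only: ennreal_plus)
      qed
      also have "ennreal (Q / r * t powr (d + 1 - n)) = ennreal (Q / r) * ennreal (t powr (d + 1 - n))"
        using Q0 r by (intro ennreal_mult) auto
      also have "\<dots> + ennreal (Q * e powr (d - n) * j) \<le> ennreal (Q / r) * ennreal (t powr (d + 1 - n)) + ennreal (Q * e powr (d - n)) * indicator E X"
        by (intro add_left_mono jE)
      finally show ?thesis using True by (simp add: y_def t_def)
    next
      case False
      then have "X \<notin> ball x (2 * r) - \<Gamma> \<or> gradient \<psi> X = 0" using \<psi>(4)[of X] by auto
      then show ?thesis by (auto simp: indicator_def)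
    qed
    have "(\<integral>\<^sup>+ X. indicator (ball x (2 * r) - \<Gamma>) X * ennreal (?D X powr (d - n) * ((?D X * norm (gradient \<psi> X))\<^sup>2 + ?D X * norm (gradient \<psi> X))) \<partial>lebesgue)
      \<le> (\<integral>\<^sup>+ X. ennreal (Q / r) * (indicator (ball x (2 * r) - \<Gamma>) X * ennreal (infdist X \<Gamma> powr (d + 1 - n))) + ennreal (Q * e powr (d - n)) * indicator E X \<partial>lebesgue)"
      by (intro nn_integral_mono pw)
    also have "\<dots> = (\<integral>\<^sup>+ X. ennreal (Q / r) * (indicator (ball x (2 * r) - \<Gamma>) X * ennreal (infdist X \<Gamma> powr (d + 1 - n))) + ennreal (Q * e powr (d - n)) * indicator E X \<partial>lborel)"
      by (rule nn_integral_completion)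
    also have "\<dots> = ennreal (Q / r) * (\<integral>\<^sup>+ X. indicator (ball x (2 * r) - \<Gamma>) X * ennreal (infdist X \<Gamma> powr (d + 1 - n)) \<partial>lborel) + ennreal (Q * e powr (d - n)) * emeasure lborel E"
    proof -
      have [measurable]: "(\<lambda>X. infdist X \<Gamma>) \<in> borel_measurable borel" by (intro borel_measurable_continuous_onI continuous_intros)
      have m1: "(\<lambda>X. indicator (ball x (2 * r) - \<Gamma>) X * ennreal (infdist X \<Gamma> powr (d + 1 - n))) \<in> borel_measurable lborel"
        using Om by measurable
      have m2: "(\<lambda>X. ennreal (Q * e powr (d - n)) * indicator E X) \<in> borel_measurable lborel" using E by measurable
      show ?thesis
        by (subst nn_integral_add[OF borel_measurable_times_ennreal[OF borel_measurable_const m1] m2],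
            subst nn_integral_cmult[OF m1], subst nn_integral_cmult_indicator[OF E]) (rule refl)
    qed
    also have "\<dots> \<le> ennreal (Q / r) * ennreal (W * (2 * r) powr (d + 1)) + ennreal (Q * e powr (d - n)) * ennreal (V * (4 * e) powr (n - d) * (2 * r) powr d)"
      unfolding E_def n_def by (intro add_mono mult_left_mono ip[OF A x] tube[OF A x]) (use r e in auto)
    also have "\<dots> = ennreal (Q / r * (W * (2 * r) powr (d + 1)) + Q * e powr (d - n) * (V * (4 * e) powr (n - d) * (2 * r) powr d))"
      using Q0 W V r by (subst ennreal_mult[symmetric], simp, simp, subst ennreal_mult[symmetric], simp, simp, subst ennreal_plus) auto
    also have "Q / r * (W * (2 * r) powr (d + 1)) + Q * e powr (d - n) * (V * (4 * e) powr (n - d) * (2 * r) powr d)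
      = Q * (W * 2 powr (d + 1) + V * 4 powr (n - d) * 2 powr d) * r powr d"
    proof -
      have "(2 * r) powr (d + 1) = 2 powr (d + 1) * (r powr d * r)" using r by (simp add: powr_mult powr_add)
      moreover have "(4 * e) powr (n - d) = 4 powr (n - d) * e powr (n - d)" using e by (simp add: powr_mult)
      moreover have "(2 * r) powr d = 2 powr d * r powr d" using r by (simp add: powr_mult)
      moreover have "e powr (d - n) * e powr (n - d) = 1" using e by (simp add: powr_add[symmetric])
      ultimately have "Q / r * (W * (2 * r) powr (d + 1)) + Q * e powr (d - n) * (V * (4 * e) powr (n - d) * (2 * r) powr d)
        = Q * (W * 2 powr (d + 1)) * r powr d * (r / r) + Q * (V * 4 powr (n - d) * 2 powr d) * r powr d * (e powr (d - n) * e powr (n - d))"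
        by (simp add: algebra_simps)
      then show ?thesis using r \<open>e powr (d - n) * e powr (n - d) = 1\<close> by (simp add: algebra_simps)
    qed
    also have "ennreal (Q * (W * 2 powr (d + 1) + V * 4 powr (n - d) * 2 powr d) * r powr d) \<le> ennreal (Z * r powr d)"
      unfolding Z_def using W V by (intro ennreal_leI mult_right_mono) (auto intro: add_nonneg_nonneg)
    finally show "\<exists>\<psi>. test_function (ball x (2 * r) - \<Gamma>) \<psi> \<and> (\<forall>X. 0 \<le> \<psi> X \<and> \<psi> X \<le> 1) \<and>
      (\<forall>X\<in>ball x r. 3 * e \<le> infdist X \<Gamma> \<longrightarrow> \<psi> X = 1) \<and>
      (\<integral>\<^sup>+ X. indicator (ball x (2 * r) - \<Gamma>) X * ennreal (Dbeta \<Gamma> \<sigma> d \<beta> X powr (d - real CARD('n)) *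
          ((Dbeta \<Gamma> \<sigma> d \<beta> X * norm (gradient \<psi> X))\<^sup>2 + Dbeta \<Gamma> \<sigma> d \<beta> X * norm (gradient \<psi> X))) \<partial>lebesgue)
        \<le> ennreal (Z * r powr d)"
      using \<psi>(1,2,3) unfolding n_def by blast
  qed
qed

section \<open>The energy estimate\<close>

lemma bdd_loc_sum:
  assumes "\<And>i. i \<in> I \<Longrightarrow> bdd_loc U (f i)"
  shows "bdd_loc U (\<lambda>x. \<Sum>i\<in>I. f i x)"
  using assms
proof (induction I rule: infinite_finite_induct)
  case (insert i I)
  then show ?case by (simp add: bdd_loc_add)
qed (auto simp: bdd_loc_def meas_loc_def intro!: exI[of _ 0])

lemma L2_loc_sum:
  assumes "\<And>i. i \<in> I \<Longrightarrow> L2_loc U (f i)"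
  shows "L2_loc U (\<lambda>x. \<Sum>i\<in>I. f i x)"
  using assms
proof (induction I rule: infinite_finite_induct)
  case (insert i I)
  then show ?case by (simp add: L2_loc_add)
qed (auto simp: L2_loc_def meas_loc_def)

lemma bdd_loc_const: "bdd_loc U (\<lambda>x. c)"
  unfolding bdd_loc_def
proof (intro conjI allI impI)
  show "meas_loc U (\<lambda>x. c)"
    unfolding meas_loc_def by (auto intro!: borel_measurable_times indicator_compact_measurable)
qed (auto intro!: exI[of _ "\<bar>c\<bar>"])

lemma bdd_loc_borel_measurable_on:
  fixes f :: "real ^ 'n::finite \<Rightarrow> real"
  assumes U: "open U" and m: "f \<in> borel_measurable (lebesgue_on U)" and B: "AE X in lebesgue_on U. \<bar>f X\<bar> \<le> B"
  shows "bdd_loc U f"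
  unfolding bdd_loc_def
proof (intro conjI allI impI)
  have Us: "U \<inter> space lebesgue \<in> sets lebesgue" using U by simp
  show "meas_loc U f"
    by (rule meas_loc_I) (use m borel_measurable_restrict_space_iff[OF Us] in blast)
  fix K assume K: "compact K \<and> K \<subseteq> U"
  have "AE X in lebesgue. X \<in> U \<longrightarrow> \<bar>f X\<bar> \<le> B" using B by (simp add: AE_restrict_space_iff[OF Us])
  then show "\<exists>B. AE x in lebesgue. x \<in> K \<longrightarrow> \<bar>f x\<bar> \<le> B"
    using K by (intro exI[of _ B]) (auto elim: eventually_mono)
qed

lemma meas_loc_borel_measurable_on:
  fixes f :: "real ^ 'n::finite \<Rightarrow> 'b::euclidean_space"
  assumes U: "open U" and m: "meas_loc U f"
  shows "f \<in> borel_measurable (lebesgue_on U)"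
proof -
  have Us: "U \<inter> space lebesgue \<in> sets lebesgue" using U by simp
  then show ?thesis using meas_loc_D[OF m U] borel_measurable_restrict_space_iff by blast
qed

text \<open>An entry is the bilinear form evaluated at two unit coordinate vectors, so the
  ellipticity constant bounds it.\<close>

lemma elliptic_matrix_entries:
  fixes A :: "real ^ 'n::finite \<Rightarrow> real ^ 'n ^ 'n"
  assumes U: "open U" and A: "elliptic_matrix U A C"
  shows "bdd_loc U (\<lambda>X. A X $ i $ j)"
proof (rule bdd_loc_borel_measurable_on[OF U])
  have m: "A \<in> borel_measurable (lebesgue_on U)" using A by (simp add: elliptic_matrix_def)
  have "continuous_on UNIV (\<lambda>M :: real ^ 'n ^ 'n. M $ i)" by (intro continuous_intros)
  from measurable_compose[OF m borel_measurable_continuous_onI[OF this]]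
  have "(\<lambda>X. (A X $ i) \<bullet> axis j 1) \<in> borel_measurable (lebesgue_on U)"
    by (intro borel_measurable_inner borel_measurable_const)
  then show "(\<lambda>X. A X $ i $ j) \<in> borel_measurable (lebesgue_on U)" by (simp add: inner_axis)
  have "\<bar>A X $ i $ j\<bar> \<le> C" if "X \<in> U" for X
  proof -
    have "\<bar>(A X *v axis j 1) \<bullet> axis i 1\<bar> \<le> C * norm (axis j 1 :: real ^ 'n) * norm (axis i 1 :: real ^ 'n)"
      using A that unfolding elliptic_matrix_def by blast
    moreover have "(A X *v axis j 1) \<bullet> axis i 1 = A X $ i $ j"
      by (simp add: inner_axis matrix_vector_mul_component)
    ultimately show ?thesis by simp
  qed
  then show "AE X in lebesgue_on U. \<bar>A X $ i $ j\<bar> \<le> C" by (intro AE_I2) simp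
qed

lemma L2_loc_matrix_vector:
  fixes A :: "real ^ 'n::finite \<Rightarrow> real ^ 'n ^ 'n"
  assumes "\<And>i j. bdd_loc U (\<lambda>X. A X $ i $ j)" "\<And>j. L2_loc U (\<lambda>X. g X $ j)"
  shows "L2_loc U (\<lambda>X. (A X *v g X) $ i)"
  unfolding matrix_vector_mult_def by (simp, intro L2_loc_sum L2_loc_bdd_mult assms)

lemma Dbeta_powr_GDERIV:
  fixes \<Gamma> :: "(real ^ 'n::finite) set"
  assumes A: "ahlfors_regular \<Gamma> \<sigma> d C" and ne: "\<Gamma> \<noteq> {}" and X: "X \<notin> \<Gamma>" and d: "d > 0" and \<beta>: "\<beta> > 0"
  shows "GDERIV (\<lambda>X. Dbeta \<Gamma> \<sigma> d \<beta> X powr s) X :> (s * Dbeta \<Gamma> \<sigma> d \<beta> X powr (s - 1)) *\<^sub>R gradient (Dbeta \<Gamma> \<sigma> d \<beta>) X"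
  by (rule GDERIV_DERIV_compose[OF Dbeta_GDERIV(1)[OF assms]]) (rule has_real_derivative_powr[OF Dbeta_bounds(3)[OF assms]])

lemma Dbeta_powr_continuous:
  fixes \<Gamma> :: "(real ^ 'n::finite) set"
  assumes A: "ahlfors_regular \<Gamma> \<sigma> d C" and ne: "\<Gamma> \<noteq> {}" and d: "d > 0" and \<beta>: "\<beta> > 0" and U: "U \<subseteq> - \<Gamma>"
  shows "continuous_on U (\<lambda>X. Dbeta \<Gamma> \<sigma> d \<beta> X powr s)"
  using U GDERIV_imp_continuous[OF Dbeta_powr_GDERIV[OF A ne _ d \<beta>]] by (intro continuous_at_imp_continuous_on) auto

text \<open>The test function is \<open>u \<theta>\<close>.\<close>

lemma weak_solution_test:
  fixes \<Gamma> :: "(real ^ 'n::finite) set"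
  assumes A: "ahlfors_regular \<Gamma> \<sigma> d C" and ne: "\<Gamma> \<noteq> {}" and d: "d > 0" and \<beta>: "\<beta> > 0"
    and ell: "elliptic_matrix (- \<Gamma>) A C2" and U: "open U" "U \<subseteq> - \<Gamma>"
    and sol: "weak_solution \<Gamma> \<sigma> d \<beta> \<gamma> A U u g" and bu: "bdd_loc U u"
    and \<theta>: "W12_loc U \<theta> D\<theta>" "bdd_loc U \<theta>" "\<And>i. bdd_loc U (\<lambda>X. D\<theta> X $ i)"
    and K: "compact K" "K \<subseteq> U" "\<And>X. X \<notin> K \<Longrightarrow> \<theta> X = 0" "\<And>X. X \<notin> K \<Longrightarrow> D\<theta> X = 0"
  defines "E \<equiv> \<lambda>X. ((A X *v g X) \<bullet> (\<theta> X *\<^sub>R g X + u X *\<^sub>R D\<theta> X)) * Dbeta \<Gamma> \<sigma> d \<beta> X powr (d + 1 + \<gamma> - real CARD('n))"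
  shows "integrable lebesgue E" "(LINT X|lebesgue. E X) = 0"
proof -
  define w where "w X = Dbeta \<Gamma> \<sigma> d \<beta> X powr (d + 1 + \<gamma> - real CARD('n))" for X
  have bw: "bdd_loc U w"
    unfolding w_def by (rule continuous_bdd_loc[OF U(1) Dbeta_powr_continuous[OF A ne d \<beta> U(2)]])
  have Wu: "W12_loc U u g" using sol by (simp add: weak_solution_def)
  note u2 = W12_loc_L2[OF Wu]
  have oG: "open (- \<Gamma>)" using ahlfors_regularD[OF A] by auto
  have bA: "bdd_loc U (\<lambda>X. A X $ i $ j)" for i j
    by (rule bdd_loc_subset[OF elliptic_matrix_entries[OF oG ell] U(2)])
  define F where "F X = w X *\<^sub>R (A X *v g X)" for X
  define h where "h X = u X *\<^sub>R D\<theta> X + \<theta> X *\<^sub>R g X" for X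
  have F2: "L2_loc U (\<lambda>X. F X $ i)" for i
    unfolding F_def by (simp, rule L2_loc_bdd_mult[OF bw L2_loc_matrix_vector[OF bA u2(2)]])
  have h2: "L2_loc U (\<lambda>X. h X $ i)" for i
    unfolding h_def by (simp, intro L2_loc_add L2_loc_bdd_mult[OF \<theta>(2) u2(2)] bdd_loc_L2_loc bdd_loc_mult bu \<theta>(3))
  have wg: "weak_gradient U (\<lambda>X. u X * \<theta> X) h"
    unfolding h_def[abs_def] by (rule weak_gradient_mult[OF U(1) Wu \<theta>(1)])
  have ann: "(LINT x:U|lebesgue. F x \<bullet> gradient \<phi> x) = 0" if "test_function U \<phi>" for \<phi>
  proof -
    have "(LINT x:U|lebesgue. ((A x *v g x) \<bullet> gradient \<phi> x) * w x) = 0"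
      using sol that by (simp add: weak_solution_def w_def)
    moreover have "F x \<bullet> gradient \<phi> x = ((A x *v g x) \<bullet> gradient \<phi> x) * w x" for x by (simp add: F_def)
    ultimately show ?thesis by simp
  qed
  have "(LINT x|lebesgue. F x \<bullet> h x) = 0"
  proof (rule test_gradient_annihilator_extend[OF U(1) F2 ann wg h2 K(1,2)])
    show "u X * \<theta> X = 0" if "X \<notin> K" for X using K(3)[OF that] by simp
    show "h X = 0" if "X \<notin> K" for X using K(3,4)[OF that] by (simp add: h_def)
  qed
  moreover have EF: "E X = F X \<bullet> h X" for X
    unfolding E_def F_def h_def w_def by (simp add: algebra_simps)
  ultimately show "(LINT X|lebesgue. E X) = 0" by simp
  have "integrable lebesgue (\<lambda>X. \<Sum>i\<in>UNIV. indicator K X * (F X $ i * h X $ i))"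
    by (intro Bochner_Integration.integrable_sum L2_loc_prod_integrable[OF F2 h2 K(1,2)])
  moreover have "(\<lambda>X. \<Sum>i\<in>UNIV. indicator K X * (F X $ i * h X $ i)) = E"
  proof
    fix X
    have "(\<Sum>i\<in>UNIV. indicator K X * (F X $ i * h X $ i)) = indicator K X * (F X \<bullet> h X)"
      by (simp add: inner_vec_def sum_distrib_left)
    also have "\<dots> = E X"
      unfolding EF using K(3,4)[of X] by (cases "X \<in> K") (auto simp: h_def)
    finally show "(\<Sum>i\<in>UNIV. indicator K X * (F X $ i * h X $ i)) = E X" .
  qed
  ultimately show "integrable lebesgue E" by simp
qed

lemma test_function_W12_loc:
  fixes \<psi> :: "real ^ 'n::finite \<Rightarrow> real"
  assumes U: "open U" and t: "test_function V \<psi>"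
  shows "W12_loc U \<psi> (gradient \<psi>)" "bdd_loc U \<psi>" "bdd_loc U (\<lambda>x. gradient \<psi> x $ i)"
proof -
  have bd: "\<exists>B. \<forall>x\<in>K. norm (gradient \<psi> x) \<le> B" for K
    using test_function_bounded[OF t] by metis
  show "W12_loc U \<psi> (gradient \<psi>)" by (rule GDERIV_W12_loc[OF U test_function_GDERIV[OF t] bd])
  show "bdd_loc U \<psi>" "bdd_loc U (\<lambda>x. gradient \<psi> x $ i)"
    by (rule GDERIV_bdd_meas_loc(1)[OF U test_function_GDERIV[OF t] bd], rule GDERIV_bdd_meas_loc(2)[OF U test_function_GDERIV[OF t] bd])
qed

text \<open>\<open>E = F \<sqdot> \<nabla>(u\<^sup>2 \<psi>\<^sup>2)\<close>.\<close>

lemma div_free_test: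
  fixes F :: "real ^ 'n::finite \<Rightarrow> real ^ 'n"
  assumes V: "open V" and F: "weakly_div_free V F" "\<And>i. bdd_loc V (\<lambda>X. F X $ i)" and U: "open U" "U \<subseteq> V"
    and Wu: "W12_loc U u g" and bu: "bdd_loc U u" and t: "test_function U \<psi>"
  defines "E \<equiv> \<lambda>X. (2 * u X * \<psi> X) *\<^sub>R (\<psi> X *\<^sub>R g X + u X *\<^sub>R gradient \<psi> X) \<bullet> F X"
  shows "integrable lebesgue E" "(LINT X|lebesgue. E X) = 0"
proof -
  obtain K where K: "compact K" "K \<subseteq> U" "\<And>x. x \<notin> K \<Longrightarrow> \<psi> x = 0" "\<And>x. x \<notin> K \<Longrightarrow> gradient \<psi> x = 0"
    using test_function_support[OF t] by metis
  note T = test_function_W12_loc[OF U(1) t]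
  note u2 = W12_loc_L2[OF Wu]
  define v where "v X = u X * \<psi> X" for X
  define Dv where "Dv X = u X *\<^sub>R gradient \<psi> X + \<psi> X *\<^sub>R g X" for X
  have wv: "weak_gradient U v Dv" unfolding v_def[abs_def] Dv_def[abs_def] by (rule weak_gradient_mult[OF U(1) Wu T(1)])
  have bv: "bdd_loc U v" unfolding v_def[abs_def] by (rule bdd_loc_mult[OF bu T(2)])
  have Dv2: "L2_loc U (\<lambda>X. Dv X $ i)" for i
    unfolding Dv_def by (simp, intro L2_loc_add L2_loc_bdd_mult[OF T(2) u2(2)] bdd_loc_L2_loc bdd_loc_mult bu T(3))
  have Wv: "W12_loc U v Dv" by (rule W12_loc_I[OF wv bdd_loc_L2_loc[OF bv] Dv2])
  \<comment> \<open>The square is differentiated as the product of \<open>v\<close> with itself,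
    which needs \<open>v\<close> in \<open>W12_loc\<close> and hence the boundedness of
    \<open>u\<close>. Extension by zero then makes it admissible on all of \<open>V\<close>.\<close>
  define h where "h X = v X *\<^sub>R Dv X + v X *\<^sub>R Dv X" for X
  have wh: "weak_gradient U (\<lambda>X. v X * v X) h" unfolding h_def[abs_def] by (rule weak_gradient_mult[OF U(1) Wv Wv])
  have v0: "v X * v X = 0" and h0: "h X = 0" if "X \<notin> K" for X using K(3)[OF that] by (simp_all add: v_def h_def)
  note ext = weak_gradient_extend[OF wh U K(1,2) v0 h0]
  have aiV: "f absolutely_integrable_on V" if "integrable lebesgue f" for f :: "real ^ 'n \<Rightarrow> 'c::euclidean_space"
    unfolding set_integrable_def
  proof (rule integrable_bounded_mult_lebesgue[OF that])
    show "(indicator V :: _ \<Rightarrow> real) \<in> borel_measurable lebesgue" using V by (intro borel_measurable_indicator) simp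
    show "\<bar>indicator V x\<bar> \<le> (1::real)" for x by (simp add: indicator_def)
  qed
  have "W11 V (\<lambda>X. v X * v X) h" unfolding W11_def using ext by (auto intro: aiV)
  moreover have "\<exists>K. compact K \<and> K \<subseteq> V \<and> (AE x in lebesgue. x \<in> V - K \<longrightarrow> v x * v x = 0)"
    using K(1,2) U(2) v0 by (intro exI[of _ K]) auto
  ultimately have "(LINT x:V|lebesgue. h x \<bullet> F x) = 0" using F(1) unfolding weakly_div_free_def by blast
  moreover have eq: "indicator V X *\<^sub>R (h X \<bullet> F X) = E X" for X
  proof (cases "X \<in> K")
    case True
    then have "X \<in> V" using K(2) U(2) by blast
    moreover have "h X \<bullet> F X = 2 * v X * (Dv X \<bullet> F X)" by (simp only: h_def inner_add_left inner_scaleR_left)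
    moreover have "Dv X = \<psi> X *\<^sub>R g X + u X *\<^sub>R gradient \<psi> X" by (simp add: Dv_def)
    ultimately have "h X \<bullet> F X = E X" by (simp only: E_def v_def inner_scaleR_left mult.assoc)
    then show ?thesis using \<open>X \<in> V\<close> by simp
  next
    case False
    then show ?thesis using h0[OF False] K(3)[OF False] by (simp add: E_def)
  qed
  ultimately show "(LINT X|lebesgue. E X) = 0" by (simp add: set_lebesgue_integral_def)
  have h2: "L2_loc U (\<lambda>X. h X $ i)" for i
    unfolding h_def vector_add_component vector_scaleR_component real_scaleR_def
    by (intro L2_loc_add L2_loc_bdd_mult[OF bv Dv2])
  have "integrable lebesgue (\<lambda>X. \<Sum>i\<in>UNIV. indicator K X * (h X $ i * F X $ i))"
    by (intro Bochner_Integration.integrable_sum L2_loc_prod_integrable[OF h2 bdd_loc_L2_loc[OF bdd_loc_subset[OF F(2) U(2)]] K(1,2)])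
  moreover have "(\<lambda>X. \<Sum>i\<in>UNIV. indicator K X * (h X $ i * F X $ i)) = E"
  proof
    fix X
    have "(\<Sum>i\<in>UNIV. indicator K X * (h X $ i * F X $ i)) = indicator K X * (h X \<bullet> F X)"
      by (simp add: inner_vec_def sum_distrib_left)
    also have "\<dots> = E X"
      unfolding eq[symmetric] using K(2) U(2) h0[of X] by (cases "X \<in> K") (auto simp: indicator_def)
    finally show "(\<Sum>i\<in>UNIV. indicator K X * (h X $ i * F X $ i)) = E X" .
  qed
  ultimately show "integrable lebesgue E" by simp
qed

section \<open>Pointwise absorption\<close>

lemma two_mult_le:
  fixes x y :: real
  assumes "\<epsilon> > 0"
  shows "2 * x * y \<le> \<epsilon> * x\<^sup>2 + y\<^sup>2 / \<epsilon>"
proof -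
  have "0 \<le> (\<epsilon> * x - y)\<^sup>2" by simp
  then have "\<epsilon> * (2 * x * y) \<le> \<epsilon> * (\<epsilon> * x\<^sup>2 + y\<^sup>2 / \<epsilon>)"
    using assms by (simp add: power2_diff power_mult_distrib algebra_simps power2_eq_square)
  then show ?thesis using assms by (simp add: mult_le_cancel_left_pos)
qed

text \<open>To be read with \<open>p = D\<^bsup>d+1-n\<^esup>\<close>, \<open>gD = \<nabla>D\<close>, \<open>g = \<nabla>u\<close> and \<open>g\<psi> = \<nabla>\<psi>\<close> at one point.\<close>

lemma energy_absorb:
  fixes A :: "real ^ 'n::finite ^ 'n" and g Db V gD g\<psi> :: "real ^ 'n" and u :: real
  assumes bdA: "\<And>\<xi> \<zeta>. \<bar>(A *v \<xi>) \<bullet> \<zeta>\<bar> \<le> C2 * norm \<xi> * norm \<zeta>" and ellA: "inverse C2 * (norm g)\<^sup>2 \<le> (A *v g) \<bullet> g"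
    and C: "C1 > 0" "C2 > 0" and b: "inverse C1 \<le> b" "b \<le> C1" and V: "norm V \<le> C1" and gD: "norm gD \<le> B"
    and D: "D > 0" and p: "p > 0" and \<psi>: "0 \<le> \<psi>" and \<gamma>: "-1 < \<gamma>" "\<gamma> < 1"
  defines "c0 \<equiv> inverse (C1 * C2)"
  defines "E \<equiv> b * \<psi>\<^sup>2 * (D * p) * ((A *v g) \<bullet> g) + 2 * u * b * \<psi> * (D * p) * ((A *v g) \<bullet> g\<psi>)
      + u * \<psi>\<^sup>2 * (D * p) * ((A *v g) \<bullet> Db) - (1 - \<gamma>) * u * \<psi>\<^sup>2 * p * (g \<bullet> V)
      - (1 - \<gamma>) * u\<^sup>2 * \<psi> * p * (b * ((A *v g\<psi>) \<bullet> gD) + g\<psi> \<bullet> V)"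
  shows "c0 / 2 * (\<psi>\<^sup>2 * (norm g)\<^sup>2 * (D * p)) \<le> E + (8 * C1\<^sup>2 * C2\<^sup>2 / c0 + 2 * C2\<^sup>2 / c0 + 8 / c0 + 2 * (C1 * C2 * B + C1)) *
     (u\<^sup>2 * (p / D * (\<psi>\<^sup>2 * (norm (D *\<^sub>R Db))\<^sup>2 + \<psi>\<^sup>2 * (norm V)\<^sup>2 + ((D * norm g\<psi>)\<^sup>2 + \<psi> * (D * norm g\<psi>)))))"
proof -
  have c0: "c0 > 0" using C by (simp add: c0_def)
  have B: "B \<ge> 0" using gD norm_ge_zero order_trans by blast
  define G where "G = \<psi> * norm g"
  define a where "a = \<bar>u\<bar>"
  define \<mu> where "\<mu> = norm g\<psi>"
  define v where "v = norm V"
  define \<nu> where "\<nu> = norm Db"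
  have nn: "G \<ge> 0" "a \<ge> 0" "\<mu> \<ge> 0" "v \<ge> 0" "\<nu> \<ge> 0" using \<psi> by (auto simp: G_def a_def \<mu>_def v_def \<nu>_def)
  have b0: "0 \<le> b" using b(1) C less_imp_le[OF positive_imp_inverse_positive[OF C(1)]] by linarith
  \<comment> \<open>\<open>T1\<close> is the coercive term. \<open>T2\<close> and \<open>T3\<close>
    come from differentiating the cutoff and \<open>b\<close>; \<open>T4\<close> and
    \<open>T5\<close> are what the divergence-free identity leaves behind.\<close>
  define T1 where "T1 = b * \<psi>\<^sup>2 * (D * p) * ((A *v g) \<bullet> g)"
  define T2 where "T2 = 2 * u * b * \<psi> * (D * p) * ((A *v g) \<bullet> g\<psi>)"
  define T3 where "T3 = u * \<psi>\<^sup>2 * (D * p) * ((A *v g) \<bullet> Db)"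
  define T4 where "T4 = (1 - \<gamma>) * u * \<psi>\<^sup>2 * p * (g \<bullet> V)"
  define T5 where "T5 = (1 - \<gamma>) * u\<^sup>2 * \<psi> * p * (b * ((A *v g\<psi>) \<bullet> gD) + g\<psi> \<bullet> V)"
  have T1: "c0 * G\<^sup>2 * (D * p) \<le> T1"
  proof -
    have "c0 * (norm g)\<^sup>2 \<le> b * ((A *v g) \<bullet> g)"
    proof -
      have "inverse C1 * (inverse C2 * (norm g)\<^sup>2) \<le> b * ((A *v g) \<bullet> g)"
        using b ellA C b0 by (intro mult_mono) auto
      then show ?thesis by (simp add: c0_def mult.assoc)
    qed
    then have "(c0 * (norm g)\<^sup>2) * (\<psi>\<^sup>2 * (D * p)) \<le> (b * ((A *v g) \<bullet> g)) * (\<psi>\<^sup>2 * (D * p))"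
      using D p by (intro mult_right_mono) auto
    then show ?thesis by (simp add: T1_def G_def power_mult_distrib mult_ac)
  qed
  have T2: "\<bar>T2\<bar> \<le> (D * p) * (c0 / 8 * G\<^sup>2 + 8 * C1\<^sup>2 * C2\<^sup>2 / c0 * (a\<^sup>2 * \<mu>\<^sup>2))"
  proof -
    have "\<bar>(A *v g) \<bullet> g\<psi>\<bar> \<le> C2 * norm g * \<mu>" unfolding \<mu>_def by (rule bdA)
    then have "b * \<bar>(A *v g) \<bullet> g\<psi>\<bar> \<le> C1 * (C2 * norm g * \<mu>)" using b b0 C by (intro mult_mono) auto
    then have "(2 * a * \<psi> * (D * p)) * (b * \<bar>(A *v g) \<bullet> g\<psi>\<bar>) \<le> (2 * a * \<psi> * (D * p)) * (C1 * (C2 * norm g * \<mu>))"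
      using nn \<psi> D p by (intro mult_left_mono) auto
    moreover have "\<bar>T2\<bar> = (2 * a * \<psi> * (D * p)) * (b * \<bar>(A *v g) \<bullet> g\<psi>\<bar>)"
      unfolding T2_def a_def abs_mult using b0 \<psi> D p by simp
    ultimately have "\<bar>T2\<bar> \<le> (D * p) * (2 * G * (C1 * C2 * a * \<mu>))" by (simp add: G_def mult_ac)
    \<comment> \<open>\<open>T2\<close>, \<open>T3\<close> and \<open>T4\<close> each spend
      \<open>c0 / 8\<close> of the coercive constant, which leaves more than the claimed
      half.\<close>
    also have "\<dots> \<le> (D * p) * (c0 / 8 * G\<^sup>2 + (C1 * C2 * a * \<mu>)\<^sup>2 / (c0 / 8))"
      using D p c0 by (intro mult_left_mono two_mult_le) auto
    finally show ?thesis by (simp add: power_mult_distrib mult_ac)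
  qed
  have T3: "\<bar>T3\<bar> \<le> (D * p) * (c0 / 8 * G\<^sup>2 + 2 * C2\<^sup>2 / c0 * (a\<^sup>2 * (\<psi>\<^sup>2 * \<nu>\<^sup>2)))"
  proof -
    have "\<bar>(A *v g) \<bullet> Db\<bar> \<le> C2 * norm g * \<nu>" unfolding \<nu>_def by (rule bdA)
    then have "(a * \<psi>\<^sup>2 * (D * p)) * \<bar>(A *v g) \<bullet> Db\<bar> \<le> (a * \<psi>\<^sup>2 * (D * p)) * (C2 * norm g * \<nu>)"
      using nn \<psi> D p by (intro mult_left_mono) auto
    moreover have "\<bar>T3\<bar> = (a * \<psi>\<^sup>2 * (D * p)) * \<bar>(A *v g) \<bullet> Db\<bar>"
      unfolding T3_def a_def abs_mult using \<psi> D p by simp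
    ultimately have "\<bar>T3\<bar> \<le> (D * p) * (2 * G * (C2 / 2 * a * (\<psi> * \<nu>)))" by (simp add: G_def mult_ac power2_eq_square)
    also have "\<dots> \<le> (D * p) * (c0 / 8 * G\<^sup>2 + (C2 / 2 * a * (\<psi> * \<nu>))\<^sup>2 / (c0 / 8))"
      using D p c0 by (intro mult_left_mono two_mult_le) auto
    finally show ?thesis by (simp add: power_mult_distrib power_divide mult_ac)
  qed
  have T4: "\<bar>T4\<bar> \<le> p * (D * (c0 / 8) * G\<^sup>2 + 8 / c0 * (a\<^sup>2 * (\<psi>\<^sup>2 * v\<^sup>2)) / D)"
  proof -
    have "\<bar>g \<bullet> V\<bar> \<le> norm g * v" unfolding v_def by (rule Cauchy_Schwarz_ineq2)
    then have "(1 - \<gamma>) * \<bar>g \<bullet> V\<bar> \<le> 2 * (norm g * v)" using \<gamma> by (intro mult_mono) auto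
    then have "(a * \<psi>\<^sup>2 * p) * ((1 - \<gamma>) * \<bar>g \<bullet> V\<bar>) \<le> (a * \<psi>\<^sup>2 * p) * (2 * (norm g * v))"
      using nn \<psi> D p by (intro mult_left_mono) auto
    moreover have "\<bar>T4\<bar> = (a * \<psi>\<^sup>2 * p) * ((1 - \<gamma>) * \<bar>g \<bullet> V\<bar>)"
      unfolding T4_def a_def abs_mult using \<psi> \<gamma> p by simp
    ultimately have "\<bar>T4\<bar> \<le> p * (2 * G * (a * (\<psi> * v)))" by (simp add: G_def mult_ac power2_eq_square)
    \<comment> \<open>\<open>T4\<close> lacks the factor \<open>D\<close> of the coercive term, so
      the Young parameter carries it. The other side then receives \<open>p / D\<close>, which is
      the Carleson weight.\<close>
    also have "\<dots> \<le> p * (D * (c0 / 8) * G\<^sup>2 + (a * (\<psi> * v))\<^sup>2 / (D * (c0 / 8)))"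
      using D p c0 by (intro mult_left_mono two_mult_le) auto
    also have "(a * (\<psi> * v))\<^sup>2 / (D * (c0 / 8)) = 8 / c0 * (a\<^sup>2 * (\<psi>\<^sup>2 * v\<^sup>2)) / D"
      using D c0 by (simp add: power_mult_distrib field_simps)
    finally show ?thesis .
  qed
  \<comment> \<open>No gradient of \<open>u\<close> occurs here, so nothing is absorbed. This term
    is the reason why the cutoff energy must also contain the first power of the gradient of the
    cutoff.\<close>
  have T5: "\<bar>T5\<bar> \<le> 2 * (C1 * C2 * B + C1) * (a\<^sup>2 * \<psi> * p * \<mu>)"
  proof -
    have "\<bar>b * ((A *v g\<psi>) \<bullet> gD)\<bar> \<le> C1 * (C2 * \<mu> * B)"
    proof -
      have "\<bar>(A *v g\<psi>) \<bullet> gD\<bar> \<le> C2 * \<mu> * norm gD" unfolding \<mu>_def by (rule bdA)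
      also have "\<dots> \<le> C2 * \<mu> * B" using gD C nn by (intro mult_left_mono) auto
      finally have "b * \<bar>(A *v g\<psi>) \<bullet> gD\<bar> \<le> C1 * (C2 * \<mu> * B)" using b b0 C by (intro mult_mono) auto
      then show ?thesis using b0 by (simp add: abs_mult)
    qed
    moreover have "\<bar>g\<psi> \<bullet> V\<bar> \<le> \<mu> * C1"
    proof -
      have "\<bar>g\<psi> \<bullet> V\<bar> \<le> \<mu> * norm V" unfolding \<mu>_def by (rule Cauchy_Schwarz_ineq2)
      also have "\<dots> \<le> \<mu> * C1" using V nn by (intro mult_left_mono) auto
      finally show ?thesis .
    qed
    ultimately have "\<bar>b * ((A *v g\<psi>) \<bullet> gD) + g\<psi> \<bullet> V\<bar> \<le> (C1 * C2 * B + C1) * \<mu>" by (simp add: algebra_simps)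
    then have "(1 - \<gamma>) * \<bar>b * ((A *v g\<psi>) \<bullet> gD) + g\<psi> \<bullet> V\<bar> \<le> 2 * ((C1 * C2 * B + C1) * \<mu>)"
      using \<gamma> by (intro mult_mono) auto
    then have "(a\<^sup>2 * \<psi> * p) * ((1 - \<gamma>) * \<bar>b * ((A *v g\<psi>) \<bullet> gD) + g\<psi> \<bullet> V\<bar>) \<le> (a\<^sup>2 * \<psi> * p) * (2 * ((C1 * C2 * B + C1) * \<mu>))"
      using nn \<psi> p by (intro mult_left_mono) auto
    moreover have "\<bar>T5\<bar> = (a\<^sup>2 * \<psi> * p) * ((1 - \<gamma>) * \<bar>b * ((A *v g\<psi>) \<bullet> gD) + g\<psi> \<bullet> V\<bar>)"
      unfolding T5_def a_def abs_mult using \<psi> \<gamma> p by simp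
    ultimately show ?thesis by (simp add: mult_ac)
  qed
  define Y1 where "Y1 = a\<^sup>2 * (p / D) * (\<psi>\<^sup>2 * (D * \<nu>)\<^sup>2)"
  define Y2 where "Y2 = a\<^sup>2 * (p / D) * (\<psi>\<^sup>2 * v\<^sup>2)"
  define Y3 where "Y3 = a\<^sup>2 * (p / D) * (D * \<mu>)\<^sup>2"
  define Y4 where "Y4 = a\<^sup>2 * (p / D) * (\<psi> * (D * \<mu>))"
  have Y: "Y1 \<ge> 0" "Y2 \<ge> 0" "Y3 \<ge> 0" "Y4 \<ge> 0" unfolding Y1_def Y2_def Y3_def Y4_def using nn D p \<psi> by auto
  define k1 k2 k3 k4 where "k1 = 8 * C1\<^sup>2 * C2\<^sup>2 / c0" and "k2 = 2 * C2\<^sup>2 / c0" and "k3 = 8 / c0" and "k4 = 2 * (C1 * C2 * B + C1)"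
  have k: "k1 \<ge> 0" "k2 \<ge> 0" "k3 \<ge> 0" "k4 \<ge> 0" using c0 C B by (auto simp: k1_def k2_def k3_def k4_def)
  define X where "X = D * p * G\<^sup>2"
  have "c0 * X \<le> T1" using T1 by (simp add: X_def mult_ac)
  moreover have "\<bar>T2\<bar> \<le> c0 / 8 * X + k1 * Y3"
    using T2 D by (simp add: X_def Y3_def k1_def k2_def k3_def k4_def power_mult_distrib power2_eq_square algebra_simps)
  moreover have "\<bar>T3\<bar> \<le> c0 / 8 * X + k2 * Y1"
    using T3 D by (simp add: X_def Y1_def k1_def k2_def k3_def k4_def power_mult_distrib power2_eq_square algebra_simps)
  moreover have "\<bar>T4\<bar> \<le> c0 / 8 * X + k3 * Y2"
    using T4 D by (simp add: X_def Y2_def k1_def k2_def k3_def k4_def algebra_simps)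
  moreover have "\<bar>T5\<bar> \<le> k4 * Y4"
    using T5 D by (simp add: Y4_def k1_def k2_def k3_def k4_def mult_ac)
  moreover have "E = T1 + T2 + T3 - T4 - T5" by (simp add: E_def T1_def T2_def T3_def T4_def T5_def)
  moreover have "(k1 + k2 + k3 + k4) * (Y1 + Y2 + (Y3 + Y4)) \<ge> k1 * Y3 + k2 * Y1 + k3 * Y2 + k4 * Y4"
  proof -
    have "k1 * Y3 + k2 * Y1 + k3 * Y2 + k4 * Y4 \<le> k1 * (Y1 + Y2 + (Y3 + Y4)) + k2 * (Y1 + Y2 + (Y3 + Y4)) + k3 * (Y1 + Y2 + (Y3 + Y4)) + k4 * (Y1 + Y2 + (Y3 + Y4))"
      using k Y by (intro add_mono mult_left_mono) auto
    then show ?thesis by (simp add: algebra_simps)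
  qed
  moreover have "c0 * X \<ge> 0" using c0 D p by (simp add: X_def)
  ultimately have "c0 / 2 * X \<le> E + (k1 + k2 + k3 + k4) * (Y1 + Y2 + (Y3 + Y4))" by linarith
  moreover have "Y1 + Y2 + (Y3 + Y4) = u\<^sup>2 * (p / D * (\<psi>\<^sup>2 * (norm (D *\<^sub>R Db))\<^sup>2 + \<psi>\<^sup>2 * (norm V)\<^sup>2 + ((D * norm g\<psi>)\<^sup>2 + \<psi> * (D * norm g\<psi>))))"
    using D by (simp add: Y1_def Y2_def Y3_def Y4_def a_def \<nu>_def v_def \<mu>_def distrib_left mult_ac)
  moreover have "X = \<psi>\<^sup>2 * (norm g)\<^sup>2 * (D * p)" by (simp add: X_def G_def power_mult_distrib mult_ac)
  ultimately show ?thesis unfolding k1_def k2_def k3_def k4_def by simp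
qed

section \<open>The energy inequality for a fixed cutoff\<close>

lemma meas_loc_norm: "meas_loc U f \<Longrightarrow> meas_loc U (\<lambda>x. norm (f x))"
  for f :: "real ^ 'n::finite \<Rightarrow> 'b::euclidean_space"
  unfolding meas_loc_def
proof (intro allI impI)
  fix K assume *: "\<forall>K. compact K \<and> K \<subseteq> U \<longrightarrow> (\<lambda>x. indicator K x *\<^sub>R f x) \<in> borel_measurable lebesgue" "compact K \<and> K \<subseteq> U"
  then have "(\<lambda>x. indicator K x *\<^sub>R f x) \<in> borel_measurable lebesgue" by blast
  then have "(\<lambda>x. norm (indicator K x *\<^sub>R f x)) \<in> borel_measurable lebesgue"
    by (rule measurable_compose[OF _ borel_measurable_norm])
  then show "(\<lambda>x. indicator K x *\<^sub>R norm (f x)) \<in> borel_measurable lebesgue" by simp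
qed

lemma meas_loc_ennreal:
  fixes h :: "real ^ 'n::finite \<Rightarrow> real"
  assumes "open U" "meas_loc U h"
  shows "(\<lambda>X. indicator U X * ennreal (h X)) \<in> borel_measurable lebesgue"
proof -
  have "(\<lambda>X. ennreal (indicator U X *\<^sub>R h X)) \<in> borel_measurable lebesgue"
    using meas_loc_D[OF assms(2,1)] by (intro measurable_compose[OF _ measurable_ennreal])
  moreover have "ennreal (indicator U X *\<^sub>R h X) = indicator U X * ennreal (h X)" for X
    by (simp add: indicator_def)
  ultimately show ?thesis by simp
qed

lemma meas_loc_power2: "meas_loc U h \<Longrightarrow> meas_loc U (\<lambda>x. (h x)\<^sup>2)"
  for h :: "real ^ 'n::finite \<Rightarrow> real"
  unfolding power2_eq_square by (rule meas_loc_mult)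

text \<open>A class closed under products. The multiplier of \<open>u\<close> in the test function
  is a product of \<open>b\<close>, two copies of the cutoff and a power of \<open>Dbeta\<close>,
  and is built up factor by factor.\<close>

definition W1bdd_loc :: "(real ^ 'n::finite) set \<Rightarrow> (real ^ 'n \<Rightarrow> real) \<Rightarrow> (real ^ 'n \<Rightarrow> real ^ 'n) \<Rightarrow> bool" where
  "W1bdd_loc U f Df \<longleftrightarrow> W12_loc U f Df \<and> bdd_loc U f \<and> (\<forall>i. bdd_loc U (\<lambda>x. Df x $ i))"

lemma W1bdd_loc_I:
  "weak_gradient U f Df \<Longrightarrow> bdd_loc U f \<Longrightarrow> (\<And>i. bdd_loc U (\<lambda>x. Df x $ i)) \<Longrightarrow> W1bdd_loc U f Df"
  unfolding W1bdd_loc_def by (blast intro: W12_loc_I bdd_loc_L2_loc)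

lemma W1bdd_loc_mult:
  assumes U: "open U" and f: "W1bdd_loc U f Df" and g: "W1bdd_loc U g Dg"
  shows "W1bdd_loc U (\<lambda>x. f x * g x) (\<lambda>x. f x *\<^sub>R Dg x + g x *\<^sub>R Df x)"
proof (rule W1bdd_loc_I)
  show "weak_gradient U (\<lambda>x. f x * g x) (\<lambda>x. f x *\<^sub>R Dg x + g x *\<^sub>R Df x)"
    using f g by (intro weak_gradient_mult U) (auto simp: W1bdd_loc_def)
  show "bdd_loc U (\<lambda>x. f x * g x)" using f g by (intro bdd_loc_mult) (auto simp: W1bdd_loc_def)
  show "bdd_loc U (\<lambda>x. (f x *\<^sub>R Dg x + g x *\<^sub>R Df x) $ i)" for i
    using f g by (simp, intro bdd_loc_add bdd_loc_mult) (auto simp: W1bdd_loc_def)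
qed

lemma weak_gradient_subset:
  assumes "weak_gradient V u g" "open V" "open U" "U \<subseteq> V"
  shows "weak_gradient U u g"
proof (rule weak_gradientI)
  show "u absolutely_integrable_on K" "(\<lambda>x. g x $ i) absolutely_integrable_on K" if "compact K" "K \<subseteq> U" for K i
    using assms that by (auto simp: weak_gradient_def intro!: abs_integrable_nth)
  show "(LINT x|lebesgue. u x * gradient \<phi> x $ i) = - (LINT x|lebesgue. \<phi> x * g x $ i)" if "test_function U \<phi>" for \<phi> i
    by (rule weak_gradient_test(3)[OF assms(1) test_function_mono[OF that assms(4)]])
qed

text \<open>On a compact set the scalar factor of the gradient is bounded by continuity, and the
  gradient of \<open>Dbeta\<close> is bounded globally.\<close>

lemma Dbeta_powr_W1bdd_loc:
  fixes \<Gamma> :: "(real ^ 'n::finite) set"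
  assumes A: "ahlfors_regular \<Gamma> \<sigma> d C" and ne: "\<Gamma> \<noteq> {}" and d: "d > 0" and \<beta>: "\<beta> > 0" and U: "open U" "U \<subseteq> - \<Gamma>"
  shows "W1bdd_loc U (\<lambda>X. Dbeta \<Gamma> \<sigma> d \<beta> X powr s) (\<lambda>X. (s * Dbeta \<Gamma> \<sigma> d \<beta> X powr (s - 1)) *\<^sub>R gradient (Dbeta \<Gamma> \<sigma> d \<beta>) X)"
    (is "W1bdd_loc U ?P ?G")
proof -
  have der: "GDERIV ?P X :> ?G X" if "X \<in> U" for X by (rule Dbeta_powr_GDERIV[OF A ne _ d \<beta>]) (use that U in auto)
  have bd: "\<exists>B. \<forall>X\<in>K. norm (?G X) \<le> B" if K: "compact K" "K \<subseteq> U" for K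
  proof -
    have "continuous_on K (\<lambda>X. s * Dbeta \<Gamma> \<sigma> d \<beta> X powr (s - 1))"
      by (intro continuous_on_mult continuous_on_const Dbeta_powr_continuous[OF A ne d \<beta>]) (use K U in auto)
    from compact_imp_bounded[OF compact_continuous_image[OF this K(1)]]
    obtain M where M: "\<And>X. X \<in> K \<Longrightarrow> \<bar>s * Dbeta \<Gamma> \<sigma> d \<beta> X powr (s - 1)\<bar> \<le> M" by (auto simp: bounded_iff)
    have "norm (?G X) \<le> M * ((d + \<beta>) / \<beta> * Dup C d \<beta>)" if "X \<in> K" for X
    proof -
      have "X \<notin> \<Gamma>" using that K U by auto
      then show ?thesis unfolding norm_scaleR
        using M[OF that] Dbeta_GDERIV(2)[OF A ne _ d \<beta>] abs_ge_zero order_trans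
        by (intro mult_mono) (auto intro: order_trans[OF abs_ge_zero])
    qed
    then show ?thesis by blast
  qed
  show ?thesis
    by (rule W1bdd_loc_I[OF GDERIV_weak_gradient[OF U(1) der bd] GDERIV_bdd_meas_loc[OF U(1) der bd]])
qed

text \<open>\<open>ennreal\<close> sends negative values to 0, so only this direction holds for
  functions of variable sign.\<close>

lemma integral_le_nn_integral:
  fixes f :: "'a \<Rightarrow> real"
  assumes "integrable M f"
  shows "ennreal (integral\<^sup>L M f) \<le> (\<integral>\<^sup>+ x. ennreal (f x) \<partial>M)"
proof -
  have i: "integrable M (\<lambda>x. max 0 (f x))" using assms by simp
  have "integral\<^sup>L M f \<le> (LINT x|M. max 0 (f x))" by (rule integral_mono[OF assms i]) simp
  then have "ennreal (integral\<^sup>L M f) \<le> ennreal (LINT x|M. max 0 (f x))" by (rule ennreal_leI)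
  also have "\<dots> = (\<integral>\<^sup>+ x. ennreal (max 0 (f x)) \<partial>M)" by (rule nn_integral_eq_integral[OF i, symmetric]) simp
  also have "\<dots> = (\<integral>\<^sup>+ x. ennreal (f x) \<partial>M)" by (rule nn_integral_cong) (simp add: max_def ennreal_neg)
  finally show ?thesis .
qed

lemma inner_transpose_matrix_vector: "v \<bullet> (transpose A *v w) = (A *v v) \<bullet> w"
  for A :: "real ^ 'n::finite ^ 'n"
  by (metis dot_lmul_matrix inner_commute transpose_matrix_vector)

text \<open>The bracket is the error constant of \<open>energy_absorb\<close>, with \<open>B\<close>
  bounding the gradient of \<open>Dbeta\<close>; the factor in front undoes the coefficient
  \<open>c0 / 2\<close> on its left side.\<close>

definition absorb_const :: "real \<Rightarrow> real \<Rightarrow> real \<Rightarrow> real" where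
  "absorb_const C1 C2 B = 2 * (C1 * C2) * (8 * C1\<^sup>2 * C2\<^sup>2 / inverse (C1 * C2) + 2 * C2\<^sup>2 / inverse (C1 * C2)
     + 8 / inverse (C1 * C2) + 2 * (C1 * C2 * B + C1))"

text \<open>Both test identities integrate to zero. Subtracting \<open>(1 - \<gamma>) / 2\<close>
  times the second from the first removes the term with \<open>\<nabla>u\<close> against
  \<open>A\<^sup>T\<nabla>D\<close>, and what remains has exactly the shape treated by
  \<open>energy_absorb\<close>.\<close>

lemma energy_cutoff:
  fixes \<Gamma> :: "(real ^ 'n::finite) set"
  assumes A: "ahlfors_regular \<Gamma> \<sigma> d C" and ne: "\<Gamma> \<noteq> {}" and d: "d > 0" and \<beta>: "\<beta> > 0" and \<gamma>: "-1 < \<gamma>" "\<gamma> < 1"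
    and C1: "C1 > 0" and ell: "elliptic_matrix (- \<Gamma>) A C2"
    and div: "weakly_div_free (- \<Gamma>)
        (\<lambda>X. Dbeta \<Gamma> \<sigma> d \<beta> X powr (d + 1 - real CARD('n)) *\<^sub>R
             (b X *\<^sub>R (transpose (A X) *v gradient (Dbeta \<Gamma> \<sigma> d \<beta>) X) + V X))"
    and b: "\<And>X. X \<notin> \<Gamma> \<Longrightarrow> inverse C1 \<le> b X \<and> b X \<le> C1" and wb: "W1bdd_loc (- \<Gamma>) b Db"
    and V: "\<And>X. X \<notin> \<Gamma> \<Longrightarrow> norm (V X) \<le> C1" "\<And>i. bdd_loc (- \<Gamma>) (\<lambda>X. V X $ i)" "meas_loc (- \<Gamma>) V"
    and mDb: "meas_loc (- \<Gamma>) Db"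
    and U: "open U" "U \<subseteq> - \<Gamma>" and sol: "weak_solution \<Gamma> \<sigma> d \<beta> \<gamma> A U u g"
    and S: "AE X in lebesgue. X \<in> U \<longrightarrow> (u X)\<^sup>2 \<le> S" "S \<ge> 0"
    and t: "test_function U \<psi>" "\<And>X. 0 \<le> \<psi> X \<and> \<psi> X \<le> 1"
    and N1: "(\<integral>\<^sup>+ X. indicator U X * ennreal (Dbeta \<Gamma> \<sigma> d \<beta> X powr (d - real CARD('n)) *
          ((Dbeta \<Gamma> \<sigma> d \<beta> X * norm (gradient \<psi> X))\<^sup>2 + Dbeta \<Gamma> \<sigma> d \<beta> X * norm (gradient \<psi> X))) \<partial>lebesgue) \<le> N1"
    and N2: "(\<integral>\<^sup>+ X. indicator U X * ennreal (Dbeta \<Gamma> \<sigma> d \<beta> X powr (d - real CARD('n)) * (norm (Dbeta \<Gamma> \<sigma> d \<beta> X *\<^sub>R Db X))\<^sup>2) \<partial>lebesgue) \<le> N2"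
    and N3: "(\<integral>\<^sup>+ X. indicator U X * ennreal (Dbeta \<Gamma> \<sigma> d \<beta> X powr (d - real CARD('n)) * (norm (V X))\<^sup>2) \<partial>lebesgue) \<le> N3"
  shows "(\<integral>\<^sup>+ X. indicator U X * ennreal ((\<psi> X)\<^sup>2 * ((norm (g X))\<^sup>2 * Dbeta \<Gamma> \<sigma> d \<beta> X powr (d + 2 - real CARD('n)))) \<partial>lebesgue)
    \<le> ennreal (absorb_const C1 C2 ((d + \<beta>) / \<beta> * Dup C d \<beta>) * S) * (N1 + N2 + N3)"
proof -
  define n where "n = real CARD('n)"
  define D where "D = Dbeta \<Gamma> \<sigma> d \<beta>"
  define gD where "gD = gradient D"
  define p where "p X = D X powr (d + 1 - n)" for X
  define P where "P X = D X powr (1 - \<gamma>)" for X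
  define gP where "gP X = ((1 - \<gamma>) * D X powr (1 - \<gamma> - 1)) *\<^sub>R gD X" for X
  define w where "w X = D X powr (d + 1 + \<gamma> - n)" for X
  define B where "B = (d + \<beta>) / \<beta> * Dup C d \<beta>"
  define k where "k = 8 * C1\<^sup>2 * C2\<^sup>2 / inverse (C1 * C2) + 2 * C2\<^sup>2 / inverse (C1 * C2) + 8 / inverse (C1 * C2) + 2 * (C1 * C2 * B + C1)"
  have C2: "C2 > 0" using ell by (simp add: elliptic_matrix_def)
  have Dp: "D X > 0" if "X \<in> U" for X
    unfolding D_def by (rule Dbeta_bounds(3)[OF A ne _ d \<beta>]) (use that U in auto)
  have gDB: "norm (gD X) \<le> B" if "X \<in> U" for X
    unfolding D_def gD_def B_def by (rule Dbeta_GDERIV(2)[OF A ne _ d \<beta>]) (use that U in auto)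
  have "B \<ge> 0" using Dlow_Dup_pos(2)[OF ahlfors_regularD(1)[OF A] \<beta>, of d] d \<beta> by (simp add: B_def)
  then have k0: "k \<ge> 0" using C1 C2 by (simp add: k_def)
  obtain K where K: "compact K" "K \<subseteq> U" "\<And>x. x \<notin> K \<Longrightarrow> \<psi> x = 0" "\<And>x. x \<notin> K \<Longrightarrow> gradient \<psi> x = 0"
    using test_function_support[OF t(1)] by metis
  have oG: "open (- \<Gamma>)" using ahlfors_regularD(2)[OF A] by auto
  have Wu: "W12_loc U u g" using sol by (simp add: weak_solution_def)
  note u2 = W12_loc_L2[OF Wu]
  have bu: "bdd_loc U u"
    unfolding bdd_loc_def
  proof (intro conjI allI impI)
    show "meas_loc U u" using u2(1) by (simp add: L2_loc_def)
    fix K' assume K': "compact K' \<and> K' \<subseteq> U"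
    have "AE X in lebesgue. X \<in> K' \<longrightarrow> \<bar>u X\<bar> \<le> sqrt S"
      using S(1)
    proof eventually_elim
      case (elim X)
      then show ?case using K' real_le_rsqrt[of "\<bar>u X\<bar>" S] by auto
    qed
    then show "\<exists>B. AE x in lebesgue. x \<in> K' \<longrightarrow> \<bar>u x\<bar> \<le> B" by blast
  qed
  have Wb: "W1bdd_loc U b Db"
    using wb weak_gradient_subset[OF _ oG U] bdd_loc_subset[OF _ U(2)]
    by (intro W1bdd_loc_I) (auto simp: W1bdd_loc_def W12_loc_def)
  have W\<psi>: "W1bdd_loc U \<psi> (gradient \<psi>)"
    using test_function_W12_loc[OF U(1) t(1)] by (simp add: W1bdd_loc_def)
  have WP: "W1bdd_loc U P gP" unfolding P_def[abs_def] gP_def[abs_def] D_def gD_def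
    by (rule Dbeta_powr_W1bdd_loc[OF A ne d \<beta> U])
  \<comment> \<open>Nested in the order in which \<open>W1bdd_loc_mult\<close> is applied, so that
    \<open>D\<theta>\<close> is literally the gradient delivered by that lemma.\<close>
  define \<theta> where "\<theta> X = b X * (\<psi> X * (\<psi> X * P X))" for X
  define D\<theta> where "D\<theta> X = b X *\<^sub>R (\<psi> X *\<^sub>R (\<psi> X *\<^sub>R gP X + P X *\<^sub>R gradient \<psi> X) + (\<psi> X * P X) *\<^sub>R gradient \<psi> X)
    + (\<psi> X * (\<psi> X * P X)) *\<^sub>R Db X" for X
  have W\<theta>: "W1bdd_loc U \<theta> D\<theta>"
    unfolding \<theta>_def[abs_def] D\<theta>_def[abs_def] by (intro W1bdd_loc_mult[OF U(1)] Wb W\<psi> WP)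
  have \<theta>0: "\<theta> X = 0" "D\<theta> X = 0" if "X \<notin> K" for X using K(3,4)[OF that] by (simp_all add: \<theta>_def D\<theta>_def)
  define E1 where "E1 X = ((A X *v g X) \<bullet> (\<theta> X *\<^sub>R g X + u X *\<^sub>R D\<theta> X)) * w X" for X
  have E1: "integrable lebesgue E1" "(LINT X|lebesgue. E1 X) = 0"
    unfolding E1_def[abs_def] w_def D_def n_def
    using W\<theta> by (intro weak_solution_test[OF A ne d \<beta> ell U sol bu _ _ _ K(1,2) \<theta>0]; simp add: W1bdd_loc_def)+
  define F where "F X = p X *\<^sub>R (b X *\<^sub>R (transpose (A X) *v gD X) + V X)" for X
  have bA: "bdd_loc (- \<Gamma>) (\<lambda>X. A X $ i $ j)" for i j by (rule elliptic_matrix_entries[OF oG ell])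
  have bp: "bdd_loc (- \<Gamma>) p"
    unfolding p_def D_def by (rule continuous_bdd_loc[OF oG Dbeta_powr_continuous[OF A ne d \<beta>]]) simp
  have bgD: "bdd_loc (- \<Gamma>) (\<lambda>X. gD X $ i)" for i
    unfolding gD_def D_def
    by (rule GDERIV_bdd_meas_loc(2)[OF oG Dbeta_GDERIV(1)[OF A ne _ d \<beta>]]) (use Dbeta_GDERIV(2)[OF A ne _ d \<beta>] in auto)
  have bF: "bdd_loc (- \<Gamma>) (\<lambda>X. F X $ i)" for i
    unfolding F_def matrix_vector_mult_def transpose_def
    using wb by (simp, intro bdd_loc_mult bdd_loc_add bdd_loc_sum bp bA bgD V(2)) (simp add: W1bdd_loc_def)
  have divF: "weakly_div_free (- \<Gamma>) F"
    using div unfolding F_def[abs_def] p_def D_def gD_def n_def .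
  define E2 where "E2 X = (2 * u X * \<psi> X) *\<^sub>R (\<psi> X *\<^sub>R g X + u X *\<^sub>R gradient \<psi> X) \<bullet> F X" for X
  have E2: "integrable lebesgue E2" "(LINT X|lebesgue. E2 X) = 0"
    unfolding E2_def[abs_def] by (rule div_free_test[OF oG divF bF U Wu bu t(1)])+
  \<comment> \<open>The factor 1/2 stems from differentiating a square, the factor
    \<open>1 - \<gamma>\<close> from differentiating the power \<open>P\<close>.\<close>
  define E where "E X = E1 X - (1 - \<gamma>) / 2 * E2 X" for X
  have E: "integrable lebesgue E" "(LINT X|lebesgue. E X) = 0"
    unfolding E_def[abs_def] using E1 E2 by simp_all
  have Eform: "E X = b X * (\<psi> X)\<^sup>2 * (D X * p X) * ((A X *v g X) \<bullet> g X) + 2 * u X * b X * \<psi> X * (D X * p X) * ((A X *v g X) \<bullet> gradient \<psi> X)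
      + u X * (\<psi> X)\<^sup>2 * (D X * p X) * ((A X *v g X) \<bullet> Db X) - (1 - \<gamma>) * u X * (\<psi> X)\<^sup>2 * p X * (g X \<bullet> V X)
      - (1 - \<gamma>) * (u X)\<^sup>2 * \<psi> X * p X * (b X * ((A X *v gradient \<psi> X) \<bullet> gD X) + gradient \<psi> X \<bullet> V X)" if X: "X \<in> U" for X
  proof -
    have Pw: "P X * w X = D X * p X"
    proof -
      have "P X * w X = D X powr ((1 - \<gamma>) + (d + 1 + \<gamma> - n))" unfolding P_def w_def by (rule powr_add[symmetric])
      also have "(1 - \<gamma>) + (d + 1 + \<gamma> - n) = 1 + (d + 1 - n)" by simp
      also have "D X powr \<dots> = D X * p X" using Dp[OF X] unfolding p_def by (subst powr_add) simp
      finally show ?thesis .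
    qed
    \<comment> \<open>After one differentiation of the power the exponent is -\<gamma>, and the
      weight of the equation turns into the weight of the divergence-free field.\<close>
    have Gw: "D X powr (1 - \<gamma> - 1) * w X = p X"
    proof -
      have "D X powr (1 - \<gamma> - 1) * w X = D X powr ((1 - \<gamma> - 1) + (d + 1 + \<gamma> - n))" unfolding w_def by (rule powr_add[symmetric])
      also have "(1 - \<gamma> - 1) + (d + 1 + \<gamma> - n) = d + 1 - n" by simp
      finally show ?thesis by (simp only: p_def)
    qed
    define a1 a2 a3 a4 where "a1 = (A X *v g X) \<bullet> g X" and "a2 = (A X *v g X) \<bullet> gD X"
      and "a3 = (A X *v g X) \<bullet> gradient \<psi> X" and "a4 = (A X *v g X) \<bullet> Db X"
    define q where "q = D X powr (1 - \<gamma> - 1)"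
    have "E1 X = (\<theta> X * a1 + u X * (b X * (\<psi> X * (\<psi> X * (((1 - \<gamma>) * q) * a2) + P X * a3) + (\<psi> X * P X) * a3) + (\<psi> X * (\<psi> X * P X)) * a4)) * w X"
      unfolding E1_def D\<theta>_def gP_def a1_def a2_def a3_def a4_def q_def
      by (simp only: inner_add_right inner_scaleR_right)
    also have "\<dots> = b X * (\<psi> X)\<^sup>2 * (P X * w X) * a1 + u X * b X * (\<psi> X)\<^sup>2 * (1 - \<gamma>) * (q * w X) * a2
       + 2 * u X * b X * \<psi> X * (P X * w X) * a3 + u X * (\<psi> X)\<^sup>2 * (P X * w X) * a4"
      unfolding \<theta>_def by (simp add: algebra_simps power2_eq_square)
    finally have 1: "E1 X = b X * (\<psi> X)\<^sup>2 * (D X * p X) * a1 + u X * b X * (\<psi> X)\<^sup>2 * (1 - \<gamma>) * p X * a2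
       + 2 * u X * b X * \<psi> X * (D X * p X) * a3 + u X * (\<psi> X)\<^sup>2 * (D X * p X) * a4"
      unfolding Pw Gw[folded q_def] .
    have F1: "v \<bullet> F X = p X * (b X * ((A X *v v) \<bullet> gD X) + v \<bullet> V X)" for v
      by (simp only: F_def inner_add_right inner_scaleR_right inner_transpose_matrix_vector)
    have "E2 X = 2 * u X * \<psi> X * (\<psi> X * (g X \<bullet> F X) + u X * (gradient \<psi> X \<bullet> F X))"
      unfolding E2_def by (simp only: inner_add_left inner_scaleR_left)
    then have 2: "E2 X = 2 * u X * \<psi> X * (\<psi> X * (p X * (b X * a2 + g X \<bullet> V X)) + u X * (p X * (b X * ((A X *v gradient \<psi> X) \<bullet> gD X) + gradient \<psi> X \<bullet> V X)))"
      unfolding F1 a2_def .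
    have half: "(1 - \<gamma>) / 2 * (2 * y * z) = (1 - \<gamma>) * (y * z)" for y z :: real by simp
    have 3: "(1 - \<gamma>) / 2 * E2 X = (1 - \<gamma>) * (u X * (\<psi> X * (\<psi> X * (p X * (b X * a2 + g X \<bullet> V X)) + u X * (p X * (b X * ((A X *v gradient \<psi> X) \<bullet> gD X) + gradient \<psi> X \<bullet> V X)))))"
      unfolding 2 mult.assoc[of "2 * u X"] by (rule half)
    show ?thesis
      unfolding E_def 1 3 a1_def[symmetric] a3_def[symmetric] a4_def[symmetric]
      by (simp add: algebra_simps power2_eq_square)
  qed
  define f where "f X = inverse (C1 * C2) / 2 * ((\<psi> X)\<^sup>2 * (norm (g X))\<^sup>2 * (D X * p X))" for X
  \<comment> \<open>The cutoff confines \<open>f\<close> to a compact subset of \<open>U\<close>,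
    where the gradient is square integrable. Finiteness here is what legitimates the
    absorption.\<close>
  have f_int: "integrable lebesgue f"
  proof -
    have bDp: "bdd_loc U (\<lambda>X. inverse (C1 * C2) / 2 * (\<psi> X * (\<psi> X * D X powr (d + 2 - n))))"
      unfolding D_def
      by (intro bdd_loc_mult bdd_loc_const continuous_bdd_loc[OF U(1) Dbeta_powr_continuous[OF A ne d \<beta> U(2)]])
        (use W\<psi> in \<open>auto simp: W1bdd_loc_def\<close>)
    have "integrable lebesgue (\<lambda>X. \<Sum>i\<in>UNIV. indicator K X * ((inverse (C1 * C2) / 2 * (\<psi> X * (\<psi> X * D X powr (d + 2 - n))) * g X $ i) * g X $ i))"
      by (intro Bochner_Integration.integrable_sum L2_loc_prod_integrable[OF L2_loc_bdd_mult[OF bDp u2(2)] u2(2) K(1,2)])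
    moreover have "(\<lambda>X. \<Sum>i\<in>UNIV. indicator K X * ((inverse (C1 * C2) / 2 * (\<psi> X * (\<psi> X * D X powr (d + 2 - n))) * g X $ i) * g X $ i)) = f"
    proof
      fix X
      show "(\<Sum>i\<in>UNIV. indicator K X * ((inverse (C1 * C2) / 2 * (\<psi> X * (\<psi> X * D X powr (d + 2 - n))) * g X $ i) * g X $ i)) = f X"
      proof (cases "X \<in> K")
        case True
        then have "D X > 0" using Dp K(2) by blast
        then have "D X powr (d + 2 - n) = D X * p X"
        proof -
          have "D X powr (d + 2 - n) = D X powr (1 + (d + 1 - n))" by (simp add: algebra_simps)
          also have "\<dots> = D X * p X" using \<open>D X > 0\<close> unfolding p_def by (subst powr_add) simp
          finally show ?thesis .
        qed
        moreover have "(norm (g X))\<^sup>2 = (\<Sum>i\<in>UNIV. g X $ i * g X $ i)"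
          by (simp add: power2_norm_eq_inner inner_vec_def)
        ultimately show ?thesis using True
          by (simp add: f_def sum_distrib_left power2_eq_square mult_ac)
      next
        case False
        then show ?thesis using K(3) by (simp add: f_def)
      qed
    qed
    ultimately show ?thesis by simp
  qed
  define R where "R X = (D X * norm (gradient \<psi> X))\<^sup>2 + D X * norm (gradient \<psi> X)" for X
  define q where "q X = D X powr (d - n)" for X
  have pq: "p X / D X = q X" if "X \<in> U" for X
    using Dp[OF that] powr_diff[of "D X" "d + 1 - n" 1] by (simp add: p_def q_def algebra_simps)
  have main: "AE X in lebesgue. ennreal (f X - E X) \<le> ennreal (k * S) * (indicator U X * ennreal (q X * R X)
      + indicator U X * ennreal (q X * (norm (D X *\<^sub>R Db X))\<^sup>2) + indicator U X * ennreal (q X * (norm (V X))\<^sup>2))"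
    using S(1)
  proof eventually_elim
    case (elim X)
    show ?case
    proof (cases "X \<in> U")
      case True
      then have XG: "X \<in> - \<Gamma>" using U by auto
      have pp: "p X > 0" using Dp[OF True] by (simp add: p_def)
      have bdA: "\<bar>(A X *v \<xi>) \<bullet> \<zeta>\<bar> \<le> C2 * norm \<xi> * norm \<zeta>" for \<xi> \<zeta> using ell XG unfolding elliptic_matrix_def by blast
      have elA: "inverse C2 * (norm (g X))\<^sup>2 \<le> (A X *v g X) \<bullet> g X" using ell XG unfolding elliptic_matrix_def by blast
      define H where "H = p X / D X * ((\<psi> X)\<^sup>2 * (norm (D X *\<^sub>R Db X))\<^sup>2 + (\<psi> X)\<^sup>2 * (norm (V X))\<^sup>2
          + ((D X * norm (gradient \<psi> X))\<^sup>2 + \<psi> X * (D X * norm (gradient \<psi> X))))"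
      have le: "f X \<le> E X + k * ((u X)\<^sup>2 * H)"
        unfolding Eform[OF True] f_def k_def H_def
        by (rule energy_absorb[OF bdA elA C1 C2 _ _ _ gDB[OF True] Dp[OF True] pp _ \<gamma>])
          (use b[of X] V(1)[of X] t(2)[of X] XG in auto)
      have \<psi>1: "0 \<le> \<psi> X" "\<psi> X \<le> 1" "(\<psi> X)\<^sup>2 \<le> 1" using t(2)[of X] by (auto intro: power_le_one)
      have q0: "q X \<ge> 0" by (simp add: q_def)
      have D0: "D X \<ge> 0" using Dp[OF True] by simp
      have "H \<le> q X * ((norm (D X *\<^sub>R Db X))\<^sup>2 + (norm (V X))\<^sup>2 + R X)"
        unfolding H_def pq[OF True] R_def
        using \<psi>1 D0 q0 by (intro mult_left_mono add_mono mult_left_le_one_le) auto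
      moreover have "H \<ge> 0" unfolding H_def pq[OF True] using \<psi>1 D0 q0 by auto
      ultimately have "(u X)\<^sup>2 * H \<le> S * (q X * ((norm (D X *\<^sub>R Db X))\<^sup>2 + (norm (V X))\<^sup>2 + R X))"
        using elim True S(2) by (intro mult_mono) auto
      then have "f X - E X \<le> k * (S * (q X * ((norm (D X *\<^sub>R Db X))\<^sup>2 + (norm (V X))\<^sup>2 + R X)))"
        using le mult_left_mono[OF _ k0] by fastforce
      also have "\<dots> = k * S * (q X * R X + q X * (norm (D X *\<^sub>R Db X))\<^sup>2 + q X * (norm (V X))\<^sup>2)"
        by (simp add: algebra_simps)
      finally have "ennreal (f X - E X) \<le> ennreal (k * S * (q X * R X + q X * (norm (D X *\<^sub>R Db X))\<^sup>2 + q X * (norm (V X))\<^sup>2))"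
        by (rule ennreal_leI)
      also have "\<dots> = ennreal (k * S) * (ennreal (q X * R X) + ennreal (q X * (norm (D X *\<^sub>R Db X))\<^sup>2) + ennreal (q X * (norm (V X))\<^sup>2))"
      proof -
        have "0 \<le> q X * R X" "0 \<le> q X * (norm (D X *\<^sub>R Db X))\<^sup>2" "0 \<le> q X * (norm (V X))\<^sup>2" "0 \<le> k * S"
          using q0 D0 k0 S(2) by (auto simp: R_def)
        then show ?thesis by (simp only: ennreal_mult ennreal_plus add_nonneg_nonneg)
      qed
      finally show ?thesis using True by simp
    next
      case False
      then have "X \<notin> K" using K(2) by auto
      then have "f X = 0" "E X = 0" using K(3,4) \<theta>0 by (auto simp: f_def E_def E1_def E2_def)
      then show ?thesis by simp
    qed
  qed
  have mD: "meas_loc U (\<lambda>X. D X powr s)" for s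
    unfolding D_def by (rule continuous_meas_loc[OF U(1) Dbeta_powr_continuous[OF A ne d \<beta> U(2)]])
  have mD1: "meas_loc U D"
  proof -
    have "continuous_on U D" unfolding D_def
      using GDERIV_imp_continuous[OF Dbeta_GDERIV(1)[OF A ne _ d \<beta>]] U(2) by (intro continuous_at_imp_continuous_on) auto
    then show ?thesis by (rule continuous_meas_loc[OF U(1)])
  qed
  have mg: "meas_loc U (\<lambda>X. norm (gradient \<psi> X))"
    by (rule meas_loc_norm, rule continuous_meas_loc[OF U(1) test_function_continuous_gradient[OF t(1)]])
  have m1: "(\<lambda>X. indicator U X * ennreal (q X * R X)) \<in> borel_measurable lebesgue"
    unfolding q_def R_def by (intro meas_loc_ennreal[OF U(1)] meas_loc_mult meas_loc_add meas_loc_power2 mD mD1 mg)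
  have m2: "(\<lambda>X. indicator U X * ennreal (q X * (norm (D X *\<^sub>R Db X))\<^sup>2)) \<in> borel_measurable lebesgue"
  proof -
    have "meas_loc U (\<lambda>X. q X * (D X * norm (Db X))\<^sup>2)"
      unfolding q_def by (intro meas_loc_mult meas_loc_power2 mD mD1 meas_loc_norm meas_loc_subset[OF mDb U(2)])
    then have "(\<lambda>X. indicator U X * ennreal (q X * (D X * norm (Db X))\<^sup>2)) \<in> borel_measurable lebesgue"
      by (rule meas_loc_ennreal[OF U(1)])
    then show ?thesis by (simp add: power_mult_distrib)
  qed
  have m3: "(\<lambda>X. indicator U X * ennreal (q X * (norm (V X))\<^sup>2)) \<in> borel_measurable lebesgue"
    unfolding q_def by (intro meas_loc_ennreal[OF U(1)] meas_loc_mult meas_loc_power2 mD meas_loc_norm meas_loc_subset[OF V(3) U(2)])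
  have f0: "f X \<ge> 0" for X
  proof (cases "X \<in> U")
    case True
    then show ?thesis using C1 C2 Dp[OF True] by (simp add: f_def p_def)
  next
    case False
    then have "X \<notin> K" using K(2) by auto
    then show ?thesis using K(3) by (simp add: f_def)
  qed
  have "(\<integral>\<^sup>+ X. ennreal (f X) \<partial>lebesgue) = ennreal (LINT X|lebesgue. f X)"
    by (rule nn_integral_eq_integral[OF f_int]) (simp add: f0)
  \<comment> \<open>\<open>E\<close> has integral zero, so it may be subtracted for free; the
    pointwise inequality controls the difference.\<close>
  also have "(LINT X|lebesgue. f X) = (LINT X|lebesgue. f X - E X)" using f_int E by simp
  also have "ennreal (LINT X|lebesgue. f X - E X) \<le> (\<integral>\<^sup>+ X. ennreal (f X - E X) \<partial>lebesgue)"
    by (rule integral_le_nn_integral) (use f_int E in simp)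
  also have "\<dots> \<le> (\<integral>\<^sup>+ X. ennreal (k * S) * (indicator U X * ennreal (q X * R X)
      + indicator U X * ennreal (q X * (norm (D X *\<^sub>R Db X))\<^sup>2) + indicator U X * ennreal (q X * (norm (V X))\<^sup>2)) \<partial>lebesgue)"
    by (rule nn_integral_mono_AE[OF main])
  also have "\<dots> = ennreal (k * S) * ((\<integral>\<^sup>+ X. indicator U X * ennreal (q X * R X) \<partial>lebesgue)
      + (\<integral>\<^sup>+ X. indicator U X * ennreal (q X * (norm (D X *\<^sub>R Db X))\<^sup>2) \<partial>lebesgue)
      + (\<integral>\<^sup>+ X. indicator U X * ennreal (q X * (norm (V X))\<^sup>2) \<partial>lebesgue))"
    by (subst nn_integral_cmult[OF borel_measurable_add[OF borel_measurable_add[OF m1 m2] m3]],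
        subst nn_integral_add[OF borel_measurable_add[OF m1 m2] m3], subst nn_integral_add[OF m1 m2]) (rule refl)
  also have "\<dots> \<le> ennreal (k * S) * (N1 + N2 + N3)"
    using N1 N2 N3 unfolding q_def R_def D_def n_def by (intro mult_left_mono add_mono) auto
  finally have fin: "(\<integral>\<^sup>+ X. ennreal (f X) \<partial>lebesgue) \<le> ennreal (k * S) * (N1 + N2 + N3)" .
  have fm: "(\<lambda>X. ennreal (f X)) \<in> borel_measurable lebesgue"
    using f_int by (intro measurable_compose[OF _ measurable_ennreal]) auto
  have "(\<integral>\<^sup>+ X. indicator U X * ennreal ((\<psi> X)\<^sup>2 * ((norm (g X))\<^sup>2 * D X powr (d + 2 - n))) \<partial>lebesgue)
    = (\<integral>\<^sup>+ X. ennreal (2 * (C1 * C2)) * ennreal (f X) \<partial>lebesgue)"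
  proof (rule nn_integral_cong)
    fix X
    show "indicator U X * ennreal ((\<psi> X)\<^sup>2 * ((norm (g X))\<^sup>2 * D X powr (d + 2 - n))) = ennreal (2 * (C1 * C2)) * ennreal (f X)"
    proof (cases "X \<in> U")
      case True
      have "D X powr (d + 2 - n) = D X powr (1 + (d + 1 - n))" by (simp add: algebra_simps)
      also have "\<dots> = D X * p X" using Dp[OF True] unfolding p_def by (subst powr_add) simp
      finally show ?thesis using True C1 C2 f0[of X]
        by (subst ennreal_mult[symmetric]) (auto simp: f_def field_simps)
    next
      case False
      then have "X \<notin> K" using K(2) by auto
      then show ?thesis using K(3) False by (simp add: f_def)
    qed
  qed
  also have "\<dots> = ennreal (2 * (C1 * C2)) * (\<integral>\<^sup>+ X. ennreal (f X) \<partial>lebesgue)" by (rule nn_integral_cmult[OF fm])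
  also have "\<dots> \<le> ennreal (2 * (C1 * C2)) * (ennreal (k * S) * (N1 + N2 + N3))" by (intro mult_left_mono fin) simp
  also have "\<dots> = ennreal (absorb_const C1 C2 B * S) * (N1 + N2 + N3)"
  proof -
    have "absorb_const C1 C2 B * S = 2 * (C1 * C2) * (k * S)" by (simp add: absorb_const_def k_def)
    moreover have "ennreal (2 * (C1 * C2) * (k * S)) = ennreal (2 * (C1 * C2)) * ennreal (k * S)"
      using C1 C2 k0 S(2) by (intro ennreal_mult) auto
    ultimately show ?thesis by (simp only: mult.assoc)
  qed
  finally show ?thesis unfolding D_def n_def B_def .
qed

section \<open>The Carleson hypotheses and the limit of the cutoffs\<close>

lemma in_CM_meas_loc:
  fixes f :: "real ^ 'n::finite \<Rightarrow> real ^ 'n"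
  assumes "in_CM \<Gamma> \<sigma> d f C" "closed \<Gamma>"
  shows "meas_loc (- \<Gamma>) f" "bdd_loc (- \<Gamma>) (\<lambda>X. f X $ i)"
proof -
  have Us: "- \<Gamma> \<inter> space lebesgue \<in> sets lebesgue" using assms(2) by (simp add: open_Compl)
  have m: "f \<in> borel_measurable (lebesgue_on (- \<Gamma>))" using assms(1) by (simp add: in_CM_def)
  show "meas_loc (- \<Gamma>) f"
    by (rule meas_loc_I) (use m borel_measurable_restrict_space_iff[OF Us] in blast)
  obtain M where M: "AE X in lebesgue_on (- \<Gamma>). norm (f X) \<le> M" using assms(1) by (auto simp: in_CM_def)
  have "continuous_on UNIV (\<lambda>v :: real ^ 'n. v $ i)" by (intro continuous_intros)
  from measurable_compose[OF m borel_measurable_continuous_onI[OF this]]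
  show "bdd_loc (- \<Gamma>) (\<lambda>X. f X $ i)"
  proof (rule bdd_loc_borel_measurable_on[rotated])
    show "AE X in lebesgue_on (- \<Gamma>). \<bar>f X $ i\<bar> \<le> M"
      using M by eventually_elim (meson component_le_norm_cart order_trans)
  qed (use assms(2) in auto)
qed

lemma meas_loc_nth:
  fixes f :: "real ^ 'n::finite \<Rightarrow> real ^ 'n"
  assumes "meas_loc U f"
  shows "meas_loc U (\<lambda>x. f x $ i)"
  unfolding meas_loc_def
proof (intro allI impI)
  fix K assume "compact K \<and> K \<subseteq> U"
  then have "(\<lambda>x. indicator K x *\<^sub>R f x) \<in> borel_measurable lebesgue" using assms by (simp add: meas_loc_def)
  moreover have "continuous_on UNIV (\<lambda>v :: real ^ 'n. v $ i)" by (intro continuous_intros)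
  ultimately have "(\<lambda>x. (indicator K x *\<^sub>R f x) $ i) \<in> borel_measurable lebesgue"
    by (rule measurable_compose[OF _ borel_measurable_continuous_onI])
  then show "(\<lambda>x. indicator K x *\<^sub>R f x $ i) \<in> borel_measurable lebesgue" by simp
qed

text \<open>The exponent d - n is negative, so the lower bound of \<open>Dbeta\<close> by the
  distance bounds the weight from above; the upper Ahlfors bound then turns the measure of the ball
  into a power of \<open>R\<close>.\<close>

lemma in_CM_Dbeta_weight:
  fixes \<Gamma> :: "(real ^ 'n::finite) set" and f :: "real ^ 'n \<Rightarrow> real ^ 'n"
  assumes A: "ahlfors_regular \<Gamma> \<sigma> d C" and d: "0 < d" "d \<le> real CARD('n) - 1" and \<beta>: "\<beta> > 0" and C1: "C1 > 0"
    and CM: "in_CM \<Gamma> \<sigma> d f C1" and x: "x \<in> \<Gamma>" and R: "R > 0"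
  shows "(\<integral>\<^sup>+ X. indicator (ball x R - \<Gamma>) X * ennreal (Dbeta \<Gamma> \<sigma> d \<beta> X powr (d - real CARD('n)) * (norm (f X))\<^sup>2) \<partial>lebesgue)
    \<le> ennreal (Dlow C d \<beta> powr (d - real CARD('n)) * C1 * (C * R powr d))"
proof -
  define n where "n = real CARD('n)"
  define a where "a = Dlow C d \<beta>"
  note AD = ahlfors_regularD[OF A]
  have a: "a > 0" unfolding a_def by (rule Dlow_Dup_pos[OF AD(1) \<beta>])
  have ne: "\<Gamma> \<noteq> {}" using x by auto
  let ?U = "ball x R - \<Gamma>"
  have oU: "open ?U" using AD(2) by (intro open_Diff) auto
  have m: "(\<lambda>X. indicator ?U X * ennreal ((norm (f X))\<^sup>2 * infdist X \<Gamma> powr (d - n))) \<in> borel_measurable lebesgue"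
  proof (rule meas_loc_ennreal[OF oU], rule meas_loc_mult)
    show "meas_loc ?U (\<lambda>X. (norm (f X))\<^sup>2)"
      by (rule meas_loc_power2, rule meas_loc_norm, rule meas_loc_subset[OF in_CM_meas_loc(1)[OF CM AD(2)]]) auto
    show "meas_loc ?U (\<lambda>X. infdist X \<Gamma> powr (d - n))"
    proof (rule continuous_meas_loc[OF oU], rule continuous_on_powr')
      show "\<forall>X\<in>?U. 0 \<le> infdist X \<Gamma> \<and> (infdist X \<Gamma> = 0 \<longrightarrow> 0 < d - n)"
        using infdist_pos[OF AD(2) ne] by (metis DiffD2 infdist_nonneg less_irrefl)
    qed (intro continuous_intros)+
  qed
  have "(\<integral>\<^sup>+ X. indicator ?U X * ennreal (Dbeta \<Gamma> \<sigma> d \<beta> X powr (d - n) * (norm (f X))\<^sup>2) \<partial>lebesgue)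
    \<le> (\<integral>\<^sup>+ X. ennreal (a powr (d - n)) * (indicator ?U X * ennreal ((norm (f X))\<^sup>2 * infdist X \<Gamma> powr (d - n))) \<partial>lebesgue)"
  proof (rule nn_integral_mono)
    fix X
    show "indicator ?U X * ennreal (Dbeta \<Gamma> \<sigma> d \<beta> X powr (d - n) * (norm (f X))\<^sup>2)
      \<le> ennreal (a powr (d - n)) * (indicator ?U X * ennreal ((norm (f X))\<^sup>2 * infdist X \<Gamma> powr (d - n)))"
    proof (cases "X \<in> ?U")
      case True
      then have XG: "X \<notin> \<Gamma>" by simp
      have t: "infdist X \<Gamma> > 0" by (rule infdist_pos[OF AD(2) ne XG])
      have "Dbeta \<Gamma> \<sigma> d \<beta> X powr (- (n - d)) \<le> (a * infdist X \<Gamma>) powr (- (n - d))"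
        using Dbeta_bounds(1)[OF A ne XG d(1) \<beta>] a t d unfolding a_def[symmetric] by (intro powr_antimono) (auto simp: n_def)
      then have "Dbeta \<Gamma> \<sigma> d \<beta> X powr (d - n) \<le> a powr (d - n) * infdist X \<Gamma> powr (d - n)"
        using a t by (simp add: powr_mult)
      then have "Dbeta \<Gamma> \<sigma> d \<beta> X powr (d - n) * (norm (f X))\<^sup>2 \<le> a powr (d - n) * infdist X \<Gamma> powr (d - n) * (norm (f X))\<^sup>2"
        by (rule mult_right_mono) simp
      then have "Dbeta \<Gamma> \<sigma> d \<beta> X powr (d - n) * (norm (f X))\<^sup>2 \<le> a powr (d - n) * ((norm (f X))\<^sup>2 * infdist X \<Gamma> powr (d - n))"
        by (simp add: mult_ac)
      then show ?thesis using True by (simp add: ennreal_mult[symmetric] ennreal_leI)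
    qed simp
  qed
  also have "\<dots> = ennreal (a powr (d - n)) * (\<integral>\<^sup>+ X. indicator ?U X * ennreal ((norm (f X))\<^sup>2 * infdist X \<Gamma> powr (d - n)) \<partial>lebesgue)"
    by (rule nn_integral_cmult[OF m])
  also have "(\<integral>\<^sup>+ X. indicator ?U X * ennreal ((norm (f X))\<^sup>2 * infdist X \<Gamma> powr (d - n)) \<partial>lebesgue) \<le> ennreal C1 * emeasure \<sigma> (ball x R)"
    using CM x R unfolding in_CM_def n_def by (auto simp: mult.commute)
  also have "\<dots> \<le> ennreal C1 * ennreal (C * R powr d)" by (intro mult_left_mono AD(7)[OF x R]) simp
  finally have "(\<integral>\<^sup>+ X. indicator ?U X * ennreal (Dbeta \<Gamma> \<sigma> d \<beta> X powr (d - n) * (norm (f X))\<^sup>2) \<partial>lebesgue)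
    \<le> ennreal (a powr (d - n)) * (ennreal C1 * ennreal (C * R powr d))" by (simp add: mult_left_mono)
  also have "\<dots> = ennreal (a powr (d - n) * C1 * (C * R powr d))"
    using C1 AD(1) by (simp add: ennreal_mult mult.assoc)
  finally show ?thesis unfolding n_def a_def .
qed

text \<open>The bound for a fixed cutoff does not depend on the scale \<open>e\<close>, so monotone
  convergence extends it to the whole ball as the scale tends to 0. Powers of \<open>r\<close> are
  traded for the measure of the ball by Ahlfors regularity.\<close>

lemma square_function_estimate:
  fixes d \<beta> \<gamma> C C1 C2 :: real
  assumes d: "0 < d" "d \<le> real CARD('n::finite) - 1" and \<gamma>: "-1 < \<gamma>" "\<gamma> < 1" and \<beta>: "0 < \<beta>" and C1: "0 < C1"
  shows "\<exists>M>0. \<forall>(\<Gamma> :: (real ^ 'n) set) (\<sigma> :: (real ^ 'n) measure) A b Db V x r u Du.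
    ahlfors_regular \<Gamma> \<sigma> d C \<and> elliptic_matrix (- \<Gamma>) A C2 \<and>
      weakly_div_free (- \<Gamma>)
        (\<lambda>X. Dbeta \<Gamma> \<sigma> d \<beta> X powr (d + 1 - real CARD('n)) *\<^sub>R
             (b X *\<^sub>R (transpose (A X) *v gradient (Dbeta \<Gamma> \<sigma> d \<beta>) X) + V X)) \<and>
      (\<forall>X\<in>- \<Gamma>. inverse C1 \<le> b X \<and> b X \<le> C1) \<and>
      weak_gradient (- \<Gamma>) b Db \<and>
      in_CM \<Gamma> \<sigma> d (\<lambda>X. Dbeta \<Gamma> \<sigma> d \<beta> X *\<^sub>R Db X) C1 \<and>
      (\<forall>X\<in>- \<Gamma>. norm (V X) \<le> C1) \<and>
      in_CM \<Gamma> \<sigma> d V C1 \<and> x \<in> \<Gamma> \<and> 0 < r \<and> weak_solution \<Gamma> \<sigma> d \<beta> \<gamma> A (ball x (2 * r) - \<Gamma>) u Du \<longrightarrow>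
         (\<integral>\<^sup>+ X \<in> ball x r - \<Gamma>.
             ennreal ((norm (Du X))\<^sup>2 * Dbeta \<Gamma> \<sigma> d \<beta> X powr (d + 2 - real CARD('n))) \<partial>lebesgue)
         \<le> ennreal M * esssup (lebesgue_on (ball x (2 * r) - \<Gamma>)) (\<lambda>X. ennreal (\<bar>u X\<bar>\<^sup>2))
             * emeasure \<sigma> (ball x r)"
proof -
  define n where "n = real CARD('n)"
  obtain Z where Z: "Z > 0" and cut: "\<forall>(\<Gamma> :: (real ^ 'n) set) \<sigma> x r e. ahlfors_regular \<Gamma> \<sigma> d C \<and> x \<in> \<Gamma> \<and> 0 < e \<and> 8 * e \<le> r \<longrightarrow>
    (\<exists>\<psi>. test_function (ball x (2 * r) - \<Gamma>) \<psi> \<and> (\<forall>X. 0 \<le> \<psi> X \<and> \<psi> X \<le> 1) \<and>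
      (\<forall>X\<in>ball x r. 3 * e \<le> infdist X \<Gamma> \<longrightarrow> \<psi> X = 1) \<and>
      (\<integral>\<^sup>+ X. indicator (ball x (2 * r) - \<Gamma>) X * ennreal (Dbeta \<Gamma> \<sigma> d \<beta> X powr (d - real CARD('n)) *
          ((Dbeta \<Gamma> \<sigma> d \<beta> X * norm (gradient \<psi> X))\<^sup>2 + Dbeta \<Gamma> \<sigma> d \<beta> X * norm (gradient \<psi> X))) \<partial>lebesgue)
        \<le> ennreal (Z * r powr d))"
    using cutoff_energy[OF d \<beta>, of C] by (elim exE conjE) (rule that)
  define k where "k = absorb_const C1 C2 ((d + \<beta>) / \<beta> * Dup C d \<beta>)"
  \<comment> \<open>The Carleson condition is applied on the ball of radius \<open>2 * r\<close>;
    hence the factor \<open>2 powr d\<close>.\<close>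
  define N where "N = Dlow C d \<beta> powr (d - n) * C1 * (C * 2 powr d)"
  \<comment> \<open>The absolute value and the summand 1 make the constant positive even before
    \<open>C\<close> and \<open>C2\<close> are known to be.\<close>
  define M where "M = \<bar>k * (Z + 2 * N) * C\<bar> + 1"
  have M: "M > 0" by (simp add: M_def add_nonneg_pos)
  show ?thesis
  proof (intro exI[of _ M] conjI M allI impI; elim conjE)
    fix \<Gamma> :: "(real ^ 'n) set" and \<sigma> :: "(real ^ 'n) measure" and A :: "real ^ 'n \<Rightarrow> real ^ 'n ^ 'n" and b u :: "real ^ 'n \<Rightarrow> real" and Db V Du :: "real ^ 'n \<Rightarrow> real ^ 'n"
      and x :: "real ^ 'n" and r :: real
    assume A: "ahlfors_regular \<Gamma> \<sigma> d C" and ell: "elliptic_matrix (- \<Gamma>) A C2"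
      and div: "weakly_div_free (- \<Gamma>)
        (\<lambda>X. Dbeta \<Gamma> \<sigma> d \<beta> X powr (d + 1 - real CARD('n)) *\<^sub>R
             (b X *\<^sub>R (transpose (A X) *v gradient (Dbeta \<Gamma> \<sigma> d \<beta>) X) + V X))"
      and b: "\<forall>X\<in>- \<Gamma>. inverse C1 \<le> b X \<and> b X \<le> C1" and wb: "weak_gradient (- \<Gamma>) b Db"
      and CMb: "in_CM \<Gamma> \<sigma> d (\<lambda>X. Dbeta \<Gamma> \<sigma> d \<beta> X *\<^sub>R Db X) C1"
      and V: "\<forall>X\<in>- \<Gamma>. norm (V X) \<le> C1" and CMV: "in_CM \<Gamma> \<sigma> d V C1"
      and x: "x \<in> \<Gamma>" and r: "0 < r" and sol: "weak_solution \<Gamma> \<sigma> d \<beta> \<gamma> A (ball x (2 * r) - \<Gamma>) u Du"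
    define U where "U = ball x (2 * r) - \<Gamma>"
    note AD = ahlfors_regularD[OF A]
    have ne: "\<Gamma> \<noteq> {}" using x by auto
    have oG: "open (- \<Gamma>)" using AD(2) by auto
    have U: "open U" "U \<subseteq> - \<Gamma>" unfolding U_def using AD(2) by (auto intro: open_Diff)
    let ?D = "Dbeta \<Gamma> \<sigma> d \<beta>"
    let ?h = "\<lambda>X. (norm (Du X))\<^sup>2 * ?D X powr (d + 2 - n)"
    define s where "s = esssup (lebesgue_on U) (\<lambda>X. ennreal (\<bar>u X\<bar>\<^sup>2))"
    have \<sigma>pos: "emeasure \<sigma> (ball x r) > 0"
      by (rule less_le_trans[OF _ AD(6)[OF x r]]) (use AD(1) r in simp)
    have "(\<integral>\<^sup>+ X. ennreal (?h X) * indicator (ball x r - \<Gamma>) X \<partial>lebesgue) \<le> ennreal M * s * emeasure \<sigma> (ball x r)"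
    proof (cases "s = top")
      case True
      \<comment> \<open>In \<open>ennreal\<close> the product of top with 0 is 0, so positivity of
        \<open>M\<close> and of the measure of the ball is essential here.\<close>
      then have "ennreal M * s * emeasure \<sigma> (ball x r) = top"
        using M \<sigma>pos by (simp add: ennreal_mult_top ennreal_top_mult)
      then show ?thesis by simp
    next
      case False
      define S where "S = enn2real s"
      have S: "s = ennreal S" "S \<ge> 0" using False by (auto simp: S_def less_top)
      have "AE X in lebesgue_on U. ennreal (\<bar>u X\<bar>\<^sup>2) \<le> ennreal S"
        using esssup_AE[of "\<lambda>X. ennreal (\<bar>u X\<bar>\<^sup>2)" "lebesgue_on U"] unfolding s_def[symmetric] S(1) .
      then have AES: "AE X in lebesgue. X \<in> U \<longrightarrow> (u X)\<^sup>2 \<le> S"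
        using U(1) S(2) by (subst (asm) AE_restrict_space_iff) (auto simp: ennreal_le_iff)
      have mDb: "meas_loc (- \<Gamma>) Db"
        using wb unfolding weak_gradient_def meas_loc_def set_integrable_def by (blast dest: borel_measurable_integrable)
      have mb: "meas_loc (- \<Gamma>) b"
        using wb unfolding weak_gradient_def meas_loc_def set_integrable_def by (blast dest: borel_measurable_integrable)
      have bb: "bdd_loc (- \<Gamma>) b"
        unfolding bdd_loc_def
      proof (intro conjI allI impI mb)
        fix K assume "compact K \<and> K \<subseteq> - \<Gamma>"
        then have KG: "K \<subseteq> - \<Gamma>" by blast
        have "\<bar>b X\<bar> \<le> C1" if "X \<in> K" for X
        proof -
          have "inverse C1 \<le> b X \<and> b X \<le> C1" using b KG that by blast
          moreover have "0 < inverse C1" using C1 by simp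
          ultimately show ?thesis by linarith
        qed
        then show "\<exists>B. AE X in lebesgue. X \<in> K \<longrightarrow> \<bar>b X\<bar> \<le> B" by (intro exI[of _ C1] AE_I2) auto
      qed
      \<comment> \<open>The Carleson condition includes boundedness of \<open>D\<close> times the
        gradient of \<open>b\<close>; dividing by \<open>D\<close>, which is continuous and positive
        off \<open>\<Gamma>\<close>, gives local boundedness of that gradient.\<close>
      have bDb: "bdd_loc (- \<Gamma>) (\<lambda>X. Db X $ i)" for i
      proof -
        have 1: "bdd_loc (- \<Gamma>) (\<lambda>X. ?D X powr (- 1) * (?D X *\<^sub>R Db X) $ i)"
          by (rule bdd_loc_mult[OF continuous_bdd_loc[OF oG Dbeta_powr_continuous[OF A ne d(1) \<beta> order_refl]] in_CM_meas_loc(2)[OF CMb AD(2)]])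
        have eq: "?D X powr (- 1) * (?D X *\<^sub>R Db X) $ i = Db X $ i" if "X \<in> - \<Gamma>" for X
          using Dbeta_bounds(3)[OF A ne _ d(1) \<beta>, of X] that by (simp add: powr_minus_divide)
        show ?thesis
          unfolding bdd_loc_def
        proof (intro conjI allI impI)
          show "meas_loc (- \<Gamma>) (\<lambda>X. Db X $ i)"
            by (rule meas_loc_nth[OF mDb])
          fix K assume K: "compact K \<and> K \<subseteq> - \<Gamma>"
          then obtain B where "AE X in lebesgue. X \<in> K \<longrightarrow> \<bar>?D X powr (- 1) * (?D X *\<^sub>R Db X) $ i\<bar> \<le> B"
            using 1 unfolding bdd_loc_def by blast
          then have "AE X in lebesgue. X \<in> K \<longrightarrow> \<bar>Db X $ i\<bar> \<le> B"
          proof eventually_elim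
            case (elim X)
            show ?case
            proof
              assume X: "X \<in> K"
              then have "X \<in> - \<Gamma>" using K by blast
              from elim X show "\<bar>Db X $ i\<bar> \<le> B" unfolding eq[OF \<open>X \<in> - \<Gamma>\<close>] by blast
            qed
          qed
          then show "\<exists>B. AE X in lebesgue. X \<in> K \<longrightarrow> \<bar>Db X $ i\<bar> \<le> B" by blast
        qed
      qed
      have Wb: "W1bdd_loc (- \<Gamma>) b Db" by (rule W1bdd_loc_I[OF wb bb bDb])
      have C2: "C2 > 0" using ell by (simp add: elliptic_matrix_def)
      have k0: "k \<ge> 0" using C1 C2 d \<beta> Dlow_Dup_pos(2)[OF AD(1) \<beta>, of d] unfolding k_def absorb_const_def
        by (intro mult_nonneg_nonneg add_nonneg_nonneg divide_nonneg_nonneg) auto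
      have N0: "N \<ge> 0" using C1 AD(1) by (simp add: N_def)
      have r2: "2 * r > 0" using r by simp
      have Nr: "Dlow C d \<beta> powr (d - n) * C1 * (C * (2 * r) powr d) = N * r powr d"
        using r by (simp add: N_def powr_mult)
      note N23 = in_CM_Dbeta_weight[OF A d \<beta> C1 _ x r2, folded n_def, unfolded Nr]
      define bound where "bound = ennreal (k * S) * (ennreal (Z * r powr d) + ennreal (N * r powr d) + ennreal (N * r powr d))"
      \<comment> \<open>A sequence of scales decreasing to 0 that respects
        \<open>8 * e \<le> r\<close> from its first term on.\<close>
      define e where "e j = r / (8 * real (Suc j))" for j
      have e: "0 < e j" "8 * e j \<le> r" for j using r by (auto simp: e_def field_simps)
      \<comment> \<open>The part of the ball where the cutoff of scale \<open>e j\<close> equals 1;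
        these sets increase to the whole ball without \<open>\<Gamma>\<close>.\<close>
      define Q where "Q j = {X \<in> ball x r - \<Gamma>. 3 * e j \<le> infdist X \<Gamma>}" for j
      have step: "(\<integral>\<^sup>+ X. ennreal (?h X) * indicator (Q j) X \<partial>lebesgue) \<le> bound" for j
      proof -
        obtain \<psi> where \<psi>: "test_function U \<psi>" "\<And>X. 0 \<le> \<psi> X \<and> \<psi> X \<le> 1"
          "\<And>X. X \<in> ball x r \<Longrightarrow> 3 * e j \<le> infdist X \<Gamma> \<Longrightarrow> \<psi> X = 1"
          "(\<integral>\<^sup>+ X. indicator U X * ennreal (?D X powr (d - real CARD('n)) *
            ((?D X * norm (gradient \<psi> X))\<^sup>2 + ?D X * norm (gradient \<psi> X))) \<partial>lebesgue) \<le> ennreal (Z * r powr d)"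
          using cut[rule_format, OF conjI[OF A conjI[OF x conjI[OF e[of j]]]]] unfolding U_def[symmetric]
          by (elim exE conjE) (rule that, blast+)
        have "(\<integral>\<^sup>+ X. ennreal (?h X) * indicator (Q j) X \<partial>lebesgue)
          \<le> (\<integral>\<^sup>+ X. indicator U X * ennreal ((\<psi> X)\<^sup>2 * ?h X) \<partial>lebesgue)"
        proof (rule nn_integral_mono)
          fix X
          show "ennreal (?h X) * indicator (Q j) X \<le> indicator U X * ennreal ((\<psi> X)\<^sup>2 * ?h X)"
          proof (cases "X \<in> Q j")
            case True
            then have "\<psi> X = 1" "X \<in> U" using \<psi>(3)[of X] r by (auto simp: Q_def U_def)
            then show ?thesis using True by simp
          qed simp
        qed
        also have "\<dots> \<le> bound"
          unfolding bound_def k_def n_def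
          by (rule energy_cutoff[OF A ne d(1) \<beta> \<gamma> C1 ell div _ Wb _ in_CM_meas_loc(2)[OF CMV AD(2)] in_CM_meas_loc(1)[OF CMV AD(2)] mDb U _ AES S(2) \<psi>(1,2,4)
              N23[OF CMb, folded U_def, unfolded n_def] N23[OF CMV, folded U_def, unfolded n_def]])
            (use b V sol in \<open>auto simp: U_def\<close>)
        finally show ?thesis .
      qed
      have mh: "(\<lambda>X. ennreal (?h X) * indicator (Q j) X) \<in> borel_measurable lebesgue" for j
      proof -
        have Qj: "Q j = U \<inter> (ball x r \<inter> {X. 3 * e j \<le> infdist X \<Gamma>})" using r by (auto simp: Q_def U_def)
        have "(\<lambda>X. indicator U X * ennreal (?h X)) \<in> borel_measurable lebesgue"
        proof (rule meas_loc_ennreal[OF U(1)], rule meas_loc_mult)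
          have "meas_loc U Du"
            using sol unfolding U_def weak_solution_def W12_loc_def weak_gradient_def meas_loc_def set_integrable_def
            by (blast dest: borel_measurable_integrable)
          then show "meas_loc U (\<lambda>X. (norm (Du X))\<^sup>2)" by (intro meas_loc_power2 meas_loc_norm)
          show "meas_loc U (\<lambda>X. ?D X powr (d + 2 - n))"
            by (rule continuous_meas_loc[OF U(1) Dbeta_powr_continuous[OF A ne d(1) \<beta> U(2)]])
        qed
        moreover have "ball x r \<inter> {X. 3 * e j \<le> infdist X \<Gamma>} \<in> sets lebesgue"
        proof -
          have "closed {X. 3 * e j \<le> infdist X \<Gamma>}" by (intro closed_Collect_le continuous_intros)
          then show ?thesis by (intro sets.Int) (auto intro: borel_closed)
        qed
        ultimately have "(\<lambda>X. (indicator U X * ennreal (?h X)) * indicator (ball x r \<inter> {X. 3 * e j \<le> infdist X \<Gamma>}) X) \<in> borel_measurable lebesgue"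
          by - (rule borel_measurable_times_ennreal, assumption, rule borel_measurable_indicator)
        moreover have "(indicator U X * ennreal (?h X)) * indicator (ball x r \<inter> {X. 3 * e j \<le> infdist X \<Gamma>}) X = ennreal (?h X) * indicator (Q j) X" for X
          unfolding Qj by (simp add: indicator_def)
        ultimately show ?thesis by simp
      qed
      have inc: "Q i \<subseteq> Q j" if "i \<le> j" for i j
      proof -
        have "e j \<le> e i" unfolding e_def using r that by (intro divide_left_mono) auto
        then show ?thesis by (auto simp: Q_def)
      qed
      have sup: "(SUP j. ennreal (?h X) * indicator (Q j) X) = ennreal (?h X) * indicator (ball x r - \<Gamma>) X" for X
      proof (cases "X \<in> ball x r - \<Gamma>")
        case True
        have t: "infdist X \<Gamma> > 0" by (rule infdist_pos[OF AD(2) ne]) (use True in auto)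
        obtain j where j: "3 * r / (8 * infdist X \<Gamma>) < real j" using reals_Archimedean2 by blast
        have "3 * e j \<le> infdist X \<Gamma>"
        proof -
          have "3 * r < real j * (8 * infdist X \<Gamma>)" using j t by (simp add: pos_divide_less_eq)
          also have "\<dots> \<le> real (Suc j) * (8 * infdist X \<Gamma>)" using t by (intro mult_right_mono) auto
          finally have "3 * r \<le> infdist X \<Gamma> * (8 * real (Suc j))" by (simp add: mult_ac)
          then have "3 * r / (8 * real (Suc j)) \<le> infdist X \<Gamma>" by (subst pos_divide_le_eq) auto
          then show ?thesis by (simp add: e_def)
        qed
        then have "X \<in> Q j" using True by (simp add: Q_def)
        then have "ennreal (?h X) * indicator (ball x r - \<Gamma>) X \<le> (SUP j. ennreal (?h X) * indicator (Q j) X)"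
          using True by (intro SUP_upper2[of j]) auto
        moreover have "(SUP j. ennreal (?h X) * indicator (Q j) X) \<le> ennreal (?h X) * indicator (ball x r - \<Gamma>) X"
          using True by (intro SUP_least) (auto simp: indicator_def)
        ultimately show ?thesis by (rule order.antisym[rotated])
      next
        case False
        then have "X \<notin> Q j" for j by (auto simp: Q_def)
        then show ?thesis using False by simp
      qed
      have "(\<integral>\<^sup>+ X. ennreal (?h X) * indicator (ball x r - \<Gamma>) X \<partial>lebesgue) = (\<integral>\<^sup>+ X. (SUP j. ennreal (?h X) * indicator (Q j) X) \<partial>lebesgue)"
        by (simp only: sup)
      also have "\<dots> = (SUP j. \<integral>\<^sup>+ X. ennreal (?h X) * indicator (Q j) X \<partial>lebesgue)"
        by (rule nn_integral_monotone_convergence_SUP[OF _ mh])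
          (use inc in \<open>auto simp: incseq_def le_fun_def indicator_def\<close>)
      also have "\<dots> \<le> bound" by (rule SUP_least[OF step])
      also have "bound = ennreal (k * S * ((Z + 2 * N) * r powr d))"
      proof -
        have "ennreal (Z * r powr d) + ennreal (N * r powr d) + ennreal (N * r powr d) = ennreal ((Z + 2 * N) * r powr d)"
          using Z N0 by (simp add: ennreal_plus[symmetric] distrib_right del: ennreal_plus)
        then show ?thesis unfolding bound_def using k0 S(2) Z N0 by (simp add: ennreal_mult[symmetric])
      qed
      \<comment> \<open>The factor \<open>C\<close> built into \<open>M\<close> pays for replacing
        the power of \<open>r\<close> by the lower Ahlfors bound.\<close>
      also have "\<dots> \<le> ennreal (M * S * (inverse C * r powr d))"
      proof (rule ennreal_leI)
        have "k * (Z + 2 * N) * C * (S * (inverse C * r powr d)) \<le> M * (S * (inverse C * r powr d))"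
          using S(2) AD(1) by (intro mult_right_mono) (auto simp: M_def)
        moreover have "k * (Z + 2 * N) * C * (S * (inverse C * r powr d)) = k * S * ((Z + 2 * N) * r powr d)"
          using AD(1) by (simp add: field_simps)
        ultimately have "k * S * ((Z + 2 * N) * r powr d) \<le> M * (S * (inverse C * r powr d))" by (simp only:)
        then show "k * S * ((Z + 2 * N) * r powr d) \<le> M * S * (inverse C * r powr d)" by (simp only: mult.assoc)
      qed
      also have "\<dots> = ennreal M * s * ennreal (inverse C * r powr d)"
        unfolding S(1) using M S(2) AD(1) by (simp add: ennreal_mult)
      also have "\<dots> \<le> ennreal M * s * emeasure \<sigma> (ball x r)" by (intro mult_left_mono AD(6)[OF x r]) simp
      finally show ?thesis .
    qed
    then show "(\<integral>\<^sup>+ X \<in> ball x r - \<Gamma>.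
             ennreal ((norm (Du X))\<^sup>2 * Dbeta \<Gamma> \<sigma> d \<beta> X powr (d + 2 - real CARD('n))) \<partial>lebesgue)
         \<le> ennreal M * esssup (lebesgue_on (ball x (2 * r) - \<Gamma>)) (\<lambda>X. ennreal (\<bar>u X\<bar>\<^sup>2))
             * emeasure \<sigma> (ball x r)"
      unfolding n_def s_def U_def .
  qed
qed

section \<open>Limits of weak solutions\<close>

lemma weak_solution_iff:
  fixes \<Gamma> :: "(real ^ 'n::finite) set"
  shows "weak_solution \<Gamma> \<sigma> d \<beta> \<gamma> A U u g \<longleftrightarrow> W12_loc U u g \<and>
    (\<forall>\<phi>. test_function U \<phi> \<longrightarrow> (LINT X|lebesgue. ((A X *v g X) \<bullet> gradient \<phi> X) * Dbeta \<Gamma> \<sigma> d \<beta> X powr (d + 1 + \<gamma> - real CARD('n))) = 0)"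
proof -
  have "(LINT X:U|lebesgue. ((A X *v g X) \<bullet> gradient \<phi> X) * Dbeta \<Gamma> \<sigma> d \<beta> X powr (d + 1 + \<gamma> - real CARD('n)))
      = (LINT X|lebesgue. ((A X *v g X) \<bullet> gradient \<phi> X) * Dbeta \<Gamma> \<sigma> d \<beta> X powr (d + 1 + \<gamma> - real CARD('n)))"
    if t: "test_function U \<phi>" for \<phi>
  proof -
    obtain K where K: "compact K" "K \<subseteq> U" "\<And>x. x \<notin> K \<Longrightarrow> \<phi> x = 0" "\<And>x. x \<notin> K \<Longrightarrow> gradient \<phi> x = 0"
      using test_function_support[OF t] by metis
    show ?thesis unfolding set_lebesgue_integral_def
    proof (rule Bochner_Integration.integral_cong[OF refl])
      fix X
      show "indicator U X *\<^sub>R (((A X *v g X) \<bullet> gradient \<phi> X) * Dbeta \<Gamma> \<sigma> d \<beta> X powr (d + 1 + \<gamma> - real CARD('n)))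
        = ((A X *v g X) \<bullet> gradient \<phi> X) * Dbeta \<Gamma> \<sigma> d \<beta> X powr (d + 1 + \<gamma> - real CARD('n))"
        using K(2) K(4)[of X] by (cases "X \<in> K") auto
    qed
  qed
  then show ?thesis unfolding weak_solution_def by auto
qed

lemma W12_loc_subset:
  assumes "W12_loc V u g" "open V" "open U" "U \<subseteq> V"
  shows "W12_loc U u g"
  using assms weak_gradient_subset[OF _ assms(2-4)] unfolding W12_loc_def by blast

lemma weak_solution_subset:
  fixes \<Gamma> :: "(real ^ 'n::finite) set"
  assumes "weak_solution \<Gamma> \<sigma> d \<beta> \<gamma> A V u g" "open V" "open U" "U \<subseteq> V"
  shows "weak_solution \<Gamma> \<sigma> d \<beta> \<gamma> A U u g"
  using assms W12_loc_subset[OF _ assms(2-4)] test_function_mono[OF _ assms(4)] unfolding weak_solution_iff by blast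

lemma weak_gradient_cong:
  fixes u :: "real ^ 'n::finite \<Rightarrow> real"
  assumes "\<And>x. x \<in> U \<Longrightarrow> u x = v x"
  shows "weak_gradient U u g \<longleftrightarrow> weak_gradient U v g"
proof -
  have 1: "u absolutely_integrable_on K \<longleftrightarrow> v absolutely_integrable_on K" if "K \<subseteq> U" for K
    unfolding set_integrable_def
    by (rule Bochner_Integration.integrable_cong[OF refl]) (use assms that in \<open>auto simp: indicator_def\<close>)
  have 2: "(LINT x:U|lebesgue. u x *\<^sub>R gradient \<phi> x) = (LINT x:U|lebesgue. v x *\<^sub>R gradient \<phi> x)" for \<phi>
    unfolding set_lebesgue_integral_def
    by (rule Bochner_Integration.integral_cong[OF refl]) (use assms in \<open>auto simp: indicator_def\<close>)
  show ?thesis unfolding weak_gradient_def using 1 2 by auto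
qed

lemma weak_solution_cong:
  fixes \<Gamma> :: "(real ^ 'n::finite) set"
  assumes "\<And>x. x \<in> U \<Longrightarrow> u x = v x"
  shows "weak_solution \<Gamma> \<sigma> d \<beta> \<gamma> A U u g \<longleftrightarrow> weak_solution \<Gamma> \<sigma> d \<beta> \<gamma> A U v g"
proof -
  have 1: "(\<lambda>x. \<bar>u x\<bar>\<^sup>2) absolutely_integrable_on K \<longleftrightarrow> (\<lambda>x. \<bar>v x\<bar>\<^sup>2) absolutely_integrable_on K" if "K \<subseteq> U" for K
    unfolding set_integrable_def
    by (rule Bochner_Integration.integrable_cong[OF refl]) (use assms that in \<open>auto simp: indicator_def\<close>)
  have "weak_gradient U u g \<longleftrightarrow> weak_gradient U v g" by (rule weak_gradient_cong) (rule assms)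
  then show ?thesis unfolding weak_solution_iff W12_loc_def using 1 by auto
qed

lemma flux_integrable:
  fixes \<Gamma> :: "(real ^ 'n::finite) set"
  assumes A: "ahlfors_regular \<Gamma> \<sigma> d C" and ne: "\<Gamma> \<noteq> {}" and d: "d > 0" and \<beta>: "\<beta> > 0"
    and ell: "elliptic_matrix (- \<Gamma>) A C2" and U: "open U" "U \<subseteq> - \<Gamma>"
    and g: "\<And>i. L2_loc U (\<lambda>x. g x $ i)" and t: "test_function U \<phi>"
  shows "integrable lebesgue (\<lambda>X. ((A X *v g X) \<bullet> gradient \<phi> X) * Dbeta \<Gamma> \<sigma> d \<beta> X powr s)"
proof -
  obtain K where K: "compact K" "K \<subseteq> U" "\<And>x. x \<notin> K \<Longrightarrow> \<phi> x = 0" "\<And>x. x \<notin> K \<Longrightarrow> gradient \<phi> x = 0"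
    using test_function_support[OF t] by metis
  have oG: "open (- \<Gamma>)" using ahlfors_regularD[OF A] by auto
  have bA: "bdd_loc U (\<lambda>X. A X $ i $ j)" for i j
    by (rule bdd_loc_subset[OF elliptic_matrix_entries[OF oG ell] U(2)])
  have b: "bdd_loc U (\<lambda>X. gradient \<phi> X $ i * Dbeta \<Gamma> \<sigma> d \<beta> X powr s)" for i
    by (intro bdd_loc_mult test_function_W12_loc(3)[OF U(1) t] continuous_bdd_loc[OF U(1) Dbeta_powr_continuous[OF A ne d \<beta> U(2)]])
  have "integrable lebesgue (\<lambda>X. \<Sum>i\<in>UNIV. indicator K X * ((A X *v g X) $ i * (gradient \<phi> X $ i * Dbeta \<Gamma> \<sigma> d \<beta> X powr s)))"
    by (intro Bochner_Integration.integrable_sum L2_loc_prod_integrable[OF L2_loc_matrix_vector[OF bA g] bdd_loc_L2_loc[OF b] K(1,2)])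
  moreover have "(\<lambda>X. \<Sum>i\<in>UNIV. indicator K X * ((A X *v g X) $ i * (gradient \<phi> X $ i * Dbeta \<Gamma> \<sigma> d \<beta> X powr s)))
    = (\<lambda>X. ((A X *v g X) \<bullet> gradient \<phi> X) * Dbeta \<Gamma> \<sigma> d \<beta> X powr s)"
  proof
    fix X
    have "(\<Sum>i\<in>UNIV. indicator K X * ((A X *v g X) $ i * (gradient \<phi> X $ i * Dbeta \<Gamma> \<sigma> d \<beta> X powr s)))
      = indicator K X * (((A X *v g X) \<bullet> gradient \<phi> X) * Dbeta \<Gamma> \<sigma> d \<beta> X powr s)"
      by (simp add: inner_vec_def sum_distrib_left sum_distrib_right mult_ac)
    also have "\<dots> = ((A X *v g X) \<bullet> gradient \<phi> X) * Dbeta \<Gamma> \<sigma> d \<beta> X powr s"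
      using K(4)[of X] by (cases "X \<in> K") auto
    finally show "(\<Sum>i\<in>UNIV. indicator K X * ((A X *v g X) $ i * (gradient \<phi> X $ i * Dbeta \<Gamma> \<sigma> d \<beta> X powr s)))
      = ((A X *v g X) \<bullet> gradient \<phi> X) * Dbeta \<Gamma> \<sigma> d \<beta> X powr s" .
  qed
  ultimately show ?thesis by simp
qed

lemma W12_loc_lincomb:
  fixes u v :: "real ^ 'n::finite \<Rightarrow> real"
  assumes u: "W12_loc U u g" and v: "W12_loc U v h"
  shows "W12_loc U (\<lambda>x. a * u x + b * v x) (\<lambda>x. a *\<^sub>R g x + b *\<^sub>R h x)"
proof (rule W12_loc_I)
  have wu: "weak_gradient U u g" and wv: "weak_gradient U v h" using u v by (auto simp: W12_loc_def)
  show c1: "L2_loc U (\<lambda>x. a * u x + b * v x)"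
    by (intro L2_loc_add L2_loc_bdd_mult bdd_loc_const W12_loc_L2(1)[OF u] W12_loc_L2(1)[OF v])
  show c2: "L2_loc U (\<lambda>x. (a *\<^sub>R g x + b *\<^sub>R h x) $ i)" for i
    unfolding vector_add_component vector_scaleR_component real_scaleR_def
    by (intro L2_loc_add L2_loc_bdd_mult bdd_loc_const W12_loc_L2(2)[OF u] W12_loc_L2(2)[OF v])
  show "weak_gradient U (\<lambda>x. a * u x + b * v x) (\<lambda>x. a *\<^sub>R g x + b *\<^sub>R h x)"
  proof (rule weak_gradientI)
    fix \<phi> :: "real ^ 'n \<Rightarrow> real" and i assume t: "test_function U \<phi>"
    note tu = weak_gradient_test[OF wu t, of i] and tv = weak_gradient_test[OF wv t, of i]
    have "(LINT x|lebesgue. (a * u x + b * v x) * gradient \<phi> x $ i)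
      = (LINT x|lebesgue. a * (u x * gradient \<phi> x $ i) + b * (v x * gradient \<phi> x $ i))"
      by (rule Bochner_Integration.integral_cong[OF refl]) (simp add: algebra_simps)
    also have "\<dots> = - (LINT x|lebesgue. a * (\<phi> x * g x $ i) + b * (\<phi> x * h x $ i))"
      using tu tv by simp
    also have "(LINT x|lebesgue. a * (\<phi> x * g x $ i) + b * (\<phi> x * h x $ i)) = (LINT x|lebesgue. \<phi> x * (a *\<^sub>R g x + b *\<^sub>R h x) $ i)"
      by (rule Bochner_Integration.integral_cong[OF refl]) (simp add: algebra_simps)
    finally show "(LINT x|lebesgue. (a * u x + b * v x) * gradient \<phi> x $ i) = - (LINT x|lebesgue. \<phi> x * (a *\<^sub>R g x + b *\<^sub>R h x) $ i)" .
  qed (use L2_loc_abs_integrable[OF c1] L2_loc_abs_integrable[OF c2] in auto)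
qed

lemma weak_solution_lincomb:
  fixes \<Gamma> :: "(real ^ 'n::finite) set"
  assumes A: "ahlfors_regular \<Gamma> \<sigma> d C" and ne: "\<Gamma> \<noteq> {}" and d: "d > 0" and \<beta>: "\<beta> > 0"
    and ell: "elliptic_matrix (- \<Gamma>) A C2" and U: "open U" "U \<subseteq> - \<Gamma>"
    and u: "weak_solution \<Gamma> \<sigma> d \<beta> \<gamma> A U u g" and v: "weak_solution \<Gamma> \<sigma> d \<beta> \<gamma> A U v h"
  shows "weak_solution \<Gamma> \<sigma> d \<beta> \<gamma> A U (\<lambda>x. a * u x + b * v x) (\<lambda>x. a *\<^sub>R g x + b *\<^sub>R h x)"
  unfolding weak_solution_iff
proof (intro conjI allI impI)
  let ?w = "\<lambda>X. Dbeta \<Gamma> \<sigma> d \<beta> X powr (d + 1 + \<gamma> - real CARD('n))"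
  have Wu: "W12_loc U u g" and Wv: "W12_loc U v h" using u v by (auto simp: weak_solution_iff)
  show "W12_loc U (\<lambda>x. a * u x + b * v x) (\<lambda>x. a *\<^sub>R g x + b *\<^sub>R h x)" by (rule W12_loc_lincomb[OF Wu Wv])
  fix \<phi> :: "real ^ 'n \<Rightarrow> real" assume t: "test_function U \<phi>"
  note iu = flux_integrable[OF A ne d \<beta> ell U W12_loc_L2(2)[OF Wu] t] and iv = flux_integrable[OF A ne d \<beta> ell U W12_loc_L2(2)[OF Wv] t]
  have "(LINT X|lebesgue. ((A X *v (a *\<^sub>R g X + b *\<^sub>R h X)) \<bullet> gradient \<phi> X) * ?w X)
    = (LINT X|lebesgue. a * (((A X *v g X) \<bullet> gradient \<phi> X) * ?w X) + b * (((A X *v h X) \<bullet> gradient \<phi> X) * ?w X))"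
  proof (rule Bochner_Integration.integral_cong[OF refl])
    fix X
    have "A X *v (a *\<^sub>R g X + b *\<^sub>R h X) = a *\<^sub>R (A X *v g X) + b *\<^sub>R (A X *v h X)"
      by (simp add: matrix_vector_right_distrib matrix_vector_mult_scaleR)
    then show "((A X *v (a *\<^sub>R g X + b *\<^sub>R h X)) \<bullet> gradient \<phi> X) * ?w X
      = a * (((A X *v g X) \<bullet> gradient \<phi> X) * ?w X) + b * (((A X *v h X) \<bullet> gradient \<phi> X) * ?w X)"
      by (simp only: inner_add_left inner_scaleR_left) (simp add: algebra_simps)
  qed
  also have "\<dots> = a * (LINT X|lebesgue. ((A X *v g X) \<bullet> gradient \<phi> X) * ?w X) + b * (LINT X|lebesgue. ((A X *v h X) \<bullet> gradient \<phi> X) * ?w X)"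
    using iu iv by simp
  also have "\<dots> = 0" using u v t by (simp add: weak_solution_iff)
  finally show "(LINT X|lebesgue. ((A X *v (a *\<^sub>R g X + b *\<^sub>R h X)) \<bullet> gradient \<phi> X) * ?w X) = 0" .
qed

lemma weak_solution_const:
  fixes \<Gamma> :: "(real ^ 'n::finite) set"
  assumes U: "open U"
  shows "weak_solution \<Gamma> \<sigma> d \<beta> \<gamma> A U (\<lambda>_. c) (\<lambda>_. 0)"
  unfolding weak_solution_iff
proof (intro conjI allI impI)
  show "W12_loc U (\<lambda>_. c) (\<lambda>_. 0)"
    by (rule GDERIV_W12_loc[OF U GDERIV_const]) auto
qed simp

text \<open>Test with \<open>v \<psi>\<^sup>2\<close> for a cutoff \<open>\<psi>\<close>.\<close>

lemma Caccioppoli: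
  fixes \<Gamma> :: "(real ^ 'n::finite) set"
  assumes A: "ahlfors_regular \<Gamma> \<sigma> d C" and ne: "\<Gamma> \<noteq> {}" and d: "d > 0" and \<beta>: "\<beta> > 0"
    and ell: "elliptic_matrix (- \<Gamma>) A C2" and U: "open U" "U \<subseteq> - \<Gamma>" and K: "compact K" "K \<subseteq> U"
  shows "\<exists>c K'. 0 \<le> c \<and> compact K' \<and> K' \<subseteq> U \<and> (\<forall>v g. weak_solution \<Gamma> \<sigma> d \<beta> \<gamma> A U v g \<and> bdd_loc U v \<longrightarrow>
    (LINT X|lebesgue. indicator K X * (norm (g X))\<^sup>2) \<le> c * (LINT X|lebesgue. indicator K' X * (v X)\<^sup>2))"
proof -
  have C2: "C2 > 0" using ell by (simp add: elliptic_matrix_def)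
  define w where "w X = Dbeta \<Gamma> \<sigma> d \<beta> X powr (d + 1 + \<gamma> - real CARD('n))" for X
  have cw: "continuous_on U w" unfolding w_def by (rule Dbeta_powr_continuous[OF A ne d \<beta> U(2)])
  have wpos: "w X > 0" if "X \<in> U" for X
    unfolding w_def using Dbeta_bounds(3)[OF A ne _ d \<beta>, of X] that U(2) by auto
  obtain \<psi> W where \<psi>: "test_function U \<psi>" "\<And>x. 0 \<le> \<psi> x" "\<And>x. \<psi> x \<le> 1" "open W" "K \<subseteq> W" "\<And>x. x \<in> W \<Longrightarrow> \<psi> x = 1"
    using smooth_cutoff[OF K(1) U(1) K(2)] by metis
  obtain K' where K': "compact K'" "K' \<subseteq> U" "\<And>x. x \<notin> K' \<Longrightarrow> \<psi> x = 0" "\<And>x. x \<notin> K' \<Longrightarrow> gradient \<psi> x = 0"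
    using test_function_support[OF \<psi>(1)] by metis
  have KK': "K \<subseteq> K'" using \<psi>(5,6) K'(3) by (metis subsetD subsetI zero_neq_one)
  \<comment> \<open>The weight is positive and continuous, so it has a positive minimum on
    \<open>K\<close>; for empty \<open>K\<close> any positive number will do.\<close>
  obtain w0 where w0: "w0 > 0" "\<And>X. X \<in> K \<Longrightarrow> w0 \<le> w X"
  proof (cases "K = {}")
    case False
    obtain X0 where "X0 \<in> K" "\<And>X. X \<in> K \<Longrightarrow> w X0 \<le> w X"
      using continuous_attains_inf[OF K(1) False continuous_on_subset[OF cw K(2)]] by blast
    then show ?thesis using that wpos K(2) by blast
  qed (use that[of 1] in auto)
  obtain w1 where w1: "\<And>X. X \<in> K' \<Longrightarrow> \<bar>w X\<bar> \<le> w1"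
    using compact_imp_bounded[OF compact_continuous_image[OF continuous_on_subset[OF cw K'(2)] K'(1)]] by (auto simp: bounded_iff)
  obtain B where B: "B > 0" "\<And>x. norm (gradient \<psi> x) \<le> B" using test_function_bounded[OF \<psi>(1)] by metis
  \<comment> \<open>The bracket bounds the cutoff term left after absorption, and the factor in
    front inverts the coercivity \<open>w0 / (2 * C2)\<close>. The solution does not enter, so one
    constant serves all differences of solutions.\<close>
  define c where "c = 2 * C2 / w0 * (2 * C2 ^ 3 * B\<^sup>2 * \<bar>w1\<bar>)"
  show ?thesis
  proof (intro exI[of _ c] exI[of _ K'] conjI allI impI)
    show "0 \<le> c" unfolding c_def
      by (intro mult_nonneg_nonneg divide_nonneg_nonneg zero_le_power zero_le_power2 abs_ge_zero less_imp_le[OF C2] less_imp_le[OF w0(1)]) simp_all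
    fix v g assume "weak_solution \<Gamma> \<sigma> d \<beta> \<gamma> A U v g \<and> bdd_loc U v"
    then have sol: "weak_solution \<Gamma> \<sigma> d \<beta> \<gamma> A U v g" and bv: "bdd_loc U v" by auto
    have Wv: "W12_loc U v g" using sol by (simp add: weak_solution_def)
    note v2 = W12_loc_L2[OF Wv]
    have W\<psi>: "W1bdd_loc U \<psi> (gradient \<psi>)"
      using test_function_W12_loc[OF U(1) \<psi>(1)] by (simp add: W1bdd_loc_def)
    note W\<psi>2 = W1bdd_loc_mult[OF U(1) W\<psi> W\<psi>]
    define D\<theta> where "D\<theta> x = \<psi> x *\<^sub>R gradient \<psi> x + \<psi> x *\<^sub>R gradient \<psi> x" for x
    define E where "E X = ((A X *v g X) \<bullet> ((\<psi> X * \<psi> X) *\<^sub>R g X + v X *\<^sub>R D\<theta> X)) * w X" for X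
    have E: "integrable lebesgue E" "(LINT X|lebesgue. E X) = 0"
      unfolding E_def[abs_def] w_def
      by (rule weak_solution_test[OF A ne d \<beta> ell U sol bv _ _ _ K'(1,2)];
          use W\<psi>2 K'(3,4) in \<open>simp add: W1bdd_loc_def D\<theta>_def[abs_def]\<close>)+
    define gK where "gK X = indicator K X * (norm (g X))\<^sup>2" for X
    have igK: "integrable lebesgue gK"
      using Wv K unfolding W12_loc_def gK_def[abs_def] by (auto simp: set_integrable_def)
    have ivK: "integrable lebesgue (\<lambda>X. indicator K' X * (v X)\<^sup>2)" using v2(1) K'(1,2) by (auto simp: L2_loc_def)
    have pw: "w0 / (2 * C2) * gK X \<le> E X + 2 * C2 ^ 3 * B\<^sup>2 * \<bar>w1\<bar> * (indicator K' X * (v X)\<^sup>2)" for X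
    proof (cases "X \<in> K'")
      case True
      then have XU: "X \<in> U" using K'(2) by auto
      then have XG: "X \<in> - \<Gamma>" using U(2) by auto
      have wX: "w X > 0" by (rule wpos[OF XU])
      define G where "G = \<psi> X * norm (g X)"
      define y where "y = C2 * \<bar>v X\<bar> * norm (gradient \<psi> X)"
      have e1: "inverse C2 * (norm (g X))\<^sup>2 \<le> (A X *v g X) \<bullet> g X" using ell XG unfolding elliptic_matrix_def by blast
      have e2: "\<bar>(A X *v g X) \<bullet> gradient \<psi> X\<bar> \<le> C2 * norm (g X) * norm (gradient \<psi> X)" using ell XG unfolding elliptic_matrix_def by blast
      have "E X = ((\<psi> X)\<^sup>2 * ((A X *v g X) \<bullet> g X) + 2 * v X * \<psi> X * ((A X *v g X) \<bullet> gradient \<psi> X)) * w X"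
        unfolding E_def D\<theta>_def by (simp only: inner_add_right inner_scaleR_right) (simp add: algebra_simps power2_eq_square)
      moreover have "(\<psi> X)\<^sup>2 * ((A X *v g X) \<bullet> g X) \<ge> inverse C2 * G\<^sup>2"
        using mult_left_mono[OF e1, of "(\<psi> X)\<^sup>2"] by (simp add: G_def power_mult_distrib mult_ac)
      \<comment> \<open>Young with parameter \<open>inverse (2 * C2)\<close> spends half of the
        coercive term.\<close>
      moreover have "2 * v X * \<psi> X * ((A X *v g X) \<bullet> gradient \<psi> X) \<ge> - (inverse (2 * C2) * G\<^sup>2 + y\<^sup>2 / inverse (2 * C2))"
      proof -
        have "\<bar>2 * v X * \<psi> X * ((A X *v g X) \<bullet> gradient \<psi> X)\<bar> = 2 * \<bar>v X\<bar> * \<psi> X * \<bar>(A X *v g X) \<bullet> gradient \<psi> X\<bar>"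
          using \<psi>(2)[of X] by (simp add: abs_mult)
        also have "\<dots> \<le> 2 * \<bar>v X\<bar> * \<psi> X * (C2 * norm (g X) * norm (gradient \<psi> X))"
          using \<psi>(2)[of X] by (intro mult_left_mono e2) auto
        also have "\<dots> = 2 * G * y" by (simp add: G_def y_def mult_ac)
        also have "\<dots> \<le> inverse (2 * C2) * G\<^sup>2 + y\<^sup>2 / inverse (2 * C2)" using C2 by (intro two_mult_le) simp
        finally show ?thesis by linarith
      qed
      moreover have "inverse C2 * G\<^sup>2 = inverse (2 * C2) * G\<^sup>2 + inverse (2 * C2) * G\<^sup>2" "y\<^sup>2 / inverse (2 * C2) = 2 * C2 * y\<^sup>2"
        using C2 by (simp_all add: field_simps)
      ultimately have "E X = ((\<psi> X)\<^sup>2 * ((A X *v g X) \<bullet> g X) + 2 * v X * \<psi> X * ((A X *v g X) \<bullet> gradient \<psi> X)) * w X"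
        "inverse (2 * C2) * G\<^sup>2 - 2 * C2 * y\<^sup>2 \<le> (\<psi> X)\<^sup>2 * ((A X *v g X) \<bullet> g X) + 2 * v X * \<psi> X * ((A X *v g X) \<bullet> gradient \<psi> X)"
        by linarith+
      then have "E X \<ge> (inverse (2 * C2) * G\<^sup>2 - 2 * C2 * y\<^sup>2) * w X"
        using mult_right_mono[OF _ less_imp_le[OF wX]] by (simp only:)
      moreover have "2 * C2 * y\<^sup>2 * w X \<le> 2 * C2 ^ 3 * B\<^sup>2 * \<bar>w1\<bar> * (v X)\<^sup>2"
      proof -
        have "(norm (gradient \<psi> X))\<^sup>2 * w X \<le> B\<^sup>2 * \<bar>w1\<bar>"
          using B(2)[of X] w1[OF True] wX by (intro mult_mono power_mono) auto
        then have "2 * C2 ^ 3 * (v X)\<^sup>2 * ((norm (gradient \<psi> X))\<^sup>2 * w X) \<le> 2 * C2 ^ 3 * (v X)\<^sup>2 * (B\<^sup>2 * \<bar>w1\<bar>)"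
          using C2 by (intro mult_left_mono) auto
        moreover have "y\<^sup>2 = C2\<^sup>2 * (v X)\<^sup>2 * (norm (gradient \<psi> X))\<^sup>2" by (simp add: y_def power_mult_distrib)
        ultimately show ?thesis by (simp add: power2_eq_square power3_eq_cube mult_ac)
      qed
      moreover have "w0 / (2 * C2) * gK X \<le> inverse (2 * C2) * G\<^sup>2 * w X"
      proof (cases "X \<in> K")
        case True
        then have "\<psi> X = 1" using \<psi>(5,6) by blast
        then have "inverse (2 * C2) * G\<^sup>2 * w0 \<le> inverse (2 * C2) * G\<^sup>2 * w X"
          by (intro mult_left_mono w0(2)[OF True] mult_nonneg_nonneg zero_le_power2) (use C2 in simp)
        moreover have "gK X = G\<^sup>2" using True \<open>\<psi> X = 1\<close> by (simp add: gK_def G_def)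
        moreover have "w0 / (2 * C2) * G\<^sup>2 = inverse (2 * C2) * G\<^sup>2 * w0" by (simp only: divide_inverse mult_ac)
        ultimately show ?thesis by (simp only:)
      next
        case False
        then show ?thesis using C2 wX by (simp add: gK_def)
      qed
      moreover have "(inverse (2 * C2) * G\<^sup>2 - 2 * C2 * y\<^sup>2) * w X = inverse (2 * C2) * G\<^sup>2 * w X - 2 * C2 * y\<^sup>2 * w X"
        by (rule left_diff_distrib)
      moreover have "indicator K' X * (v X)\<^sup>2 = (v X)\<^sup>2" using True by simp
      ultimately show ?thesis by (simp only:)
    next
      case False
      then have "X \<notin> K" using KK' by auto
      then show ?thesis using False K'(3,4) by (simp add: gK_def E_def D\<theta>_def)
    qed
    have "w0 / (2 * C2) * (LINT X|lebesgue. gK X) = (LINT X|lebesgue. w0 / (2 * C2) * gK X)" by simp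
    also have "\<dots> \<le> (LINT X|lebesgue. E X + 2 * C2 ^ 3 * B\<^sup>2 * \<bar>w1\<bar> * (indicator K' X * (v X)\<^sup>2))"
      by (rule integral_mono) (use igK E ivK pw in auto)
    also have "\<dots> = (LINT X|lebesgue. E X) + (LINT X|lebesgue. 2 * C2 ^ 3 * B\<^sup>2 * \<bar>w1\<bar> * (indicator K' X * (v X)\<^sup>2))"
      by (rule Bochner_Integration.integral_add[OF E(1)]) (rule integrable_mult_right[OF ivK])
    also have "\<dots> = 2 * C2 ^ 3 * B\<^sup>2 * \<bar>w1\<bar> * (LINT X|lebesgue. indicator K' X * (v X)\<^sup>2)" using E(2) by simp
    finally have fin: "w0 / (2 * C2) * (LINT X|lebesgue. gK X) \<le> 2 * C2 ^ 3 * B\<^sup>2 * \<bar>w1\<bar> * (LINT X|lebesgue. indicator K' X * (v X)\<^sup>2)" .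
    have "2 * C2 / w0 * (w0 / (2 * C2) * (LINT X|lebesgue. gK X)) \<le> 2 * C2 / w0 * (2 * C2 ^ 3 * B\<^sup>2 * \<bar>w1\<bar> * (LINT X|lebesgue. indicator K' X * (v X)\<^sup>2))"
      by (rule mult_left_mono[OF fin]) (use C2 w0 in simp)
    then show "(LINT X|lebesgue. indicator K X * (norm (g X))\<^sup>2) \<le> c * (LINT X|lebesgue. indicator K' X * (v X)\<^sup>2)"
      using C2 w0(1) by (simp add: gK_def c_def mult.assoc)
  qed (use K' in auto)
qed

section \<open>Strong convergence of the gradients\<close>

text \<open>The weight 2^j on the squared increments forces geometric decay of the increments with
  ratio 1 / sqrt 2, so the telescoping series converges absolutely.\<close>

lemma rapidly_Cauchy_convergent:
  fixes f :: "nat \<Rightarrow> 'a::banach"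
  assumes "\<And>j. j \<ge> J \<Longrightarrow> 2 ^ j * (norm (f (Suc j) - f j))\<^sup>2 \<le> s"
  shows "convergent f"
proof -
  define q where "q = 1 / sqrt 2"
  have q: "0 < q" "q < 1" by (auto simp: q_def)
  have q2: "(q ^ j)\<^sup>2 * 2 ^ j = 1" for j
  proof -
    have "(q ^ j)\<^sup>2 = (q\<^sup>2) ^ j" by (simp add: power_mult[symmetric] mult.commute)
    also have "q\<^sup>2 = 1 / 2" by (simp add: q_def power_divide)
    finally show ?thesis by (simp add: power_divide)
  qed
  have "norm (f (Suc j) - f j) \<le> sqrt \<bar>s\<bar> * q ^ j" if "j \<ge> J" for j
  proof -
    have "(norm (f (Suc j) - f j))\<^sup>2 = (q ^ j)\<^sup>2 * (2 ^ j * (norm (f (Suc j) - f j))\<^sup>2)"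
      using q2[of j] by (simp add: mult.assoc[symmetric])
    also have "\<dots> \<le> (q ^ j)\<^sup>2 * \<bar>s\<bar>" using assms[OF that] by (intro mult_left_mono) auto
    also have "\<dots> = (sqrt \<bar>s\<bar> * q ^ j)\<^sup>2" by (simp add: power_mult_distrib)
    finally show ?thesis by (rule power2_le_imp_le) (use q in simp)
  qed
  then have bound: "norm (norm (f (Suc j) - f j)) \<le> sqrt \<bar>s\<bar> * q ^ j" if "j \<ge> J" for j using that by simp
  have geo: "summable (\<lambda>j. sqrt \<bar>s\<bar> * q ^ j)" using q by (intro summable_mult summable_geometric) simp
  have "summable (\<lambda>j. norm (f (Suc j) - f j))" by (rule summable_comparison_test'[OF geo bound])
  then have "summable (\<lambda>j. f (Suc j) - f j)" by (rule summable_norm_cancel)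
  then have "convergent (\<lambda>n. \<Sum>j<n. f (Suc j) - f j)" by (simp add: summable_iff_convergent)
  then have "convergent (\<lambda>n. (f n - f 0) + f 0)"
    unfolding sum_lessThan_telescope by (intro convergent_add convergent_const)
  then show ?thesis by simp
qed

text \<open>A Riesz-Fischer argument on an exhaustion. Squared increments weighted by 2^j have
  integrals at most 2^(-j), so their sum is finite almost everywhere and the sequence converges
  there. Fatou's lemma carries the rate over to the limit.\<close>

lemma L2_limit_exists:
  fixes f :: "nat \<Rightarrow> real ^ 'n::finite \<Rightarrow> real ^ 'n"
  assumes U: "open U" and m: "\<And>j. meas_loc U (f j)"
    and Cp: "\<And>j. compact (Cp j)" "\<And>j. Cp j \<subseteq> U" "\<And>i j. i \<le> j \<Longrightarrow> Cp i \<subseteq> Cp j" "(\<Union>j. Cp j) = U"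
    and c: "\<And>j l. j \<le> l \<Longrightarrow> (\<integral>\<^sup>+ x. indicator (Cp j) x * ennreal ((norm (f l x - f j x))\<^sup>2) \<partial>lebesgue) \<le> ennreal ((1 / 4) ^ j)"
  obtains g where "meas_loc U g"
    "\<And>j. (\<integral>\<^sup>+ x. indicator (Cp j) x * ennreal ((norm (g x - f j x))\<^sup>2) \<partial>lebesgue) \<le> ennreal ((1 / 4) ^ j)"
proof -
  define F where "F j x = indicator U x *\<^sub>R f j x" for j x
  have mF: "F j \<in> borel_measurable lebesgue" for j unfolding F_def[abs_def] by (rule meas_loc_D[OF m U])
  define g where "g x = lim (\<lambda>j. F j x)" for x
  have mg: "g \<in> borel_measurable lebesgue" unfolding g_def by (rule borel_measurable_lim_metric[OF mF])
  have mn: "(\<lambda>x. ennreal ((norm (F l x - F j x))\<^sup>2)) \<in> borel_measurable lebesgue" for l j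
    using mF by measurable
  have mi: "(\<lambda>x. indicator (Cp i) x * ennreal ((norm (F l x - F j x))\<^sup>2)) \<in> borel_measurable lebesgue" for i l j
    by (intro borel_measurable_times_ennreal borel_measurable_indicator compact_sets_lebesgue Cp mn)
  have eqF: "indicator (Cp i) x * ennreal ((norm (F l x - F j x))\<^sup>2) = indicator (Cp i) x * ennreal ((norm (f l x - f j x))\<^sup>2)" for i l j x
    using Cp(2)[of i] by (cases "x \<in> Cp i") (auto simp: F_def)
  have "(\<integral>\<^sup>+ x. (\<Sum>j. ennreal (2 ^ j) * (indicator (Cp j) x * ennreal ((norm (F (Suc j) x - F j x))\<^sup>2))) \<partial>lebesgue)
    = (\<Sum>j. \<integral>\<^sup>+ x. ennreal (2 ^ j) * (indicator (Cp j) x * ennreal ((norm (F (Suc j) x - F j x))\<^sup>2)) \<partial>lebesgue)"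
    by (rule nn_integral_suminf) (rule borel_measurable_times_ennreal[OF borel_measurable_const mi])
  also have "\<dots> \<le> (\<Sum>j. ennreal ((1 / 2) ^ j))"
  proof (rule suminf_le)
    fix j
    have "(\<integral>\<^sup>+ x. ennreal (2 ^ j) * (indicator (Cp j) x * ennreal ((norm (F (Suc j) x - F j x))\<^sup>2)) \<partial>lebesgue)
      = ennreal (2 ^ j) * (\<integral>\<^sup>+ x. indicator (Cp j) x * ennreal ((norm (F (Suc j) x - F j x))\<^sup>2) \<partial>lebesgue)"
      by (rule nn_integral_cmult[OF mi])
    also have "\<dots> \<le> ennreal (2 ^ j) * ennreal ((1 / 4) ^ j)"
      unfolding eqF by (intro mult_left_mono c) auto
    also have "\<dots> = ennreal ((1 / 2) ^ j)"
      by (simp add: ennreal_mult[symmetric] power_mult_distrib[symmetric])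
    finally show "(\<integral>\<^sup>+ x. ennreal (2 ^ j) * (indicator (Cp j) x * ennreal ((norm (F (Suc j) x - F j x))\<^sup>2)) \<partial>lebesgue) \<le> ennreal ((1 / 2) ^ j)" .
  qed auto
  also have "\<dots> < \<infinity>"
  proof -
    have "(\<lambda>j. (1 / 2 :: real) ^ j) sums (1 / (1 - 1 / 2))" by (rule geometric_sums) simp
    then show ?thesis by (subst suminf_ennreal2) (auto simp: sums_iff)
  qed
  finally have fin: "(\<integral>\<^sup>+ x. (\<Sum>j. ennreal (2 ^ j) * (indicator (Cp j) x * ennreal ((norm (F (Suc j) x - F j x))\<^sup>2))) \<partial>lebesgue) \<noteq> \<infinity>"
    by simp
  have "AE x in lebesgue. (\<Sum>j. ennreal (2 ^ j) * (indicator (Cp j) x * ennreal ((norm (F (Suc j) x - F j x))\<^sup>2))) \<noteq> \<infinity>"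
    by (rule nn_integral_PInf_AE[OF _ fin])
      (intro borel_measurable_suminf_order borel_measurable_times_ennreal borel_measurable_const borel_measurable_indicator compact_sets_lebesgue Cp mn)
  then have conv: "AE x in lebesgue. (\<lambda>j. F j x) \<longlonglongrightarrow> g x"
  proof eventually_elim
    case (elim x)
    show ?case
    proof (cases "x \<in> U")
      case True
      define S where "S = (\<Sum>j. ennreal (2 ^ j) * (indicator (Cp j) x * ennreal ((norm (F (Suc j) x - F j x))\<^sup>2)))"
      \<comment> \<open>A point is seen by the sets \<open>Cp j\<close> only from some index on,
        which is why the convergence criterion allows a starting index.\<close>
      obtain J where J: "x \<in> Cp J" using True Cp(4) by blast
      have "2 ^ j * (norm (F (Suc j) x - F j x))\<^sup>2 \<le> enn2real S" if "j \<ge> J" for j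
      proof -
        have "x \<in> Cp j" using J Cp(3)[OF that] by blast
        then have "ennreal (2 ^ j * (norm (F (Suc j) x - F j x))\<^sup>2) = ennreal (2 ^ j) * (indicator (Cp j) x * ennreal ((norm (F (Suc j) x - F j x))\<^sup>2))"
          by (simp add: ennreal_mult)
        also have "\<dots> \<le> S" unfolding S_def by (rule term_le_suminf[of "\<lambda>j. ennreal (2 ^ j) * (indicator (Cp j) x * ennreal ((norm (F (Suc j) x - F j x))\<^sup>2))"])
        also have "S = ennreal (enn2real S)" using elim by (simp add: S_def less_top)
        finally show ?thesis by (simp add: ennreal_le_iff)
      qed
      from rapidly_Cauchy_convergent[of J "\<lambda>j. F j x", OF this]
      show ?thesis unfolding g_def by (simp add: convergent_LIMSEQ_iff)
    next
      case False
      then have "(\<lambda>j. F j x) = (\<lambda>j. 0)" by (simp add: F_def)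
      then show ?thesis unfolding g_def by (simp add: lim_const)
    qed
  qed
  show ?thesis
  proof (rule that[of g])
    show "meas_loc U g"
      unfolding meas_loc_def by (intro allI impI borel_measurable_scaleR indicator_compact_measurable mg) auto
    fix j
    have "(\<integral>\<^sup>+ x. indicator (Cp j) x * ennreal ((norm (g x - f j x))\<^sup>2) \<partial>lebesgue)
      = (\<integral>\<^sup>+ x. liminf (\<lambda>l. indicator (Cp j) x * ennreal ((norm (F l x - F j x))\<^sup>2)) \<partial>lebesgue)"
    proof (rule nn_integral_cong_AE)
      show "AE x in lebesgue. indicator (Cp j) x * ennreal ((norm (g x - f j x))\<^sup>2) = liminf (\<lambda>l. indicator (Cp j) x * ennreal ((norm (F l x - F j x))\<^sup>2))"
        using conv
      proof eventually_elim
        case (elim x)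
        have "(\<lambda>l. ennreal (indicator (Cp j) x * (norm (F l x - F j x))\<^sup>2)) \<longlonglongrightarrow> ennreal (indicator (Cp j) x * (norm (g x - F j x))\<^sup>2)"
          by (intro tendsto_intros elim)
        moreover have "ennreal (indicator (Cp j) x * t) = indicator (Cp j) x * ennreal t" for t by (simp add: indicator_def)
        ultimately have "(\<lambda>l. indicator (Cp j) x * ennreal ((norm (F l x - F j x))\<^sup>2)) \<longlonglongrightarrow> indicator (Cp j) x * ennreal ((norm (g x - F j x))\<^sup>2)"
          by simp
        then have "liminf (\<lambda>l. indicator (Cp j) x * ennreal ((norm (F l x - F j x))\<^sup>2)) = indicator (Cp j) x * ennreal ((norm (g x - F j x))\<^sup>2)"
          by (intro lim_imp_Liminf) auto
        moreover have "indicator (Cp j) x * ennreal ((norm (g x - F j x))\<^sup>2) = indicator (Cp j) x * ennreal ((norm (g x - f j x))\<^sup>2)"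
          using Cp(2)[of j] by (cases "x \<in> Cp j") (auto simp: F_def)
        ultimately show ?case by simp
      qed
    qed
    also have "\<dots> \<le> liminf (\<lambda>l. \<integral>\<^sup>+ x. indicator (Cp j) x * ennreal ((norm (F l x - F j x))\<^sup>2) \<partial>lebesgue)"
      by (rule nn_integral_liminf[OF mi])
    also have "\<dots> \<le> limsup (\<lambda>l. \<integral>\<^sup>+ x. indicator (Cp j) x * ennreal ((norm (F l x - F j x))\<^sup>2) \<partial>lebesgue)"
      by (rule Liminf_le_Limsup) simp
    also have "\<dots> \<le> ennreal ((1 / 4) ^ j)"
      unfolding eqF by (rule Limsup_bounded, rule eventually_mono[OF eventually_ge_at_top[of j]], rule c)
    finally show "(\<integral>\<^sup>+ x. indicator (Cp j) x * ennreal ((norm (g x - f j x))\<^sup>2) \<partial>lebesgue) \<le> ennreal ((1 / 4) ^ j)" .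
  qed
qed

lemma indicator_ennreal: "indicator K x * ennreal t = ennreal (indicator K x * t)"
  by (simp add: indicator_def)

lemma meas_loc_const: "meas_loc U (\<lambda>x. c :: real)"
  using bdd_loc_const[of U c] by (simp add: bdd_loc_def)

lemma compact_exhaustion:
  fixes U :: "(real ^ 'n::finite) set"
  assumes "open U"
  obtains C :: "nat \<Rightarrow> (real ^ 'n) set" where "\<And>n. compact (C n)" "\<And>n. C n \<subseteq> U" "\<And>i j. i \<le> j \<Longrightarrow> C i \<subseteq> C j" "(\<Union>n. C n) = U"
    "\<And>K. compact K \<Longrightarrow> K \<subseteq> U \<Longrightarrow> \<exists>n. K \<subseteq> C n"
proof -
  obtain C :: "nat \<Rightarrow> (real ^ 'n) set" where C: "\<And>n. compact (C n)" "\<And>n. C n \<subseteq> U" "\<And>n. C n \<subseteq> interior (C (Suc n))" "\<Union>(range C) = U"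
    "\<And>K. \<lbrakk>compact K; K \<subseteq> U\<rbrakk> \<Longrightarrow> \<exists>N. \<forall>n\<ge>N. K \<subseteq> C n"
    by (rule open_Union_compact_subsets[OF assms]) (rule that)
  have inc: "C n \<subseteq> C m" if "n \<le> m" for n m
    using that C(3) interior_subset by (induction rule: dec_induct) blast+
  have c5: "\<exists>n. K \<subseteq> C n" if K: "compact K" "K \<subseteq> U" for K
  proof -
    obtain N where "\<forall>n\<ge>N. K \<subseteq> C n" using C(5)[OF K] by metis
    then show ?thesis by (intro exI[of _ N]) simp
  qed
  show ?thesis by (rule that[OF C(1,2) _ C(4)]) (erule inc, rule c5)
qed

text \<open>Young's inequality with parameter 2^(-j) balances the fixed square of \<open>H\<close>
  against the error 4^(-j), so the pairings converge geometrically.\<close>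

lemma L2_pairing_limit:
  fixes H G :: "real ^ 'n::finite \<Rightarrow> real" and f :: "nat \<Rightarrow> real ^ 'n \<Rightarrow> real"
  assumes H: "L2_loc U H" and G: "L2_loc U G" and f: "\<And>j. L2_loc U (f j)" and K: "compact K" "K \<subseteq> U" "\<And>x. x \<notin> K \<Longrightarrow> H x = 0"
    and c: "\<And>j. j \<ge> J \<Longrightarrow> (LINT x|lebesgue. indicator K x * (f j x - G x)\<^sup>2) \<le> (1 / 4) ^ j"
  shows "(\<lambda>j. LINT x|lebesgue. H x * f j x) \<longlonglongrightarrow> (LINT x|lebesgue. H x * G x)"
proof -
  have HK: "indicator K x * (H x * t) = H x * t" "indicator K x * (H x)\<^sup>2 = (H x)\<^sup>2" for x t using K(3)[of x] by (auto simp: indicator_def)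
  have int: "integrable lebesgue (\<lambda>x. H x * k x)" if "L2_loc U k" for k
    using L2_loc_prod_integrable[OF H that K(1,2)] unfolding HK .
  have H2: "integrable lebesgue (\<lambda>x. (H x)\<^sup>2)"
    using H K(1,2) unfolding L2_loc_def by (metis (no_types, lifting) HK(2) Bochner_Integration.integrable_cong)
  define A where "A = (LINT x|lebesgue. (H x)\<^sup>2)"
  have diff: "L2_loc U (\<lambda>x. f j x - G x)" for j
  proof -
    have "L2_loc U (\<lambda>x. f j x + (-1) * G x)" by (intro L2_loc_add f L2_loc_bdd_mult[OF bdd_loc_const G])
    then show ?thesis by simp
  qed
  have bound: "\<bar>(LINT x|lebesgue. H x * f j x) - (LINT x|lebesgue. H x * G x)\<bar> \<le> (A + 1) * (1 / 2) ^ j" if j: "j \<ge> J" for j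
  proof -
    define \<delta> :: real where "\<delta> = (1 / 2) ^ j"
    have \<delta>: "\<delta> > 0" by (simp add: \<delta>_def)
    have i2: "integrable lebesgue (\<lambda>x. indicator K x * (f j x - G x)\<^sup>2)" using diff[of j] K(1,2) by (auto simp: L2_loc_def)
    have "(LINT x|lebesgue. H x * f j x) - (LINT x|lebesgue. H x * G x) = (LINT x|lebesgue. H x * (f j x - G x))"
      using Bochner_Integration.integral_diff[OF int[OF f] int[OF G]] by (simp add: right_diff_distrib)
    then have "\<bar>(LINT x|lebesgue. H x * f j x) - (LINT x|lebesgue. H x * G x)\<bar> \<le> (LINT x|lebesgue. \<bar>H x * (f j x - G x)\<bar>)"
      using integral_abs_bound by simp
    also have "\<dots> \<le> (LINT x|lebesgue. \<delta> / 2 * (H x)\<^sup>2 + 1 / (2 * \<delta>) * (indicator K x * (f j x - G x)\<^sup>2))"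
    proof (rule integral_mono)
      show "integrable lebesgue (\<lambda>x. \<bar>H x * (f j x - G x)\<bar>)" by (rule integrable_abs[OF int[OF diff]])
      show "integrable lebesgue (\<lambda>x. \<delta> / 2 * (H x)\<^sup>2 + 1 / (2 * \<delta>) * (indicator K x * (f j x - G x)\<^sup>2))"
        by (intro Bochner_Integration.integrable_add integrable_mult_right H2 i2)
      show "\<bar>H x * (f j x - G x)\<bar> \<le> \<delta> / 2 * (H x)\<^sup>2 + 1 / (2 * \<delta>) * (indicator K x * (f j x - G x)\<^sup>2)" for x
        using Young_weighted[OF \<delta>, of "H x" "f j x - G x"] K(3)[of x] by (cases "x \<in> K") auto
    qed
    also have "\<dots> = \<delta> / 2 * A + 1 / (2 * \<delta>) * (LINT x|lebesgue. indicator K x * (f j x - G x)\<^sup>2)"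
      using H2 i2 unfolding A_def by simp
    also have "\<dots> \<le> \<delta> / 2 * A + 1 / (2 * \<delta>) * (1 / 4) ^ j"
      by (intro add_left_mono mult_left_mono c[OF j]) (use \<delta> in simp)
    also have "1 / (2 * \<delta>) * (1 / 4) ^ j = \<delta> / 2"
      by (simp add: \<delta>_def power_divide field_simps power_mult_distrib[symmetric])
    also have "\<delta> / 2 * A + \<delta> / 2 \<le> (A + 1) * \<delta>"
    proof -
      have "A \<ge> 0" by (simp add: A_def)
      then have "0 \<le> \<delta> * A" using \<delta> by simp
      then show ?thesis using \<delta> by (simp add: algebra_simps)
    qed
    finally show ?thesis by (simp add: \<delta>_def)
  qed
  have "(\<lambda>j. (LINT x|lebesgue. H x * f j x) - (LINT x|lebesgue. H x * G x)) \<longlonglongrightarrow> 0"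
  proof (rule Lim_null_comparison)
    show "\<forall>\<^sub>F j in sequentially. norm ((LINT x|lebesgue. H x * f j x) - (LINT x|lebesgue. H x * G x)) \<le> (A + 1) * (1 / 2) ^ j"
      by (rule eventually_mono[OF eventually_ge_at_top[of J]]) (use bound in simp)
    show "(\<lambda>j. (A + 1) * (1 / 2) ^ j) \<longlonglongrightarrow> 0"
      by (rule tendsto_mult_right_zero) (rule LIMSEQ_power_zero, simp)
  qed
  then show ?thesis by (simp add: LIM_zero_iff)
qed

text \<open>Boundedness and dominated convergence give L2 convergence of the functions on compact
  sets. Applied to differences, Caccioppoli turns this into a Cauchy property of the gradients. A
  subsequence with rates has a limit gradient, and both the weak gradient identity and the equation
  pass to the limit along it.\<close>

lemma weak_solution_limit:
  fixes \<Gamma> :: "(real ^ 'n::finite) set"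
  assumes A: "ahlfors_regular \<Gamma> \<sigma> d C" and ne: "\<Gamma> \<noteq> {}" and d: "d > 0" and \<beta>: "\<beta> > 0"
    and ell: "elliptic_matrix (- \<Gamma>) A C2" and U: "open U" "U \<subseteq> - \<Gamma>"
    and sol: "\<And>n. weak_solution \<Gamma> \<sigma> d \<beta> \<gamma> A U (u n) (g n)"
    and bd: "\<And>n x. x \<in> U \<Longrightarrow> \<bar>u n x\<bar> \<le> 1" and lim: "\<And>x. x \<in> U \<Longrightarrow> (\<lambda>n. u n x) \<longlonglongrightarrow> v x"
  shows "\<exists>G. weak_solution \<Gamma> \<sigma> d \<beta> \<gamma> A U v G"
proof -
  have W: "W12_loc U (u n) (g n)" for n using sol by (simp add: weak_solution_iff)
  have mu: "meas_loc U (u n)" for n using W12_loc_L2(1)[OF W[of n]] by (simp add: L2_loc_def)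
  have mv: "meas_loc U v"
    unfolding meas_loc_def
  proof (intro allI impI)
    fix K assume K: "compact K \<and> K \<subseteq> U"
    show "(\<lambda>x. indicator K x *\<^sub>R v x) \<in> borel_measurable lebesgue"
    proof (rule borel_measurable_LIMSEQ_real)
      show "(\<lambda>x. indicator K x *\<^sub>R u n x) \<in> borel_measurable lebesgue" for n using mu K by (simp add: meas_loc_def)
      show "(\<lambda>n. indicator K x *\<^sub>R u n x) \<longlonglongrightarrow> indicator K x *\<^sub>R v x" for x
        using lim[of x] K by (cases "x \<in> K") auto
    qed
  qed
  have bv: "\<bar>v x\<bar> \<le> 1" if "x \<in> U" for x
    by (rule LIMSEQ_le_const2[OF tendsto_rabs[OF lim[OF that]]]) (use bd[OF that] in auto)
  have bu: "bdd_loc U (u n)" for n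
    unfolding bdd_loc_def by (intro conjI allI impI mu exI[of _ 1] AE_I2 bd) blast
  have bvl: "bdd_loc U v"
    unfolding bdd_loc_def by (intro conjI allI impI mv exI[of _ 1] AE_I2 bv) blast
  have L2c: "(\<lambda>n. LINT x|lebesgue. indicator K x * (u n x - v x)\<^sup>2) \<longlonglongrightarrow> 0" if K: "compact K" "K \<subseteq> U" for K
  proof -
    have "(\<lambda>n. LINT x|lebesgue. indicator K x * (u n x - v x)\<^sup>2) \<longlonglongrightarrow> (LINT x::real ^ 'n|lebesgue. 0)"
    \<comment> \<open>The majorant 4 is the square of 1 + 1: all the functions and their limit are
      bounded by 1.\<close>
    proof (rule integral_dominated_convergence[where w = "\<lambda>x. indicator K x * 4"])
      show "integrable lebesgue (\<lambda>x :: real ^ 'n. indicator K x * (4 :: real))"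
        by (intro integrable_mult_left compact_integrable_indicator K)
      have m: "meas_loc U (\<lambda>x. (u n x + (-1) * v x)\<^sup>2)" for n
        by (intro meas_loc_power2 meas_loc_add meas_loc_mult mu mv) (rule meas_loc_const)
      show "(\<lambda>x. indicator K x * (u n x - v x)\<^sup>2) \<in> borel_measurable lebesgue" for n
        using m[of n] K by (simp add: meas_loc_def)
      show "AE x in lebesgue. (\<lambda>n. indicator K x * (u n x - v x)\<^sup>2) \<longlonglongrightarrow> 0"
      proof (rule AE_I2)
        fix x
        show "(\<lambda>n. indicator K x * (u n x - v x)\<^sup>2) \<longlonglongrightarrow> 0"
        proof (cases "x \<in> K")
          case True
          then have "(\<lambda>n. (u n x - v x)\<^sup>2) \<longlonglongrightarrow> (v x - v x)\<^sup>2" using K by (intro tendsto_intros lim) auto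
          then show ?thesis using True by simp
        qed simp
      qed
      show "AE x in lebesgue. norm (indicator K x * (u n x - v x)\<^sup>2) \<le> indicator K x * 4" for n
      proof (rule AE_I2)
        fix x
        show "norm (indicator K x * (u n x - v x)\<^sup>2) \<le> indicator K x * 4"
        proof (cases "x \<in> K")
          case True
          then have "\<bar>u n x - v x\<bar> \<le> \<bar>2\<bar>" using bd[of x n] bv[of x] K by auto
          then have "(u n x - v x)\<^sup>2 \<le> 2\<^sup>2" unfolding abs_le_square_iff .
          then show ?thesis using True by simp
        qed simp
      qed
    qed simp
    then show ?thesis by simp
  qed
  obtain Cp :: "nat \<Rightarrow> (real ^ 'n) set" where Cp: "\<And>n. compact (Cp n)" "\<And>n. Cp n \<subseteq> U" "\<And>i j. i \<le> j \<Longrightarrow> Cp i \<subseteq> Cp j" "(\<Union>n. Cp n) = U"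
    "\<And>K. compact K \<Longrightarrow> K \<subseteq> U \<Longrightarrow> \<exists>n. K \<subseteq> Cp n"
    by (rule compact_exhaustion[OF U(1)]) (rule that)
  have Wd: "W12_loc U (\<lambda>x. 1 * u n x + (-1) * u m x) (\<lambda>x. 1 *\<^sub>R g n x + (-1) *\<^sub>R g m x)" for n m
    by (rule W12_loc_lincomb[OF W W])
  have ig: "integrable lebesgue (\<lambda>x. indicator (Cp j) x * (norm (g n x - g m x))\<^sup>2)" for j n m
    using Wd[of n m] Cp(1,2)[of j] by (auto simp: W12_loc_def set_integrable_def)
  have ex: "\<exists>N. \<forall>n\<ge>N. \<forall>m\<ge>N. (LINT x|lebesgue. indicator (Cp j) x * (norm (g n x - g m x))\<^sup>2) \<le> (1 / 4) ^ j" for j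
  proof -
    obtain c K' where c: "0 \<le> c" "compact K'" "K' \<subseteq> U" and cac: "\<And>v g. weak_solution \<Gamma> \<sigma> d \<beta> \<gamma> A U v g \<Longrightarrow> bdd_loc U v \<Longrightarrow>
      (LINT X|lebesgue. indicator (Cp j) X * (norm (g X))\<^sup>2) \<le> c * (LINT X|lebesgue. indicator K' X * (v X)\<^sup>2)"
      using Caccioppoli[OF A ne d \<beta> ell U Cp(1)[of j] Cp(2)[of j], where \<gamma> = \<gamma>] by (elim exE conjE) (rule that, blast+)
    \<comment> \<open>The 4 accounts for splitting the difference at \<open>v\<close> into two
      doubled squares; \<open>c + 1\<close> avoids dividing by a vanishing \<open>c\<close>.\<close>
    define \<eta> :: real where "\<eta> = (1 / 4) ^ j / (4 * (c + 1))"
    have \<eta>: "\<eta> > 0" using c by (simp add: \<eta>_def)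
    have "\<forall>\<^sub>F n in sequentially. (LINT x|lebesgue. indicator K' x * (u n x - v x)\<^sup>2) < \<eta>"
      using order_tendstoD(2)[OF L2c[OF c(2,3)] \<eta>] .
    then obtain N where N: "\<And>n. n \<ge> N \<Longrightarrow> (LINT x|lebesgue. indicator K' x * (u n x - v x)\<^sup>2) < \<eta>"
      by (auto simp: eventually_sequentially)
    have "(LINT x|lebesgue. indicator (Cp j) x * (norm (g n x - g m x))\<^sup>2) \<le> (1 / 4) ^ j" if nm: "n \<ge> N" "m \<ge> N" for n m
    proof -
      have s: "weak_solution \<Gamma> \<sigma> d \<beta> \<gamma> A U (\<lambda>x. 1 * u n x + (-1) * u m x) (\<lambda>x. 1 *\<^sub>R g n x + (-1) *\<^sub>R g m x)"
        by (rule weak_solution_lincomb[OF A ne d \<beta> ell U sol sol])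
      have b: "bdd_loc U (\<lambda>x. 1 * u n x + (-1) * u m x)"
        by (intro bdd_loc_add bdd_loc_mult bdd_loc_const bu)
      have dv: "L2_loc U (\<lambda>x. u k x - v x)" for k
      proof -
        have "bdd_loc U (\<lambda>x. u k x + (-1) * v x)" by (intro bdd_loc_add bdd_loc_mult bdd_loc_const bu bvl)
        then show ?thesis using bdd_loc_L2_loc by fastforce
      qed
      have i: "integrable lebesgue (\<lambda>x. indicator K' x * (u k x - v x)\<^sup>2)" for k using dv[of k] c(2,3) by (auto simp: L2_loc_def)
      have "(LINT x|lebesgue. indicator (Cp j) x * (norm (g n x - g m x))\<^sup>2) \<le> c * (LINT X|lebesgue. indicator K' X * (u n X - u m X)\<^sup>2)"
        using cac[OF s b] by simp
      also have "(LINT X|lebesgue. indicator K' X * (u n X - u m X)\<^sup>2)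
        \<le> (LINT X|lebesgue. 2 * (indicator K' X * (u n X - v X)\<^sup>2) + 2 * (indicator K' X * (u m X - v X)\<^sup>2))"
      proof (rule integral_mono)
        show "integrable lebesgue (\<lambda>X. indicator K' X * (u n X - u m X)\<^sup>2)"
          using bdd_loc_L2_loc[OF b] c(2,3) by (auto simp: L2_loc_def)
        show "integrable lebesgue (\<lambda>X. 2 * (indicator K' X * (u n X - v X)\<^sup>2) + 2 * (indicator K' X * (u m X - v X)\<^sup>2))"
          by (intro Bochner_Integration.integrable_add integrable_mult_right i)
        fix X
        have "0 \<le> ((u n X - v X) + (u m X - v X))\<^sup>2" by simp
        then have "(u n X - u m X)\<^sup>2 \<le> 2 * (u n X - v X)\<^sup>2 + 2 * (u m X - v X)\<^sup>2"
          by (simp add: power2_eq_square algebra_simps)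
        then show "indicator K' X * (u n X - u m X)\<^sup>2 \<le> 2 * (indicator K' X * (u n X - v X)\<^sup>2) + 2 * (indicator K' X * (u m X - v X)\<^sup>2)"
          by (simp add: indicator_def)
      qed
      also have "\<dots> = 2 * (LINT X|lebesgue. indicator K' X * (u n X - v X)\<^sup>2) + 2 * (LINT X|lebesgue. indicator K' X * (u m X - v X)\<^sup>2)"
        using i by simp
      also have "\<dots> \<le> 4 * \<eta>" using N[OF nm(1)] N[OF nm(2)] by linarith
      finally have "(LINT x|lebesgue. indicator (Cp j) x * (norm (g n x - g m x))\<^sup>2) \<le> c * (4 * \<eta>)"
        using c(1) by (simp add: mult_left_mono)
      also have "\<dots> \<le> (c + 1) * (4 * \<eta>)" using \<eta> by (intro mult_right_mono) auto
      also have "\<dots> = (4 * (c + 1)) * \<eta>" by simp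
      also have "\<dots> = (1 / 4) ^ j" unfolding \<eta>_def using c(1) by (simp only: times_divide_eq_right) (rule nonzero_mult_div_cancel_left, simp)
      finally show ?thesis .
    qed
    then show ?thesis by blast
  qed
  obtain N where N0: "\<forall>j. \<forall>n\<ge>N j. \<forall>m\<ge>N j. (LINT x|lebesgue. indicator (Cp j) x * (norm (g n x - g m x))\<^sup>2) \<le> (1 / 4) ^ j"
  proof -
    have "\<forall>j. \<exists>N. \<forall>n\<ge>N. \<forall>m\<ge>N. (LINT x|lebesgue. indicator (Cp j) x * (norm (g n x - g m x))\<^sup>2) \<le> (1 / 4) ^ j"
      by (intro allI ex)
    from choice[OF this] show ?thesis by (elim exE) (rule that)
  qed
  note N = N0[rule_format]
  \<comment> \<open>The sum dominates every earlier threshold, so \<open>r l\<close> is at least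
    \<open>N j\<close> whenever l is at least j; the summand \<open>j\<close> makes \<open>r\<close>
    tend to infinity.\<close>
  define r where "r j = (\<Sum>i\<le>j. N i) + j" for j
  have rN: "N j \<le> r l" if "j \<le> l" for j l
  proof -
    have "N j \<le> (\<Sum>i\<le>l. N i)" using that by (intro member_le_sum) auto
    then show ?thesis by (simp add: r_def)
  qed
  have rlim: "filterlim r at_top sequentially"
    by (rule filterlim_at_top_mono[OF filterlim_ident]) (simp add: r_def)
  define f where "f j = g (r j)" for j
  have fL2: "L2_loc U (\<lambda>x. f j x $ i)" for j i unfolding f_def by (rule W12_loc_L2(2)[OF W])
  have mf: "meas_loc U (f j)" for j
  proof -
    have "weak_gradient U (u (r j)) (f j)" using W[of "r j"] by (simp add: W12_loc_def f_def)
    then show ?thesis unfolding weak_gradient_def meas_loc_def set_integrable_def by (blast dest: borel_measurable_integrable)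
  qed
  have fc: "(\<integral>\<^sup>+ x. indicator (Cp j) x * ennreal ((norm (f l x - f j x))\<^sup>2) \<partial>lebesgue) \<le> ennreal ((1 / 4) ^ j)" if "j \<le> l" for j l
  proof -
    have "(\<integral>\<^sup>+ x. indicator (Cp j) x * ennreal ((norm (f l x - f j x))\<^sup>2) \<partial>lebesgue)
      = ennreal (LINT x|lebesgue. indicator (Cp j) x * (norm (f l x - f j x))\<^sup>2)"
      unfolding indicator_ennreal f_def by (rule nn_integral_eq_integral[OF ig]) auto
    also have "\<dots> \<le> ennreal ((1 / 4) ^ j)"
      unfolding f_def by (intro ennreal_leI N rN that) simp
    finally show ?thesis .
  qed
  obtain G where G: "meas_loc U G"
    "\<And>j. (\<integral>\<^sup>+ x. indicator (Cp j) x * ennreal ((norm (G x - f j x))\<^sup>2) \<partial>lebesgue) \<le> ennreal ((1 / 4) ^ j)"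
    using L2_limit_exists[OF U(1) mf Cp(1,2,3,4) fc] by blast
  have diffK: "integrable lebesgue (\<lambda>x. indicator K x * (f j x $ i - G x $ i)\<^sup>2)"
    "(LINT x|lebesgue. indicator K x * (f j x $ i - G x $ i)\<^sup>2) \<le> (1 / 4) ^ j"
    if K: "compact K" "K \<subseteq> Cp j" for K j i
  proof -
    have KU: "K \<subseteq> U" using K Cp(2) by blast
    have "meas_loc U (\<lambda>x. (f j x $ i + (-1) * G x $ i)\<^sup>2)"
      by (intro meas_loc_power2 meas_loc_add meas_loc_mult meas_loc_nth mf G(1)) (rule meas_loc_const)
    then have m: "(\<lambda>x. indicator K x * (f j x $ i - G x $ i)\<^sup>2) \<in> borel_measurable lebesgue"
      using K KU by (simp add: meas_loc_def)
    have "(\<integral>\<^sup>+ x. ennreal (indicator K x * (f j x $ i - G x $ i)\<^sup>2) \<partial>lebesgue)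
      \<le> (\<integral>\<^sup>+ x. indicator (Cp j) x * ennreal ((norm (G x - f j x))\<^sup>2) \<partial>lebesgue)"
    proof (rule nn_integral_mono)
      fix x
      have "\<bar>f j x $ i - G x $ i\<bar> \<le> norm (G x - f j x)"
        using component_le_norm_cart[of "G x - f j x" i] by simp
      then have "(f j x $ i - G x $ i)\<^sup>2 \<le> (norm (G x - f j x))\<^sup>2" by (simp add: abs_le_square_iff[symmetric])
      then show "ennreal (indicator K x * (f j x $ i - G x $ i)\<^sup>2) \<le> indicator (Cp j) x * ennreal ((norm (G x - f j x))\<^sup>2)"
        using K(2) by (auto simp: indicator_def intro: ennreal_leI)
    qed
    also have "\<dots> \<le> ennreal ((1 / 4) ^ j)" by (rule G(2))
    finally have le: "(\<integral>\<^sup>+ x. ennreal (indicator K x * (f j x $ i - G x $ i)\<^sup>2) \<partial>lebesgue) \<le> ennreal ((1 / 4) ^ j)" .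
    show i: "integrable lebesgue (\<lambda>x. indicator K x * (f j x $ i - G x $ i)\<^sup>2)"
      by (rule integrableI_nonneg[OF m]) (use le_less_trans[OF le] in auto)
    show "(LINT x|lebesgue. indicator K x * (f j x $ i - G x $ i)\<^sup>2) \<le> (1 / 4) ^ j"
      using le nn_integral_eq_integral[OF i] by (simp add: ennreal_le_iff)
  qed
  have GL2: "L2_loc U (\<lambda>x. G x $ i)" for i
    unfolding L2_loc_def
  proof (intro conjI allI impI)
    show "meas_loc U (\<lambda>x. G x $ i)" by (rule meas_loc_nth[OF G(1)])
    fix K assume K: "compact K \<and> K \<subseteq> U"
    then obtain J where J: "K \<subseteq> Cp J" using Cp(5) by blast
    \<comment> \<open>Only the difference of \<open>G\<close> from an approximant is known to be
      square integrable on \<open>K\<close>; \<open>G\<close> is recovered by subtracting it from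
      that approximant.\<close>
    have d: "L2_loc K (\<lambda>x. f J x $ i + (-1) * G x $ i)"
      unfolding L2_loc_def
    proof (intro conjI allI impI)
      have "meas_loc U (\<lambda>x. f J x $ i + (-1) * G x $ i)"
        by (intro meas_loc_add meas_loc_mult meas_loc_nth mf G(1)) (rule meas_loc_const)
      then show "meas_loc K (\<lambda>x. f J x $ i + (-1) * G x $ i)" by (rule meas_loc_subset) (use K in blast)
      fix K2 assume "compact K2 \<and> K2 \<subseteq> K"
      then show "integrable lebesgue (\<lambda>x. indicator K2 x * (f J x $ i + (-1) * G x $ i)\<^sup>2)"
        using diffK(1)[of K2 J i] J by auto
    qed
    have "L2_loc K (\<lambda>x. f J x $ i + (-1) * (f J x $ i + (-1) * G x $ i))"
      by (intro L2_loc_add L2_loc_bdd_mult[OF bdd_loc_const d] L2_loc_subset[OF fL2]) (use K in blast)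
    then show "integrable lebesgue (\<lambda>x. indicator K x * (G x $ i)\<^sup>2)" using K by (simp add: L2_loc_def)
  qed
  have pair: "(\<lambda>j. LINT x|lebesgue. H x * f j x $ i) \<longlonglongrightarrow> (LINT x|lebesgue. H x * G x $ i)"
    if H: "L2_loc U H" and K: "compact K" "K \<subseteq> U" "\<And>x. x \<notin> K \<Longrightarrow> H x = 0" for H K i
  proof -
    obtain J where J: "K \<subseteq> Cp J" using Cp(5)[OF K(1,2)] by blast
    show ?thesis
    proof (rule L2_pairing_limit[OF H GL2 fL2 K(1,2)])
      show "(LINT x|lebesgue. indicator K x * (f j x $ i - G x $ i)\<^sup>2) \<le> (1 / 4) ^ j" if "J \<le> j" for j
        by (rule diffK(2)[OF K(1)]) (use J Cp(3)[OF that] in blast)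
    qed (rule K(3))
  qed
  have wg: "weak_gradient U v G"
  proof (rule weak_gradientI)
    show "v absolutely_integrable_on K" if "compact K" "K \<subseteq> U" for K
      by (rule L2_loc_abs_integrable[OF bdd_loc_L2_loc[OF bvl] that])
    show "(\<lambda>x. G x $ i) absolutely_integrable_on K" if "compact K" "K \<subseteq> U" for K i
      by (rule L2_loc_abs_integrable[OF GL2 that])
    fix \<phi> :: "real ^ 'n \<Rightarrow> real" and i assume t: "test_function U \<phi>"
    obtain K where K: "compact K" "K \<subseteq> U" "\<And>x. x \<notin> K \<Longrightarrow> \<phi> x = 0" "\<And>x. x \<notin> K \<Longrightarrow> gradient \<phi> x = 0"
      using test_function_support[OF t] by metis
    have wf: "weak_gradient U (u (r j)) (f j)" for j using W[of "r j"] by (simp add: W12_loc_def f_def)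
    note tj = weak_gradient_test[OF wf t, of _ i]
    have tt: "test_function U (\<lambda>x. gradient \<phi> x $ i)" by (rule test_function_partial[OF t])
    have "integrable lebesgue (\<lambda>x. gradient \<phi> x $ i *\<^sub>R (1 :: real))"
      by (rule test_mult_integrable[OF tt]) (rule L2_loc_abs_integrable[OF bdd_loc_L2_loc[OF bdd_loc_const]])
    then have iphi: "integrable lebesgue (\<lambda>x. \<bar>gradient \<phi> x $ i\<bar>)" by simp
    have vm: "(\<lambda>x. v x * gradient \<phi> x $ i) \<in> borel_measurable lebesgue"
    proof -
      have "integrable lebesgue (\<lambda>x. gradient \<phi> x $ i *\<^sub>R v x)"
        by (rule test_mult_integrable[OF tt]) (rule L2_loc_abs_integrable[OF bdd_loc_L2_loc[OF bvl]])
      then show ?thesis by (simp add: mult.commute borel_measurable_integrable)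
    qed
    have l1: "(\<lambda>j. LINT x|lebesgue. u (r j) x * gradient \<phi> x $ i) \<longlonglongrightarrow> (LINT x|lebesgue. v x * gradient \<phi> x $ i)"
    proof (rule integral_dominated_convergence[OF vm _ iphi])
      show "(\<lambda>x. u (r j) x * gradient \<phi> x $ i) \<in> borel_measurable lebesgue" for j by (rule borel_measurable_integrable[OF tj(1)])
      show "AE x in lebesgue. (\<lambda>j. u (r j) x * gradient \<phi> x $ i) \<longlonglongrightarrow> v x * gradient \<phi> x $ i"
      proof (rule AE_I2)
        fix x
        show "(\<lambda>j. u (r j) x * gradient \<phi> x $ i) \<longlonglongrightarrow> v x * gradient \<phi> x $ i"
        proof (cases "x \<in> K")
          case True
          then show ?thesis using K(2) by (intro tendsto_mult tendsto_const filterlim_compose[OF lim rlim]) auto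
        next
          case False
          then show ?thesis using K(4) by simp
        qed
      qed
      show "AE x in lebesgue. norm (u (r j) x * gradient \<phi> x $ i) \<le> \<bar>gradient \<phi> x $ i\<bar>" for j
      proof (rule AE_I2)
        fix x
        show "norm (u (r j) x * gradient \<phi> x $ i) \<le> \<bar>gradient \<phi> x $ i\<bar>"
        proof (cases "x \<in> K")
          case True
          then have "x \<in> U" using K(2) by blast
          then show ?thesis using bd[of x "r j"] by (simp add: abs_mult mult_left_le_one_le)
        next
          case False
          then show ?thesis using K(4) by simp
        qed
      qed
    qed
    have "(\<lambda>j. LINT x|lebesgue. \<phi> x * f j x $ i) \<longlonglongrightarrow> (LINT x|lebesgue. \<phi> x * G x $ i)"
      by (rule pair[OF bdd_loc_L2_loc[OF test_function_W12_loc(2)[OF U(1) t]] K(1,2,3)])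
    from tendsto_minus[OF this] have "(\<lambda>j. LINT x|lebesgue. u (r j) x * gradient \<phi> x $ i) \<longlonglongrightarrow> - (LINT x|lebesgue. \<phi> x * G x $ i)"
      by (simp only: tj(3))
    with l1 show "(LINT x|lebesgue. v x * gradient \<phi> x $ i) = - (LINT x|lebesgue. \<phi> x * G x $ i)" by (rule LIMSEQ_unique)
  qed
  have "weak_solution \<Gamma> \<sigma> d \<beta> \<gamma> A U v G"
    unfolding weak_solution_iff
  proof (intro conjI allI impI)
    show "W12_loc U v G" by (rule W12_loc_I[OF wg bdd_loc_L2_loc[OF bvl] GL2])
    fix \<phi> :: "real ^ 'n \<Rightarrow> real" assume t: "test_function U \<phi>"
    let ?w = "\<lambda>X. Dbeta \<Gamma> \<sigma> d \<beta> X powr (d + 1 + \<gamma> - real CARD('n))"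
    obtain K where K: "compact K" "K \<subseteq> U" "\<And>x. x \<notin> K \<Longrightarrow> \<phi> x = 0" "\<And>x. x \<notin> K \<Longrightarrow> gradient \<phi> x = 0"
      using test_function_support[OF t] by metis
    have oG: "open (- \<Gamma>)" using ahlfors_regularD[OF A] by auto
    \<comment> \<open>Matrix, weight and test gradient are gathered into fixed compactly supported
      functions \<open>H l\<close>, so the equation becomes a finite sum of pairings that are linear
      in the gradient and converge.\<close>
    define H where "H l X = (\<Sum>i\<in>UNIV. A X $ i $ l * (gradient \<phi> X $ i * ?w X))" for l X
    have HL2: "L2_loc U (H l)" for l
      unfolding H_def
      by (intro bdd_loc_L2_loc bdd_loc_sum bdd_loc_mult bdd_loc_subset[OF elliptic_matrix_entries[OF oG ell] U(2)]
          test_function_W12_loc(3)[OF U(1) t] continuous_bdd_loc[OF U(1) Dbeta_powr_continuous[OF A ne d \<beta> U(2)]])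
    have H0: "H l X = 0" if "X \<notin> K" for l X using K(4)[OF that] by (simp add: H_def)
    have expand: "((A X *v h X) \<bullet> gradient \<phi> X) * ?w X = (\<Sum>l\<in>UNIV. H l X * h X $ l)" for h :: "real ^ 'n \<Rightarrow> real ^ 'n" and X
    proof -
      have "((A X *v h X) \<bullet> gradient \<phi> X) * ?w X = (\<Sum>i\<in>UNIV. \<Sum>l\<in>UNIV. A X $ i $ l * (gradient \<phi> X $ i * ?w X) * h X $ l)"
        by (simp add: inner_vec_def matrix_vector_mult_def sum_distrib_left sum_distrib_right mult_ac)
      also have "\<dots> = (\<Sum>l\<in>UNIV. \<Sum>i\<in>UNIV. A X $ i $ l * (gradient \<phi> X $ i * ?w X) * h X $ l)" by (rule sum.swap)
      also have "\<dots> = (\<Sum>l\<in>UNIV. H l X * h X $ l)" by (simp add: H_def sum_distrib_right)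
      finally show ?thesis .
    qed
    have iH: "integrable lebesgue (\<lambda>X. H l X * k X)" if "L2_loc U k" for l k
    proof -
      have "(\<lambda>X. indicator K X * (H l X * k X)) = (\<lambda>X. H l X * k X)"
        by (rule ext) (auto simp: indicator_def H0)
      then show ?thesis using L2_loc_prod_integrable[OF HL2[of l] that K(1,2)] by (simp only:)
    qed
    have zero: "(\<Sum>l\<in>UNIV. (LINT X|lebesgue. H l X * f j X $ l)) = 0" for j
    proof -
      have "(\<Sum>l\<in>UNIV. (LINT X|lebesgue. H l X * f j X $ l)) = (LINT X|lebesgue. (\<Sum>l\<in>UNIV. H l X * f j X $ l))"
        by (rule Bochner_Integration.integral_sum[symmetric]) (rule iH[OF fL2])
      also have "\<dots> = (LINT X|lebesgue. ((A X *v f j X) \<bullet> gradient \<phi> X) * ?w X)" by (simp only: expand)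
      also have "\<dots> = 0" using sol[of "r j"] t by (simp add: weak_solution_iff f_def)
      finally show ?thesis .
    qed
    have "(\<lambda>j. \<Sum>l\<in>UNIV. (LINT X|lebesgue. H l X * f j X $ l)) \<longlonglongrightarrow> (\<Sum>l\<in>UNIV. (LINT X|lebesgue. H l X * G X $ l))"
      by (intro tendsto_sum pair[OF HL2 K(1,2) H0])
    then have "(\<Sum>l\<in>UNIV. (LINT X|lebesgue. H l X * G X $ l)) = 0" unfolding zero by (simp add: LIMSEQ_const_iff)
    moreover have "(\<Sum>l\<in>UNIV. (LINT X|lebesgue. H l X * G X $ l)) = (LINT X|lebesgue. (\<Sum>l\<in>UNIV. H l X * G X $ l))"
      by (rule Bochner_Integration.integral_sum[symmetric]) (rule iH[OF GL2])
    ultimately show "(LINT X|lebesgue. ((A X *v G X) \<bullet> gradient \<phi> X) * ?w X) = 0" by (simp only: expand)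
  qed
  then show ?thesis by blast
qed

section \<open>Harmonic measure\<close>

text \<open>Harmonic measure is characterised by compactly supported continuous data. The first
  factor is a tent of shrinking width around \<open>F\<close>; the second cuts off at infinity and
  opens up as \<open>k\<close> grows.\<close>

lemma closed_indicator_limit:
  fixes F :: "(real ^ 'n::finite) set"
  assumes F: "closed F" "F \<noteq> {}"
  defines "g \<equiv> \<lambda>k y. max 0 (1 - real k * infdist y F) * max 0 (min 1 (real k + 1 - norm y))"
  shows "continuous_on UNIV (g k)" "0 \<le> g k y" "g k y \<le> 1" "norm y > real k + 1 \<Longrightarrow> g k y = 0"
    "(\<lambda>k. g k y) \<longlonglongrightarrow> indicator F y"
proof -
  show "continuous_on UNIV (g k)" unfolding g_def by (intro continuous_intros)
  show "0 \<le> g k y" unfolding g_def by (intro mult_nonneg_nonneg) auto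
  have "0 \<le> infdist y F" by (rule infdist_nonneg)
  then show "g k y \<le> 1" unfolding g_def by (intro mult_le_one) auto
  show "norm y > real k + 1 \<Longrightarrow> g k y = 0" by (simp add: g_def)
  show "(\<lambda>k. g k y) \<longlonglongrightarrow> indicator F y"
  proof (cases "y \<in> F")
    case True
    have "\<forall>\<^sub>F k in sequentially. g k y = 1"
      using eventually_ge_at_top[of "nat \<lceil>norm y\<rceil>"]
    proof eventually_elim
      case (elim k)
      then have "norm y \<le> real k" by linarith
      then show ?case using True by (simp add: g_def)
    qed
    then show ?thesis using True by (auto intro: tendsto_eventually)
  next
    case False
    then have t: "infdist y F > 0" by (rule infdist_pos[OF F])
    obtain N where N: "1 / infdist y F < real N" using reals_Archimedean2 by blast
    have "\<forall>\<^sub>F k in sequentially. g k y = 0"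
      using eventually_ge_at_top[of N]
    proof eventually_elim
      case (elim k)
      then have "1 / infdist y F < real k" using N by linarith
      then have "1 < real k * infdist y F" using t by (simp add: pos_divide_less_eq)
      then show ?case by (simp add: g_def)
    qed
    then show ?thesis using False by (auto intro: tendsto_eventually)
  qed
qed

text \<open>Complements are handled by linearity, since constants are solutions and the measures
  have mass one. Disjoint unions are limits of partial sums, which are solutions bounded by
  1.\<close>

lemma harmonic_measure_weak_solution:
  fixes \<Gamma> :: "(real ^ 'n::finite) set"
  assumes A: "ahlfors_regular \<Gamma> \<sigma> d C" and ne: "\<Gamma> \<noteq> {}" and d: "d > 0" and \<beta>: "\<beta> > 0"
    and ell: "elliptic_matrix (- \<Gamma>) A C2" and hm: "harmonic_measure \<Gamma> \<sigma> d \<beta> \<gamma> A \<omega>" and H: "H \<in> sets borel"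
  shows "\<exists>Du. weak_solution \<Gamma> \<sigma> d \<beta> \<gamma> A (- \<Gamma>) (\<lambda>X. measure (\<omega> X) H) Du"
proof -
  have cl: "closed \<Gamma>" and oG: "open (- \<Gamma>)" using ahlfors_regularD(2)[OF A] by auto
  have pr: "sets (\<omega> X) = sets borel" "prob_space (\<omega> X)" "emeasure (\<omega> X) \<Gamma> = 1" "space (\<omega> X) = UNIV" if "X \<in> - \<Gamma>" for X
    using hm that sets_eq_imp_space_eq[of "\<omega> X" borel] unfolding harmonic_measure_def by auto
  note limit = weak_solution_limit[OF A ne d \<beta> ell oG order_refl, where \<gamma> = \<gamma>]
  note lincomb = weak_solution_lincomb[OF A ne d \<beta> ell oG order_refl, where \<gamma> = \<gamma>]
  define P where "P H \<longleftrightarrow> (\<exists>Du. weak_solution \<Gamma> \<sigma> d \<beta> \<gamma> A (- \<Gamma>) (\<lambda>X. measure (\<omega> X) H) Du)" for H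
  have closed_case: "P F" if F: "closed F" for F
  proof (cases "F = {}")
    case True
    then show ?thesis unfolding P_def by (intro exI[of _ "\<lambda>_. 0"]) (simp add: weak_solution_const[OF oG])
  next
    case False
    define g where "g k y = max 0 (1 - real k * infdist y F) * max 0 (min 1 (real k + 1 - norm y))" for k :: nat and y
    note g = closed_indicator_limit[OF F False, folded g_def]
    have "\<exists>Du. weak_solution \<Gamma> \<sigma> d \<beta> \<gamma> A (- \<Gamma>) (\<lambda>X. LINT y:\<Gamma>|\<omega> X. g k y) Du" for k
    proof -
      have "compact (\<Gamma> \<inter> cball 0 (real k + 1))" by (intro closed_Int_compact cl compact_cball)
      moreover have "\<forall>y\<in>\<Gamma> - \<Gamma> \<inter> cball 0 (real k + 1). g k y = 0"
      proof
        fix y assume "y \<in> \<Gamma> - \<Gamma> \<inter> cball 0 (real k + 1)"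
        then have "norm y > real k + 1" by (simp add: not_le)
        then show "g k y = 0" by (rule g(4))
      qed
      ultimately have "\<exists>K. compact K \<and> K \<subseteq> \<Gamma> \<and> (\<forall>y\<in>\<Gamma> - K. g k y = 0)"
        by (intro exI[of _ "\<Gamma> \<inter> cball 0 (real k + 1)"]) auto
      moreover have "continuous_on \<Gamma> (g k)" using g(1) continuous_on_subset by blast
      ultimately show ?thesis using hm unfolding harmonic_measure_def by blast
    qed
    then have "\<forall>k. \<exists>Du. weak_solution \<Gamma> \<sigma> d \<beta> \<gamma> A (- \<Gamma>) (\<lambda>X. LINT y:\<Gamma>|\<omega> X. g k y) Du" by (intro allI)
    from choice[OF this] obtain Du where Du: "\<forall>k. weak_solution \<Gamma> \<sigma> d \<beta> \<gamma> A (- \<Gamma>) (\<lambda>X. LINT y:\<Gamma>|\<omega> X. g k y) (Du k)"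
      by (elim exE)
    show ?thesis
      unfolding P_def
    proof (rule limit[where u = "\<lambda>k X. LINT y:\<Gamma>|\<omega> X. g k y" and g = Du])
      show "weak_solution \<Gamma> \<sigma> d \<beta> \<gamma> A (- \<Gamma>) (\<lambda>X. LINT y:\<Gamma>|\<omega> X. g n y) (Du n)" for n using Du by blast
      fix X assume X: "X \<in> - \<Gamma>"
      interpret prob_space "\<omega> X" by (rule pr(2)[OF X])
      have gm: "(\<lambda>y. indicator \<Gamma> y *\<^sub>R g k y) \<in> borel_measurable (\<omega> X)" for k
      proof -
        have "(\<lambda>y. indicator \<Gamma> y *\<^sub>R g k y) \<in> borel_measurable borel"
          using borel_measurable_continuous_onI[OF g(1)] cl by (intro borel_measurable_scaleR borel_measurable_indicator) auto
        then show ?thesis by (simp only: measurable_cong_sets[OF pr(1)[OF X] refl])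
      qed
      have gb: "norm (indicator \<Gamma> y *\<^sub>R g k y) \<le> 1" for k y using g(2,3)[of k y] by (simp add: indicator_def)
      have gi: "integrable (\<omega> X) (\<lambda>y. indicator \<Gamma> y *\<^sub>R g k y)" for k
        by (rule integrable_const_bound[OF _ gm]) (use gb in auto)
      show "\<bar>LINT y:\<Gamma>|\<omega> X. g n y\<bar> \<le> 1" for n
      proof -
        have "\<bar>LINT y:\<Gamma>|\<omega> X. g n y\<bar> \<le> (LINT y|\<omega> X. \<bar>indicator \<Gamma> y *\<^sub>R g n y\<bar>)"
          unfolding set_lebesgue_integral_def by (rule integral_abs_bound)
        also have "\<dots> \<le> (LINT y|\<omega> X. 1)"
          by (rule integral_mono) (use gi gb in auto)
        finally show ?thesis by (simp add: prob_space)
      qed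
      have "(\<lambda>n. LINT y|\<omega> X. indicator \<Gamma> y *\<^sub>R g n y) \<longlonglongrightarrow> (LINT y|\<omega> X. indicator F y)"
      proof (rule integral_dominated_convergence[where w = "\<lambda>_. 1"])
        show "(indicator F :: _ \<Rightarrow> real) \<in> borel_measurable (\<omega> X)" using F pr(1)[OF X] by (intro borel_measurable_indicator) auto
        \<comment> \<open>Data are integrated over \<open>\<Gamma>\<close>; full mass there removes
          the indicator in the limit, so \<open>F\<close> may range over the closed sets of the
          whole space, which generate the Borel sets.\<close>
        have "AE y in \<omega> X. y \<in> \<Gamma>"
        proof (rule AE_prob_1)
          show "prob \<Gamma> = 1" using pr(3)[OF X] by (simp add: measure_def)
        qed
        then show "AE y in \<omega> X. (\<lambda>n. indicator \<Gamma> y *\<^sub>R g n y) \<longlonglongrightarrow> indicator F y"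
          by eventually_elim (use g(5) in simp)
      qed (use gm gb in auto)
      then show "(\<lambda>n. LINT y:\<Gamma>|\<omega> X. g n y) \<longlonglongrightarrow> measure (\<omega> X) F"
        unfolding set_lebesgue_integral_def using F pr(1)[OF X] pr(4)[OF X] by simp
    qed
  qed
  have sb: "sets (borel :: (real ^ 'n) measure) = sigma_sets UNIV (Collect closed)"
    unfolding borel_eq_closed by (rule sets_measure_of) simp
  have stable: "Int_stable (Collect (closed :: (real ^ 'n) set \<Rightarrow> bool))" by (auto simp: Int_stable_def)
  have sub: "Collect (closed :: (real ^ 'n) set \<Rightarrow> bool) \<subseteq> Pow UNIV" by simp
  have Hs: "H \<in> sigma_sets UNIV (Collect closed)" using H by (simp only: sb)
  have "P H"
  proof (induction rule: sigma_sets_induct_disjoint[OF stable sub Hs, case_names basic empty compl union])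
    case (basic F)
    then show ?case using closed_case by simp
  next
    case empty
    then show ?case using closed_case by simp
  next
    case (compl B)
    then have B: "B \<in> sets borel" unfolding sb by simp
    obtain Du where Du: "weak_solution \<Gamma> \<sigma> d \<beta> \<gamma> A (- \<Gamma>) (\<lambda>X. measure (\<omega> X) B) Du" using compl(2) by (auto simp: P_def)
    have "weak_solution \<Gamma> \<sigma> d \<beta> \<gamma> A (- \<Gamma>) (\<lambda>X. 1 * 1 + (-1) * measure (\<omega> X) B) (\<lambda>X. 1 *\<^sub>R 0 + (-1) *\<^sub>R Du X)"
      by (rule lincomb[OF weak_solution_const[OF oG] Du])
    \<comment> \<open>The complement formula holds off \<open>\<Gamma>\<close> only, where the
      measures are probabilities; hence the passage through
      \<open>weak_solution_cong\<close>.\<close>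
    moreover have "1 * 1 + (-1) * measure (\<omega> X) B = measure (\<omega> X) (UNIV - B)" if "X \<in> - \<Gamma>" for X
    proof -
      interpret prob_space "\<omega> X" by (rule pr(2)[OF that])
      show ?thesis using prob_compl[of B] B pr(1,4)[OF that] by simp
    qed
    ultimately have "weak_solution \<Gamma> \<sigma> d \<beta> \<gamma> A (- \<Gamma>) (\<lambda>X. measure (\<omega> X) (UNIV - B)) (\<lambda>X. 1 *\<^sub>R 0 + (-1) *\<^sub>R Du X)"
      using weak_solution_cong[of "- \<Gamma>" "\<lambda>X. 1 * 1 + (-1) * measure (\<omega> X) B" "\<lambda>X. measure (\<omega> X) (UNIV - B)"] by blast
    then show ?case unfolding P_def by blast
  next
    case (union B)
    then have B: "range B \<subseteq> sets borel" unfolding sb by blast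
    have "\<forall>i. \<exists>Du. weak_solution \<Gamma> \<sigma> d \<beta> \<gamma> A (- \<Gamma>) (\<lambda>X. measure (\<omega> X) (B i)) Du" using union(3) by (auto simp: P_def)
    from choice[OF this] obtain Du where Du: "\<forall>i. weak_solution \<Gamma> \<sigma> d \<beta> \<gamma> A (- \<Gamma>) (\<lambda>X. measure (\<omega> X) (B i)) (Du i)" by (elim exE)
    have fin: "weak_solution \<Gamma> \<sigma> d \<beta> \<gamma> A (- \<Gamma>) (\<lambda>X. \<Sum>i<n. measure (\<omega> X) (B i)) (\<lambda>X. \<Sum>i<n. Du i X)" for n
    proof (induction n)
      case 0
      then show ?case using weak_solution_const[OF oG, where c = 0] by simp
    next
      case (Suc n)
      from lincomb[OF this Du[rule_format, of n], of 1 1] show ?case by simp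
    qed
    show ?case
      unfolding P_def
    proof (rule limit[where u = "\<lambda>n X. \<Sum>i<n. measure (\<omega> X) (B i)", OF fin])
      fix X assume X: "X \<in> - \<Gamma>"
      interpret prob_space "\<omega> X" by (rule pr(2)[OF X])
      have sums: "(\<lambda>i. measure (\<omega> X) (B i)) sums measure (\<omega> X) (\<Union>i. B i)"
        using B union(1) pr(1)[OF X] by (intro finite_measure_UNION) auto
      then show "(\<lambda>n. \<Sum>i<n. measure (\<omega> X) (B i)) \<longlonglongrightarrow> measure (\<omega> X) (\<Union>i. B i)" by (simp add: sums_def)
      fix n
      have "(\<Sum>i<n. measure (\<omega> X) (B i)) \<le> measure (\<omega> X) (\<Union>i. B i)"
        using sums sum_le_suminf[of "\<lambda>i. measure (\<omega> X) (B i)" "{..<n}"] by (simp add: sums_iff)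
      also have "\<dots> \<le> 1" by (rule prob_le_1)
      finally show "\<bar>\<Sum>i<n. measure (\<omega> X) (B i)\<bar> \<le> 1" by (simp add: sum_nonneg)
    qed
  qed
  then show ?thesis unfolding P_def .
qed

theorem lemma1p20:
  fixes d \<beta> \<gamma> C\<sigma> C1 C2 :: real
  assumes "0 < d" and "d \<le> real CARD('n::finite) - 1"
    and "-1 < \<gamma>" and "\<gamma> < 1" and "0 < \<beta>" and "0 < C1"
  shows "\<exists>C>0. \<exists>K>0.
    \<forall>(\<Gamma> :: (real ^ 'n) set) (\<sigma> :: (real ^ 'n) measure)
      (A :: real ^ 'n \<Rightarrow> real ^ 'n ^ 'n)
      (b :: real ^ 'n \<Rightarrow> real) (Db :: real ^ 'n \<Rightarrow> real ^ 'n) (V :: real ^ 'n \<Rightarrow> real ^ 'n).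
      ahlfors_regular \<Gamma> \<sigma> d C\<sigma> \<and>
      elliptic_matrix (- \<Gamma>) A C2 \<and>
      weakly_div_free (- \<Gamma>)
        (\<lambda>X. Dbeta \<Gamma> \<sigma> d \<beta> X powr (d + 1 - real CARD('n)) *\<^sub>R
             (b X *\<^sub>R (transpose (A X) *v gradient (Dbeta \<Gamma> \<sigma> d \<beta>) X) + V X)) \<and>
      (\<forall>X\<in>- \<Gamma>. inverse C1 \<le> b X \<and> b X \<le> C1) \<and>
      weak_gradient (- \<Gamma>) b Db \<and>
      in_CM \<Gamma> \<sigma> d (\<lambda>X. Dbeta \<Gamma> \<sigma> d \<beta> X *\<^sub>R Db X) C1 \<and>
      (\<forall>X\<in>- \<Gamma>. norm (V X) \<le> C1) \<and>
      in_CM \<Gamma> \<sigma> d V C1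
      \<longrightarrow>
      (\<forall>x\<in>\<Gamma>. \<forall>r>0. \<forall>(u :: real ^ 'n \<Rightarrow> real) Du.
         weak_solution \<Gamma> \<sigma> d \<beta> \<gamma> A (ball x (2 * r) - \<Gamma>) u Du \<longrightarrow>
         (\<integral>\<^sup>+ X \<in> ball x r - \<Gamma>.
             ennreal ((norm (Du X))\<^sup>2 * Dbeta \<Gamma> \<sigma> d \<beta> X powr (d + 2 - real CARD('n))) \<partial>lebesgue)
         \<le> ennreal C * esssup (lebesgue_on (ball x (2 * r) - \<Gamma>)) (\<lambda>X. ennreal (\<bar>u X\<bar>\<^sup>2))
             * emeasure \<sigma> (ball x r)) \<and>
      (d < real CARD('n) - 1 \<longrightarrow>
        (\<forall>\<omega>. harmonic_measure \<Gamma> \<sigma> d \<beta> \<gamma> A \<omega> \<longrightarrow>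
          (\<forall>x\<in>\<Gamma>. \<forall>r>0. \<forall>H. H \<in> sets borel \<and> H \<subseteq> \<Gamma> \<longrightarrow>
            (\<exists>Du. weak_solution \<Gamma> \<sigma> d \<beta> \<gamma> A (- \<Gamma>) (\<lambda>X. measure (\<omega> X) H) Du \<and>
              (\<integral>\<^sup>+ X \<in> ball x r - \<Gamma>.
                  ennreal ((norm (Du X))\<^sup>2 * Dbeta \<Gamma> \<sigma> d \<beta> X powr (d + 2 - real CARD('n))) \<partial>lebesgue)
              \<le> ennreal K * emeasure \<sigma> (ball x r)))))"
proof -
  obtain M where M: "M > 0" and est: "\<forall>(\<Gamma> :: (real ^ 'n) set) (\<sigma> :: (real ^ 'n) measure) A b Db V x r u Du.
    ahlfors_regular \<Gamma> \<sigma> d C\<sigma> \<and> elliptic_matrix (- \<Gamma>) A C2 \<and>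
      weakly_div_free (- \<Gamma>)
        (\<lambda>X. Dbeta \<Gamma> \<sigma> d \<beta> X powr (d + 1 - real CARD('n)) *\<^sub>R
             (b X *\<^sub>R (transpose (A X) *v gradient (Dbeta \<Gamma> \<sigma> d \<beta>) X) + V X)) \<and>
      (\<forall>X\<in>- \<Gamma>. inverse C1 \<le> b X \<and> b X \<le> C1) \<and>
      weak_gradient (- \<Gamma>) b Db \<and>
      in_CM \<Gamma> \<sigma> d (\<lambda>X. Dbeta \<Gamma> \<sigma> d \<beta> X *\<^sub>R Db X) C1 \<and>
      (\<forall>X\<in>- \<Gamma>. norm (V X) \<le> C1) \<and>
      in_CM \<Gamma> \<sigma> d V C1 \<and> x \<in> \<Gamma> \<and> 0 < r \<and> weak_solution \<Gamma> \<sigma> d \<beta> \<gamma> A (ball x (2 * r) - \<Gamma>) u Du \<longrightarrow>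
         (\<integral>\<^sup>+ X \<in> ball x r - \<Gamma>.
             ennreal ((norm (Du X))\<^sup>2 * Dbeta \<Gamma> \<sigma> d \<beta> X powr (d + 2 - real CARD('n))) \<partial>lebesgue)
         \<le> ennreal M * esssup (lebesgue_on (ball x (2 * r) - \<Gamma>)) (\<lambda>X. ennreal (\<bar>u X\<bar>\<^sup>2))
             * emeasure \<sigma> (ball x r)"
    using square_function_estimate[OF assms, of C\<sigma> C2] by (elim exE conjE) (rule that)
  show ?thesis
  \<comment> \<open>The same \<open>M\<close> is the witness for both constants, because harmonic
    measure takes values in [0,1] and its essential supremum is at most 1.\<close>
  proof (intro exI[of _ M] conjI M allI impI; elim conjE)
    fix \<Gamma> :: "(real ^ 'n) set" and \<sigma> :: "(real ^ 'n) measure" and A :: "real ^ 'n \<Rightarrow> real ^ 'n ^ 'n"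
      and b :: "real ^ 'n \<Rightarrow> real" and Db V :: "real ^ 'n \<Rightarrow> real ^ 'n"
    assume hyps: "ahlfors_regular \<Gamma> \<sigma> d C\<sigma>" "elliptic_matrix (- \<Gamma>) A C2"
      "weakly_div_free (- \<Gamma>)
        (\<lambda>X. Dbeta \<Gamma> \<sigma> d \<beta> X powr (d + 1 - real CARD('n)) *\<^sub>R
             (b X *\<^sub>R (transpose (A X) *v gradient (Dbeta \<Gamma> \<sigma> d \<beta>) X) + V X))"
      "\<forall>X\<in>- \<Gamma>. inverse C1 \<le> b X \<and> b X \<le> C1" "weak_gradient (- \<Gamma>) b Db"
      "in_CM \<Gamma> \<sigma> d (\<lambda>X. Dbeta \<Gamma> \<sigma> d \<beta> X *\<^sub>R Db X) C1" "\<forall>X\<in>- \<Gamma>. norm (V X) \<le> C1" "in_CM \<Gamma> \<sigma> d V C1"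
    show "\<forall>x\<in>\<Gamma>. \<forall>r>0. \<forall>(u :: real ^ 'n \<Rightarrow> real) Du.
         weak_solution \<Gamma> \<sigma> d \<beta> \<gamma> A (ball x (2 * r) - \<Gamma>) u Du \<longrightarrow>
         (\<integral>\<^sup>+ X \<in> ball x r - \<Gamma>.
             ennreal ((norm (Du X))\<^sup>2 * Dbeta \<Gamma> \<sigma> d \<beta> X powr (d + 2 - real CARD('n))) \<partial>lebesgue)
         \<le> ennreal M * esssup (lebesgue_on (ball x (2 * r) - \<Gamma>)) (\<lambda>X. ennreal (\<bar>u X\<bar>\<^sup>2))
             * emeasure \<sigma> (ball x r)"
      by (intro ballI allI impI, rule est[rule_format, of \<Gamma> \<sigma> A b V Db]) (intro conjI hyps)
    fix \<omega>
    assume hm: "harmonic_measure \<Gamma> \<sigma> d \<beta> \<gamma> A \<omega>"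
    show "\<forall>x\<in>\<Gamma>. \<forall>r>0. \<forall>H. H \<in> sets borel \<and> H \<subseteq> \<Gamma> \<longrightarrow>
            (\<exists>Du. weak_solution \<Gamma> \<sigma> d \<beta> \<gamma> A (- \<Gamma>) (\<lambda>X. measure (\<omega> X) H) Du \<and>
              (\<integral>\<^sup>+ X \<in> ball x r - \<Gamma>.
                  ennreal ((norm (Du X))\<^sup>2 * Dbeta \<Gamma> \<sigma> d \<beta> X powr (d + 2 - real CARD('n))) \<partial>lebesgue)
              \<le> ennreal M * emeasure \<sigma> (ball x r))"
    proof (intro ballI allI impI; elim conjE)
      fix x H and r :: real
      assume x: "x \<in> \<Gamma>" and r: "0 < r" and H: "H \<in> sets borel" "H \<subseteq> \<Gamma>"
      have ne: "\<Gamma> \<noteq> {}" using x by auto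
      have cl: "closed \<Gamma>" by (rule ahlfors_regularD(2)[OF hyps(1)])
      define U where "U = ball x (2 * r) - \<Gamma>"
      have oU: "open U" unfolding U_def using cl by (intro open_Diff) auto
      obtain Du where Du: "weak_solution \<Gamma> \<sigma> d \<beta> \<gamma> A (- \<Gamma>) (\<lambda>X. measure (\<omega> X) H) Du"
        using harmonic_measure_weak_solution[OF hyps(1) ne assms(1,5) hyps(2) hm H(1)] by blast
      have sol: "weak_solution \<Gamma> \<sigma> d \<beta> \<gamma> A U (\<lambda>X. measure (\<omega> X) H) Du"
        by (rule weak_solution_subset[OF Du _ oU]) (use cl in \<open>auto simp: U_def\<close>)
      have m: "meas_loc U (\<lambda>X. measure (\<omega> X) H)"
        using W12_loc_L2(1)[of U "\<lambda>X. measure (\<omega> X) H" Du] sol by (simp add: weak_solution_def L2_loc_def)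
      \<comment> \<open>An almost everywhere bound controls \<open>esssup\<close> only for
        measurable functions; measurability in the pole \<open>X\<close> is inherited from being a
        weak solution.\<close>
      have ess: "esssup (lebesgue_on U) (\<lambda>X. ennreal (\<bar>measure (\<omega> X) H\<bar>\<^sup>2)) \<le> 1"
      proof (rule esssup_I)
        have "(\<lambda>X. \<bar>measure (\<omega> X) H\<bar>\<^sup>2) \<in> borel_measurable (lebesgue_on U)"
          using meas_loc_borel_measurable_on[OF oU meas_loc_power2[OF m]] by simp
        then show "(\<lambda>X. ennreal (\<bar>measure (\<omega> X) H\<bar>\<^sup>2)) \<in> borel_measurable (lebesgue_on U)"
          by (rule measurable_compose[OF _ measurable_ennreal])
        show "AE X in lebesgue_on U. ennreal (\<bar>measure (\<omega> X) H\<bar>\<^sup>2) \<le> 1"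
        proof (rule AE_I2)
          fix X assume "X \<in> space (lebesgue_on U)"
          then have "prob_space (\<omega> X)" using hm by (auto simp: harmonic_measure_def U_def)
          then have "measure (\<omega> X) H \<le> 1" by (rule prob_space.prob_le_1)
          then show "ennreal (\<bar>measure (\<omega> X) H\<bar>\<^sup>2) \<le> 1" by (simp add: power_le_one)
        qed
      qed
      have "(\<integral>\<^sup>+ X \<in> ball x r - \<Gamma>.
             ennreal ((norm (Du X))\<^sup>2 * Dbeta \<Gamma> \<sigma> d \<beta> X powr (d + 2 - real CARD('n))) \<partial>lebesgue)
         \<le> ennreal M * esssup (lebesgue_on (ball x (2 * r) - \<Gamma>)) (\<lambda>X. ennreal (\<bar>measure (\<omega> X) H\<bar>\<^sup>2))
             * emeasure \<sigma> (ball x r)"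
        by (rule est[rule_format, of \<Gamma> \<sigma> A b V Db]) (intro conjI hyps x r sol[unfolded U_def])
      also have "\<dots> \<le> ennreal M * 1 * emeasure \<sigma> (ball x r)"
        by (intro mult_right_mono mult_left_mono ess[unfolded U_def]) auto
      finally show "\<exists>Du. weak_solution \<Gamma> \<sigma> d \<beta> \<gamma> A (- \<Gamma>) (\<lambda>X. measure (\<omega> X) H) Du \<and>
              (\<integral>\<^sup>+ X \<in> ball x r - \<Gamma>.
                  ennreal ((norm (Du X))\<^sup>2 * Dbeta \<Gamma> \<sigma> d \<beta> X powr (d + 2 - real CARD('n))) \<partial>lebesgue)
              \<le> ennreal M * emeasure \<sigma> (ball x r)"
        using Du by auto
    qed
  qed
qed

end
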